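(* Let $T$ be a torus-fibered $T^2$-knot in a closed, connected, oriented $4$-manifold $X$, and let $K$ be a fibered knot in a closed $3$-manifold $Y$. Suppose that $f: \partial(S^1 \times E_Y(K))\to \partial(X \setminus \mathring{\nu}T)$ is a diffeomorphism of the $3$-torus that sends $\{\mathrm{pt}\} \times \lambda$ to $\{\mathrm{pt}\} \times \partial D^2$, where $\lambda$ is a longitude of $K$ in $E_Y(K)$ and $\{\mathrm{pt}\}\times\partial D^2$ is a meridian of $T$ under $\nu T\cong T^2\times D^2$. Then the generalized Fintushel-Stern knot surgery $X_{T,K,f} = (X\setminus\mathring{\nu}T)\cup_f (S^1\times E_Y(K))$ along $T$ with knot $K$ and mapping $f$ fibers over the circle.
   Context: All manifolds and maps are smooth. For a knot $K$ in a closed, connected, oriented $3$-manifold $Y$, $E_Y(K) = Y \setminus \mathring{\nu}K$ denotes the exterior of $K$, where $\mathring{\nu}K$ is the interior of a closed tubular neighborhood of $K$. The knot $K$ is fibered if $E_Y(K)$ admits a smooth fibration over $S^1$ whose fiber is a Seifert surface for $K$ (a compact, connected, oriented surface with a single boundary component, a longitude of $K$ on $\partial E_Y(K)$). An embedded $2$-torus $T$ in a closed $4$-manifold $X$ is a torus-fibered $T^2$-knot if $T$ has self-intersection number zero and its exterior $X\setminus\mathring{\nu}T$ (with $\nu T\cong T^2\times D^2$ a closed tubular neighborhood and $\mathring{\nu}T$ its interior) fibers over the $2$-torus such that the monodromy of the fibration fixes the boundary of the fiber pointwise; that is, $X\setminus\mathring{\nu}T$ is a smooth bundle over $T^2$ with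 fiber $\Sigma_{g,1}$ (the compact, oriented genus $g$ surface with one boundary component, for some $g\ge 0$) and structure group the diffeomorphisms of $\Sigma_{g,1}$ restricting to the identity on $\partial\Sigma_{g,1}$. A closed manifold "fibers over the circle" if it is the total space of a smooth fiber bundle over $S^1$. *)

theory Defs
  imports "HOL-Analysis.Analysis"
begin

section \<open>Smooth maps between subsets of Euclidean spaces\<close>

primrec k_smooth_on :: "nat \<Rightarrow> 'a::euclidean_space set \<Rightarrow> ('a \<Rightarrow> 'b::euclidean_space) \<Rightarrow> bool" where
  "k_smooth_on 0 = (\<lambda>S f. continuous_on S f)"
| "k_smooth_on (Suc k) = (\<lambda>S f. (\<forall>x\<in>S. f differentiable (at x)) \<and>
      (\<forall>v. k_smooth_on k S (\<lambda>x. frechet_derivative f (at x) v)))"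

text \<open>On a set that need not be open, smoothness means that local smooth extensions exist.\<close>

definition smooth_on_set :: "'a::euclidean_space set \<Rightarrow> ('a \<Rightarrow> 'b::euclidean_space) \<Rightarrow> bool" where
  "smooth_on_set S f \<longleftrightarrow>
     (\<forall>x\<in>S. \<exists>W g. open W \<and> x \<in> W \<and> (\<forall>k. k_smooth_on k W g) \<and> (\<forall>y\<in>S \<inter> W. g y = f y))"

section \<open>Smooth manifolds with boundary\<close>

text \<open>
  A manifold carries a (not necessarily maximal) atlas; the dimension is the dimension of the model
  space. Charts are pairs of a domain and a coordinate map, and only the values of the coordinate
  map on the domain matter. A chart takes values either in an open set of the model space or in a
  relatively open subset of one of its coordinate half-spaces. The half-space is not fixed once and
  for all, so that a product of a manifold without boundary and a manifold with boundary is
  directly a manifold with boundary.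
\<close>

record ('a, 'e) manifold =
  mtop :: "'a topology"
  atlas :: "('a set \<times> ('a \<Rightarrow> 'e)) set"

abbreviation pts :: "('a, 'e) manifold \<Rightarrow> 'a set" where
  "pts M \<equiv> topspace (mtop M)"

definition chart_image :: "'e::euclidean_space set \<Rightarrow> bool" where
  "chart_image W \<longleftrightarrow> open W \<or> (\<exists>b\<in>Basis. openin (top_of_set {x. 0 \<le> x \<bullet> b}) W)"

definition is_chart :: "'a topology \<Rightarrow> 'a set \<Rightarrow> ('a \<Rightarrow> 'e::euclidean_space) \<Rightarrow> bool" where
  "is_chart T U \<phi> \<longleftrightarrow> openin T U \<and> chart_image (\<phi> ` U) \<and>
     homeomorphic_map (subtopology T U) (top_of_set (\<phi> ` U)) \<phi>"

definition smooth_manifold :: "('a, 'e::euclidean_space) manifold \<Rightarrow> bool" where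
  "smooth_manifold M \<longleftrightarrow>
     Hausdorff_space (mtop M) \<and> second_countable (mtop M) \<and>
     (\<forall>(U, \<phi>)\<in>atlas M. is_chart (mtop M) U \<phi>) \<and>
     \<Union>(fst ` atlas M) = pts M \<and>
     (\<forall>(U, \<phi>)\<in>atlas M. \<forall>(V, \<psi>)\<in>atlas M. smooth_on_set (\<phi> ` (U \<inter> V)) (\<psi> \<circ> inv_into U \<phi>))"

definition boundary :: "('a, 'e::euclidean_space) manifold \<Rightarrow> 'a set" where
  "boundary M = {x. \<exists>(U, \<phi>)\<in>atlas M. x \<in> U \<and> \<phi> x \<notin> interior (\<phi> ` U)}"

definition closed_manifold :: "('a, 'e::euclidean_space) manifold \<Rightarrow> bool" where
  "closed_manifold M \<longleftrightarrow> smooth_manifold M \<and> compact_space (mtop M) \<and> boundary M = {}"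

definition smooth_map_on ::
  "('a, 'e::euclidean_space) manifold \<Rightarrow> 'a set \<Rightarrow> ('b, 'd::euclidean_space) manifold \<Rightarrow> ('a \<Rightarrow> 'b) \<Rightarrow> bool" where
  "smooth_map_on M S N f \<longleftrightarrow> continuous_map (subtopology (mtop M) S) (mtop N) f \<and>
     (\<forall>(U, \<phi>)\<in>atlas M. \<forall>(V, \<psi>)\<in>atlas N.
        smooth_on_set (\<phi> ` (S \<inter> U \<inter> f -` V)) (\<psi> \<circ> f \<circ> inv_into U \<phi>))"

definition smooth_map ::
  "('a, 'e::euclidean_space) manifold \<Rightarrow> ('b, 'd::euclidean_space) manifold \<Rightarrow> ('a \<Rightarrow> 'b) \<Rightarrow> bool" where
  "smooth_map M N f \<longleftrightarrow> smooth_map_on M (pts M) N f"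

definition diffeomorphism ::
  "('a, 'e::euclidean_space) manifold \<Rightarrow> ('b, 'd::euclidean_space) manifold \<Rightarrow> ('a \<Rightarrow> 'b) \<Rightarrow> bool" where
  "diffeomorphism M N f \<longleftrightarrow> bij_betw f (pts M) (pts N) \<and>
     smooth_map M N f \<and> smooth_map N M (inv_into (pts M) f)"

definition euclid :: "('e, 'e::euclidean_space) manifold" where
  "euclid = \<lparr>mtop = euclidean, atlas = {(UNIV, \<lambda>x. x)}\<rparr>"

text \<open>
  The structure induced on a subset \<open>S\<close> of \<open>M\<close>, with model space \<open>'d\<close>: all charts of the subspace
  that are smooth with respect to \<open>M\<close> and have a smooth inverse into \<open>M\<close>. These charts are always
  mutually compatible, and they cover \<open>S\<close> iff \<open>S\<close> is an embedded submanifold (possibly with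
  boundary) of dimension \<open>DIM('d)\<close>. For \<open>S = pts M\<close> and \<open>'d = 'e\<close> this is the maximal atlas.
\<close>

definition submanifold :: "('a, 'e::euclidean_space) manifold \<Rightarrow> 'a set \<Rightarrow> ('a, 'd::euclidean_space) manifold" where
  "submanifold M S =
     \<lparr>mtop = subtopology (mtop M) S,
      atlas = {(U, \<phi>). is_chart (subtopology (mtop M) S) U \<phi> \<and>
                 smooth_map_on M U euclid \<phi> \<and> smooth_map_on euclid (\<phi> ` U) M (inv_into U \<phi>)}\<rparr>"

definition prod_manifold ::
  "('a, 'e::euclidean_space) manifold \<Rightarrow> ('b, 'd::euclidean_space) manifold \<Rightarrow> ('a \<times> 'b, 'e \<times> 'd) manifold" where
  "prod_manifold M N =
     \<lparr>mtop = prod_topology (mtop M) (mtop N),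
      atlas = {(U \<times> V, map_prod \<phi> \<psi>) |U V \<phi> \<psi>. (U, \<phi>) \<in> atlas M \<and> (V, \<psi>) \<in> atlas N}\<rparr>"

definition smooth_embedding ::
  "('a, 'e::euclidean_space) manifold \<Rightarrow> ('b, 'd::euclidean_space) manifold \<Rightarrow> ('a \<Rightarrow> 'b) \<Rightarrow> bool" where
  "smooth_embedding M N f \<longleftrightarrow> f ` pts M \<subseteq> pts N \<and>
     smooth_manifold (submanifold N (f ` pts M) :: ('b, 'e) manifold) \<and>
     diffeomorphism M (submanifold N (f ` pts M) :: ('b, 'e) manifold) f"

definition circle :: "(complex, real) manifold" where
  "circle = submanifold euclid (sphere 0 1)"

definition disk :: "(complex, complex) manifold" where
  "disk = submanifold euclid (cball 0 1)"

definition torus :: "(complex \<times> complex, real \<times> real) manifold" where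
  "torus = prod_manifold circle circle"

section \<open>Orientations\<close>

definition orientation :: "('a, real ^ 'n) manifold \<Rightarrow> ('a set \<times> ('a \<Rightarrow> real ^ 'n)) set \<Rightarrow> bool" where
  "orientation M \<O> \<longleftrightarrow>
     \<O> \<subseteq> atlas (submanifold M (pts M) :: ('a, real ^ 'n) manifold) \<and>
     \<Union>(fst ` \<O>) = pts M \<and>
     (\<forall>(U, \<phi>)\<in>\<O>. \<forall>(V, \<psi>)\<in>\<O>. \<forall>x\<in>U \<inter> V. \<exists>D.
        (\<psi> \<circ> inv_into U \<phi> has_derivative D) (at (\<phi> x) within \<phi> ` (U \<inter> V)) \<and> 0 < det (matrix D))"

definition orientable :: "('a, real ^ 'n) manifold \<Rightarrow> bool" where
  "orientable M \<longleftrightarrow> (\<exists>\<O>. orientation M \<O>)"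

section \<open>Smooth fiber bundles\<close>

text \<open>
  \<open>G\<close> is the structure group, a group of self-diffeomorphisms of the fiber \<open>F\<close>. The base is always
  a manifold without boundary here, so the products below have no corners.
\<close>

definition smooth_fiber_bundle ::
  "('a, 'e::euclidean_space) manifold \<Rightarrow> ('b, 'd::euclidean_space) manifold \<Rightarrow>
   ('f, 'c::euclidean_space) manifold \<Rightarrow> ('f \<Rightarrow> 'f) set \<Rightarrow> ('a \<Rightarrow> 'b) \<Rightarrow> bool" where
  "smooth_fiber_bundle M B F G p \<longleftrightarrow>
     smooth_manifold M \<and> smooth_manifold B \<and> smooth_manifold F \<and> smooth_map M B p \<and>
     (\<exists>\<T>. \<Union>(fst ` \<T>) = pts B \<and>
        (\<forall>(V, \<Phi>)\<in>\<T>. openin (mtop B) V \<and>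
           diffeomorphism (submanifold M (pts M \<inter> p -` V) :: ('a, 'e) manifold)
             (prod_manifold (submanifold B V :: ('b, 'd) manifold) F) \<Phi> \<and>
           (\<forall>x\<in>pts M \<inter> p -` V. fst (\<Phi> x) = p x)) \<and>
        (\<forall>(V, \<Phi>)\<in>\<T>. \<forall>(V', \<Phi>')\<in>\<T>. \<forall>b\<in>V \<inter> V'. \<exists>g\<in>G. \<forall>y\<in>pts F.
           \<Phi>' (inv_into (pts M \<inter> p -` V) \<Phi> (b, y)) = (b, g y)))"

definition diffeos :: "('f, 'c::euclidean_space) manifold \<Rightarrow> ('f \<Rightarrow> 'f) set" where
  "diffeos F = {g. diffeomorphism F F g}"

definition diffeos_rel_boundary :: "('f, 'c::euclidean_space) manifold \<Rightarrow> ('f \<Rightarrow> 'f) set" where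
  "diffeos_rel_boundary F = {g \<in> diffeos F. \<forall>x\<in>boundary F. g x = x}"

text \<open>
  Fibers can be realized inside the total space, so it is no restriction that the carrier type of
  the fiber is that of the total space.
\<close>

definition fibers_over_circle :: "('a, real ^ 4) manifold \<Rightarrow> bool" where
  "fibers_over_circle M \<longleftrightarrow>
     (\<exists>(F :: ('a, real ^ 3) manifold) p. smooth_fiber_bundle M circle F (diffeos F) p)"

section \<open>Tubular neighborhoods and exteriors\<close>

text \<open>
  A closed tubular neighborhood of a submanifold \<open>K\<close> diffeomorphic to \<open>S\<close>, with trivial normal disk
  bundle, is given by a parametrization \<open>S \<times> D\<^sup>2 \<rightarrow> M\<close>. Every knot in an oriented 3-manifold and every
  torus of self-intersection zero in an oriented 4-manifold has such neighborhoods.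
\<close>

definition tubular_neighborhood ::
  "('s, 'd::euclidean_space) manifold \<Rightarrow> ('a, 'e::euclidean_space) manifold \<Rightarrow> 'a set \<Rightarrow>
   ('s \<times> complex \<Rightarrow> 'a) \<Rightarrow> bool" where
  "tubular_neighborhood S M K \<nu> \<longleftrightarrow>
     smooth_embedding (prod_manifold S disk) M \<nu> \<and> \<nu> ` (pts S \<times> {0}) = K"

definition exterior ::
  "('s, 'd::euclidean_space) manifold \<Rightarrow> ('a, 'e::euclidean_space) manifold \<Rightarrow>
   ('s \<times> complex \<Rightarrow> 'a) \<Rightarrow> ('a, 'e) manifold" where
  "exterior S M \<nu> = submanifold M (pts M - \<nu> ` (pts S \<times> ball 0 1))"

section \<open>Fibered knots\<close>

definition knot :: "('a, real ^ 3) manifold \<Rightarrow> 'a set \<Rightarrow> bool" where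
  "knot Y K \<longleftrightarrow> (\<exists>\<kappa>. smooth_embedding circle Y \<kappa> \<and> \<kappa> ` pts circle = K)"

text \<open>
  A longitude is a simple closed curve on the boundary torus that is parallel to the knot, i.e.
  homotopic to it in the tubular neighborhood; the framing is arbitrary.
\<close>

definition longitude :: "('a, real ^ 3) manifold \<Rightarrow> (complex \<times> complex \<Rightarrow> 'a) \<Rightarrow> 'a set \<Rightarrow> bool" where
  "longitude Y \<nu> L \<longleftrightarrow> (let E = exterior circle Y \<nu> in
     \<exists>l. smooth_embedding circle (submanifold E (boundary E) :: ('a, real ^ 2) manifold) l \<and>
         l ` pts circle = L \<and>
         homotopic_with (\<lambda>_. True) (mtop circle)
           (subtopology (mtop Y) (\<nu> ` (pts circle \<times> pts disk))) l (\<lambda>z. \<nu> (z, 0)))"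

definition one_holed_surface :: "('a, real ^ 2) manifold \<Rightarrow> bool" where
  "one_holed_surface F \<longleftrightarrow>
     smooth_manifold F \<and> compact_space (mtop F) \<and> connected_space (mtop F) \<and> orientable F \<and>
     boundary F \<noteq> {} \<and> connectedin (mtop F) (boundary F)"

definition seifert_surface :: "('a, real ^ 3) manifold \<Rightarrow> (complex \<times> complex \<Rightarrow> 'a) \<Rightarrow> 'a set \<Rightarrow> bool" where
  "seifert_surface Y \<nu> S \<longleftrightarrow>
     S \<subseteq> pts (exterior circle Y \<nu>) \<and>
     one_holed_surface (submanifold Y S :: ('a, real ^ 2) manifold) \<and>
     longitude Y \<nu> (boundary (submanifold Y S :: ('a, real ^ 2) manifold))"

definition fibered_knot ::
  "('a, real ^ 3) manifold \<Rightarrow> 'a set \<Rightarrow> (complex \<times> complex \<Rightarrow> 'a) \<Rightarrow> bool" where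
  "fibered_knot Y K \<nu> \<longleftrightarrow> knot Y K \<and> tubular_neighborhood circle Y K \<nu> \<and>
     (let E = exterior circle Y \<nu> in
      \<exists>(F :: ('a, real ^ 2) manifold) p. smooth_fiber_bundle E circle F (diffeos F) p \<and>
        (\<forall>z\<in>pts circle. seifert_surface Y \<nu> {x \<in> pts E. p x = z}))"

section \<open>Self-intersection numbers and torus-fibered torus knots\<close>

definition torus_frame :: "('a \<Rightarrow> real ^ 4) \<Rightarrow> (complex \<times> complex \<Rightarrow> 'a) \<Rightarrow> complex \<times> complex \<Rightarrow> (real ^ 4) list" where
  "torus_frame \<phi> i = (\<lambda>(z, w).
     [vector_derivative (\<lambda>s. \<phi> (i (z * cis s, w))) (at 0),
      vector_derivative (\<lambda>s. \<phi> (i (z, w * cis s))) (at 0)])"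

text \<open>
  The determinant comparing the coordinate orientation with the one given by the tangent frames of
  \<open>i\<close> at \<open>P\<close> and of \<open>g\<close> at \<open>Q\<close>, where \<open>i P = g Q\<close>. Its sign does not depend on the chart of \<open>\<O>\<close>.
\<close>

definition intersection_det ::
  "('a \<Rightarrow> real ^ 4) \<Rightarrow> (complex \<times> complex \<Rightarrow> 'a) \<Rightarrow> (complex \<times> complex \<Rightarrow> 'a) \<Rightarrow>
   complex \<times> complex \<Rightarrow> complex \<times> complex \<Rightarrow> real" where
  "intersection_det \<phi> i g P Q = det (vector (torus_frame \<phi> i P @ torus_frame \<phi> g Q) :: real ^ 4 ^ 4)"

definition intersection_pairs ::
  "(complex \<times> complex \<Rightarrow> 'a) \<Rightarrow> (complex \<times> complex \<Rightarrow> 'a) \<Rightarrow>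
   ((complex \<times> complex) \<times> (complex \<times> complex)) set" where
  "intersection_pairs i g = {(P, Q). P \<in> pts torus \<and> Q \<in> pts torus \<and> i P = g Q}"

text \<open>
  The signed number of intersection points of \<open>i\<close> with a smooth map \<open>g\<close> that is homotopic and
  transverse to it. Such maps exist, and the number does not depend on the choice.
\<close>

definition self_intersection ::
  "('a, real ^ 4) manifold \<Rightarrow> ('a set \<times> ('a \<Rightarrow> real ^ 4)) set \<Rightarrow> (complex \<times> complex \<Rightarrow> 'a) \<Rightarrow> real \<Rightarrow> bool" where
  "self_intersection X \<O> i n \<longleftrightarrow>
     (\<exists>g. smooth_map torus X g \<and> homotopic_with (\<lambda>_. True) (mtop torus) (mtop X) i g \<and>
        (\<forall>(P, Q)\<in>intersection_pairs i g. \<forall>(U, \<phi>)\<in>\<O>. i P \<in> U \<longrightarrow> intersection_det \<phi> i g P Q \<noteq> 0) \<and>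
        finite (intersection_pairs i g) \<and>
        n = (\<Sum>(P, Q)\<in>intersection_pairs i g.
               sgn (intersection_det (SOME \<phi>. \<exists>U. (U, \<phi>) \<in> \<O> \<and> i P \<in> U) i g P Q)))"

text \<open>
  The fiber is some \<open>\<Sigma>\<^bsub>g,1\<^esub>\<close>, i.e. a compact connected orientable surface with one boundary component.
\<close>

definition torus_fibered_knot ::
  "('a, real ^ 4) manifold \<Rightarrow> ('a set \<times> ('a \<Rightarrow> real ^ 4)) set \<Rightarrow> 'a set \<Rightarrow>
   ((complex \<times> complex) \<times> complex \<Rightarrow> 'a) \<Rightarrow> bool" where
  "torus_fibered_knot X \<O> T \<nu> \<longleftrightarrow>
     (\<exists>i. smooth_embedding torus X i \<and> i ` pts torus = T \<and> self_intersection X \<O> i 0) \<and>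
     tubular_neighborhood torus X T \<nu> \<and>
     (\<exists>(F :: ('a, real ^ 2) manifold) p. one_holed_surface F \<and>
        smooth_fiber_bundle (exterior torus X \<nu>) torus F (diffeos_rel_boundary F) p)"

section \<open>Gluing along the boundary and knot surgery\<close>

text \<open>
  The smooth manifold \<open>A \<union>\<^sub>f B\<close>, for a diffeomorphism \<open>f : \<partial>B \<rightarrow> \<partial>A\<close>, is determined up to
  diffeomorphism by the following: it is covered by smoothly embedded copies of \<open>A\<close> and \<open>B\<close>, which
  meet exactly in their boundaries, and there according to \<open>f\<close>.
\<close>

definition is_gluing ::
  "('a, 'e::euclidean_space) manifold \<Rightarrow> ('b, 'd::euclidean_space) manifold \<Rightarrow> ('b \<Rightarrow> 'a) \<Rightarrow>
   ('m, 'c::euclidean_space) manifold \<Rightarrow> bool" where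
  "is_gluing A B f M \<longleftrightarrow> smooth_manifold M \<and>
     (\<exists>a b. smooth_embedding A M a \<and> smooth_embedding B M b \<and>
        a ` pts A \<union> b ` pts B = pts M \<and>
        a ` pts A \<inter> b ` pts B = a ` boundary A \<and>
        a ` pts A \<inter> b ` pts B = b ` boundary B \<and>
        (\<forall>x\<in>boundary B. b x = a (f x)))"

abbreviation circle_times_exterior ::
  "('b, real ^ 3) manifold \<Rightarrow> (complex \<times> complex \<Rightarrow> 'b) \<Rightarrow> (complex \<times> 'b, real \<times> (real ^ 3)) manifold" where
  "circle_times_exterior Y \<mu> \<equiv> prod_manifold circle (exterior circle Y \<mu>)"

definition knot_surgery ::
  "('a, real ^ 4) manifold \<Rightarrow> ((complex \<times> complex) \<times> complex \<Rightarrow> 'a) \<Rightarrow>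
   ('b, real ^ 3) manifold \<Rightarrow> (complex \<times> complex \<Rightarrow> 'b) \<Rightarrow> (complex \<times> 'b \<Rightarrow> 'a) \<Rightarrow>
   ('m, real ^ 4) manifold \<Rightarrow> bool" where
  "knot_surgery X \<nu> Y \<mu> f M \<longleftrightarrow> is_gluing (exterior torus X \<nu>) (circle_times_exterior Y \<mu>) f M"

definition boundary_3manifold :: "('a, 'e::euclidean_space) manifold \<Rightarrow> ('a, real ^ 3) manifold" where
  "boundary_3manifold M = submanifold M (boundary M)"

end

theory Submission
  imports Defs
begin

text \<open>
  Let \<open>A\<close> be the exterior of \<open>T\<close>, with bundle projection \<open>p = (p1, p2)\<close>, let \<open>B\<close> be \<open>S\<^sup>1\<close> times the exterior of \<open>K\<close>,
  with circle-valued functions \<open>s\<close> (the first coordinate) and \<open>q\<close> (the fibration of \<open>K\<close>), and let \<open>N\<close> be the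
  3-torus in \<open>M\<close> along which \<open>A\<close> and \<open>B\<close> are glued. Any four maps from the 3-torus to the circle are
  integrally dependent up to homotopy, so for suitable exponents, not all zero, \<open>uA = p1\<^sup>m p2\<^sup>n\<close> and
  \<open>uB = s\<^sup>k q\<^sup>l\<close> satisfy \<open>uB = uA cis h\<close> on \<open>N\<close> for a continuous real function \<open>h\<close>. Neither pair of exponents
  vanishes: a submersion to the circle on \<open>N\<close> is not of the form \<open>cis h\<close>, because \<open>h\<close> has a maximum. Hence
  both \<open>uA\<close> and \<open>uB\<close> are submersions, also when restricted to \<open>N\<close>. If \<open>\<sigma>\<close> is a defining function of \<open>N\<close>,
  positive in \<open>A\<close>, and \<open>f\<close> decreases from 1 to 0 near 0, then \<open>uA cis (f(\<sigma>) (h + C))\<close> interpolates between \<open>uA\<close>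
  and a multiple of \<open>uB\<close>, and for a large constant \<open>C\<close> it is a submersion \<open>M \<rightarrow> S\<^sup>1\<close>. By Ehresmann's theorem
  it is a fiber bundle.
\<close>

section \<open>Smooth functions on open subsets of Euclidean spaces\<close>

text \<open>A circle-valued map is handled through its angle. Near the seam the angle of
  \<open>uA cis (f(\<sigma>) (h + C))\<close> has the differential
  \<open>d\<theta> + f dh + f' (h + C) d\<sigma>\<close>, where \<open>\<theta>\<close> is the angle
  of \<open>uA\<close> and \<open>\<theta> + h\<close> that of \<open>uB\<close>. Near the two ends
  of the interpolation the last term can have any size, so regularity must come there from vectors
  in the kernel of \<open>d\<sigma>\<close>. This is why regularity of \<open>uA\<close> and
  \<open>uB\<close> is carried by two-sided curves inside the pieces, which are automatically
  tangent to the seam where they meet it. In the middle \<open>f'\<close> is bounded away from 0,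
  and the constant \<open>C\<close>, which merely rotates \<open>uB\<close>, makes the last term
  dominate. Collars do not occur: both maps are extended across the seam and compared there. The
  curves are lifts of lines of direction \<open>(m, n)\<close>, along which \<open>p1^m p2^n\<close>
  turns with speed \<open>m^2 + n^2\<close>. Charts may take values in half-spaces, so questions
  about boundary points, including the absence of a boundary of \<open>M\<close>, are settled by
  invariance of domain and by first-order conditions at the seam.\<close>

lemma frechet_derivative_cong_open:
  assumes "open S" "x \<in> S" "\<And>y. y \<in> S \<Longrightarrow> f y = g y"
  shows "frechet_derivative f (at x) = frechet_derivative g (at x)"
proof -
  have "(f has_derivative D) (at x) \<longleftrightarrow> (g has_derivative D) (at x)" for D
    using has_derivative_transform_within_open[of f D x UNIV S g]
      has_derivative_transform_within_open[of g D x UNIV S f] assms by auto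
  then show ?thesis
    by (simp add: frechet_derivative_def)
qed

lemma k_smooth_on_subset: "k_smooth_on k S f \<Longrightarrow> T \<subseteq> S \<Longrightarrow> k_smooth_on k T f"
  by (induction k arbitrary: f) (auto intro: continuous_on_subset)

lemma k_smooth_on_Suc_imp: "k_smooth_on (Suc k) S f \<Longrightarrow> k_smooth_on k S f"
proof (induction k arbitrary: f)
  case 0
  then show ?case
    by (auto intro!: continuous_at_imp_continuous_on differentiable_imp_continuous_within)
next
  case (Suc k)
  then show ?case
    by (metis k_smooth_on.simps(2))
qed

lemma k_smooth_on_cong:
  assumes "open S" "\<And>x. x \<in> S \<Longrightarrow> f x = g x"
  shows "k_smooth_on k S f \<longleftrightarrow> k_smooth_on k S g"
  using assms(2)
proof (induction k arbitrary: f g)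
  case 0
  then show ?case by (auto cong: continuous_on_cong)
next
  case (Suc k)
  have "f differentiable (at x) \<longleftrightarrow> g differentiable (at x)" if "x \<in> S" for x
    using has_derivative_transform_within_open[of f _ x UNIV S g]
      has_derivative_transform_within_open[of g _ x UNIV S f] assms Suc.prems that
    by (metis differentiable_def)
  moreover have "k_smooth_on k S (\<lambda>x. frechet_derivative f (at x) v) \<longleftrightarrow>
      k_smooth_on k S (\<lambda>x. frechet_derivative g (at x) v)" for v
    using frechet_derivative_cong_open[OF assms(1), of _ f g] Suc.prems
    by (intro Suc.IH) auto
  ultimately show ?case by simp
qed

text \<open>An explicit derivative is easier to handle than the choice behind
  \<open>frechet_derivative\<close>; the smoothness inductions below go through this rule.\<close>

lemma k_smooth_on_SucI:
  assumes "open S" "\<And>x. x \<in> S \<Longrightarrow> (f has_derivative D x) (at x)"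
    "\<And>v. k_smooth_on k S (\<lambda>x. D x v)"
  shows "k_smooth_on (Suc k) S f"
proof -
  have "k_smooth_on k S (\<lambda>x. frechet_derivative f (at x) v)" for v
    using assms(3)[of v] frechet_derivative_at[OF assms(2)] assms(1)
    by (subst k_smooth_on_cong[where g = "\<lambda>x. D x v"]) auto
  then show ?thesis
    using assms(2) by (auto simp: differentiable_def)
qed

lemma k_smooth_on_SucD:
  assumes "k_smooth_on (Suc k) S f" "x \<in> S"
  shows "(f has_derivative frechet_derivative f (at x)) (at x)"
  using assms by (simp add: frechet_derivative_works)

lemma k_smooth_on_const: "open S \<Longrightarrow> k_smooth_on k S (\<lambda>x. c)"
proof (induction k arbitrary: c)
  case (Suc k)
  show ?case
    by (rule k_smooth_on_SucI[where D = "\<lambda>x v. 0"]) (use Suc in auto)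
qed auto

lemma k_smooth_on_linear:
  assumes "bounded_linear L" "open S" "k_smooth_on k S f"
  shows "k_smooth_on k S (\<lambda>x. L (f x))"
  using assms(3)
proof (induction k arbitrary: f)
  case 0
  then show ?case
    using assms(1) by (auto intro: bounded_linear.continuous_on)
next
  case (Suc k)
  show ?case
    by (rule k_smooth_on_SucI[where D = "\<lambda>x v. L (frechet_derivative f (at x) v)"])
      (use assms Suc in \<open>auto intro!: bounded_linear.has_derivative[OF assms(1)] k_smooth_on_SucD\<close>)
qed

lemma k_smooth_on_add:
  assumes "open S" "k_smooth_on k S f" "k_smooth_on k S g"
  shows "k_smooth_on k S (\<lambda>x. f x + g x)"
  using assms(2,3)
proof (induction k arbitrary: f g)
  case 0
  then show ?case by (auto intro: continuous_on_add)
next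
  case (Suc k)
  show ?case
    by (rule k_smooth_on_SucI[where D = "\<lambda>x v. frechet_derivative f (at x) v + frechet_derivative g (at x) v"])
      (use assms(1) Suc in \<open>auto intro!: has_derivative_add k_smooth_on_SucD\<close>)
qed

text \<open>The product rule yields two products with one differentiated factor each. The
  undifferentiated factor enters the induction hypothesis with one order of smoothness less, which
  \<open>k_smooth_on_Suc_imp\<close> supplies.\<close>

lemma k_smooth_on_bilinear:
  assumes bl: "bounded_bilinear pr" and "open S" "k_smooth_on k S f" "k_smooth_on k S g"
  shows "k_smooth_on k S (\<lambda>x. pr (f x) (g x))"
  using assms(3,4)
proof (induction k arbitrary: f g)
  case 0
  then show ?case using bl by (auto intro: bounded_bilinear.continuous_on)
next
  case (Suc k)
  have "k_smooth_on k S f" "k_smooth_on k S g"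
    using Suc.prems k_smooth_on_Suc_imp by blast+
  then show ?case
    by (intro k_smooth_on_SucI[where D = "\<lambda>x v. pr (f x) (frechet_derivative g (at x) v) + pr (frechet_derivative f (at x) v) (g x)"])
      (use assms(2) Suc in \<open>auto intro!: bounded_bilinear.FDERIV[OF bl] k_smooth_on_SucD k_smooth_on_add\<close>)
qed

lemma k_smooth_on_sum:
  assumes "finite I" "open S" "\<And>i. i \<in> I \<Longrightarrow> k_smooth_on k S (f i)"
  shows "k_smooth_on k S (\<lambda>x. \<Sum>i\<in>I. f i x)"
  using assms by (induction I rule: finite_induct) (auto intro: k_smooth_on_const k_smooth_on_add)

lemma k_smooth_on_prod:
  fixes f :: "'i \<Rightarrow> 'a::euclidean_space \<Rightarrow> real"
  assumes "finite I" "open S" "\<And>i. i \<in> I \<Longrightarrow> k_smooth_on k S (f i)"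
  shows "k_smooth_on k S (\<lambda>x. \<Prod>i\<in>I. f i x)"
  using assms by (induction I rule: finite_induct)
    (auto intro: k_smooth_on_const k_smooth_on_bilinear[OF bounded_bilinear_mult])

text \<open>In the chain rule the direction fed to the derivative of \<open>g\<close> depends on
  \<open>x\<close>, which the induction hypothesis cannot treat. Expanding that direction in
  \<open>Basis\<close> leaves finitely many products of a component of the derivative of
  \<open>f\<close> with the composition of \<open>f\<close> and a derivative of \<open>g\<close> in
  a fixed direction.\<close>

lemma k_smooth_on_compose:
  fixes g :: "'b::euclidean_space \<Rightarrow> 'c::euclidean_space" and f :: "'a::euclidean_space \<Rightarrow> 'b"
  assumes "open S" "open T" "k_smooth_on k T g" "k_smooth_on k S f" "f ` S \<subseteq> T"
  shows "k_smooth_on k S (\<lambda>x. g (f x))"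
  using assms(3-5)
proof (induction k arbitrary: g f)
  case 0
  then show ?case by (auto intro: continuous_on_compose2)
next
  case (Suc k)
  let ?D = "\<lambda>x v. \<Sum>b\<in>Basis. (frechet_derivative f (at x) v \<bullet> b) *\<^sub>R frechet_derivative g (at (f x)) b"
  have f: "k_smooth_on k S f"
    using Suc.prems k_smooth_on_Suc_imp by blast
  show ?case
  proof (rule k_smooth_on_SucI[where D = ?D])
    fix x assume x: "x \<in> S"
    then have "f x \<in> T" using Suc.prems by auto
    then have g': "(g has_derivative frechet_derivative g (at (f x))) (at (f x))"
      using Suc.prems k_smooth_on_SucD by blast
    have f': "(f has_derivative frechet_derivative f (at x)) (at x)"
      using Suc.prems x k_smooth_on_SucD by blast
    have lin: "linear (frechet_derivative g (at (f x)))"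
      using g' has_derivative_linear by blast
    have rep: "frechet_derivative g (at (f x)) u = (\<Sum>b\<in>Basis. (u \<bullet> b) *\<^sub>R frechet_derivative g (at (f x)) b)" for u
      by (subst euclidean_representation[of u, symmetric], simp only: linear_sum[OF lin] linear_scale[OF lin])
    have "frechet_derivative g (at (f x)) \<circ> frechet_derivative f (at x) = ?D x"
      by (rule ext, unfold o_def, rule rep)
    then show "((\<lambda>x. g (f x)) has_derivative ?D x) (at x)"
      using diff_chain_at[OF f' g'] by (simp add: o_def)
  next
    show "k_smooth_on k S (\<lambda>x. ?D x v)" for v
      using Suc.prems f assms(1)
      by (intro k_smooth_on_sum k_smooth_on_bilinear[OF bounded_bilinear_scaleR]
          k_smooth_on_linear[OF bounded_linear_inner_left] Suc.IH[of "\<lambda>y. frechet_derivative g (at y) _"]) auto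
  qed (rule assms(1))
qed

section \<open>Smooth functions on open sets: closure rules and elementary functions\<close>

definition smooth_on :: "'a::euclidean_space set \<Rightarrow> ('a \<Rightarrow> 'b::euclidean_space) \<Rightarrow> bool" where
  "smooth_on S f \<longleftrightarrow> open S \<and> (\<forall>k. k_smooth_on k S f)"

lemma smooth_on_open: "smooth_on S f \<Longrightarrow> open S"
  by (simp add: smooth_on_def)

lemma smooth_on_subset: "smooth_on S f \<Longrightarrow> open T \<Longrightarrow> T \<subseteq> S \<Longrightarrow> smooth_on T f"
  using k_smooth_on_subset unfolding smooth_on_def by blast

lemma smooth_on_cong: "smooth_on S f \<Longrightarrow> (\<And>x. x \<in> S \<Longrightarrow> f x = g x) \<Longrightarrow> smooth_on S g"
  using k_smooth_on_cong[of S f g] by (auto simp: smooth_on_def)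

lemma smooth_on_has_derivative:
  "smooth_on S f \<Longrightarrow> x \<in> S \<Longrightarrow> (f has_derivative frechet_derivative f (at x)) (at x)"
  unfolding smooth_on_def using k_smooth_on_SucD by blast

lemma smooth_on_frechet: "smooth_on S f \<Longrightarrow> smooth_on S (\<lambda>x. frechet_derivative f (at x) v)"
  unfolding smooth_on_def by (metis k_smooth_on.simps(2))

lemma smooth_on_continuous: "smooth_on S f \<Longrightarrow> continuous_on S f"
  unfolding smooth_on_def by (metis k_smooth_on.simps(1))

lemma smooth_on_const: "open S \<Longrightarrow> smooth_on S (\<lambda>x. c)"
  by (simp add: smooth_on_def k_smooth_on_const)

lemma k_smooth_on_id: "open S \<Longrightarrow> k_smooth_on k S (\<lambda>x. x)"
proof (induction k)
  case (Suc k)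
  show ?case
    by (rule k_smooth_on_SucI[where D = "\<lambda>x v. v"])
      (use Suc in \<open>auto intro: k_smooth_on_const\<close>)
qed auto

lemma smooth_on_id: "open S \<Longrightarrow> smooth_on S (\<lambda>x. x)"
  by (simp add: smooth_on_def k_smooth_on_id)

lemma smooth_on_linear: "bounded_linear L \<Longrightarrow> smooth_on S f \<Longrightarrow> smooth_on S (\<lambda>x. L (f x))"
  by (simp add: smooth_on_def k_smooth_on_linear)

lemma smooth_on_add: "smooth_on S f \<Longrightarrow> smooth_on S g \<Longrightarrow> smooth_on S (\<lambda>x. f x + g x)"
  by (simp add: smooth_on_def k_smooth_on_add)

lemma smooth_on_bilinear:
  "bounded_bilinear pr \<Longrightarrow> smooth_on S f \<Longrightarrow> smooth_on S g \<Longrightarrow> smooth_on S (\<lambda>x. pr (f x) (g x))"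
  by (simp add: smooth_on_def k_smooth_on_bilinear)

lemma smooth_on_minus: "smooth_on S f \<Longrightarrow> smooth_on S (\<lambda>x. - f x)"
  by (rule smooth_on_linear) (rule bounded_linear_minus[OF bounded_linear_ident])

lemma smooth_on_diff: "smooth_on S f \<Longrightarrow> smooth_on S g \<Longrightarrow> smooth_on S (\<lambda>x. f x - g x)"
  using smooth_on_add[OF _ smooth_on_minus] by fastforce

lemma smooth_on_compose:
  "smooth_on T g \<Longrightarrow> smooth_on S f \<Longrightarrow> f ` S \<subseteq> T \<Longrightarrow> smooth_on S (\<lambda>x. g (f x))"
  using k_smooth_on_compose unfolding smooth_on_def by blast

lemmas smooth_on_mult = smooth_on_bilinear[OF bounded_bilinear_mult]
  and smooth_on_scaleR = smooth_on_bilinear[OF bounded_bilinear_scaleR]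
  and smooth_on_inner = smooth_on_bilinear[OF bounded_bilinear_inner]

lemma smooth_on_Pair:
  assumes "smooth_on S f" "smooth_on S g"
  shows "smooth_on S (\<lambda>x. (f x, g x))"
proof -
  have "smooth_on S (\<lambda>x. (f x, 0) + (0, g x))"
    using assms by (intro smooth_on_add smooth_on_linear[of "\<lambda>y. (y, 0)"] smooth_on_linear[of "\<lambda>y. (0, y)"]
        bounded_linear_Pair bounded_linear_ident bounded_linear_zero)
  then show ?thesis by simp
qed

lemma smooth_on_preimage: "smooth_on S f \<Longrightarrow> open T \<Longrightarrow> open (S \<inter> f -` T)"
  using continuous_open_preimage[of S f T] smooth_on_continuous smooth_on_open by blast

text \<open>Bootstrapping for functions that solve a differential equation: if the derivative is as
  smooth as the function itself, every order of smoothness follows. It serves the inverse, the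
  square root, \<open>Ln\<close> and \<open>cis\<close>.\<close>

lemma smooth_onI_derivative:
  assumes "open S" "\<And>x. x \<in> S \<Longrightarrow> (f has_derivative D x) (at x)"
    "\<And>k v. k_smooth_on k S f \<Longrightarrow> k_smooth_on k S (\<lambda>x. D x v)"
  shows "smooth_on S f"
proof -
  have "continuous_on S f"
    using assms(1,2) has_derivative_continuous by (blast intro: continuous_at_imp_continuous_on)
  then have "k_smooth_on k S f" for k
  proof (induction k)
    case (Suc k)
    then show ?case
      using assms by (intro k_smooth_on_SucI[where D = D]) auto
  qed auto
  then show ?thesis using assms(1) by (simp add: smooth_on_def)
qed

lemma smooth_on_inverse_real: "smooth_on (- {0::real}) inverse"
proof (rule smooth_onI_derivative[where D = "\<lambda>x v. - (inverse x * v * inverse x)"])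
  show "k_smooth_on k (- {0::real}) (\<lambda>x. - (inverse x * v * inverse x))"
    if "k_smooth_on k (- {0::real}) inverse" for k and v :: real
    using that by (intro k_smooth_on_linear[OF bounded_linear_minus[OF bounded_linear_ident]]
        k_smooth_on_bilinear[OF bounded_bilinear_mult] k_smooth_on_const) auto
qed (auto intro!: has_derivative_inverse')

lemma smooth_on_inverse_complex: "smooth_on (- {0::complex}) inverse"
proof (rule smooth_onI_derivative[where D = "\<lambda>x v. - (inverse x * v * inverse x)"])
  show "k_smooth_on k (- {0::complex}) (\<lambda>x. - (inverse x * v * inverse x))"
    if "k_smooth_on k (- {0::complex}) inverse" for k and v :: complex
    using that by (intro k_smooth_on_linear[OF bounded_linear_minus[OF bounded_linear_ident]]
        k_smooth_on_bilinear[OF bounded_bilinear_mult] k_smooth_on_const) auto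
qed (auto intro!: has_derivative_inverse')

lemma smooth_on_inverse_fun:
  fixes f :: "'a::euclidean_space \<Rightarrow> real"
  assumes "smooth_on S f" "\<And>x. x \<in> S \<Longrightarrow> f x \<noteq> 0"
  shows "smooth_on S (\<lambda>x. inverse (f x))"
  using assms by (intro smooth_on_compose[OF smooth_on_inverse_real]) auto

lemma smooth_on_sqrt: "smooth_on {0<..} sqrt"
proof (rule smooth_onI_derivative[where D = "\<lambda>x v. v * (inverse (sqrt x) / 2)"])
  fix k and v :: real assume sq: "k_smooth_on k {0<..} sqrt"
  have inv: "k_smooth_on k (- {0::real}) inverse"
    using smooth_on_inverse_real by (simp add: smooth_on_def)
  have "k_smooth_on k {0<..} (\<lambda>x. inverse (sqrt x))"
    by (rule k_smooth_on_compose[OF _ _ inv sq]) auto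
  from k_smooth_on_linear[OF bounded_linear_mult_right[of "v/2"] _ this]
  show "k_smooth_on k {0<..} (\<lambda>x. v * (inverse (sqrt x) / 2))"
    by simp
next
  show "(sqrt has_derivative (\<lambda>v. v * (inverse (sqrt x) / 2))) (at x)" if "x \<in> {0<..}" for x
  proof -
    have "(\<lambda>v. v * (inverse (sqrt x) / 2)) = (*) (inverse (sqrt x) / 2)"
      by (simp add: fun_eq_iff)
    then show ?thesis
      using DERIV_real_sqrt[of x] that by (simp only: has_field_derivative_def) simp
  qed
qed auto

lemma smooth_on_Ln: "smooth_on (- \<real>\<^sub>\<le>\<^sub>0) Ln"
proof -
  have inv: "k_smooth_on k (- \<real>\<^sub>\<le>\<^sub>0) (\<lambda>z::complex. inverse z)" for k
    using smooth_on_inverse_complex k_smooth_on_subset[of k "- {0::complex}" inverse "- \<real>\<^sub>\<le>\<^sub>0"]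
    by (auto simp: smooth_on_def)
  show ?thesis
  proof (rule smooth_onI_derivative[where D = "\<lambda>x v. inverse x * v"])
    show "k_smooth_on k (- \<real>\<^sub>\<le>\<^sub>0) (\<lambda>x. inverse x * v)" for k and v :: complex
      using k_smooth_on_linear[OF bounded_linear_mult_left _ inv] open_Compl[OF closed_nonpos_Reals_complex] by blast
    show "(Ln has_derivative (*) (inverse x)) (at x)" if "x \<in> - \<real>\<^sub>\<le>\<^sub>0" for x
      using has_field_derivative_Ln[of x] that by (simp add: has_field_derivative_def)
  qed auto
qed

lemma smooth_on_cis: "smooth_on UNIV cis"
proof (rule smooth_onI_derivative[where D = "\<lambda>t v. of_real v * (\<i> * cis t)"])
  show "k_smooth_on k UNIV (\<lambda>t. of_real v * (\<i> * cis t))" if "k_smooth_on k UNIV cis" for k and v :: real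
    using k_smooth_on_linear[OF bounded_linear_mult_right[of "of_real v * \<i>"] _ that] by (simp add: mult.assoc)
qed (auto intro!: derivative_eq_intros simp: scaleR_conv_of_real)

lemma smooth_on_cis_fun: "smooth_on S f \<Longrightarrow> smooth_on S (\<lambda>x. cis (f x))"
  by (rule smooth_on_compose[OF smooth_on_cis]) auto

section \<open>The smooth inverse function theorem\<close>

lemma smooth_on_if_has_derivative_smooth:
  assumes "\<And>k. k_smooth_on k S f \<Longrightarrow> k_smooth_on (Suc k) S f" "open S" "continuous_on S f"
  shows "smooth_on S f"
proof -
  have "k_smooth_on k S f" for k
    by (induction k) (use assms in auto)
  then show ?thesis using assms(2) by (simp add: smooth_on_def)
qed

lemma k_smooth_on_det:
  fixes A :: "'a::euclidean_space \<Rightarrow> real^'n^'n"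
  assumes "open S" "\<And>i j. k_smooth_on k S (\<lambda>x. A x $ i $ j)"
  shows "k_smooth_on k S (\<lambda>x. det (A x))"
  unfolding det_def using assms
  by (intro k_smooth_on_sum k_smooth_on_bilinear[OF bounded_bilinear_mult] k_smooth_on_const k_smooth_on_prod) auto

lemma k_smooth_on_vec:
  fixes f :: "'a::euclidean_space \<Rightarrow> real^'n"
  assumes "open S" "\<And>i. k_smooth_on k S (\<lambda>x. f x $ i)"
  shows "k_smooth_on k S f"
proof -
  have "k_smooth_on k S (\<lambda>x. \<Sum>i\<in>UNIV. f x $ i *\<^sub>R (axis i 1 :: real^'n))"
    using assms by (intro k_smooth_on_sum k_smooth_on_bilinear[OF bounded_bilinear_scaleR] k_smooth_on_const) auto
  moreover have "(\<Sum>i\<in>UNIV. f x $ i *\<^sub>R (axis i 1 :: real^'n)) = f x" for x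
    using basis_expansion[of "f x"] by (simp add: scalar_mult_eq_scaleR)
  ultimately show ?thesis by simp
qed

text \<open>The classical theorem gives a differentiable local inverse \<open>g\<close> whose
  derivative inverts that of \<open>f\<close> at \<open>g y\<close>. By Cramer's rule the entries of
  this inverse are quotients of determinants in the entries of \<open>D (g y)\<close>, so a
  \<open>k\<close>-smooth \<open>g\<close> is smooth to order \<open>k + 1\<close>.\<close>

theorem smooth_inverse_function:
  fixes f :: "real^'n \<Rightarrow> real^'n"
  assumes f: "smooth_on W f" and x0: "x0 \<in> W"
    and inj: "\<And>v. frechet_derivative f (at x0) v = 0 \<Longrightarrow> v = 0"
  obtains U g where "open U" "x0 \<in> U" "U \<subseteq> W" "smooth_on (f ` U) g" "\<And>x. x \<in> U \<Longrightarrow> g (f x) = x"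
    "\<And>x v. x \<in> U \<Longrightarrow> frechet_derivative f (at x) v = 0 \<Longrightarrow> v = 0"
proof -
  define D where "D x = frechet_derivative f (at x)" for x
  \<comment> \<open>The inverse function theorem asks for continuity of the derivative in the normed
    space of bounded linear functions; in finite dimension componentwise continuity
    suffices.\<close>
  define f' where "f' x = Blinfun (D x)" for x
  have derf: "(f has_derivative D x) (at x)" if "x \<in> W" for x
    unfolding D_def using smooth_on_has_derivative[OF f that] .
  have bl: "bounded_linear (D x)" if "x \<in> W" for x
    using derf[OF that] has_derivative_bounded_linear by blast
  have app: "blinfun_apply (f' x) = D x" if "x \<in> W" for x
    unfolding f'_def using bl[OF that] by (rule bounded_linear_Blinfun_apply)
  have cont: "continuous_on W f'"
  proof (rule continuous_on_blinfun_componentwise)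
    fix i :: "real^'n"
    have "continuous_on W (\<lambda>x. D x i)"
      unfolding D_def using smooth_on_continuous[OF smooth_on_frechet[OF f]] .
    then show "continuous_on W (\<lambda>x. blinfun_apply (f' x) i)"
      using app by (simp cong: continuous_on_cong)
  qed
  have lin: "linear (D x0)"
    using bl[OF x0] bounded_linear.linear by blast
  then have "Vector_Spaces.linear (*\<^sub>R) (*\<^sub>R) (D x0)" "Modules.additive (D x0)"
    by (simp_all add: linear_def Modules.additive_def linear_add)
  moreover have "inj (D x0)"
    using lin inj unfolding D_def by (simp add: linear_injective_0)
  ultimately obtain B where B: "linear B" "B \<circ> D x0 = id"
    using linear_injective_left_inverse[of "D x0"] lin by blast
  have invf: "Blinfun B o\<^sub>L f' x0 = id_blinfun"
    using B x0 by (intro blinfun_eqI)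
      (simp add: app bounded_linear_Blinfun_apply linear_conv_bounded_linear pointfree_idE)
  obtain U V g g' where UV: "open U" "U \<subseteq> W" "x0 \<in> U" "open V" "homeomorphism U V f g"
    and g: "\<And>y. y \<in> V \<Longrightarrow> (g has_derivative (g' y)) (at y)"
    and g': "\<And>y. y \<in> V \<Longrightarrow> g' y = inv (blinfun_apply (f' (g y)))"
    and bij: "\<And>y. y \<in> V \<Longrightarrow> bij (blinfun_apply (f' (g y)))"
    using inverse_function_theorem[OF smooth_on_open[OF f] _ cont x0 invf] derf app by metis
  have V: "V = f ` U" and gf: "\<And>x. x \<in> U \<Longrightarrow> g (f x) = x" and gV: "g ` V = U"
    using UV(5) by (auto simp: homeomorphism_def)
  have bijD: "bij (D x)" if "x \<in> U" for x
    using bij[of "f x"] gf that app UV(2) V by (metis imageI subset_iff)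
  have "smooth_on V g"
  proof (rule smooth_on_if_has_derivative_smooth)
    fix k assume k: "k_smooth_on k V g"
    define A where "A y = matrix (D (g y))" for y
    have linD: "linear (D (g y))" if "y \<in> V" for y
      using bl[of "g y"] bounded_linear.linear that gV UV(2) by blast
    have A: "A y *v v = D (g y) v" if "y \<in> V" for y v
      unfolding A_def using matrix_works[of "D (g y)" v] linD[OF that] by simp
    have detA: "det (A y) \<noteq> 0" if "y \<in> V" for y
    proof -
      have "bij (D (g y))" using bijD gV that by blast
      then show ?thesis
        using det_nz_iff_inj[OF linD[OF that]] unfolding A_def by (simp add: bij_is_inj)
    qed
    have Dk: "k_smooth_on k V (\<lambda>y. D (g y) v)" for v
      using f gV UV(2,4) k unfolding D_def
      by (intro k_smooth_on_compose[of V W k "\<lambda>x. frechet_derivative f (at x) v" g])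
        (auto simp: smooth_on_def simp del: k_smooth_on.simps dest!: smooth_on_frechet[of W f v, unfolded smooth_on_def])
    have Ak: "k_smooth_on k V (\<lambda>y. A y $ i $ j)" for i j
      unfolding A_def matrix_def
      using k_smooth_on_linear[OF bounded_linear_vec_nth UV(4) Dk] by simp
    show "k_smooth_on (Suc k) V g"
    proof (rule k_smooth_on_SucI[OF UV(4) g])
      fix v
      have "g' y v = (\<chi> i. det (\<chi> a b. if b = i then v $ a else A y $ a $ b) * inverse (det (A y)))"
        if y: "y \<in> V" for y
      proof -
        have "bij (D (g y))" "blinfun_apply (f' (g y)) = D (g y)"
          using bijD gV y app UV(2) by blast+
        then have "D (g y) (g' y v) = v"
          using g'[OF y] by (simp add: bij_is_surj surj_f_inv_f)
        then have "A y *v g' y v = v"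
          using A[OF y] by simp
        then show ?thesis
          using cramer[OF detA[OF y], of "g' y v" v] by (simp add: divide_inverse)
      qed
      moreover have "k_smooth_on k V (\<lambda>y. \<chi> i. det (\<chi> a b. if b = i then v $ a else A y $ a $ b) * inverse (det (A y)))"
      proof (rule k_smooth_on_vec[OF UV(4)])
        fix i
        have e: "k_smooth_on k V (\<lambda>y. (\<chi> a b. if b = i then v $ a else A y $ a $ b) $ a $ b)" for a b
          using Ak[of a b] k_smooth_on_const[OF UV(4)] by (cases "b = i") auto
        have d: "k_smooth_on k V (\<lambda>y. inverse (det (A y)))"
          using detA smooth_on_inverse_real UV(4) k_smooth_on_det[OF UV(4) Ak]
          by (intro k_smooth_on_compose[of V "- {0}" k inverse]) (auto simp: smooth_on_def simp del: k_smooth_on.simps)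
        show "k_smooth_on k V (\<lambda>y. (\<chi> i. det (\<chi> a b. if b = i then v $ a else A y $ a $ b) * inverse (det (A y))) $ i)"
          using k_smooth_on_bilinear[OF bounded_bilinear_mult UV(4) k_smooth_on_det[OF UV(4) e] d] by simp
      qed
      ultimately show "k_smooth_on k V (\<lambda>y. g' y v)"
        using k_smooth_on_cong[OF UV(4), of "\<lambda>y. g' y v"] by simp
    qed
  next
    show "continuous_on V g" using UV(5) by (simp add: homeomorphism_def)
  qed (rule UV(4))
  then show ?thesis
    using that[of U g] UV V gf bijD unfolding D_def[symmetric]
    by (metis bij_is_inj linear_injective_0 bl bounded_linear.linear subset_iff)
qed

lemma frechet_derivative_compose:
  assumes "smooth_on T g" "smooth_on S f" "f x \<in> T" "x \<in> S"
  shows "frechet_derivative (\<lambda>x. g (f x)) (at x) v = frechet_derivative g (at (f x)) (frechet_derivative f (at x) v)"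
  using diff_chain_at[OF smooth_on_has_derivative[OF assms(2,4)] smooth_on_has_derivative[OF assms(1,3)]]
  by (simp add: o_def frechet_derivative_at[symmetric] fun_eq_iff)

section \<open>Smooth maps between manifolds\<close>

lemma k_smooth_on_local:
  assumes "\<And>x. x \<in> S \<Longrightarrow> \<exists>W. x \<in> W \<and> k_smooth_on k W f \<and> open W"
  shows "k_smooth_on k S f"
  using assms
proof (induction k arbitrary: f)
  case 0
  then show ?case
    by simp (metis continuous_at_imp_continuous_on continuous_on_eq_continuous_at)
next
  case (Suc k)
  then show ?case
    by (simp, metis)
qed

section \<open>Smoothness on arbitrary sets by local extensions\<close>

lemma smooth_on_set_iff:
  "smooth_on_set S f \<longleftrightarrow> (\<forall>x\<in>S. \<exists>W g. smooth_on W g \<and> x \<in> W \<and> (\<forall>y\<in>S \<inter> W. g y = f y))"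
  unfolding smooth_on_set_def smooth_on_def by metis

lemma smooth_on_imp_smooth_on_set: "smooth_on S f \<Longrightarrow> smooth_on_set S f"
  unfolding smooth_on_set_iff by blast

lemma smooth_on_set_imp_smooth_on:
  assumes "smooth_on_set S f" "open S"
  shows "smooth_on S f"
proof -
  have "k_smooth_on k S f" for k
  proof (rule k_smooth_on_local)
    fix x assume "x \<in> S"
    then obtain W g where W: "smooth_on W g" "x \<in> W" "\<And>y. y \<in> S \<inter> W \<Longrightarrow> g y = f y"
      using assms(1) unfolding smooth_on_set_iff by meson
    have o: "open (S \<inter> W)"
      using assms(2) smooth_on_open[OF W(1)] by blast
    have "smooth_on (S \<inter> W) f"
      by (rule smooth_on_cong[OF smooth_on_subset[OF W(1) o]]) (use W(3) in auto)
    then have "k_smooth_on k (S \<inter> W) f"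
      by (simp add: smooth_on_def)
    then show "\<exists>W. x \<in> W \<and> k_smooth_on k W f \<and> open W"
      using W(2) \<open>x \<in> S\<close> o by (intro exI[of _ "S \<inter> W"]) simp
  qed
  then show ?thesis using assms(2) by (simp add: smooth_on_def)
qed

lemma smooth_on_set_subset: "smooth_on_set S f \<Longrightarrow> T \<subseteq> S \<Longrightarrow> smooth_on_set T f"
  unfolding smooth_on_set_iff by (meson IntD1 IntD2 IntI subsetD)

lemma smooth_on_set_cong: "smooth_on_set S f \<Longrightarrow> (\<And>x. x \<in> S \<Longrightarrow> f x = g x) \<Longrightarrow> smooth_on_set S g"
  unfolding smooth_on_set_iff by (metis IntD1)

lemma smooth_on_set_local:
  assumes "\<And>x. x \<in> S \<Longrightarrow> \<exists>W. open W \<and> x \<in> W \<and> smooth_on_set (S \<inter> W) f"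
  shows "smooth_on_set S f"
  unfolding smooth_on_set_iff
proof
  fix x assume x: "x \<in> S"
  then obtain W where W: "open W" "x \<in> W" "smooth_on_set (S \<inter> W) f"
    using assms by blast
  then obtain V g where V: "smooth_on V g" "x \<in> V" "\<And>y. y \<in> S \<inter> W \<inter> V \<Longrightarrow> g y = f y"
    unfolding smooth_on_set_iff using x by (metis IntI)
  show "\<exists>W g. smooth_on W g \<and> x \<in> W \<and> (\<forall>y\<in>S \<inter> W. g y = f y)"
    using V W smooth_on_subset[OF V(1), of "V \<inter> W"] smooth_on_open[OF V(1)]
    by (intro exI[of _ "V \<inter> W"] exI[of _ g]) auto
qed

lemma smooth_on_set_compose:
  assumes g: "smooth_on_set T g" and f: "smooth_on_set S f" and sub: "f ` S \<subseteq> T"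
  shows "smooth_on_set S (\<lambda>x. g (f x))"
  unfolding smooth_on_set_iff
proof
  fix x assume x: "x \<in> S"
  obtain W F where F: "smooth_on W F" "x \<in> W" "\<And>y. y \<in> S \<inter> W \<Longrightarrow> F y = f y"
    using f x unfolding smooth_on_set_iff by meson
  have "f x \<in> T" using x sub by auto
  then obtain V G where G: "smooth_on V G" "f x \<in> V" "\<And>y. y \<in> T \<inter> V \<Longrightarrow> G y = g y"
    using g unfolding smooth_on_set_iff by meson
  have o: "open (W \<inter> F -` V)"
    using smooth_on_preimage[OF F(1)] smooth_on_open[OF G(1)] by blast
  then have "smooth_on (W \<inter> F -` V) (\<lambda>x. G (F x))"
    by (intro smooth_on_compose[OF G(1)] smooth_on_subset[OF F(1)]) auto
  then show "\<exists>W h. smooth_on W h \<and> x \<in> W \<and> (\<forall>y\<in>S \<inter> W. h y = g (f y))"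
    using F G x sub by (intro exI[of _ "W \<inter> F -` V"] exI[of _ "\<lambda>x. G (F x)"]) auto
qed

lemma smooth_on_set_Pair:
  assumes f: "smooth_on_set S f" and g: "smooth_on_set S g"
  shows "smooth_on_set S (\<lambda>x. (f x, g x))"
  unfolding smooth_on_set_iff
proof
  fix x assume x: "x \<in> S"
  obtain W F where F: "smooth_on W F" "x \<in> W" "\<And>y. y \<in> S \<inter> W \<Longrightarrow> F y = f y"
    using f x unfolding smooth_on_set_iff by meson
  obtain V G where G: "smooth_on V G" "x \<in> V" "\<And>y. y \<in> S \<inter> V \<Longrightarrow> G y = g y"
    using g x unfolding smooth_on_set_iff by meson
  have o: "open (W \<inter> V)"
    using smooth_on_open[OF F(1)] smooth_on_open[OF G(1)] by blast
  then have "smooth_on (W \<inter> V) (\<lambda>x. (F x, G x))"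
    by (intro smooth_on_Pair smooth_on_subset[OF F(1)] smooth_on_subset[OF G(1)]) auto
  then show "\<exists>W h. smooth_on W h \<and> x \<in> W \<and> (\<forall>y\<in>S \<inter> W. h y = (f y, g y))"
    using F G by (intro exI[of _ "W \<inter> V"] exI[of _ "\<lambda>x. (F x, G x)"]) auto
qed

lemma smooth_on_set_continuous:
  assumes "smooth_on_set S f"
  shows "continuous_on S f"
  unfolding continuous_on_eq_continuous_within
proof
  fix x assume x: "x \<in> S"
  obtain W F where F: "smooth_on W F" "x \<in> W" "\<And>y. y \<in> S \<inter> W \<Longrightarrow> F y = f y"
    using assms x unfolding smooth_on_set_iff by meson
  have "open W" "continuous_on W F" using F smooth_on_open smooth_on_continuous by blast+
  then have "isCont F x"
    using F(2) continuous_on_eq_continuous_at by blast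
  then have "continuous (at x within S) F"
    using continuous_within_subset by blast
  then show "continuous (at x within S) f"
    using continuous_transform_within_openin[of x S F "S \<inter> W" f] x F \<open>open W\<close>
    by (metis (no_types, lifting) IntI openin_open_Int)
qed

section \<open>Topology of coordinate charts\<close>

text \<open>Keeps only the topological part of \<open>is_chart\<close> and drops the shape of the
  image; \<open>charted\<close> likewise drops the compatibility of charts. In this generality
  products are charted without any discussion of the half-space in which a product chart takes its
  values.\<close>

definition coord :: "'a topology \<Rightarrow> 'a set \<Rightarrow> ('a \<Rightarrow> 'e::euclidean_space) \<Rightarrow> bool" where
  "coord T U \<phi> \<longleftrightarrow> openin T U \<and> homeomorphic_map (subtopology T U) (top_of_set (\<phi> ` U)) \<phi>"

definition charted :: "('a, 'e::euclidean_space) manifold \<Rightarrow> bool" where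
  "charted M \<longleftrightarrow> (\<forall>(U, \<phi>)\<in>atlas M. coord (mtop M) U \<phi>) \<and> \<Union>(fst ` atlas M) = pts M"

lemma is_chart_coord: "is_chart T U \<phi> \<longleftrightarrow> coord T U \<phi> \<and> chart_image (\<phi> ` U)"
  by (auto simp: is_chart_def coord_def)

lemma smooth_manifold_charted: "smooth_manifold M \<Longrightarrow> charted M"
  by (auto simp: smooth_manifold_def charted_def is_chart_coord)

lemma charted_coord: "charted M \<Longrightarrow> (U, \<phi>) \<in> atlas M \<Longrightarrow> coord (mtop M) U \<phi>"
  by (auto simp: charted_def)

lemma charted_obtain:
  assumes "charted M" "x \<in> pts M"
  obtains U \<phi> where "(U, \<phi>) \<in> atlas M" "x \<in> U"
  using assms unfolding charted_def by fastforce

lemma coord_openin: "coord T U \<phi> \<Longrightarrow> openin T U"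
  by (simp add: coord_def)

lemma coord_subset: "coord T U \<phi> \<Longrightarrow> U \<subseteq> topspace T"
  by (simp add: coord_def openin_subset)

lemma coord_inj: "coord T U \<phi> \<Longrightarrow> inj_on \<phi> U"
  unfolding coord_def homeomorphic_map_def
  by (metis openin_subset topspace_subtopology_subset)

lemma coord_inv: "coord T U \<phi> \<Longrightarrow> x \<in> U \<Longrightarrow> inv_into U \<phi> (\<phi> x) = x"
  by (simp add: coord_inj)

lemma coord_continuous: "coord T U \<phi> \<Longrightarrow> continuous_map (subtopology T U) euclidean \<phi>"
  unfolding coord_def using homeomorphic_imp_continuous_map continuous_map_in_subtopology by blast

lemma coord_inv_continuous_sub:
  assumes "coord T U \<phi>"
  shows "continuous_map (top_of_set (\<phi> ` U)) (subtopology T U) (inv_into U \<phi>)"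
proof -
  obtain g where g: "homeomorphic_maps (subtopology T U) (top_of_set (\<phi> ` U)) \<phi> g"
    using assms unfolding coord_def homeomorphic_map_maps by blast
  have "g (\<phi> x) = x" if "x \<in> U" for x
    using g that coord_subset[OF assms] unfolding homeomorphic_maps_def by auto
  then have "g p = inv_into U \<phi> p" if "p \<in> \<phi> ` U" for p
    using that coord_inv[OF assms] by auto
  then show ?thesis
    using g unfolding homeomorphic_maps_def
    by (metis (no_types, lifting) continuous_map_eq topspace_euclidean_subtopology)
qed

lemma coord_inv_continuous:
  "coord T U \<phi> \<Longrightarrow> continuous_map (top_of_set (\<phi> ` U)) T (inv_into U \<phi>)"
  using coord_inv_continuous_sub continuous_map_into_fulltopology by blast

lemma coordI:
  assumes U: "openin T U" and c: "continuous_map (subtopology T U) euclidean \<phi>"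
    and g: "continuous_map (top_of_set (\<phi> ` U)) T g" and gf: "\<And>x. x \<in> U \<Longrightarrow> g (\<phi> x) = x"
  shows "coord T U \<phi>"
proof -
  have "homeomorphic_maps (subtopology T U) (top_of_set (\<phi> ` U)) \<phi> g"
    using assms openin_subset[OF U]
    by (auto simp: homeomorphic_maps_def continuous_map_in_subtopology)
  then show ?thesis
    using U by (auto simp: coord_def homeomorphic_map_maps)
qed

text \<open>Chart images need not be open in the model space, so an open condition on points is
  encoded by an open set \<open>W\<close> of the model space that is tested only on points of
  \<open>U\<close>.\<close>

lemma coord_open:
  assumes "coord T U \<phi>" "openin T Q"
  obtains W where "open W" "\<And>y. y \<in> U \<Longrightarrow> \<phi> y \<in> W \<longleftrightarrow> y \<in> Q"
proof -
  have "openin (top_of_set (\<phi> ` U)) {p \<in> topspace (top_of_set (\<phi> ` U)). inv_into U \<phi> p \<in> Q}"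
    using openin_continuous_map_preimage[OF coord_inv_continuous[OF assms(1)] assms(2)] .
  then obtain W where "open W" "{p \<in> \<phi> ` U. inv_into U \<phi> p \<in> Q} = \<phi> ` U \<inter> W"
    by (auto simp: openin_open)
  moreover have "\<phi> y \<in> W \<longleftrightarrow> y \<in> Q" if "y \<in> U" for y
    using calculation(2) coord_inv[OF assms(1) that] that by (metis (mono_tags, lifting) IntD2 IntI image_eqI mem_Collect_eq)
  ultimately show ?thesis
    using that[of W] by blast
qed

lemma coord_preimage:
  assumes "coord T U \<phi>" "open W"
  shows "openin T (U \<inter> \<phi> -` W)"
proof -
  have "openin (subtopology T U) {x \<in> topspace (subtopology T U). \<phi> x \<in> W}"
    using openin_continuous_map_preimage[OF coord_continuous[OF assms(1)]] assms(2) by simp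
  moreover have "{x \<in> topspace (subtopology T U). \<phi> x \<in> W} = U \<inter> \<phi> -` W"
    using coord_subset[OF assms(1)] by auto
  ultimately show ?thesis
    using coord_openin[OF assms(1)] openin_open_subtopology by metis
qed

lemma coord_restrict:
  assumes c: "coord T U \<phi>" and Q: "openin T Q" "Q \<subseteq> U"
  shows "coord T Q \<phi>"
proof (rule coordI[OF Q(1)])
  show "continuous_map (subtopology T Q) euclidean \<phi>"
    using coord_continuous[OF c] Q(2) continuous_map_from_subtopology_mono by blast
  show "continuous_map (top_of_set (\<phi> ` Q)) T (inv_into U \<phi>)"
    using coord_inv_continuous[OF c] Q(2)
    by (meson continuous_map_from_subtopology_mono image_mono)
qed (use coord_inv[OF c] Q in auto)

section \<open>Smooth maps between manifolds: locality and composition\<close>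

lemma smooth_map_onD:
  "smooth_map_on M S N f \<Longrightarrow> (U, \<phi>) \<in> atlas M \<Longrightarrow> (V, \<psi>) \<in> atlas N \<Longrightarrow>
    smooth_on_set (\<phi> ` (S \<inter> U \<inter> f -` V)) (\<psi> \<circ> f \<circ> inv_into U \<phi>)"
  unfolding smooth_map_on_def by fast

lemma smooth_map_on_continuous: "smooth_map_on M S N f \<Longrightarrow> continuous_map (subtopology (mtop M) S) (mtop N) f"
  by (simp add: smooth_map_on_def)

lemma smooth_map_on_into: "smooth_map_on M S N f \<Longrightarrow> x \<in> S \<Longrightarrow> x \<in> pts M \<Longrightarrow> f x \<in> pts N"
  using smooth_map_on_continuous[of M S N f] by (auto simp: continuous_map_def Pi_iff)

lemma smooth_map_on_preimage:
  assumes "smooth_map_on M S N f" "openin (mtop N) V"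
  obtains Q where "openin (mtop M) Q" "\<And>x. x \<in> S \<Longrightarrow> x \<in> pts M \<Longrightarrow> f x \<in> V \<longleftrightarrow> x \<in> Q"
proof -
  have "openin (subtopology (mtop M) S) {x \<in> topspace (subtopology (mtop M) S). f x \<in> V}"
    using openin_continuous_map_preimage[OF smooth_map_on_continuous[OF assms(1)] assms(2)] .
  then obtain Q where Q: "openin (mtop M) Q" "{x \<in> topspace (subtopology (mtop M) S). f x \<in> V} = Q \<inter> S"
    by (auto simp: openin_subtopology)
  show ?thesis
    by (rule that[OF Q(1)]) (use Q(2) in \<open>auto simp: set_eq_iff\<close>)
qed

lemma smooth_map_on_subset:
  assumes "smooth_map_on M S N f" "T \<subseteq> S"
  shows "smooth_map_on M T N f"
  unfolding smooth_map_on_def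
proof (intro conjI ballI, safe)
  show "continuous_map (subtopology (mtop M) T) (mtop N) f"
    using smooth_map_on_continuous[OF assms(1)] assms(2) continuous_map_from_subtopology_mono by blast
  fix U \<phi> V \<psi> assume "(U, \<phi>) \<in> atlas M" "(V, \<psi>) \<in> atlas N"
  from smooth_map_onD[OF assms(1) this]
  show "smooth_on_set (\<phi> ` (T \<inter> U \<inter> f -` V)) (\<psi> \<circ> f \<circ> inv_into U \<phi>)"
    by (rule smooth_on_set_subset) (use assms(2) in auto)
qed

lemma smooth_map_on_cong:
  assumes M: "charted M" and f: "smooth_map_on M S N f" and eq: "\<And>x. x \<in> S \<Longrightarrow> x \<in> pts M \<Longrightarrow> f x = g x"
  shows "smooth_map_on M S N g"
  unfolding smooth_map_on_def
proof (intro conjI ballI, safe)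
  show "continuous_map (subtopology (mtop M) S) (mtop N) g"
    using smooth_map_on_continuous[OF f] eq by (auto intro: continuous_map_eq)
  fix U \<phi> V \<psi> assume *: "(U, \<phi>) \<in> atlas M" "(V, \<psi>) \<in> atlas N"
  have c: "coord (mtop M) U \<phi>" using charted_coord[OF M *(1)] .
  have "S \<inter> U \<inter> f -` V = S \<inter> U \<inter> g -` V"
    using eq coord_subset[OF c] by auto
  then show "smooth_on_set (\<phi> ` (S \<inter> U \<inter> g -` V)) (\<psi> \<circ> g \<circ> inv_into U \<phi>)"
    using smooth_map_onD[OF f *]
    by (rule_tac smooth_on_set_cong[of _ "\<psi> \<circ> f \<circ> inv_into U \<phi>"])
      (use eq coord_subset[OF c] coord_inv[OF c] in \<open>auto simp: subset_iff\<close>)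
qed

lemma continuous_map_local:
  assumes "\<And>x. x \<in> topspace X \<Longrightarrow> \<exists>Q. openin X Q \<and> x \<in> Q \<and> continuous_map (subtopology X Q) Y f"
  shows "continuous_map X Y f"
  by (rule pasting_lemma[where I = "{Q. openin X Q \<and> continuous_map (subtopology X Q) Y f}" and T = "\<lambda>Q. Q" and f = "\<lambda>Q. f"])
    (use assms in auto)

lemma smooth_map_on_local:
  assumes M: "charted M"
    and loc: "\<And>x. x \<in> S \<Longrightarrow> x \<in> pts M \<Longrightarrow> \<exists>Q. openin (mtop M) Q \<and> x \<in> Q \<and> smooth_map_on M (S \<inter> Q) N f"
  shows "smooth_map_on M S N f"
  unfolding smooth_map_on_def
proof (intro conjI ballI, safe)
  show "continuous_map (subtopology (mtop M) S) (mtop N) f"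
  proof (rule continuous_map_local)
    fix x assume "x \<in> topspace (subtopology (mtop M) S)"
    then obtain Q where Q: "openin (mtop M) Q" "x \<in> Q" "x \<in> S" "smooth_map_on M (S \<inter> Q) N f"
      using loc[of x] by auto
    then show "\<exists>Q. openin (subtopology (mtop M) S) Q \<and> x \<in> Q \<and> continuous_map (subtopology (subtopology (mtop M) S) Q) (mtop N) f"
      using smooth_map_on_continuous[OF Q(4)]
      by (intro exI[of _ "S \<inter> Q"]) (auto simp: openin_subtopology_Int2 subtopology_subtopology Int_assoc[symmetric])
  qed
next
  fix U \<phi> V \<psi> assume *: "(U, \<phi>) \<in> atlas M" "(V, \<psi>) \<in> atlas N"
  have c: "coord (mtop M) U \<phi>" using charted_coord[OF M *(1)] .
  show "smooth_on_set (\<phi> ` (S \<inter> U \<inter> f -` V)) (\<psi> \<circ> f \<circ> inv_into U \<phi>)"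
  proof (rule smooth_on_set_local)
    fix p assume "p \<in> \<phi> ` (S \<inter> U \<inter> f -` V)"
    then obtain x where x: "p = \<phi> x" "x \<in> S" "x \<in> U" "f x \<in> V" by auto
    obtain Q where Q: "openin (mtop M) Q" "x \<in> Q" "smooth_map_on M (S \<inter> Q) N f"
      using loc[of x] x coord_subset[OF c] by auto
    obtain W where W: "open W" "\<And>y. y \<in> U \<Longrightarrow> \<phi> y \<in> W \<longleftrightarrow> y \<in> Q"
      using coord_open[OF c Q(1)] by blast
    have "\<phi> ` (S \<inter> U \<inter> f -` V) \<inter> W \<subseteq> \<phi> ` (S \<inter> Q \<inter> U \<inter> f -` V)"
      using W(2) by auto
    then show "\<exists>W. open W \<and> p \<in> W \<and> smooth_on_set (\<phi> ` (S \<inter> U \<inter> f -` V) \<inter> W) (\<psi> \<circ> f \<circ> inv_into U \<phi>)"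
      using smooth_map_onD[OF Q(3) *] smooth_on_set_subset W x Q(2) by metis
  qed
qed

lemma smooth_map_on_compose:
  assumes M: "charted M" and N: "charted N"
    and f: "smooth_map_on M S N f" and g: "smooth_map_on N T P g"
    and sub: "\<And>x. x \<in> S \<Longrightarrow> x \<in> pts M \<Longrightarrow> f x \<in> T"
  shows "smooth_map_on M S P (\<lambda>x. g (f x))"
  unfolding smooth_map_on_def
proof (intro conjI ballI, safe)
  have "continuous_map (subtopology (mtop M) S) (subtopology (mtop N) T) f"
    using smooth_map_on_continuous[OF f] sub by (auto simp: continuous_map_in_subtopology)
  then show "continuous_map (subtopology (mtop M) S) (mtop P) (\<lambda>x. g (f x))"
    using smooth_map_on_continuous[OF g] continuous_map_compose by (fastforce simp: o_def)
next
  fix U \<phi> Z \<xi> assume *: "(U, \<phi>) \<in> atlas M" "(Z, \<xi>) \<in> atlas P"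
  have c: "coord (mtop M) U \<phi>" using charted_coord[OF M *(1)] .
  show "smooth_on_set (\<phi> ` (S \<inter> U \<inter> (\<lambda>x. g (f x)) -` Z)) (\<xi> \<circ> (\<lambda>x. g (f x)) \<circ> inv_into U \<phi>)"
  proof (rule smooth_on_set_local)
    fix p assume "p \<in> \<phi> ` (S \<inter> U \<inter> (\<lambda>x. g (f x)) -` Z)"
    then obtain x where x: "p = \<phi> x" "x \<in> S" "x \<in> U" "g (f x) \<in> Z" by auto
    have xM: "x \<in> pts M" using x coord_subset[OF c] by auto
    then have "f x \<in> pts N" using smooth_map_on_into[OF f x(2)] by blast
    then obtain V \<psi> where V: "(V, \<psi>) \<in> atlas N" "f x \<in> V"
      using charted_obtain[OF N] by blast
    have d: "coord (mtop N) V \<psi>" using charted_coord[OF N V(1)] .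
    obtain Q where Q: "openin (mtop M) Q" "\<And>y. y \<in> S \<Longrightarrow> y \<in> pts M \<Longrightarrow> f y \<in> V \<longleftrightarrow> y \<in> Q"
      using smooth_map_on_preimage[OF f coord_openin[OF d]] by blast
    obtain W where W: "open W" "\<And>y. y \<in> U \<Longrightarrow> \<phi> y \<in> W \<longleftrightarrow> y \<in> Q"
      using coord_open[OF c Q(1)] by blast
    \<comment> \<open>The coordinate expressions of \<open>f\<close> and \<open>g\<close> compose
      only where \<open>f\<close> lands in the intermediate chart domain \<open>V\<close>;
      \<open>W\<close> cuts out this part.\<close>
    let ?X = "\<phi> ` (S \<inter> U \<inter> (\<lambda>x. g (f x)) -` Z) \<inter> W"
    have X: "\<exists>y. q = \<phi> y \<and> y \<in> S \<and> y \<in> U \<and> f y \<in> V \<and> g (f y) \<in> Z" if "q \<in> ?X" for q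
      using that W(2) Q(2) coord_subset[OF c] by auto
    have 1: "smooth_on_set ?X (\<psi> \<circ> f \<circ> inv_into U \<phi>)"
      by (rule smooth_on_set_subset[OF smooth_map_onD[OF f *(1) V(1)]]) (use X in blast)
    have 2: "smooth_on_set (\<psi> ` (T \<inter> V \<inter> g -` Z)) (\<xi> \<circ> g \<circ> inv_into V \<psi>)"
      by (rule smooth_map_onD[OF g V(1) *(2)])
    have "smooth_on_set ?X (\<lambda>q. (\<xi> \<circ> g \<circ> inv_into V \<psi>) ((\<psi> \<circ> f \<circ> inv_into U \<phi>) q))"
    proof (rule smooth_on_set_compose[OF 2 1])
      show "(\<psi> \<circ> f \<circ> inv_into U \<phi>) ` ?X \<subseteq> \<psi> ` (T \<inter> V \<inter> g -` Z)"
      proof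
        fix r assume "r \<in> (\<psi> \<circ> f \<circ> inv_into U \<phi>) ` ?X"
        then obtain q where q: "q \<in> ?X" "r = (\<psi> \<circ> f \<circ> inv_into U \<phi>) q" by blast
        then obtain y where "q = \<phi> y" "y \<in> S" "y \<in> U" "f y \<in> V" "g (f y) \<in> Z"
          using X by blast
        then show "r \<in> \<psi> ` (T \<inter> V \<inter> g -` Z)"
          using q(2) coord_inv[OF c, of y] coord_subset[OF c] sub[of y] by auto
      qed
    qed
    then have "smooth_on_set ?X (\<xi> \<circ> (\<lambda>x. g (f x)) \<circ> inv_into U \<phi>)"
    proof (rule smooth_on_set_cong)
      fix q assume "q \<in> ?X"
      then obtain y where "q = \<phi> y" "y \<in> U" "f y \<in> V"
        using X by blast
      then show "(\<xi> \<circ> g \<circ> inv_into V \<psi>) ((\<psi> \<circ> f \<circ> inv_into U \<phi>) q) = (\<xi> \<circ> (\<lambda>x. g (f x)) \<circ> inv_into U \<phi>) q"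
        by (simp add: coord_inv[OF c] coord_inv[OF d])
    qed
    moreover have "p \<in> W"
      using W(2) Q(2) x xM V(2) by auto
    ultimately show "\<exists>W. open W \<and> p \<in> W \<and> smooth_on_set (\<phi> ` (S \<inter> U \<inter> (\<lambda>x. g (f x)) -` Z) \<inter> W) (\<xi> \<circ> (\<lambda>x. g (f x)) \<circ> inv_into U \<phi>)"
      using W(1) by blast
  qed
qed

section \<open>Maps to and from Euclidean spaces\<close>

lemma euclid_simps [simp]: "mtop euclid = euclidean" "atlas euclid = {(UNIV, \<lambda>x. x)}"
  by (simp_all add: euclid_def)

lemma inv_into_UNIV_ident [simp]: "inv_into UNIV (\<lambda>x. x) = (\<lambda>x. x)"
  by (metis (no_types, lifting) ext inj_def inv_f_f)

lemma charted_euclid: "charted euclid"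
  by (auto simp: charted_def coord_def euclid_def intro!: homeomorphic_map_maps[THEN iffD2] exI[of _ "\<lambda>x. x"])
     (simp add: homeomorphic_maps_def)

text \<open>Euclidean space has a single global chart, so the coordinate expressions see all of
  \<open>f\<close> near each point, and continuity follows from their smoothness.\<close>

lemma smooth_map_on_euclid_iff:
  assumes M: "charted M"
  shows "smooth_map_on M S euclid f \<longleftrightarrow> (\<forall>(U, \<phi>)\<in>atlas M. smooth_on_set (\<phi> ` (S \<inter> U)) (f \<circ> inv_into U \<phi>))" (is "_ \<longleftrightarrow> ?R")
proof
  show "smooth_map_on M S euclid f \<Longrightarrow> ?R"
    by (auto simp: smooth_map_on_def o_def)
next
  assume R: ?R
  have "continuous_map (subtopology (mtop M) S) euclidean f"
  proof (rule continuous_map_local)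
    fix x assume x: "x \<in> topspace (subtopology (mtop M) S)"
    then obtain U \<phi> where U: "(U, \<phi>) \<in> atlas M" "x \<in> U"
      using charted_obtain[OF M, of x] by auto
    have co: "coord (mtop M) U \<phi>" using charted_coord[OF M U(1)] .
    have "continuous_on (\<phi> ` (S \<inter> U)) (f \<circ> inv_into U \<phi>)"
      using R U(1) smooth_on_set_continuous by fast
    moreover have "continuous_map (subtopology (mtop M) (S \<inter> U)) (top_of_set (\<phi> ` (S \<inter> U))) \<phi>"
      using coord_continuous[OF co] by (auto simp: continuous_map_in_subtopology intro: continuous_map_from_subtopology_mono)
    ultimately have "continuous_map (subtopology (mtop M) (S \<inter> U)) euclidean ((f \<circ> inv_into U \<phi>) \<circ> \<phi>)"
      by (meson continuous_map_compose continuous_map_iff_continuous)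
    then have "continuous_map (subtopology (mtop M) (S \<inter> U)) euclidean f"
      by (rule continuous_map_eq) (use coord_inv[OF co] in auto)
    then show "\<exists>Q. openin (subtopology (mtop M) S) Q \<and> x \<in> Q \<and> continuous_map (subtopology (subtopology (mtop M) S) Q) euclidean f"
      using x U coord_openin[OF co]
      by (intro exI[of _ "S \<inter> U"]) (auto simp: openin_subtopology_Int2 subtopology_subtopology Int_assoc[symmetric])
  qed
  then show "smooth_map_on M S euclid f"
    using R by (auto simp: smooth_map_on_def o_def)
qed

lemma smooth_map_on_euclid_euclid: "smooth_map_on euclid S euclid f \<longleftrightarrow> smooth_on_set S f"
  by (simp add: smooth_map_on_euclid_iff[OF charted_euclid] o_def)

lemma smooth_map_on_chart:
  assumes "smooth_manifold M" "(U, \<phi>) \<in> atlas M"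
  shows "smooth_map_on M U euclid \<phi>"
  unfolding smooth_map_on_euclid_iff[OF smooth_manifold_charted[OF assms(1)]]
proof safe
  fix V \<psi> assume "(V, \<psi>) \<in> atlas M"
  then have "smooth_on_set (\<psi> ` (V \<inter> U)) (\<phi> \<circ> inv_into V \<psi>)"
    using assms unfolding smooth_manifold_def by fast
  then show "smooth_on_set (\<psi> ` (U \<inter> V)) (\<phi> \<circ> inv_into V \<psi>)" by (simp add: Int_commute)
qed

lemma smooth_map_on_chart_inv:
  assumes "smooth_manifold M" "(U, \<phi>) \<in> atlas M"
  shows "smooth_map_on euclid (\<phi> ` U) M (inv_into U \<phi>)"
  unfolding smooth_map_on_def
proof (intro conjI ballI, safe)
  have c: "coord (mtop M) U \<phi>" using charted_coord[OF smooth_manifold_charted] assms by blast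
  show "continuous_map (subtopology (mtop euclid) (\<phi> ` U)) (mtop M) (inv_into U \<phi>)"
    using coord_inv_continuous[OF c] by simp
  fix A \<alpha> V \<psi> assume *: "(A, \<alpha>) \<in> atlas (euclid :: ('b, 'b) manifold)" "(V, \<psi>) \<in> atlas M"
  have "smooth_on_set (\<phi> ` (U \<inter> V)) (\<psi> \<circ> inv_into U \<phi>)"
    using assms *(2) unfolding smooth_manifold_def by fast
  moreover have "\<phi> ` U \<inter> inv_into U \<phi> -` V = \<phi> ` (U \<inter> V)"
    using coord_inv[OF c] by auto
  ultimately show "smooth_on_set (\<alpha> ` (\<phi> ` U \<inter> A \<inter> inv_into U \<phi> -` V)) (\<psi> \<circ> inv_into U \<phi> \<circ> inv_into A \<alpha>)"
    using *(1) by (simp add: o_def)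
qed

section \<open>Structures induced on subsets\<close>

lemma submanifold_simps [simp]: "mtop (submanifold M S) = subtopology (mtop M) S"
  by (simp add: submanifold_def)

lemma submanifold_atlas_iff: "(U, \<phi>) \<in> atlas (submanifold M S) \<longleftrightarrow> is_chart (subtopology (mtop M) S) U \<phi> \<and>
     smooth_map_on M U euclid \<phi> \<and> smooth_map_on euclid (\<phi> ` U) M (inv_into U \<phi>)"
  by (simp add: submanifold_def)

lemma charted_submanifoldI:
  assumes "\<And>x. x \<in> S \<Longrightarrow> x \<in> pts M \<Longrightarrow> \<exists>U \<phi>. x \<in> U \<and> (U, \<phi>) \<in> atlas (submanifold M S :: ('a, 'd::euclidean_space) manifold)"
  shows "charted (submanifold M S :: ('a, 'd::euclidean_space) manifold)"
proof -
  have c: "coord (subtopology (mtop M) S) U \<phi>" if "(U, \<phi>) \<in> atlas (submanifold M S :: ('a, 'd) manifold)" for U \<phi>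
    using that by (simp add: submanifold_atlas_iff is_chart_coord)
  have "pts (submanifold M S :: ('a, 'd) manifold) \<subseteq> \<Union>(fst ` atlas (submanifold M S :: ('a, 'd) manifold))"
    using assms by force
  moreover have "\<Union>(fst ` atlas (submanifold M S :: ('a, 'd) manifold)) \<subseteq> pts (submanifold M S :: ('a, 'd) manifold)"
    using coord_subset[OF c] by fastforce
  ultimately show ?thesis
    unfolding charted_def using c by fastforce
qed

text \<open>A transition map is an inverse chart, smooth into \<open>M\<close>, followed by a chart
  that is smooth with respect to \<open>M\<close>, so compatibility is automatic once the charts
  cover \<open>S\<close>.\<close>

lemma smooth_manifold_submanifold:
  assumes M: "smooth_manifold M" and ch: "charted (submanifold M S :: ('a, 'd::euclidean_space) manifold)"
  shows "smooth_manifold (submanifold M S :: ('a, 'd::euclidean_space) manifold)"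
proof -
  have MC: "charted M" using smooth_manifold_charted[OF M] .
  have "smooth_on_set (\<phi> ` (U \<inter> V)) (\<psi> \<circ> inv_into U \<phi>)"
    if U: "(U, \<phi>) \<in> atlas (submanifold M S :: ('a, 'd) manifold)" and V: "(V, \<psi>) \<in> atlas (submanifold M S :: ('a, 'd) manifold)" for U \<phi> V \<psi>
  proof -
    have c: "coord (subtopology (mtop M) S) U \<phi>" using U by (simp add: submanifold_atlas_iff is_chart_coord)
    have i: "smooth_map_on euclid (\<phi> ` (U \<inter> V)) M (inv_into U \<phi>)"
      using U smooth_map_on_subset[of euclid "\<phi> ` U" M "inv_into U \<phi>" "\<phi> ` (U \<inter> V)"] by (auto simp: submanifold_atlas_iff)
    have p: "smooth_map_on M V euclid \<psi>" using V by (simp add: submanifold_atlas_iff)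
    have "smooth_map_on euclid (\<phi> ` (U \<inter> V)) euclid (\<lambda>x. \<psi> (inv_into U \<phi> x))"
      by (rule smooth_map_on_compose[OF charted_euclid MC i p]) (use coord_inv[OF c] in auto)
    then show ?thesis by (simp add: smooth_map_on_euclid_euclid o_def)
  qed
  moreover have "is_chart (subtopology (mtop M) S) U \<phi>" if U: "(U, \<phi>) \<in> atlas (submanifold M S :: ('a, 'd) manifold)" for U \<phi>
    using that by (simp add: submanifold_atlas_iff)
  ultimately show ?thesis
    using M ch by (auto simp: smooth_manifold_def charted_def Hausdorff_space_subtopology second_countable_subtopology)
qed

text \<open>The inverse of each chart of \<open>submanifold N Z\<close> is smooth into
  \<open>N\<close> by definition, and it is the coordinate expression of the inclusion. This holds
  for every \<open>Z\<close>, whether or not such charts cover it.\<close>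

lemma smooth_map_on_incl: "smooth_map_on (submanifold N Z :: ('a, 'd::euclidean_space) manifold) S N (\<lambda>x. x)"
  unfolding smooth_map_on_def
proof (intro conjI ballI, safe)
  show "continuous_map (subtopology (mtop (submanifold N Z)) S) (mtop N) (\<lambda>x. x)"
    by (simp add: subtopology_subtopology continuous_map_from_subtopology)
  fix U and \<phi> :: "'a \<Rightarrow> 'd" and V \<psi> assume *: "(U, \<phi>) \<in> atlas (submanifold N Z :: ('a, 'd) manifold)" "(V, \<psi>) \<in> atlas N"
  have c: "coord (subtopology (mtop N) Z) U \<phi>" using * by (simp add: submanifold_atlas_iff is_chart_coord)
  have "smooth_map_on euclid (\<phi> ` U) N (inv_into U \<phi>)" using * by (simp add: submanifold_atlas_iff)
  from smooth_map_onD[OF this _ *(2), of UNIV "\<lambda>x. x"]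
  have "smooth_on_set (\<phi> ` U \<inter> inv_into U \<phi> -` V) (\<psi> \<circ> inv_into U \<phi>)" by (simp add: o_def)
  then have "smooth_on_set (\<phi> ` (S \<inter> U \<inter> V)) (\<psi> \<circ> inv_into U \<phi>)"
    by (rule smooth_on_set_subset) (use coord_inv[OF c] in auto)
  then show "smooth_on_set (\<phi> ` (S \<inter> U \<inter> (\<lambda>x. x) -` V)) (\<psi> \<circ> (\<lambda>x. x) \<circ> inv_into U \<phi>)"
    by (simp add: o_def)
qed

lemma smooth_map_on_into_sub_ident:
  "charted N \<Longrightarrow> smooth_map_on N Z (submanifold N Z :: ('a, 'd::euclidean_space) manifold) (\<lambda>x. x)"
  unfolding smooth_map_on_def
proof (intro conjI ballI, safe)
  assume N: "charted N"
  show "continuous_map (subtopology (mtop N) Z) (mtop (submanifold N Z)) (\<lambda>x. x)"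
    by simp
  fix U \<phi> V and \<psi> :: "'a \<Rightarrow> 'd" assume *: "(U, \<phi>) \<in> atlas N" "(V, \<psi>) \<in> atlas (submanifold N Z :: ('a, 'd) manifold)"
  have "smooth_map_on N V euclid \<psi>" using * by (simp add: submanifold_atlas_iff)
  from smooth_map_onD[OF this *(1), of UNIV "\<lambda>x. x"]
  have "smooth_on_set (\<phi> ` (V \<inter> U)) (\<psi> \<circ> inv_into U \<phi>)" by (simp add: o_def)
  then have "smooth_on_set (\<phi> ` (Z \<inter> U \<inter> V)) (\<psi> \<circ> inv_into U \<phi>)"
    by (rule smooth_on_set_subset) auto
  then show "smooth_on_set (\<phi> ` (Z \<inter> U \<inter> (\<lambda>x. x) -` V)) (\<psi> \<circ> (\<lambda>x. x) \<circ> inv_into U \<phi>)"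
    by (simp add: o_def)
qed

lemma smooth_map_on_to_sub:
  assumes "charted P" "charted N" "smooth_map_on P S N f" "\<And>x. x \<in> S \<Longrightarrow> x \<in> pts P \<Longrightarrow> f x \<in> Z"
  shows "smooth_map_on P S (submanifold N Z :: ('a, 'd::euclidean_space) manifold) f"
  using smooth_map_on_compose[OF assms(1,2,3) smooth_map_on_into_sub_ident[OF assms(2)] assms(4)] .

lemma smooth_map_on_out_sub:
  assumes "charted P" "charted (submanifold N Z :: ('a, 'd::euclidean_space) manifold)"
    "smooth_map_on P S (submanifold N Z :: ('a, 'd::euclidean_space) manifold) f"
  shows "smooth_map_on P S N f"
  using smooth_map_on_compose[OF assms smooth_map_on_incl[where S = UNIV]] by simp

lemma smooth_map_on_restrict_sub:
  assumes "charted (submanifold N Z :: ('a, 'd::euclidean_space) manifold)" "charted N" "smooth_map_on N S P f"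
  shows "smooth_map_on (submanifold N Z :: ('a, 'd::euclidean_space) manifold) S P f"
  using smooth_map_on_compose[OF assms(1,2) smooth_map_on_incl assms(3)] by simp

lemma smooth_map_on_from_sub:
  assumes "charted (submanifold N Z :: ('a, 'd::euclidean_space) manifold)" "charted N" "S \<subseteq> Z"
    "smooth_map_on (submanifold N Z :: ('a, 'd::euclidean_space) manifold) S P f"
  shows "smooth_map_on N S P f"
  using smooth_map_on_compose[OF assms(2,1) smooth_map_on_subset[OF smooth_map_on_into_sub_ident[OF assms(2)] assms(3)] assms(4)]
  by simp

section \<open>Algebra of vector-valued smooth maps\<close>

lemma smooth_map_on_apply:
  assumes "charted M" "smooth_map_on M S euclid f" "smooth_on_set T g" "\<And>x. x \<in> S \<Longrightarrow> x \<in> pts M \<Longrightarrow> f x \<in> T"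
  shows "smooth_map_on M S euclid (\<lambda>x. g (f x))"
  using smooth_map_on_compose[OF assms(1) charted_euclid assms(2) _ assms(4), of euclid g] assms(3)
  by (simp add: smooth_map_on_euclid_euclid)

lemma smooth_map_on_euclid_Pair:
  assumes "charted M" "smooth_map_on M S euclid f" "smooth_map_on M S euclid g"
  shows "smooth_map_on M S euclid (\<lambda>x. (f x, g x))"
  using assms smooth_on_set_Pair unfolding smooth_map_on_euclid_iff[OF assms(1)] by (fastforce simp: o_def)

lemma smooth_map_on_const: "charted M \<Longrightarrow> smooth_map_on M S euclid (\<lambda>x. c)"
  by (auto simp: smooth_map_on_euclid_iff o_def
      intro: smooth_on_set_subset[OF smooth_on_imp_smooth_on_set[OF smooth_on_const[of UNIV]]])

lemma smooth_map_on_binary: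
  assumes "charted M" "smooth_map_on M S euclid f" "smooth_map_on M S euclid g"
    "smooth_on UNIV (\<lambda>(x, y). h x y)"
  shows "smooth_map_on M S euclid (\<lambda>x. h (f x) (g x))"
  using smooth_map_on_apply[OF assms(1) smooth_map_on_euclid_Pair[OF assms(1-3)] smooth_on_imp_smooth_on_set[OF assms(4)]]
  by simp

lemma smooth_on_fst: "smooth_on UNIV fst" and smooth_on_snd: "smooth_on UNIV snd"
  using smooth_on_linear[OF bounded_linear_fst smooth_on_id[OF open_UNIV]]
    smooth_on_linear[OF bounded_linear_snd smooth_on_id[OF open_UNIV]] by auto

lemma smooth_map_on_add:
  assumes "charted M" "smooth_map_on M S euclid f" "smooth_map_on M S euclid g"
  shows "smooth_map_on M S euclid (\<lambda>x. f x + g x)"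
  by (rule smooth_map_on_binary[OF assms]) (simp add: case_prod_unfold smooth_on_add smooth_on_fst smooth_on_snd)

lemma smooth_map_on_bilinear:
  assumes "bounded_bilinear h" "charted M" "smooth_map_on M S euclid f" "smooth_map_on M S euclid g"
  shows "smooth_map_on M S euclid (\<lambda>x. h (f x) (g x))"
  by (rule smooth_map_on_binary[OF assms(2-)])
     (simp add: case_prod_unfold smooth_on_bilinear[OF assms(1)] smooth_on_fst smooth_on_snd)

lemmas smooth_map_on_mult = smooth_map_on_bilinear[OF bounded_bilinear_mult]
  and smooth_map_on_scaleR = smooth_map_on_bilinear[OF bounded_bilinear_scaleR]

lemma smooth_map_on_sum:
  assumes "charted M" "\<And>i. i \<in> I \<Longrightarrow> smooth_map_on M S euclid (f i)"
  shows "smooth_map_on M S euclid (\<lambda>x. \<Sum>i\<in>I. f i x)"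
proof (cases "finite I")
  case True
  then show ?thesis
    using assms(2) by (induction I rule: finite_induct) (auto intro: smooth_map_on_add smooth_map_on_const assms(1))
qed (simp add: smooth_map_on_const assms(1))

lemma smooth_map_on_smooth_on:
  assumes "charted M" "smooth_map_on M S euclid f" "smooth_on T g" "\<And>x. x \<in> S \<Longrightarrow> x \<in> pts M \<Longrightarrow> f x \<in> T"
  shows "smooth_map_on M S euclid (\<lambda>x. g (f x))"
  by (rule smooth_map_on_apply[OF assms(1,2) smooth_on_imp_smooth_on_set[OF assms(3)] assms(4)])

section \<open>Products and diffeomorphisms\<close>

lemma coord_prod:
  assumes c: "coord T U \<phi>" and d: "coord T' V \<psi>"
  shows "coord (prod_topology T T') (U \<times> V) (map_prod \<phi> \<psi>)"
proof (rule coordI[where g = "map_prod (inv_into U \<phi>) (inv_into V \<psi>)"])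
  show "openin (prod_topology T T') (U \<times> V)"
    using coord_openin[OF c] coord_openin[OF d] by (simp add: openin_prod_Times_iff)
  have "continuous_map (prod_topology (subtopology T U) (subtopology T' V)) (prod_topology euclidean euclidean) (\<lambda>(x, y). (\<phi> x, \<psi> y))"
    using coord_continuous[OF c] coord_continuous[OF d] continuous_map_prod_top by blast
  then show "continuous_map (subtopology (prod_topology T T') (U \<times> V)) euclidean (map_prod \<phi> \<psi>)"
    by (simp add: subtopology_Times map_prod_def)
  have "continuous_map (prod_topology (top_of_set (\<phi> ` U)) (top_of_set (\<psi> ` V))) (prod_topology T T') (\<lambda>(x, y). (inv_into U \<phi> x, inv_into V \<psi> y))"
    using coord_inv_continuous[OF c] coord_inv_continuous[OF d] continuous_map_prod_top by blast
  moreover have "top_of_set (map_prod \<phi> \<psi> ` (U \<times> V)) = prod_topology (top_of_set (\<phi> ` U)) (top_of_set (\<psi> ` V))"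
    by (simp add: map_prod_surj_on)
  ultimately show "continuous_map (top_of_set (map_prod \<phi> \<psi> ` (U \<times> V))) (prod_topology T T') (map_prod (inv_into U \<phi>) (inv_into V \<psi>))"
    by (simp add: map_prod_def)
qed (use coord_inv[OF c] coord_inv[OF d] in auto)

lemma prod_manifold_simps [simp]: "mtop (prod_manifold M N) = prod_topology (mtop M) (mtop N)"
  by (simp add: prod_manifold_def)

lemma prod_manifold_atlas:
  "c \<in> atlas (prod_manifold M N) \<longleftrightarrow> (\<exists>U \<phi> V \<psi>. c = (U \<times> V, map_prod \<phi> \<psi>) \<and> (U, \<phi>) \<in> atlas M \<and> (V, \<psi>) \<in> atlas N)"
  by (auto simp: prod_manifold_def)

lemma charted_prod:
  assumes M: "charted M" and N: "charted N"
  shows "charted (prod_manifold M N)"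
  unfolding charted_def
proof (intro conjI)
  show "\<forall>(U, \<phi>)\<in>atlas (prod_manifold M N). coord (mtop (prod_manifold M N)) U \<phi>"
    using charted_coord[OF M] charted_coord[OF N] by (auto simp: prod_manifold_atlas coord_prod)
  show "\<Union> (fst ` atlas (prod_manifold M N)) = pts (prod_manifold M N)"
  proof
    show "\<Union> (fst ` atlas (prod_manifold M N)) \<subseteq> pts (prod_manifold M N)"
      using coord_subset[OF charted_coord[OF M]] coord_subset[OF charted_coord[OF N]]
      by (fastforce simp: prod_manifold_atlas)
    show "pts (prod_manifold M N) \<subseteq> \<Union> (fst ` atlas (prod_manifold M N))"
    proof
      fix z assume "z \<in> pts (prod_manifold M N)"
      then have "fst z \<in> pts M" "snd z \<in> pts N" by auto
      then obtain U \<phi> V \<psi> where "(U, \<phi>) \<in> atlas M" "fst z \<in> U" "(V, \<psi>) \<in> atlas N" "snd z \<in> V"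
        using charted_obtain[OF M] charted_obtain[OF N] by metis
      then have "(U \<times> V, map_prod \<phi> \<psi>) \<in> atlas (prod_manifold M N)" "z \<in> U \<times> V"
        by (auto simp: prod_manifold_atlas mem_Times_iff)
      then show "z \<in> \<Union> (fst ` atlas (prod_manifold M N))" by force
    qed
  qed
qed

lemma smooth_map_on_prod_Pair:
  assumes P: "charted P" and f: "smooth_map_on P S M f" and g: "smooth_map_on P S N g"
  shows "smooth_map_on P S (prod_manifold M N) (\<lambda>x. (f x, g x))"
  unfolding smooth_map_on_def
proof (intro conjI ballI, safe)
  show "continuous_map (subtopology (mtop P) S) (mtop (prod_manifold M N)) (\<lambda>x. (f x, g x))"
    using smooth_map_on_continuous[OF f] smooth_map_on_continuous[OF g] by (simp add: continuous_map_paired)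
  fix U \<phi> V \<psi> assume *: "(U, \<phi>) \<in> atlas P" "(V, \<psi>) \<in> atlas (prod_manifold M N)"
  obtain V1 \<psi>1 V2 \<psi>2 where V: "V = V1 \<times> V2" "\<psi> = map_prod \<psi>1 \<psi>2" "(V1, \<psi>1) \<in> atlas M" "(V2, \<psi>2) \<in> atlas N"
    using *(2) by (auto simp: prod_manifold_atlas)
  have 1: "smooth_on_set (\<phi> ` (S \<inter> U \<inter> f -` V1)) (\<psi>1 \<circ> f \<circ> inv_into U \<phi>)"
    using smooth_map_onD[OF f *(1) V(3)] .
  have 2: "smooth_on_set (\<phi> ` (S \<inter> U \<inter> g -` V2)) (\<psi>2 \<circ> g \<circ> inv_into U \<phi>)"
    using smooth_map_onD[OF g *(1) V(4)] .
  have "smooth_on_set (\<phi> ` (S \<inter> U \<inter> (\<lambda>x. (f x, g x)) -` V)) (\<lambda>x. ((\<psi>1 \<circ> f \<circ> inv_into U \<phi>) x, (\<psi>2 \<circ> g \<circ> inv_into U \<phi>) x))"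
    by (rule smooth_on_set_Pair; rule smooth_on_set_subset[OF 1] smooth_on_set_subset[OF 2]) (auto simp: V)
  then show "smooth_on_set (\<phi> ` (S \<inter> U \<inter> (\<lambda>x. (f x, g x)) -` V)) (\<psi> \<circ> (\<lambda>x. (f x, g x)) \<circ> inv_into U \<phi>)"
    by (simp add: V o_def)
qed

lemma smooth_map_on_prod_fst:
  assumes M: "smooth_manifold M" and N: "charted N"
  shows "smooth_map_on (prod_manifold M N) S M fst"
  unfolding smooth_map_on_def
proof (intro conjI ballI, safe)
  show "continuous_map (subtopology (mtop (prod_manifold M N)) S) (mtop M) fst"
    by (simp add: continuous_map_fst continuous_map_from_subtopology)
  fix U \<phi> V \<psi> assume *: "(U, \<phi>) \<in> atlas (prod_manifold M N)" "(V, \<psi>) \<in> atlas M"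
  obtain U1 \<phi>1 U2 \<phi>2 where U: "U = U1 \<times> U2" "\<phi> = map_prod \<phi>1 \<phi>2" "(U1, \<phi>1) \<in> atlas M" "(U2, \<phi>2) \<in> atlas N"
    using *(1) by (auto simp: prod_manifold_atlas)
  have c: "coord (mtop M) U1 \<phi>1" using charted_coord[OF smooth_manifold_charted[OF M] U(3)] .
  have e: "coord (mtop (prod_manifold M N)) U \<phi>"
    using charted_coord[OF charted_prod[OF smooth_manifold_charted[OF M] N] *(1)] .
  have 1: "smooth_on_set (\<phi>1 ` (U1 \<inter> V)) (\<psi> \<circ> inv_into U1 \<phi>1)"
    using M U(3) *(2) unfolding smooth_manifold_def by fast
  have "smooth_on_set (\<phi> ` (S \<inter> U \<inter> fst -` V)) (\<lambda>x. (\<psi> \<circ> inv_into U1 \<phi>1) (fst x))"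
    by (rule smooth_on_set_compose[OF 1 smooth_on_set_subset[OF smooth_on_imp_smooth_on_set[OF smooth_on_fst]]])
       (auto simp: U)
  then show "smooth_on_set (\<phi> ` (S \<inter> U \<inter> fst -` V)) (\<psi> \<circ> fst \<circ> inv_into U \<phi>)"
    by (rule smooth_on_set_cong) (use coord_inv[OF c] coord_inv[OF e] in \<open>auto simp: U\<close>)
qed

lemma smooth_map_on_prod_snd:
  assumes M: "charted M" and N: "smooth_manifold N"
  shows "smooth_map_on (prod_manifold M N) S N snd"
  unfolding smooth_map_on_def
proof (intro conjI ballI, safe)
  show "continuous_map (subtopology (mtop (prod_manifold M N)) S) (mtop N) snd"
    by (simp add: continuous_map_snd continuous_map_from_subtopology)
  fix U \<phi> V \<psi> assume *: "(U, \<phi>) \<in> atlas (prod_manifold M N)" "(V, \<psi>) \<in> atlas N"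
  obtain U1 \<phi>1 U2 \<phi>2 where U: "U = U1 \<times> U2" "\<phi> = map_prod \<phi>1 \<phi>2" "(U1, \<phi>1) \<in> atlas M" "(U2, \<phi>2) \<in> atlas N"
    using *(1) by (auto simp: prod_manifold_atlas)
  have c: "coord (mtop N) U2 \<phi>2" using charted_coord[OF smooth_manifold_charted[OF N] U(4)] .
  have e: "coord (mtop (prod_manifold M N)) U \<phi>"
    using charted_coord[OF charted_prod[OF M smooth_manifold_charted[OF N]] *(1)] .
  have 1: "smooth_on_set (\<phi>2 ` (U2 \<inter> V)) (\<psi> \<circ> inv_into U2 \<phi>2)"
    using N U(4) *(2) unfolding smooth_manifold_def by fast
  have "smooth_on_set (\<phi> ` (S \<inter> U \<inter> snd -` V)) (\<lambda>x. (\<psi> \<circ> inv_into U2 \<phi>2) (snd x))"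
    by (rule smooth_on_set_compose[OF 1 smooth_on_set_subset[OF smooth_on_imp_smooth_on_set[OF smooth_on_snd]]])
       (auto simp: U)
  then show "smooth_on_set (\<phi> ` (S \<inter> U \<inter> snd -` V)) (\<psi> \<circ> snd \<circ> inv_into U \<phi>)"
    by (rule smooth_on_set_cong) (use coord_inv[OF c] coord_inv[OF e] in \<open>auto simp: U\<close>)
qed

section \<open>Open submanifolds\<close>

lemma chart_image_subset:
  assumes "chart_image W" "openin (top_of_set W) W'"
  shows "chart_image W'"
  using assms openin_open_trans openin_trans unfolding chart_image_def by blast

lemma atlas_open_submanifold:
  fixes M :: "('a, 'e::euclidean_space) manifold"
  assumes M: "smooth_manifold M" and U: "(U, \<phi>) \<in> atlas M" and Q: "openin (mtop M) Q" "Q \<subseteq> U" "Q \<subseteq> S"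
  shows "(Q, \<phi>) \<in> atlas (submanifold M S :: ('a, 'e::euclidean_space) manifold)"
proof -
  have c: "coord (mtop M) U \<phi>" using charted_coord[OF smooth_manifold_charted[OF M] U] .
  obtain W where W: "open W" "\<And>y. y \<in> U \<Longrightarrow> \<phi> y \<in> W \<longleftrightarrow> y \<in> Q"
    using coord_open[OF c Q(1)] by blast
  have im: "\<phi> ` Q = \<phi> ` U \<inter> W" using W Q(2) by auto
  have cQ: "coord (mtop M) Q \<phi>" using coord_restrict[OF c Q(1,2)] .
  have sub: "openin (subtopology (mtop M) S) Q"
    using Q(1,3) openin_subtopology by fastforce
  have "chart_image (\<phi> ` Q)"
    using M U chart_image_subset[of "\<phi> ` U"] W(1) unfolding im smooth_manifold_def is_chart_def by fastforce
  then have "is_chart (subtopology (mtop M) S) Q \<phi>"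
    using cQ sub Q(3) by (simp add: is_chart_def coord_def subtopology_subtopology Int_absorb1)
  moreover have "smooth_map_on M Q euclid \<phi>"
    using smooth_map_on_subset[OF smooth_map_on_chart[OF M U] Q(2)] .
  moreover have "smooth_map_on euclid (\<phi> ` Q) M (inv_into Q \<phi>)"
  proof (rule smooth_map_on_cong[OF charted_euclid])
    show "smooth_map_on euclid (\<phi> ` Q) M (inv_into U \<phi>)"
      using smooth_map_on_subset[OF smooth_map_on_chart_inv[OF M U]] Q(2) by blast
    show "inv_into U \<phi> x = inv_into Q \<phi> x" if "x \<in> \<phi> ` Q" for x
      using that coord_inv[OF c] coord_inv[OF cQ] Q(2) by auto
  qed
  ultimately show ?thesis by (simp add: submanifold_atlas_iff)
qed

lemma charted_open_submanifold:
  fixes M :: "('a, 'e::euclidean_space) manifold"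
  assumes M: "smooth_manifold M" and Q: "openin (mtop M) Q"
  shows "charted (submanifold M Q :: ('a, 'e::euclidean_space) manifold)"
proof (rule charted_submanifoldI)
  fix x assume x: "x \<in> Q" "x \<in> pts M"
  then obtain U and \<phi> :: "'a \<Rightarrow> 'e" where U: "(U, \<phi>) \<in> atlas M" "x \<in> U"
    using charted_obtain[OF smooth_manifold_charted[OF M]] by blast
  have "openin (mtop M) (U \<inter> Q)"
    using coord_openin[OF charted_coord[OF smooth_manifold_charted[OF M] U(1)]] Q by blast
  then show "\<exists>U \<phi>. x \<in> U \<and> (U, \<phi>) \<in> atlas (submanifold M Q :: ('a, 'e) manifold)"
    using atlas_open_submanifold[OF M U(1), of "U \<inter> Q" Q] x U by blast
qed

section \<open>Diffeomorphisms\<close>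

lemma diffeomorphismI:
  assumes M: "charted M" and N: "charted N" and f: "smooth_map_on M (pts M) N f" and g: "smooth_map_on N (pts N) M g"
    and gf: "\<And>x. x \<in> pts M \<Longrightarrow> g (f x) = x" and fg: "\<And>y. y \<in> pts N \<Longrightarrow> f (g y) = y"
  shows "diffeomorphism M N f"
  unfolding diffeomorphism_def smooth_map_def
proof (intro conjI f)
  show b: "bij_betw f (pts M) (pts N)"
    by (rule bij_betw_byWitness[where f' = g]) (use gf fg smooth_map_on_into[OF f] smooth_map_on_into[OF g] in auto)
  show "smooth_map_on N (pts N) M (inv_into (pts M) f)"
    by (rule smooth_map_on_cong[OF N g]) (metis b bij_betw_def fg g inv_into_f_eq smooth_map_on_into)
qed

lemma diffeomorphismE:
  assumes "diffeomorphism M N f"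
  obtains g where "smooth_map_on M (pts M) N f" "smooth_map_on N (pts N) M g"
    "\<And>x. x \<in> pts M \<Longrightarrow> g (f x) = x" "\<And>y. y \<in> pts N \<Longrightarrow> f (g y) = y"
    "g = inv_into (pts M) f"
  using assms unfolding diffeomorphism_def smooth_map_def
  by (metis bij_betw_inv_into_left bij_betw_inv_into_right)

lemma diffeomorphism_compose:
  assumes "charted M" "charted N" "charted P" "diffeomorphism M N f" "diffeomorphism N P g"
  shows "diffeomorphism M P (\<lambda>x. g (f x))"
proof -
  obtain f' where f: "smooth_map_on M (pts M) N f" "smooth_map_on N (pts N) M f'"
    "\<And>x. x \<in> pts M \<Longrightarrow> f' (f x) = x" "\<And>y. y \<in> pts N \<Longrightarrow> f (f' y) = y"
    using diffeomorphismE[OF assms(4)] by metis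
  obtain g' where g: "smooth_map_on N (pts N) P g" "smooth_map_on P (pts P) N g'"
    "\<And>x. x \<in> pts N \<Longrightarrow> g' (g x) = x" "\<And>y. y \<in> pts P \<Longrightarrow> g (g' y) = y"
    using diffeomorphismE[OF assms(5)] by metis
  show ?thesis
  proof (rule diffeomorphismI[OF assms(1,3), where g = "\<lambda>x. f' (g' x)"])
    show "smooth_map_on M (pts M) P (\<lambda>x. g (f x))"
      by (rule smooth_map_on_compose[OF assms(1,2) f(1) g(1)]) (use smooth_map_on_into[OF f(1)] in auto)
    show "smooth_map_on P (pts P) M (\<lambda>x. f' (g' x))"
      by (rule smooth_map_on_compose[OF assms(3,2) g(2) f(2)]) (use smooth_map_on_into[OF g(2)] in auto)
  qed (use f g smooth_map_on_into[OF f(1)] smooth_map_on_into[OF g(2)] in auto)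
qed

lemma diffeomorphism_inv:
  assumes "charted M" "charted N" "diffeomorphism M N f"
  shows "diffeomorphism N M (inv_into (pts M) f)"
  using diffeomorphismE[OF assms(3)] diffeomorphismI[OF assms(2,1)] by metis

lemma inv_into_diffeo:
  assumes "diffeomorphism M N f" 
  shows "x \<in> pts M \<Longrightarrow> inv_into (pts M) f (f x) = x" "y \<in> pts N \<Longrightarrow> f (inv_into (pts M) f y) = y"
  using diffeomorphismE[OF assms] by metis+

section \<open>Boundary points\<close>

text \<open>Only the continuity of transition maps enters: if \<open>x\<close> is interior in one
  chart, invariance of domain makes the transition map open near it, so \<open>x\<close> is interior
  in every other chart.\<close>

lemma boundary_iff:
  assumes M: "smooth_manifold M" and U: "(U, \<phi>) \<in> atlas M" and x: "x \<in> U"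
  shows "x \<in> boundary M \<longleftrightarrow> \<phi> x \<notin> interior (\<phi> ` U)"
proof
  assume "x \<in> boundary M"
  then obtain V \<psi> where V: "(V, \<psi>) \<in> atlas M" "x \<in> V" "\<psi> x \<notin> interior (\<psi> ` V)"
    unfolding boundary_def by auto
  have c: "coord (mtop M) U \<phi>" and d: "coord (mtop M) V \<psi>"
    using charted_coord[OF smooth_manifold_charted[OF M]] U V(1) by blast+
  show "\<phi> x \<notin> interior (\<phi> ` U)"
  proof
    assume i: "\<phi> x \<in> interior (\<phi> ` U)"
    obtain W where W: "open W" "\<And>y. y \<in> U \<Longrightarrow> \<phi> y \<in> W \<longleftrightarrow> y \<in> V"
      using coord_open[OF c coord_openin[OF d]] by blast
    let ?G = "interior (\<phi> ` U) \<inter> W"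
    let ?h = "\<psi> \<circ> inv_into U \<phi>"
    have G: "\<exists>y. q = \<phi> y \<and> y \<in> U \<and> y \<in> V" if "q \<in> ?G" for q
      using that W(2) subsetD[OF interior_subset, of q "\<phi> ` U"] by auto
    have "smooth_on_set (\<phi> ` (U \<inter> V)) ?h"
      using M U V(1) unfolding smooth_manifold_def by fast
    then have "continuous_on (\<phi> ` (U \<inter> V)) ?h"
      by (rule smooth_on_set_continuous)
    then have "continuous_on ?G ?h"
      by (rule continuous_on_subset) (use G in blast)
    moreover have "inj_on ?h ?G"
      by (rule inj_onI) (use G coord_inv[OF c] inj_onD[OF coord_inj[OF d]] in \<open>metis comp_apply\<close>)
    ultimately have "open (?h ` ?G)"
      using invariance_of_domain W(1) by blast
    moreover have "?h ` ?G \<subseteq> \<psi> ` V"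
      using G coord_inv[OF c] by fastforce
    moreover have "\<psi> x \<in> ?h ` ?G"
      using i W(2)[OF x] V(2) coord_inv[OF c x] by (intro image_eqI[of _ _ "\<phi> x"]) auto
    ultimately show False
      using V(3) interior_maximal by blast
  qed
next
  show "\<phi> x \<notin> interior (\<phi> ` U) \<Longrightarrow> x \<in> boundary M"
    using U x unfolding boundary_def by blast
qed

text \<open>Without boundary points a chart image consists of interior points. Ordinary two-sided
  derivatives are therefore available in all charts of a closed manifold.\<close>

lemma closed_manifold_chart_open:
  assumes "closed_manifold M" "(U, \<phi>) \<in> atlas M"
  shows "open (\<phi> ` U)"
proof -
  have "\<phi> x \<in> interior (\<phi> ` U)" if "x \<in> U" for x
    using assms boundary_iff[of M U \<phi> x] that by (auto simp: closed_manifold_def)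
  then have "interior (\<phi> ` U) = \<phi> ` U"
    using interior_subset by blast
  then show ?thesis by (metis open_interior)
qed

lemma closed_manifold_smooth: "closed_manifold M \<Longrightarrow> smooth_manifold M"
  by (simp add: closed_manifold_def)

lemma closed_manifold_charted: "closed_manifold M \<Longrightarrow> charted M"
  by (simp add: closed_manifold_def smooth_manifold_charted)

section \<open>Bump functions and partitions of unity\<close>

text \<open>The powers of \<open>x\<close> in the denominator make the family closed under
  differentiation, so that smoothness can be proved for all \<open>n\<close> at once. The case
  \<open>n = 0\<close> is the classical flat function.\<close>

definition exp_recip :: "nat \<Rightarrow> real \<Rightarrow> real" where
  "exp_recip n x = (if 0 < x then exp (- (1 / x)) / x ^ n else 0)"

text \<open>Comes from \<open>exp y \<ge> (y / m) ^ m\<close> with \<open>y = 1 / x\<close> and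
  \<open>m = Suc n\<close>. The exponent exceeds \<open>n\<close> by one, which leaves a factor
  \<open>x\<close> and gives linear decay at 0.\<close>

lemma exp_recip_bound: "\<bar>exp_recip n x\<bar> \<le> real (Suc n) ^ Suc n * \<bar>x\<bar>"
proof (cases "0 < x")
  case True
  let ?m = "real (Suc n)"
  have "(1 / x / ?m) ^ Suc n \<le> exp (1 / x / ?m) ^ Suc n"
    using True exp_ge_add_one_self[of "1 / x / ?m"] by (intro power_mono) (linarith, simp)
  also have "\<dots> = exp (1 / x)"
    by (subst exp_of_nat_mult[symmetric]) simp
  finally have le: "(1 / x / ?m) ^ Suc n \<le> exp (1 / x)" .
  have "1 = (1 / x / ?m) ^ Suc n * (x * ?m) ^ Suc n"
    using True by (simp only: power_mult_distrib[symmetric]) simp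
  also have "\<dots> \<le> exp (1 / x) * (x * ?m) ^ Suc n"
    using True by (intro mult_right_mono[OF le]) simp
  also have "\<dots> = (?m ^ Suc n * x) * (exp (1 / x) * x ^ n)"
    by (simp only: power_mult_distrib power_Suc mult_ac)
  finally have "1 / (exp (1 / x) * x ^ n) \<le> ?m ^ Suc n * x"
    using True by (subst pos_divide_le_eq) auto
  then have "exp (- (1 / x)) / x ^ n \<le> ?m ^ Suc n * x"
    using True by (simp add: exp_minus divide_inverse)
  then show ?thesis using True by (simp add: exp_recip_def)
next
  case False
  have "0 \<le> real (Suc n) ^ Suc n * \<bar>x\<bar>"
    by (intro mult_nonneg_nonneg) auto
  then show ?thesis using False by (simp only: exp_recip_def if_False abs_zero)
qed

lemma exp_recip_deriv:
  "(exp_recip n has_real_derivative (exp_recip (n + 2) x - n * exp_recip (n + 1) x)) (at x)"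
proof -
  consider "x < 0" | "0 < x" | "x = 0" by linarith
  then show ?thesis
  proof cases
    case 1
    have "(exp_recip n has_real_derivative 0) (at x)"
      by (rule DERIV_cong[OF has_field_derivative_transform_within_open[of "\<lambda>x. 0" 0 x "{..<0}"]])
        (use 1 in \<open>auto simp: exp_recip_def\<close>)
    then show ?thesis using 1 by (simp add: exp_recip_def)
  next
    case 2
    have e: "((\<lambda>x. exp (- (1 / x))) has_real_derivative exp (- (1 / x)) / x\<^sup>2) (at x)"
      using 2 by (auto intro!: derivative_eq_intros simp: field_simps power2_eq_square)
    have p: "((\<lambda>x. x ^ n) has_real_derivative n * x ^ (n - 1)) (at x)"
      using DERIV_pow[of n x UNIV] by simp
    have "(exp (- (1 / x)) / x\<^sup>2 * x ^ n - exp (- (1 / x)) * (n * x ^ (n - 1))) / (x ^ n * x ^ n) =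
      exp (- (1 / x)) / x ^ (n + 2) - n * (exp (- (1 / x)) / x ^ (n + 1))"
      using 2 by (cases n) (auto simp: field_simps power2_eq_square)
    then have "((\<lambda>x. exp (- (1 / x)) / x ^ n) has_real_derivative
        (exp (- (1 / x)) / x ^ (n + 2) - n * (exp (- (1 / x)) / x ^ (n + 1)))) (at x)"
      using DERIV_divide[OF e p] 2 by simp
    then show ?thesis
      by (subst DERIV_cong_ev[OF refl _ refl, of _ "\<lambda>x. exp (- (1 / x)) / x ^ n"])
        (use 2 eventually_nhds_in_open[of "{0<..}" x] in \<open>auto simp: exp_recip_def elim!: eventually_mono\<close>)
  next
    case 3
    have "((\<lambda>h. exp_recip n h / h) \<longlongrightarrow> 0) (at 0)"
    proof (rule Lim_null_comparison)
      show "\<forall>\<^sub>F h in at 0. norm (exp_recip n h / h) \<le> real (Suc (Suc n)) ^ Suc (Suc n) * \<bar>h\<bar>"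
      proof (rule always_eventually, rule allI)
        fix h :: real
        \<comment> \<open>The difference quotient at 0 is the next member of the family, whose
          linear decay gives the derivative 0.\<close>
        have "exp_recip n h / h = exp_recip (Suc n) h"
          by (simp add: exp_recip_def)
        then show "norm (exp_recip n h / h) \<le> real (Suc (Suc n)) ^ Suc (Suc n) * \<bar>h\<bar>"
          using exp_recip_bound[of "Suc n" h] by simp
      qed
      show "((\<lambda>h. real (Suc (Suc n)) ^ Suc (Suc n) * \<bar>h\<bar>) \<longlongrightarrow> 0) (at 0)"
        by (rule tendsto_eq_intros | simp)+
    qed
    then show ?thesis
      using 3 by (simp add: has_field_derivative_iff exp_recip_def)
  qed
qed

lemma k_smooth_on_exp_recip: "k_smooth_on k UNIV (exp_recip n)"
proof (induction k arbitrary: n)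
  case 0
  show ?case
    using DERIV_isCont[OF exp_recip_deriv] by (simp add: continuous_at_imp_continuous_on)
next
  case (Suc k)
  show ?case
  proof (rule k_smooth_on_SucI)
    show "(exp_recip n has_derivative (*) (exp_recip (n + 2) x - n * exp_recip (n + 1) x)) (at x)" for x
      using exp_recip_deriv[of n x] by (simp add: has_field_derivative_def)
    fix v :: real
    have "k_smooth_on k UNIV (\<lambda>x. exp_recip (n + 2) x + (- real n) * exp_recip (n + 1) x)"
      by (intro k_smooth_on_add Suc.IH k_smooth_on_linear[OF bounded_linear_mult_right]) auto
    from k_smooth_on_linear[OF bounded_linear_mult_left[of v] _ this]
    show "k_smooth_on k UNIV (\<lambda>x. (exp_recip (n + 2) x - n * exp_recip (n + 1) x) * v)"
      by simp
  qed auto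
qed

text \<open>A smooth transition from 0, up to \<open>-1\<close>, to 1, from \<open>1\<close> on. The
  arguments \<open>1 + s\<close> and \<open>1 - s\<close> are never both nonpositive, so the
  denominator is positive.\<close>

definition smooth_step :: "real \<Rightarrow> real" where
  "smooth_step s = exp_recip 0 (1 + s) * inverse (exp_recip 0 (1 + s) + exp_recip 0 (1 - s))"

lemma exp_recip_nonneg: "0 \<le> exp_recip n x" and exp_recip_pos: "0 < x \<Longrightarrow> 0 < exp_recip n x"
  and exp_recip_nonpos: "x \<le> 0 \<Longrightarrow> exp_recip n x = 0"
  by (auto simp: exp_recip_def)

lemma smooth_step_denominator: "0 < exp_recip 0 (1 + s) + exp_recip 0 (1 - s)"
  using exp_recip_nonneg[of 0 "1 + s"] exp_recip_nonneg[of 0 "1 - s"] exp_recip_pos[of "1 + s" 0] exp_recip_pos[of "1 - s" 0]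
  by (cases "0 < 1 + s") linarith+

lemma smooth_on_smooth_step: "smooth_on UNIV smooth_step"
proof -
  have e: "smooth_on UNIV (exp_recip 0)"
    using k_smooth_on_exp_recip by (simp add: smooth_on_def)
  have 1: "smooth_on UNIV (\<lambda>s. exp_recip 0 (1 + s))"
    by (rule smooth_on_compose[OF e smooth_on_add[OF smooth_on_const smooth_on_id]]) auto
  have 2: "smooth_on UNIV (\<lambda>s. exp_recip 0 (1 - s))"
    by (rule smooth_on_compose[OF e smooth_on_diff[OF smooth_on_const smooth_on_id]]) auto
  have "smooth_on UNIV (\<lambda>s. exp_recip 0 (1 + s) * inverse (exp_recip 0 (1 + s) + exp_recip 0 (1 - s)))"
    by (rule smooth_on_mult[OF 1 smooth_on_inverse_fun[OF smooth_on_add[OF 1 2]]])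
       (metis less_irrefl smooth_step_denominator)
  then show ?thesis by (simp add: smooth_step_def[abs_def])
qed

lemma smooth_step_range: "0 \<le> smooth_step s" "smooth_step s \<le> 1"
  using smooth_step_denominator[of s] exp_recip_nonneg[of 0 "1 + s"] exp_recip_nonneg[of 0 "1 - s"]
  by (auto simp: smooth_step_def field_simps)

lemma smooth_step_eq_0: "s \<le> -1 \<Longrightarrow> smooth_step s = 0"
  and smooth_step_eq_1: "1 \<le> s \<Longrightarrow> smooth_step s = 1"
  using smooth_step_denominator[of s] exp_recip_nonpos[of "1 + s" 0] exp_recip_nonpos[of "1 - s" 0]
  by (auto simp: smooth_step_def field_simps)

lemma smooth_step_deriv:
  obtains d where "\<And>s. (smooth_step has_real_derivative d s) (at s)" "\<And>s. -1 < s \<Longrightarrow> s < 1 \<Longrightarrow> 0 < d s"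
    "continuous_on UNIV d"
proof -
  define d where "d s = frechet_derivative smooth_step (at s) 1" for s
  have d: "(smooth_step has_real_derivative d s) (at s)" for s
  proof -
    have D: "(smooth_step has_derivative frechet_derivative smooth_step (at s)) (at s)"
      using smooth_on_has_derivative[OF smooth_on_smooth_step] by simp
    have "frechet_derivative smooth_step (at s) v = d s * v" for v
      using linear_scale[OF has_derivative_linear[OF D], of v 1] by (simp add: d_def mult.commute)
    then have "frechet_derivative smooth_step (at s) = (*) (d s)" by (rule ext)
    then show ?thesis using D by (simp add: has_field_derivative_def)
  qed
  have "0 < d s" if s: "-1 < s" "s < 1" for s
  proof -
    let ?f = "\<lambda>s. exp_recip 0 (1 + s)" and ?g = "\<lambda>s. exp_recip 0 (1 - s)"
    have f: "(?f has_real_derivative exp_recip 2 (1 + s)) (at s)"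
    proof -
      have "((\<lambda>s. 1 + s) has_real_derivative 1) (at s)"
        by (auto intro!: derivative_eq_intros)
      from DERIV_chain2[OF exp_recip_deriv[of 0] this] show ?thesis
        by (simp add: numeral_2_eq_2)
    qed
    have g: "(?g has_real_derivative - exp_recip 2 (1 - s)) (at s)"
    proof -
      have "((\<lambda>s. 1 - s) has_real_derivative - 1) (at s)"
        by (auto intro!: derivative_eq_intros)
      from DERIV_chain2[OF exp_recip_deriv[of 0] this] show ?thesis
        by (simp add: numeral_2_eq_2)
    qed
    have nz: "?f s + ?g s \<noteq> 0" using smooth_step_denominator[of s] by simp
    have "((\<lambda>s. ?f s / (?f s + ?g s)) has_real_derivative
       (exp_recip 2 (1 + s) * (?f s + ?g s) - ?f s * (exp_recip 2 (1 + s) + - exp_recip 2 (1 - s))) / ((?f s + ?g s) * (?f s + ?g s))) (at s)"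
      by (rule DERIV_divide[OF f DERIV_add[OF f g] nz])
    moreover have "(\<lambda>s. ?f s / (?f s + ?g s)) = smooth_step"
      by (simp add: fun_eq_iff smooth_step_def divide_inverse)
    ultimately have "d s = (exp_recip 2 (1 + s) * (?f s + ?g s) - ?f s * (exp_recip 2 (1 + s) + - exp_recip 2 (1 - s))) / ((?f s + ?g s) * (?f s + ?g s))"
      using DERIV_unique[OF d] by simp
    \<comment> \<open>After cancellation both remaining terms of the numerator are products of
      positive values, since \<open>1 + s\<close> and \<open>1 - s\<close> are positive.\<close>
    also have "\<dots> = (exp_recip 2 (1 + s) * ?g s + ?f s * exp_recip 2 (1 - s)) / ((?f s + ?g s) * (?f s + ?g s))"
      by (simp add: algebra_simps)
    also have "\<dots> > 0"
      using s smooth_step_denominator[of s] exp_recip_pos[of "1 + s"] exp_recip_pos[of "1 - s"]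
      by (intro divide_pos_pos mult_pos_pos add_pos_pos) auto
    finally show ?thesis .
  qed
  moreover have "continuous_on UNIV d"
    unfolding d_def by (rule smooth_on_continuous[OF smooth_on_frechet[OF smooth_on_smooth_step]])
  ultimately show ?thesis using d that by blast
qed

section \<open>Bump functions, partitions of unity and convex gluing\<close>

text \<open>\<open>M\<close> is covered by the open sets \<open>C\<close> and
  \<open>pts M - K\<close>; on their overlap both definitions give 0.\<close>

lemma smooth_map_on_extend_zero:
  fixes f :: "'a \<Rightarrow> 'd::euclidean_space"
  assumes M: "charted M" and f: "smooth_map_on M C euclid f" and C: "openin (mtop M) C"
    and K: "closedin (mtop M) K" "K \<subseteq> C" and r: "\<And>x. x \<in> C \<Longrightarrow> x \<notin> K \<Longrightarrow> f x = 0"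
  shows "smooth_map_on M S euclid (\<lambda>x. if x \<in> C then f x else 0)"
proof (rule smooth_map_on_local[OF M])
  fix x assume x: "x \<in> S" "x \<in> pts M"
  show "\<exists>Q. openin (mtop M) Q \<and> x \<in> Q \<and> smooth_map_on M (S \<inter> Q) euclid (\<lambda>x. if x \<in> C then f x else 0)"
  proof (cases "x \<in> C")
    case True
    have "smooth_map_on M (S \<inter> C) euclid (\<lambda>x. if x \<in> C then f x else 0)"
      by (rule smooth_map_on_cong[OF M smooth_map_on_subset[OF f]]) auto
    then show ?thesis using True C by blast
  next
    case False
    have "smooth_map_on M (S \<inter> (pts M - K)) euclid (\<lambda>x. if x \<in> C then f x else 0)"
      by (rule smooth_map_on_cong[OF M smooth_map_on_const[OF M, of _ 0]]) (use r in auto)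
    then show ?thesis using False K x by (metis Diff_iff openin_diff openin_topspace subsetD)
  qed
qed

lemma smooth_on_norm_sq: "smooth_on UNIV (\<lambda>x::'e::euclidean_space. x \<bullet> x)"
  by (rule smooth_on_inner) (auto intro: smooth_on_id)

lemma ex_bump:
  fixes M :: "('a, 'e::euclidean_space) manifold"
  assumes M: "closed_manifold M" and C: "openin (mtop M) C" "x \<in> C"
  obtains \<beta> :: "'a \<Rightarrow> real" and K Q where "smooth_map_on M (pts M) euclid \<beta>" "\<And>y. 0 \<le> \<beta> y" "\<And>y. \<beta> y \<le> 1"
    "closedin (mtop M) K" "K \<subseteq> C" "\<And>y. y \<notin> K \<Longrightarrow> \<beta> y = 0" "openin (mtop M) Q" "x \<in> Q" "Q \<subseteq> K" "\<And>y. y \<in> Q \<Longrightarrow> \<beta> y = 1"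
proof -
  have MC: "charted M" and MS: "smooth_manifold M" and H: "Hausdorff_space (mtop M)"
    using M by (auto simp: closed_manifold_charted closed_manifold_smooth) (simp add: closed_manifold_def smooth_manifold_def)
  have xM: "x \<in> pts M" using C openin_subset by blast
  obtain U and \<phi> :: "'a \<Rightarrow> 'e" where U: "(U, \<phi>) \<in> atlas M" "x \<in> U"
    using charted_obtain[OF MC xM] by blast
  have c: "coord (mtop M) U \<phi>" using charted_coord[OF MC U(1)] .
  obtain W where W: "open W" "\<And>y. y \<in> U \<Longrightarrow> \<phi> y \<in> W \<longleftrightarrow> y \<in> C"
    using coord_open[OF c C(1)] by blast
  have "open (\<phi> ` U \<inter> W)" "\<phi> x \<in> \<phi> ` U \<inter> W"
    using closed_manifold_chart_open[OF M U(1)] W U C by auto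
  then obtain e where e: "0 < e" "cball (\<phi> x) e \<subseteq> \<phi> ` U \<inter> W"
    using open_contains_cball by blast
  define r where "r = e / 2"
  have r: "0 < r" "cball (\<phi> x) (2 * r) \<subseteq> \<phi> ` U \<inter> W"
    using e by (auto simp: r_def)
  \<comment> \<open>The shift by 2 puts the transition between the squared radii \<open>r^2\<close>
    and \<open>3 r^2\<close>. Hence \<open>b\<close> is 1 on the ball of radius \<open>r\<close> and
    vanishes outside the ball of radius \<open>2 r\<close>.\<close>
  define b where "b p = 1 - smooth_step ((p - \<phi> x) \<bullet> (p - \<phi> x) / r\<^sup>2 - 2)" for p
  have bs: "smooth_on UNIV b"
  proof -
    have 1: "smooth_on UNIV (\<lambda>p. p - \<phi> x)"
      by (intro smooth_on_diff smooth_on_id smooth_on_const) auto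
    have 2: "smooth_on UNIV (\<lambda>p. (p - \<phi> x) \<bullet> (p - \<phi> x))"
      by (rule smooth_on_compose[OF smooth_on_norm_sq 1]) auto
    have 3: "smooth_on UNIV (\<lambda>p. (p - \<phi> x) \<bullet> (p - \<phi> x) / r\<^sup>2 - 2)"
      by (intro smooth_on_diff smooth_on_const smooth_on_linear[OF bounded_linear_divide 2]) auto
    show ?thesis
      unfolding b_def[abs_def]
      by (intro smooth_on_diff smooth_on_const smooth_on_compose[OF smooth_on_smooth_step 3]) auto
  qed
  define K where "K = inv_into U \<phi> ` cball (\<phi> x) (2 * r)"
  define Q where "Q = U \<inter> \<phi> -` ball (\<phi> x) r"
  have dist: "(p - \<phi> x) \<bullet> (p - \<phi> x) = (dist (\<phi> x) p)\<^sup>2" for p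
    by (simp add: dist_norm norm_minus_commute power2_norm_eq_inner)
  have b0: "b p = 0" if "p \<notin> cball (\<phi> x) (2 * r)" for p
  proof -
    have "(2 * r)\<^sup>2 \<le> (dist (\<phi> x) p)\<^sup>2" using that r(1) by (intro power_mono) auto
    moreover have "(2 * r)\<^sup>2 = 4 * r\<^sup>2"
      by (simp add: power_mult_distrib)
    ultimately have "3 * r\<^sup>2 \<le> (dist (\<phi> x) p)\<^sup>2"
      using zero_le_power2[of r] by linarith
    then have "1 \<le> (p - \<phi> x) \<bullet> (p - \<phi> x) / r\<^sup>2 - 2"
      using r(1) unfolding dist by (simp add: field_simps)
    then show ?thesis by (simp add: b_def smooth_step_eq_1)
  qed
  have b1: "b p = 1" if "p \<in> ball (\<phi> x) r" for p
  proof -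
    have "(dist (\<phi> x) p)\<^sup>2 \<le> r\<^sup>2" using that by (intro power_mono) auto
    then have "(p - \<phi> x) \<bullet> (p - \<phi> x) / r\<^sup>2 - 2 \<le> -1"
      using r(1) unfolding dist by (simp add: field_simps)
    then show ?thesis by (simp add: b_def smooth_step_eq_0)
  qed
  have B: "\<exists>z. p = \<phi> z \<and> z \<in> U \<and> z \<in> C" if "p \<in> cball (\<phi> x) (2 * r)" for p
  proof -
    have "p \<in> \<phi> ` U" "p \<in> W" using r(2) that by blast+
    then obtain z where "p = \<phi> z" "z \<in> U" by blast
    then show ?thesis using W(2)[of z] \<open>p \<in> W\<close> by auto
  qed
  have KB: "\<exists>z. y = z \<and> z \<in> U \<and> z \<in> C \<and> \<phi> z \<in> cball (\<phi> x) (2 * r)" if yK: "y \<in> K" for y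
  proof -
    obtain p where p: "p \<in> cball (\<phi> x) (2 * r)" "y = inv_into U \<phi> p" using yK unfolding K_def by blast
    obtain z where "p = \<phi> z" "z \<in> U" "z \<in> C" using B[OF p(1)] by blast
    then show ?thesis using p coord_inv[OF c] by simp
  qed
  have KU: "K \<subseteq> U" and KC: "K \<subseteq> C" using KB by blast+
  have phiK: "y \<in> K \<longleftrightarrow> \<phi> y \<in> cball (\<phi> x) (2 * r)" if "y \<in> U" for y
  proof
    show "y \<in> K \<Longrightarrow> \<phi> y \<in> cball (\<phi> x) (2 * r)" using KB by blast
    assume "\<phi> y \<in> cball (\<phi> x) (2 * r)"
    then show "y \<in> K" unfolding K_def by (rule image_eqI[rotated]) (simp add: coord_inv[OF c that])
  qed
  \<comment> \<open>The closed ball is compact and lies in the chart image, so \<open>K\<close> is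
    compact and therefore closed in the Hausdorff space \<open>M\<close>.\<close>
  have "compactin (top_of_set (\<phi> ` U)) (cball (\<phi> x) (2 * r))"
    using r(2) by (simp add: compactin_subtopology)
  then have "compactin (mtop M) K"
    unfolding K_def using image_compactin coord_inv_continuous[OF c] by blast
  then have K: "closedin (mtop M) K" using H compactin_imp_closedin by blast
  have s: "smooth_map_on M U euclid (\<lambda>y. b (\<phi> y))"
    by (rule smooth_map_on_smooth_on[OF MC smooth_map_on_chart[OF MS U(1)] bs]) auto
  show thesis
  proof (rule that[of "\<lambda>y. if y \<in> U then b (\<phi> y) else 0" K Q])
    show "smooth_map_on M (pts M) euclid (\<lambda>y. if y \<in> U then b (\<phi> y) else 0)"
      by (rule smooth_map_on_extend_zero[OF MC s coord_openin[OF c] K KU]) (simp add: phiK b0)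
    show "openin (mtop M) Q" unfolding Q_def by (rule coord_preimage[OF c]) simp
    show "closedin (mtop M) K" "K \<subseteq> C" by (fact K KC)+
    show "x \<in> Q" using U r by (simp add: Q_def)
    show "Q \<subseteq> K"
    proof
      fix y assume "y \<in> Q"
      then have "y \<in> U" "dist (\<phi> x) (\<phi> y) < r" by (simp_all add: Q_def)
      then show "y \<in> K" using phiK[of y] r(1) by simp
    qed
    show "(if y \<in> U then b (\<phi> y) else 0) = 1" if "y \<in> Q" for y
      using that b1[of "\<phi> y"] by (simp add: Q_def)
    show "(if y \<in> U then b (\<phi> y) else 0) = 0" if "y \<notin> K" for y
      using that b0[of "\<phi> y"] phiK[of y] by (cases "y \<in> U") simp_all
    show "0 \<le> (if y \<in> U then b (\<phi> y) else 0)" "(if y \<in> U then b (\<phi> y) else 0) \<le> 1" for y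
      by (simp_all add: b_def smooth_step_range)
  qed
qed

text \<open>By compactness, finitely many bump functions suffice for one of them to be 1 at each
  point; division by their sum normalizes them. The closed sets \<open>K i\<close> are recorded
  because extension by zero needs them.\<close>

lemma partition_of_unity:
  fixes M :: "('a, 'e::euclidean_space) manifold"
  assumes M: "closed_manifold M" and C: "\<And>x. x \<in> pts M \<Longrightarrow> openin (mtop M) (C x) \<and> x \<in> C x"
  obtains F and \<rho> :: "'a \<Rightarrow> 'a \<Rightarrow> real" and K where "finite F" "F \<subseteq> pts M"
    "\<And>i. i \<in> F \<Longrightarrow> smooth_map_on M (pts M) euclid (\<rho> i)" "\<And>i y. 0 \<le> \<rho> i y"
    "\<And>y. y \<in> pts M \<Longrightarrow> (\<Sum>i\<in>F. \<rho> i y) = 1"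
    "\<And>i. i \<in> F \<Longrightarrow> closedin (mtop M) (K i)" "\<And>i. i \<in> F \<Longrightarrow> K i \<subseteq> C i" "\<And>i y. i \<in> F \<Longrightarrow> y \<notin> K i \<Longrightarrow> \<rho> i y = 0"
proof -
  have MC: "charted M" using M by (rule closed_manifold_charted)
  have "\<forall>x\<in>pts M. \<exists>\<beta> :: 'a \<Rightarrow> real. \<exists>K Q. smooth_map_on M (pts M) euclid \<beta> \<and> (\<forall>y. 0 \<le> \<beta> y) \<and>
    closedin (mtop M) K \<and> K \<subseteq> C x \<and> (\<forall>y. y \<notin> K \<longrightarrow> \<beta> y = 0) \<and> openin (mtop M) Q \<and> x \<in> Q \<and> (\<forall>y\<in>Q. \<beta> y = 1)"
  proof
    fix x assume x: "x \<in> pts M"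
    obtain \<beta> :: "'a \<Rightarrow> real" and K Q where "smooth_map_on M (pts M) euclid \<beta>" "\<And>y. 0 \<le> \<beta> y" "\<And>y. \<beta> y \<le> 1"
    "closedin (mtop M) K" "K \<subseteq> C x" "\<And>y. y \<notin> K \<Longrightarrow> \<beta> y = 0" "openin (mtop M) Q" "x \<in> Q" "Q \<subseteq> K" "\<And>y. y \<in> Q \<Longrightarrow> \<beta> y = 1"
      using ex_bump[OF M, of "C x" x] C[OF x] by blast
    then show "\<exists>\<beta> :: 'a \<Rightarrow> real. \<exists>K Q. smooth_map_on M (pts M) euclid \<beta> \<and> (\<forall>y. 0 \<le> \<beta> y) \<and>
    closedin (mtop M) K \<and> K \<subseteq> C x \<and> (\<forall>y. y \<notin> K \<longrightarrow> \<beta> y = 0) \<and> openin (mtop M) Q \<and> x \<in> Q \<and> (\<forall>y\<in>Q. \<beta> y = 1)"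
      by (intro exI[of _ \<beta>] exI[of _ K] exI[of _ Q]) simp
  qed
  from bchoice[OF this] obtain \<beta> :: "'a \<Rightarrow> 'a \<Rightarrow> real" where b': "\<forall>x\<in>pts M. \<exists>K Q. smooth_map_on M (pts M) euclid (\<beta> x) \<and> (\<forall>y. 0 \<le> \<beta> x y) \<and>
    closedin (mtop M) K \<and> K \<subseteq> C x \<and> (\<forall>y. y \<notin> K \<longrightarrow> \<beta> x y = 0) \<and> openin (mtop M) Q \<and> x \<in> Q \<and> (\<forall>y\<in>Q. \<beta> x y = 1)" ..
  from bchoice[OF this] obtain K where "\<forall>x\<in>pts M. \<exists>Q. smooth_map_on M (pts M) euclid (\<beta> x) \<and> (\<forall>y. 0 \<le> \<beta> x y) \<and>
    closedin (mtop M) (K x) \<and> K x \<subseteq> C x \<and> (\<forall>y. y \<notin> K x \<longrightarrow> \<beta> x y = 0) \<and> openin (mtop M) Q \<and> x \<in> Q \<and> (\<forall>y\<in>Q. \<beta> x y = 1)" ..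
  from bchoice[OF this] obtain Q where bb: "\<forall>x\<in>pts M. smooth_map_on M (pts M) euclid (\<beta> x) \<and> (\<forall>y. 0 \<le> \<beta> x y) \<and>
    closedin (mtop M) (K x) \<and> K x \<subseteq> C x \<and> (\<forall>y. y \<notin> K x \<longrightarrow> \<beta> x y = 0) \<and> openin (mtop M) (Q x) \<and> x \<in> Q x \<and> (\<forall>y\<in>Q x. \<beta> x y = 1)" ..
  have b: "\<And>x. x \<in> pts M \<Longrightarrow> smooth_map_on M (pts M) euclid (\<beta> x)"
    "\<And>x y. x \<in> pts M \<Longrightarrow> 0 \<le> \<beta> x y" "\<And>x. x \<in> pts M \<Longrightarrow> closedin (mtop M) (K x)" "\<And>x. x \<in> pts M \<Longrightarrow> K x \<subseteq> C x"
    "\<And>x y. x \<in> pts M \<Longrightarrow> y \<notin> K x \<Longrightarrow> \<beta> x y = 0" "\<And>x. x \<in> pts M \<Longrightarrow> openin (mtop M) (Q x)" "\<And>x. x \<in> pts M \<Longrightarrow> x \<in> Q x"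
    "\<And>x y. x \<in> pts M \<Longrightarrow> y \<in> Q x \<Longrightarrow> \<beta> x y = 1"
    using bb by simp_all
  have "compactin (mtop M) (pts M)" using M by (simp add: closed_manifold_def compact_space_def)
  then obtain \<F> where F: "finite \<F>" "\<F> \<subseteq> Q ` pts M" "pts M \<subseteq> \<Union>\<F>"
    using compactinD[of "mtop M" "pts M" "Q ` pts M"] b(6,7) by blast
  then obtain F where F': "F \<subseteq> pts M" "finite F" "\<F> = Q ` F"
    by (meson finite_subset_image)
  define s where "s y = (\<Sum>i\<in>F. \<beta> i y)" for y
  have s: "0 < s y" if y: "y \<in> pts M" for y
  proof -
    obtain i where i: "i \<in> F" "y \<in> Q i" using F(3) F'(3) y by auto
    then have "0 < \<beta> i y" using b(8) F'(1) by force
    then show ?thesis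
      unfolding s_def using i(1) F' b(2) by (intro sum_pos2[of F i]) auto
  qed
  define \<rho> where "\<rho> i y = (if i \<in> pts M \<and> 0 < s y then \<beta> i y * inverse (s y) else 0)" for i y
  have ss: "smooth_map_on M (pts M) euclid s"
    unfolding s_def[abs_def] by (rule smooth_map_on_sum[OF MC]) (use F'(1) b(1) in auto)
  have inv: "smooth_map_on M (pts M) euclid (\<lambda>y. inverse (s y))"
    by (rule smooth_map_on_smooth_on[OF MC ss smooth_on_inverse_real]) (use s in force)
  show thesis
  proof (rule that[of F \<rho> K])
    show "smooth_map_on M (pts M) euclid (\<rho> i)" if "i \<in> F" for i
      by (rule smooth_map_on_cong[OF MC smooth_map_on_mult[OF MC b(1)[of i] inv]]) (use that F' s in \<open>auto simp: \<rho>_def\<close>)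
    show "(\<Sum>i\<in>F. \<rho> i y) = 1" if "y \<in> pts M" for y
    proof -
      have "(\<Sum>i\<in>F. \<rho> i y) = (\<Sum>i\<in>F. \<beta> i y * inverse (s y))"
        by (rule sum.cong) (use s[OF that] F'(1) in \<open>auto simp: \<rho>_def\<close>)
      also have "\<dots> = s y * inverse (s y)" by (simp add: s_def sum_distrib_right)
      finally show ?thesis using s[OF that] by simp
    qed
  qed (use F' b in \<open>auto simp: \<rho>_def subset_iff\<close>)
qed

text \<open>A partition of unity averages local solutions, and a pointwise convex constraint
  survives averaging. Extension problems fit this pattern with a singleton constraint on a closed
  set and no constraint elsewhere.\<close>

lemma glue_convex:
  fixes M :: "('a, 'e::euclidean_space) manifold" and Q :: "'a \<Rightarrow> 'd::euclidean_space set"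
  assumes M: "closed_manifold M" and Q: "\<And>y. y \<in> pts M \<Longrightarrow> convex (Q y)"
    and loc: "\<And>x. x \<in> pts M \<Longrightarrow> \<exists>C f. openin (mtop M) C \<and> x \<in> C \<and> smooth_map_on M C euclid f \<and> (\<forall>y\<in>C. f y \<in> Q y)"
  obtains f where "smooth_map_on M (pts M) euclid f" "\<And>y. y \<in> pts M \<Longrightarrow> f y \<in> Q y"
proof -
  have MC: "charted M" using M by (rule closed_manifold_charted)
  obtain C f where C: "\<And>x. x \<in> pts M \<Longrightarrow> openin (mtop M) (C x) \<and> x \<in> C x"
    and f: "\<And>x. x \<in> pts M \<Longrightarrow> smooth_map_on M (C x) euclid (f x)" "\<And>x y. x \<in> pts M \<Longrightarrow> y \<in> C x \<Longrightarrow> f x y \<in> Q y"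
    using loc by metis
  obtain F and \<rho> :: "'a \<Rightarrow> 'a \<Rightarrow> real" and K where F: "finite F" "F \<subseteq> pts M"
    and \<rho>: "\<And>i. i \<in> F \<Longrightarrow> smooth_map_on M (pts M) euclid (\<rho> i)" "\<And>i y. 0 \<le> \<rho> i y"
    "\<And>y. y \<in> pts M \<Longrightarrow> (\<Sum>i\<in>F. \<rho> i y) = 1"
    and K: "\<And>i. i \<in> F \<Longrightarrow> closedin (mtop M) (K i)" "\<And>i. i \<in> F \<Longrightarrow> K i \<subseteq> C i" "\<And>i y. i \<in> F \<Longrightarrow> y \<notin> K i \<Longrightarrow> \<rho> i y = 0"
    by (rule partition_of_unity[OF M C, rotated]) (rule that; assumption)
  define g where "g y = (\<Sum>i\<in>F. if y \<in> C i then \<rho> i y *\<^sub>R f i y else 0)" for y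
  show thesis
  proof (rule that[of g])
    show "smooth_map_on M (pts M) euclid g"
      unfolding g_def[abs_def]
    proof (rule smooth_map_on_sum[OF MC])
      fix i assume i: "i \<in> F"
      have iM: "i \<in> pts M" using i F by blast
      have s: "smooth_map_on M (C i) euclid (\<lambda>y. \<rho> i y *\<^sub>R f i y)"
        using openin_subset[of "mtop M" "C i"] C[OF iM]
        by (intro smooth_map_on_scaleR[OF MC smooth_map_on_subset[OF \<rho>(1)[OF i]] f(1)[OF iM]]) simp
      show "smooth_map_on M (pts M) euclid (\<lambda>y. if y \<in> C i then \<rho> i y *\<^sub>R f i y else 0)"
        by (rule smooth_map_on_extend_zero[OF MC s conjunct1[OF C[OF iM]] K(1,2)[OF i]]) (simp add: K(3)[OF i])
    qed
    fix y assume y: "y \<in> pts M"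
    let ?J = "{i \<in> F. y \<in> C i}"
    have z: "\<rho> i y = 0" if "i \<in> F - ?J" for i using that K by blast
    have "(\<Sum>i\<in>?J. \<rho> i y) = 1"
      using sum.mono_neutral_right[of F ?J "\<lambda>i. \<rho> i y"] F(1) z \<rho>(3)[OF y] by auto
    then have "(\<Sum>i\<in>?J. \<rho> i y *\<^sub>R f i y) \<in> Q y"
      using F f(2) \<rho>(2) by (intro convex_sum[OF _ Q[OF y]]) auto
    moreover have "g y = (\<Sum>i\<in>?J. \<rho> i y *\<^sub>R f i y)"
      unfolding g_def using F(1) by (subst sum.inter_filter) auto
    ultimately show "g y \<in> Q y" by simp
  qed
qed

section \<open>Gluing along a common boundary\<close>

lemma derivative_nonneg_right:
  fixes k :: "'a::euclidean_space \<Rightarrow> real"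
  assumes "(k has_derivative K) (at p)" "\<forall>\<^sub>F t in at_right 0. k p \<le> k (p + t *\<^sub>R v)"
  shows "0 \<le> K v"
proof -
  have "((\<lambda>t. p + t *\<^sub>R v) has_vector_derivative v) (at 0 within {0<..})"
    by (auto intro!: derivative_eq_intros)
  moreover have "(k has_derivative K) (at (p + 0 *\<^sub>R v))" using assms(1) by simp
  ultimately have "((k \<circ> (\<lambda>t. p + t *\<^sub>R v)) has_vector_derivative K v) (at 0 within {0<..})"
    using vector_derivative_diff_chain_within[of "\<lambda>t. p + t *\<^sub>R v" v 0 "{0<..}" k K] has_derivative_at_withinI by blast
  then have "((\<lambda>t. k (p + t *\<^sub>R v)) has_real_derivative K v) (at 0 within {0<..})"
    by (simp add: has_real_derivative_iff_has_vector_derivative o_def)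
  then have lim: "((\<lambda>t. (k (p + t *\<^sub>R v) - k p) / t) \<longlongrightarrow> K v) (at_right 0)"
    by (simp add: has_field_derivative_iff)
  show ?thesis
  proof (rule tendsto_lowerbound[OF lim])
    show "\<forall>\<^sub>F t in at_right 0. 0 \<le> (k (p + t *\<^sub>R v) - k p) / t"
      using assms(2) eventually_at_right_less[of "0::real"] by eventually_elim simp
  qed simp
qed

text \<open>On the bounding hyperplane both \<open>u\<close> and \<open>- u\<close> are limits of
  inward vectors, so \<open>L\<close> vanishes there and is a multiple of the inner product with
  \<open>b\<close>.\<close>

lemma functional_on_halfspace:
  fixes L :: "'a::euclidean_space \<Rightarrow> real"
  assumes L: "linear L" and b: "b \<noteq> 0" and pos: "\<And>u. 0 < u \<bullet> b \<Longrightarrow> 0 \<le> L u"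
  obtains c where "0 \<le> c" "\<And>u. L u = c * (u \<bullet> b)"
proof -
  have bb: "0 < b \<bullet> b" using b by simp
  have ge: "0 \<le> L u" if "u \<bullet> b = 0" for u
  proof (rule ccontr)
    assume "\<not> 0 \<le> L u"
    then have neg: "L u < 0" by simp
    \<comment> \<open>So small that \<open>s * L b\<close> compensates at most half of the negative
      value \<open>L u\<close>.\<close>
    define s where "s = - L u / (2 * (\<bar>L b\<bar> + 1))"
    have den: "0 < 2 * (\<bar>L b\<bar> + 1)"
      by (intro mult_pos_pos add_nonneg_pos) auto
    have s: "0 < s" unfolding s_def by (rule divide_pos_pos[OF _ den]) (use neg in simp)
    have "0 \<le> L (u + s *\<^sub>R b)"
      using that bb s by (intro pos) (simp add: inner_add_left)
    also have "L (u + s *\<^sub>R b) = L u + s * L b"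
      by (simp add: linear_add[OF L] linear_scale[OF L])
    also have "\<dots> \<le> L u + s * (\<bar>L b\<bar> + 1)"
      using s by (intro add_left_mono mult_left_mono) auto
    also have "\<dots> = L u / 2" by (simp add: s_def field_simps)
    finally show False using neg by simp
  qed
  have z: "L u = 0" if "u \<bullet> b = 0" for u
    using ge[OF that] ge[of "- u"] that by (simp add: linear_neg[OF L])
  show thesis
  proof (rule that[of "L b / (b \<bullet> b)"])
    show "0 \<le> L b / (b \<bullet> b)" using pos[OF bb] bb by simp
    fix u
    have "L (u - (u \<bullet> b / (b \<bullet> b)) *\<^sub>R b) = 0"
      using bb by (intro z) (simp add: inner_diff_left)
    then show "L u = L b / (b \<bullet> b) * (u \<bullet> b)"
      by (simp add: linear_diff[OF L] linear_scale[OF L])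
  qed
qed

text \<open>The open half-space spans: \<open>u\<close> is the difference of \<open>u + s b\<close>
  and \<open>s b\<close>, both of which are inward for large \<open>s\<close>.\<close>

lemma linear_eq_ident_on_halfspace:
  fixes L :: "'a::euclidean_space \<Rightarrow> 'a"
  assumes L: "linear L" and b: "b \<noteq> 0" and pos: "\<And>u. 0 < u \<bullet> b \<Longrightarrow> L u = u"
  shows "L u = u"
proof -
  have bb: "0 < b \<bullet> b" using b by simp
  define s where "s = (\<bar>u \<bullet> b\<bar> + 1) / (b \<bullet> b)"
  have s: "0 < s" using bb by (simp add: s_def)
  have "(u + s *\<^sub>R b) \<bullet> b = u \<bullet> b + (\<bar>u \<bullet> b\<bar> + 1)"
    using bb by (simp add: s_def inner_add_left)
  then have "0 < (u + s *\<^sub>R b) \<bullet> b" by linarith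
  then have "L (u + s *\<^sub>R b) = u + s *\<^sub>R b" by (rule pos)
  moreover have "L (s *\<^sub>R b) = s *\<^sub>R b" using bb s by (intro pos) simp
  ultimately show ?thesis by (simp add: linear_add[OF L])
qed

text \<open>Treats interior and boundary points alike: at least an open half-space of directions
  points into the chart image. If the image is open, any \<open>b\<close> will do.\<close>

lemma chart_image_direction:
  fixes P :: "'d::euclidean_space set"
  assumes "chart_image P" "p \<in> P"
  obtains b where "b \<noteq> 0" "\<And>v. 0 < v \<bullet> b \<Longrightarrow> \<forall>\<^sub>F t in at_right 0. p + t *\<^sub>R v \<in> P"
proof -
  have lim: "((\<lambda>t. p + t *\<^sub>R v) \<longlongrightarrow> p) (at_right (0::real))" for v
    by (auto intro!: tendsto_eq_intros)
  consider "open P" | b where "b \<in> Basis" "openin (top_of_set {x. 0 \<le> x \<bullet> b}) P"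
    using assms(1) unfolding chart_image_def by blast
  then show thesis
  proof cases
    case 1
    have "\<forall>\<^sub>F t in at_right 0. p + t *\<^sub>R v \<in> P" for v
      using topological_tendstoD[OF lim 1 assms(2)] .
    moreover obtain b :: 'd where "b \<in> Basis" using nonempty_Basis by blast
    ultimately show ?thesis using that[of b] nonzero_Basis by blast
  next
    case 2
    then obtain Q where Q: "open Q" "P = {x. 0 \<le> x \<bullet> b} \<inter> Q" by (auto simp: openin_open)
    have pQ: "p \<in> Q" "0 \<le> p \<bullet> b" using assms(2) Q by auto
    have "\<forall>\<^sub>F t in at_right 0. p + t *\<^sub>R v \<in> P" if "0 < v \<bullet> b" for v
      using topological_tendstoD[OF lim Q(1) pQ(1)] eventually_at_right_less[of "0::real"]
      by eventually_elim (use that pQ Q in \<open>auto simp: inner_add_left\<close>)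
    then show ?thesis using that[of b] 2 nonzero_Basis by blast
  qed
qed

text \<open>Transition maps between a chart of \<open>S\<close> and a chart of \<open>M\<close> are
  smooth only through local extensions to open sets. The extensions \<open>f\<close> and
  \<open>g\<close> are tied to the charts on points of \<open>U \<inter> V\<close> only and need not
  invert each other elsewhere.\<close>

lemma chart_transition_extensions:
  fixes M :: "('a, 'e::euclidean_space) manifold" and \<phi> :: "'a \<Rightarrow> 'd::euclidean_space"
  assumes M: "smooth_manifold M" and U: "(U, \<phi>) \<in> atlas (submanifold M S)" "x \<in> U"
    and V: "(V, \<psi>) \<in> atlas M" "x \<in> V"
  obtains W f W' g where "smooth_on W f" "\<psi> x \<in> W" "\<And>y. y \<in> U \<inter> V \<Longrightarrow> \<psi> y \<in> W \<Longrightarrow> f (\<psi> y) = \<phi> y"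
    "smooth_on W' g" "\<phi> x \<in> W'" "\<And>y. y \<in> U \<inter> V \<Longrightarrow> \<phi> y \<in> W' \<Longrightarrow> g (\<phi> y) = \<psi> y"
proof -
  have c: "coord (subtopology (mtop M) S) U \<phi>" and 1: "smooth_map_on M U euclid \<phi>"
    and 2: "smooth_map_on euclid (\<phi> ` U) M (inv_into U \<phi>)"
    using U(1) by (simp_all add: submanifold_atlas_iff is_chart_coord)
  have d: "coord (mtop M) V \<psi>" using charted_coord[OF smooth_manifold_charted[OF M] V(1)] .
  have "smooth_on_set (\<psi> ` (U \<inter> V)) (\<phi> \<circ> inv_into V \<psi>)"
    using smooth_map_onD[OF 1 V(1), of UNIV "\<lambda>x. x"] by (simp add: o_def)
  then obtain W f where f: "smooth_on W f" "\<psi> x \<in> W" "\<And>q. q \<in> \<psi> ` (U \<inter> V) \<inter> W \<Longrightarrow> f q = (\<phi> \<circ> inv_into V \<psi>) q"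
    unfolding smooth_on_set_iff using U(2) V(2) by (metis (no_types, lifting) IntI imageI)
  have "smooth_on_set (\<phi> ` U \<inter> inv_into U \<phi> -` V) (\<psi> \<circ> inv_into U \<phi>)"
    using smooth_map_onD[OF 2 _ V(1), of UNIV "\<lambda>x. x"] by (simp add: o_def)
  then obtain W' g where g: "smooth_on W' g" "\<phi> x \<in> W'" "\<And>q. q \<in> (\<phi> ` U \<inter> inv_into U \<phi> -` V) \<inter> W' \<Longrightarrow> g q = (\<psi> \<circ> inv_into U \<phi>) q"
    unfolding smooth_on_set_iff using U(2) V(2) coord_inv[OF c U(2)] by (metis (no_types, lifting) IntI imageI vimageI)
  show thesis
  proof (rule that[OF f(1,2) _ g(1,2)])
    show "f (\<psi> y) = \<phi> y" if "y \<in> U \<inter> V" "\<psi> y \<in> W" for y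
      using f(3)[of "\<psi> y"] that coord_inv[OF d, of y] by simp
    show "g (\<phi> y) = \<psi> y" if "y \<in> U \<inter> V" "\<phi> y \<in> W'" for y
      using g(3)[of "\<phi> y"] that coord_inv[OF c, of y] by simp
  qed
qed

lemma chart_right_eventually:
  fixes \<phi> :: "'a \<Rightarrow> 'd::euclidean_space"
  assumes c: "coord T U \<phi>" and x: "x \<in> U" and Q: "openin T Q" "x \<in> Q"
    and ev: "\<forall>\<^sub>F t in at_right 0. \<phi> x + t *\<^sub>R v \<in> \<phi> ` U" and W: "open W" "\<phi> x \<in> W"
  shows "\<forall>\<^sub>F t in at_right 0. \<exists>y\<in>U \<inter> Q. \<phi> y = \<phi> x + t *\<^sub>R v \<and> \<phi> y \<in> W"
proof -
  obtain W1 where W1: "open W1" "\<And>y. y \<in> U \<Longrightarrow> \<phi> y \<in> W1 \<longleftrightarrow> y \<in> Q"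
    using coord_open[OF c Q(1)] by blast
  have lim: "((\<lambda>t. \<phi> x + t *\<^sub>R v) \<longlongrightarrow> \<phi> x) (at_right (0::real))"
    by (auto intro!: tendsto_eq_intros)
  have "\<forall>\<^sub>F t in at_right 0. \<phi> x + t *\<^sub>R v \<in> W1 \<inter> W"
    using topological_tendstoD[OF lim, of "W1 \<inter> W"] W W1 x Q by blast
  with ev show ?thesis
  proof eventually_elim
    case (elim t)
    then obtain y where y: "y \<in> U" "\<phi> y = \<phi> x + t *\<^sub>R v" by auto
    then show ?case using elim W1(2)[OF y(1)] by auto
  qed
qed

text \<open>The extensions invert each other along the chart image, which contains short inward
  rays, and the directions of these fill an open half-space. This determines the composition of the
  two derivatives. It also shows that a function minimal at \<open>x\<close> along \<open>S\<close>
  has nonnegative derivative in inward directions.\<close>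

lemma tangent_frame:
  fixes M :: "('a, 'e::euclidean_space) manifold" and \<phi> :: "'a \<Rightarrow> 'd::euclidean_space"
  assumes M: "smooth_manifold M" and U: "(U, \<phi>) \<in> atlas (submanifold M S)" "x \<in> U"
    and V: "(V, \<psi>) \<in> atlas M" "x \<in> V"
    and f: "smooth_on W f" "\<psi> x \<in> W" "\<And>y. y \<in> U \<inter> V \<Longrightarrow> \<psi> y \<in> W \<Longrightarrow> f (\<psi> y) = \<phi> y"
    and g: "smooth_on W' g" "\<phi> x \<in> W'" "\<And>y. y \<in> U \<inter> V \<Longrightarrow> \<phi> y \<in> W' \<Longrightarrow> g (\<phi> y) = \<psi> y"
    and b: "b \<noteq> 0" "\<And>v. 0 < v \<bullet> b \<Longrightarrow> \<forall>\<^sub>F t in at_right 0. \<phi> x + t *\<^sub>R v \<in> \<phi> ` U"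
  shows "frechet_derivative f (at (\<psi> x)) (frechet_derivative g (at (\<phi> x)) v) = v"
    and "openin (mtop M) Q \<Longrightarrow> x \<in> Q \<Longrightarrow> (k has_derivative K) (at (\<psi> x)) \<Longrightarrow> (\<And>z. z \<in> Q \<inter> S \<inter> V \<Longrightarrow> k (\<psi> x) \<le> k (\<psi> z))
      \<Longrightarrow> 0 < v \<bullet> b \<Longrightarrow> (0::real) \<le> K (frechet_derivative g (at (\<phi> x)) v)"
proof -
  define p where "p = \<phi> x"
  have c: "coord (subtopology (mtop M) S) U \<phi>"
    using U(1) by (simp_all add: submanifold_atlas_iff is_chart_coord)
  have US: "U \<subseteq> S" using coord_subset[OF c] by auto
  have d: "coord (mtop M) V \<psi>" using charted_coord[OF smooth_manifold_charted[OF M] V(1)] .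
  have gp: "g p = \<psi> x" using g U V by (simp add: p_def)
  have Dg: "(g has_derivative frechet_derivative g (at p)) (at p)"
    using smooth_on_has_derivative[OF g(1,2)] by (simp add: p_def)
  have sub_open: "openin (subtopology (mtop M) S) (S \<inter> (Q' \<inter> V))" if "openin (mtop M) Q'" for Q'
    using openin_subtopology_Int2 openin_Int[OF that coord_openin[OF d]] by blast
  let ?D = "\<lambda>v. frechet_derivative f (at (\<psi> x)) (frechet_derivative g (at p) v)"
  have Df: "(f has_derivative frechet_derivative f (at (g p))) (at (g p))"
    using smooth_on_has_derivative[OF f(1,2)] by (simp add: gp)
  have fg: "((\<lambda>q. f (g q)) has_derivative ?D) (at p)"
    using diff_chain_at[OF Dg Df] by (simp add: o_def gp)
  have linD: "linear ?D" using has_derivative_linear[OF fg] .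
  obtain W1 where W1: "open W1" "\<And>y. y \<in> V \<Longrightarrow> \<psi> y \<in> W1 \<longleftrightarrow> y \<in> V"
    using coord_open[OF d coord_openin[OF d]] by blast
  show "frechet_derivative f (at (\<psi> x)) (frechet_derivative g (at (\<phi> x)) v) = v"
    unfolding p_def[symmetric]
  proof (rule linear_eq_ident_on_halfspace[OF linD b(1)])
    fix v assume v: "0 < v \<bullet> b"
    have o: "open (W' \<inter> g -` W)" using smooth_on_preimage[OF g(1) smooth_on_open[OF f(1)]] .
    have "\<forall>\<^sub>F t in at_right 0. \<exists>y\<in>U \<inter> (S \<inter> (pts M \<inter> V)). \<phi> y = \<phi> x + t *\<^sub>R v \<and> \<phi> y \<in> W' \<inter> g -` W"
      by (rule chart_right_eventually[OF c U(2) sub_open _ b(2)[OF v] o])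
        (use U V US coord_subset[OF d] g gp f in \<open>auto simp: p_def\<close>)
    then have ev: "\<forall>\<^sub>F t in at_right 0. f (g (p + t *\<^sub>R v)) = p + t *\<^sub>R v"
    proof eventually_elim
      case (elim t)
      then obtain y where y: "y \<in> U" "y \<in> V" "\<phi> y = p + t *\<^sub>R v" "\<phi> y \<in> W'" "g (\<phi> y) \<in> W"
        by (auto simp: p_def)
      have "g (\<phi> y) = \<psi> y" using g(3)[of y] y by simp
      then have "f (g (\<phi> y)) = \<phi> y" using f(3)[of y] y by simp
      then show ?case by (simp add: y(3))
    qed
    have fgp: "f (g p) = p" using f(3)[of x] U V f(2) gp by (simp add: p_def)
    \<comment> \<open>A vector identity is tested by scalar functions that vanish along the ray.
      With the test vector \<open>v - ?D v\<close> the resulting inequality says that a norm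
      vanishes.\<close>
    have der: "((\<lambda>q. s * ((f (g q) - q) \<bullet> w)) has_derivative (\<lambda>v. s * ((?D v - v) \<bullet> w))) (at p)" for w and s :: real
      by (rule has_derivative_mult_right, rule has_derivative_inner_left, rule has_derivative_diff[OF fg]) simp
    have "0 \<le> s * ((?D v - v) \<bullet> w)" for w s
      by (rule derivative_nonneg_right[OF der]) (use ev in eventually_elim, simp add: fgp)
    from this[of 1 "v - ?D v"] have "(?D v - v) \<bullet> (?D v - v) \<le> 0"
      by (simp add: inner_diff_left inner_diff_right inner_commute algebra_simps)
    then have "(?D v - v) \<bullet> (?D v - v) = 0"
      using inner_ge_zero[of "?D v - v"] by linarith
    then show "?D v = v" by simp
  qed
  assume Q: "openin (mtop M) Q" "x \<in> Q" and k: "(k has_derivative K) (at (\<psi> x))"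
    and kQ: "\<And>z. z \<in> Q \<inter> S \<inter> V \<Longrightarrow> k (\<psi> x) \<le> k (\<psi> z)" and v: "0 < v \<bullet> b"
  have "((\<lambda>q. k (g q)) has_derivative (\<lambda>v. K (frechet_derivative g (at p) v))) (at p)"
    using diff_chain_at[OF Dg, of k K] k by (simp add: o_def gp)
  then have "0 \<le> K (frechet_derivative g (at p) v)"
  proof (rule derivative_nonneg_right)
    have "\<forall>\<^sub>F t in at_right 0. \<exists>y\<in>U \<inter> (S \<inter> (Q \<inter> V)). \<phi> y = \<phi> x + t *\<^sub>R v \<and> \<phi> y \<in> W'"
      by (rule chart_right_eventually[OF c U(2) sub_open[OF Q(1)] _ b(2)[OF v] smooth_on_open[OF g(1)] g(2)])
        (use U V US Q in auto)
    then show "\<forall>\<^sub>F t in at_right 0. k (g p) \<le> k (g (p + t *\<^sub>R v))"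
    proof eventually_elim
      case (elim t)
      then obtain y where y: "y \<in> U" "y \<in> V" "y \<in> S" "y \<in> Q" "\<phi> y = p + t *\<^sub>R v" "\<phi> y \<in> W'"
        by (auto simp: p_def)
      have "g (\<phi> y) = \<psi> y" using g(3)[of y] y by simp
      then have "k (g p) \<le> k (g (\<phi> y))" using kQ[of y] y gp by simp
      then show ?case by (simp add: y(5))
    qed
  qed
  then show "0 \<le> K (frechet_derivative g (at (\<phi> x)) v)" by (simp add: p_def)
qed

text \<open>Determines the tangent half-space \<open>{v. 0 \<le> \<tau> v}\<close> of \<open>S\<close> at \<open>x\<close> without reference to charts of \<open>S\<close>.\<close>

definition inward_conormal ::
  "('a, 'e::euclidean_space) manifold \<Rightarrow> 'a set \<Rightarrow> 'a \<Rightarrow> 'a set \<Rightarrow> ('a \<Rightarrow> 'e) \<Rightarrow> ('e \<Rightarrow> real) \<Rightarrow> bool" where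
  "inward_conormal M S x V \<psi> \<tau> \<longleftrightarrow> linear \<tau> \<and> (\<exists>w. 0 < \<tau> w) \<and>
    (\<forall>Q k K. openin (mtop M) Q \<and> x \<in> Q \<and> (k has_derivative K) (at (\<psi> x)) \<and> (\<forall>z\<in>Q \<inter> S \<inter> V. k (\<psi> x) \<le> k (\<psi> z))
      \<longrightarrow> (\<exists>c\<ge>0. \<forall>v. K v = c * \<tau> v))"

lemma inward_conormalD:
  assumes "inward_conormal M S x V \<psi> \<tau>" "openin (mtop M) Q" "x \<in> Q" "(k has_derivative K) (at (\<psi> x))"
    "\<And>z. z \<in> Q \<inter> S \<inter> V \<Longrightarrow> k (\<psi> x) \<le> k (\<psi> z)"
  obtains c where "0 \<le> c" "\<And>v. K v = c * \<tau> v"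
  using assms unfolding inward_conormal_def by metis

text \<open>The conormal is the derivative of the coordinate \<open>b\<close> of a chart of
  \<open>S\<close>, extended to an open set of the chart of \<open>M\<close>. Equality of dimensions
  turns the one-sided inverse relation of \<open>tangent_frame\<close> into a two-sided one, so
  functionals on the model space of \<open>M\<close> can be compared in the chart of
  \<open>S\<close>.\<close>

lemma ex_inward_conormal:
  fixes M :: "('a, 'e::euclidean_space) manifold"
  assumes M: "smooth_manifold M" and MS: "charted (submanifold M S :: ('a, 'd::euclidean_space) manifold)"
    and dim: "DIM('d) = DIM('e)" and x: "x \<in> pts M" "x \<in> S" and V: "(V, \<psi>) \<in> atlas M" "x \<in> V"
  shows "\<exists>\<tau>. inward_conormal M S x V \<psi> \<tau>"
proof -
  obtain U and \<phi> :: "'a \<Rightarrow> 'd" where U: "(U, \<phi>) \<in> atlas (submanifold M S)" "x \<in> U"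
    using charted_obtain[OF MS, of x] x by auto
  obtain W f W' g where f: "smooth_on W f" "\<psi> x \<in> W" "\<And>y. y \<in> U \<inter> V \<Longrightarrow> \<psi> y \<in> W \<Longrightarrow> f (\<psi> y) = \<phi> y"
    and g: "smooth_on W' g" "\<phi> x \<in> W'" "\<And>y. y \<in> U \<inter> V \<Longrightarrow> \<phi> y \<in> W' \<Longrightarrow> g (\<phi> y) = \<psi> y"
    by (rule chart_transition_extensions[OF M U V]) (rule that; assumption)
  have "chart_image (\<phi> ` U)" using U(1) by (simp add: submanifold_atlas_iff is_chart_def)
  then obtain b where b: "b \<noteq> 0" "\<And>v. 0 < v \<bullet> b \<Longrightarrow> \<forall>\<^sub>F t in at_right 0. \<phi> x + t *\<^sub>R v \<in> \<phi> ` U"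
    using chart_image_direction[of "\<phi> ` U" "\<phi> x"] U(2) by auto
  let ?F = "frechet_derivative f (at (\<psi> x))" and ?G = "frechet_derivative g (at (\<phi> x))"
  have FG: "?F (?G v) = v" for v using tangent_frame(1)[OF M U V f g b] .
  have linF: "linear ?F" and linG: "linear ?G"
    using smooth_on_has_derivative[OF f(1,2)] smooth_on_has_derivative[OF g(1,2)] has_derivative_linear by blast+
  have injG: "inj ?G" by (rule injI) (metis FG)
  have "dim (range ?G) = dim (UNIV :: 'd set)"
    using dim_image_eq[OF linG, of UNIV] injG by simp
  then have "span (range ?G) = UNIV"
    using dim by (simp add: dim_eq_full)
  moreover have "span (range ?G) = range ?G"
    using linear_subspace_image[OF linG subspace_UNIV] span_eq_iff by blast
  ultimately have surjG: "\<exists>u. w = ?G u" for w by (metis UNIV_I imageE)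
  have GF: "?G (?F w) = w" for w using surjG[of w] FG by auto
  have "inward_conormal M S x V \<psi> (\<lambda>w. ?F w \<bullet> b)"
    unfolding inward_conormal_def
  proof (intro conjI allI impI)
    show "linear (\<lambda>w. ?F w \<bullet> b)"
      by (intro linearI) (simp_all add: linear_add[OF linF] linear_scale[OF linF] inner_add_left)
    have "0 < ?F (?G b) \<bullet> b" using FG[of b] b(1) by simp
    then show "\<exists>w. 0 < ?F w \<bullet> b" by blast
    fix Q and k K :: "'e \<Rightarrow> real" assume "openin (mtop M) Q \<and> x \<in> Q \<and> (k has_derivative K) (at (\<psi> x)) \<and> (\<forall>z\<in>Q \<inter> S \<inter> V. k (\<psi> x) \<le> k (\<psi> z))"
    then have *: "openin (mtop M) Q" "x \<in> Q" "(k has_derivative K) (at (\<psi> x))" "\<And>z. z \<in> Q \<inter> S \<inter> V \<Longrightarrow> k (\<psi> x) \<le> k (\<psi> z)"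
      by blast+
    have linKG: "linear (\<lambda>u. K (?G u))"
      using linear_compose[OF linG has_derivative_linear[OF *(3)]] by (simp add: o_def)
    obtain c where c: "0 \<le> c" "\<And>u. K (?G u) = c * (u \<bullet> b)"
      using functional_on_halfspace[OF linKG b(1) tangent_frame(2)[OF M U V f g b *]] by blast
    show "\<exists>c\<ge>0. \<forall>v. K v = c * (?F v \<bullet> b)"
      using c GF by (metis)
  qed
  then show ?thesis by blast
qed

section \<open>Boundary defining functions and the absence of a boundary after gluing\<close>

text \<open>The function is the normal coordinate of a boundary chart of \<open>S\<close>, extended
  smoothly over an open set. That nonnegative values force membership in \<open>S\<close> comes from
  the inverse function theorem: the extension is injective near \<open>x\<close>, and the chart of
  \<open>S\<close> already fills the half-space near \<open>\<phi> x\<close>.\<close>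

lemma boundary_defining_function:
  fixes M :: "('a, real^'n) manifold"
  assumes M: "smooth_manifold M" and MS: "smooth_manifold (submanifold M S :: ('a, real^'n) manifold)"
    and x: "x \<in> boundary (submanifold M S :: ('a, real^'n) manifold)" and V: "(V, \<psi>) \<in> atlas M" "x \<in> V"
  obtains Q W and f :: "real^'n \<Rightarrow> real^'n" and b where "openin (mtop M) Q" "x \<in> Q" "Q \<subseteq> V" "smooth_on W f" "\<And>z. z \<in> Q \<Longrightarrow> \<psi> z \<in> W"
    "\<And>z. z \<in> Q \<Longrightarrow> z \<in> S \<longleftrightarrow> 0 \<le> f (\<psi> z) \<bullet> b"
    "\<And>z. z \<in> Q \<Longrightarrow> z \<in> boundary (submanifold M S :: ('a, real^'n) manifold) \<longleftrightarrow> f (\<psi> z) \<bullet> b = 0"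
    "\<And>q. q \<in> W \<Longrightarrow> \<exists>w. frechet_derivative f (at q) w \<bullet> b \<noteq> 0"
proof -
  let ?MS = "submanifold M S :: ('a, real^'n) manifold"
  have xS: "x \<in> pts M" "x \<in> S"
    using x coord_subset[OF charted_coord[OF smooth_manifold_charted[OF MS]]] by (fastforce simp: boundary_def)+
  obtain U and \<phi> :: "'a \<Rightarrow> real^'n" where U: "(U, \<phi>) \<in> atlas ?MS" "x \<in> U"
    using charted_obtain[OF smooth_manifold_charted[OF MS], of x] xS by auto
  have c: "coord (subtopology (mtop M) S) U \<phi>" and ci: "chart_image (\<phi> ` U)"
    using U(1) by (simp_all add: submanifold_atlas_iff is_chart_coord)
  have d: "coord (mtop M) V \<psi>" using charted_coord[OF smooth_manifold_charted[OF M] V(1)] .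
  have ni: "\<phi> x \<notin> interior (\<phi> ` U)" using boundary_iff[OF MS U] x by blast
  then have "\<not> open (\<phi> ` U)" using U(2) interior_open by blast
  then obtain b where b: "b \<in> Basis" "openin (top_of_set {p. 0 \<le> p \<bullet> b}) (\<phi> ` U)"
    using ci unfolding chart_image_def by blast
  then obtain P0 where P0: "open P0" "\<phi> ` U = {p. 0 \<le> p \<bullet> b} \<inter> P0" by (auto simp: openin_open)
  have b0: "b \<noteq> 0" using b(1) nonzero_Basis by blast
  have intU: "\<phi> z \<notin> interior (\<phi> ` U) \<longleftrightarrow> \<phi> z \<bullet> b = 0" if z: "z \<in> U" for z
  proof -
    have zP: "\<phi> z \<in> P0" "0 \<le> \<phi> z \<bullet> b" using P0(2) z by auto
    have "interior (\<phi> ` U) = {p. 0 < p \<bullet> b} \<inter> P0"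
      using P0 interior_halfspace_ge[OF b0, of 0] by (simp add: interior_open inner_commute)
    then show ?thesis using zP by auto
  qed
  obtain W f W' g where f: "smooth_on W f" "\<psi> x \<in> W" "\<And>y. y \<in> U \<inter> V \<Longrightarrow> \<psi> y \<in> W \<Longrightarrow> f (\<psi> y) = \<phi> y"
    and g: "smooth_on W' g" "\<phi> x \<in> W'" "\<And>y. y \<in> U \<inter> V \<Longrightarrow> \<phi> y \<in> W' \<Longrightarrow> g (\<phi> y) = \<psi> y"
    by (rule chart_transition_extensions[OF M U V]) (rule that; assumption)
  obtain b1 where b1: "b1 \<noteq> 0" "\<And>v. 0 < v \<bullet> b1 \<Longrightarrow> \<forall>\<^sub>F t in at_right 0. \<phi> x + t *\<^sub>R v \<in> \<phi> ` U"
    using chart_image_direction[OF ci, of "\<phi> x"] U(2) by auto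
  let ?F = "\<lambda>q. frechet_derivative f (at q)" and ?G = "frechet_derivative g (at (\<phi> x))"
  have FG: "?F (\<psi> x) (?G v) = v" for v using tangent_frame(1)[OF M U V f g b1] .
  have linF: "linear (?F q)" if "q \<in> W" for q
    using smooth_on_has_derivative[OF f(1) that] has_derivative_linear by blast
  have "surj (?F (\<psi> x))" by (metis FG surjI)
  then have injF: "inj (?F (\<psi> x))" using linear_surjective_imp_injective[OF linF[OF f(2)]] by simp
  have "\<And>v. ?F (\<psi> x) v = 0 \<Longrightarrow> v = 0" using injF linear_injective_0[OF linF[OF f(2)]] by blast
  then obtain W1 h where W1: "open W1" "\<psi> x \<in> W1" "W1 \<subseteq> W" "smooth_on (f ` W1) h" "\<And>q. q \<in> W1 \<Longrightarrow> h (f q) = q"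
    "\<And>q v. q \<in> W1 \<Longrightarrow> ?F q v = 0 \<Longrightarrow> v = 0"
    using smooth_inverse_function[OF f(1,2)] by metis
  obtain Q0 where Q0: "openin (mtop M) Q0" "U = Q0 \<inter> S"
    using coord_openin[OF c] by (auto simp: openin_subtopology)
  obtain P1 where P1: "open P1" "\<And>y. y \<in> U \<Longrightarrow> \<phi> y \<in> P1 \<longleftrightarrow> y \<in> S \<inter> V"
    using coord_open[OF c openin_subtopology_Int2[OF coord_openin[OF d]]] by blast
  \<comment> \<open>Points of \<open>P\<close> in the half-space are coordinates of points of
    \<open>S \<inter> V\<close>, and \<open>g\<close> sends them to where \<open>f\<close> is
    injective.\<close>
  define P where "P = P0 \<inter> P1 \<inter> (W' \<inter> g -` W1)"
  have P: "open P" unfolding P_def by (rule open_Int[OF open_Int[OF P0(1) P1(1)] smooth_on_preimage[OF g(1) W1(1)]])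
  have fx: "f (\<psi> x) = \<phi> x" using f(2,3) U V by simp
  have gx: "g (\<phi> x) = \<psi> x" using g(2,3) U V by simp
  have xP: "\<phi> x \<in> P" using P0(2) P1(2)[OF U(2)] U(2) xS V(2) g(2) gx W1(2) by (auto simp: P_def)
  have oW: "open (W1 \<inter> f -` P)"
    using smooth_on_preimage[OF smooth_on_subset[OF f(1) W1(1,3)] P] .
  define Q where "Q = (V \<inter> \<psi> -` (W1 \<inter> f -` P)) \<inter> Q0"
  have SU: "z \<in> U \<and> f (\<psi> z) = \<phi> z" if "z \<in> Q" "z \<in> S" for z
  proof -
    have "z \<in> U" using that Q0(2) by (auto simp: Q_def)
    moreover have "z \<in> V" "\<psi> z \<in> W" using that W1(3) by (auto simp: Q_def)
    ultimately show ?thesis using f(3)[of z] by simp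
  qed
  have US: "z \<in> S" if z: "z \<in> Q" "0 \<le> f (\<psi> z) \<bullet> b" for z
  proof -
    have zV: "z \<in> V" "\<psi> z \<in> W1" "f (\<psi> z) \<in> P" using z(1) by (auto simp: Q_def)
    then have "f (\<psi> z) \<in> \<phi> ` U" using P0(2) z(2) by (auto simp: P_def)
    then obtain y where y: "y \<in> U" "f (\<psi> z) = \<phi> y" by auto
    have yV: "y \<in> V" "\<phi> y \<in> W'" "g (\<phi> y) \<in> W1" using P1(2)[OF y(1)] zV(3) y(2) by (auto simp: P_def)
    then have gy: "g (\<phi> y) = \<psi> y" using g(3) y(1) by simp
    then have "f (\<psi> y) = \<phi> y" using f(3)[of y] y(1) yV W1(3) by auto
    then have "\<psi> y = \<psi> z" using W1(5)[of "\<psi> y"] W1(5)[OF zV(2)] y(2) yV(3) gy by simp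
    then have "y = z" using inj_onD[OF coord_inj[OF d]] yV(1) zV(1) by blast
    then show ?thesis using y(1) Q0(2) by blast
  qed
  have bS: "z \<in> S" if "z \<in> boundary ?MS" for z
    using that coord_subset[OF charted_coord[OF smooth_manifold_charted[OF MS]]] by (fastforce simp: boundary_def)
  have bd: "z \<in> boundary ?MS \<longleftrightarrow> f (\<psi> z) \<bullet> b = 0" if z: "z \<in> Q" for z
  proof
    assume b: "z \<in> boundary ?MS"
    have zU: "z \<in> U" "f (\<psi> z) = \<phi> z" using SU[OF z bS[OF b]] by auto
    then show "f (\<psi> z) \<bullet> b = 0" using boundary_iff[OF MS U(1) zU(1)] intU[OF zU(1)] b by simp
  next
    assume e: "f (\<psi> z) \<bullet> b = 0"
    have zU: "z \<in> U" "f (\<psi> z) = \<phi> z" using SU[OF z US[OF z]] e by auto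
    then show "z \<in> boundary ?MS" using boundary_iff[OF MS U(1) zU(1)] intU[OF zU(1)] e by simp
  qed
  show thesis
  proof (rule that[of Q W1 f b])
    show "openin (mtop M) Q" unfolding Q_def using coord_preimage[OF d oW] Q0(1) by blast
    show "x \<in> Q" using V(2) W1(2) fx xP U(2) Q0(2) by (auto simp: Q_def)
    show "smooth_on W1 f" by (rule smooth_on_subset[OF f(1) W1(1,3)])
    show "z \<in> S \<longleftrightarrow> 0 \<le> f (\<psi> z) \<bullet> b" if z: "z \<in> Q" for z
    proof
      assume "z \<in> S"
      then have "\<phi> z \<in> \<phi> ` U" "f (\<psi> z) = \<phi> z" using SU[OF z] by auto
      then show "0 \<le> f (\<psi> z) \<bullet> b" unfolding P0(2) by simp
    qed (rule US[OF z])
    show "\<exists>w. ?F q w \<bullet> b \<noteq> 0" if q: "q \<in> W1" for q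
    proof -
      have lin: "linear (?F q)" using linF q W1(3) by blast
      have "inj (?F q)" using linear_injective_0[OF lin] W1(6)[OF q] by blast
      then have "surj (?F q)" using linear_injective_imp_surjective[OF lin] by simp
      then obtain w where "?F q w = b" by (metis surjD)
      then show ?thesis using b0 by (intro exI[of _ w]) simp
    qed
  qed (use bd in \<open>auto simp: Q_def\<close>)
qed

text \<open>The extension \<open>g\<close> of the inverse transition is injective on an open set and
  the dimensions agree, so invariance of domain produces an open subset of the chart image of
  \<open>M\<close>.\<close>

lemma interior_chart_transfer:
  fixes M :: "('a, 'e::euclidean_space) manifold" and \<phi> :: "'a \<Rightarrow> 'd::euclidean_space"
  assumes M: "smooth_manifold M" and U: "(U, \<phi>) \<in> atlas (submanifold M S)" "x \<in> U"
    and V: "(V, \<psi>) \<in> atlas M" "x \<in> V" and dim: "DIM('d) = DIM('e)" and i: "\<phi> x \<in> interior (\<phi> ` U)"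
  shows "\<psi> x \<in> interior (\<psi> ` V)"
proof -
  have c: "coord (subtopology (mtop M) S) U \<phi>" using U(1) by (simp add: submanifold_atlas_iff is_chart_coord)
  have d: "coord (mtop M) V \<psi>" using charted_coord[OF smooth_manifold_charted[OF M] V(1)] .
  obtain W f W' g where f: "smooth_on W f" "\<psi> x \<in> W" "\<And>y. y \<in> U \<inter> V \<Longrightarrow> \<psi> y \<in> W \<Longrightarrow> f (\<psi> y) = \<phi> y"
    and g: "smooth_on W' g" "\<phi> x \<in> W'" "\<And>y. y \<in> U \<inter> V \<Longrightarrow> \<phi> y \<in> W' \<Longrightarrow> g (\<phi> y) = \<psi> y"
    by (rule chart_transition_extensions[OF M U V]) (rule that; assumption)
  obtain P1 where P1: "open P1" "\<And>y. y \<in> U \<Longrightarrow> \<phi> y \<in> P1 \<longleftrightarrow> y \<in> S \<inter> V"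
    using coord_open[OF c openin_subtopology_Int2[OF coord_openin[OF d]]] by blast
  have xS: "x \<in> S" using coord_subset[OF c] U(2) by auto
  let ?G = "interior (\<phi> ` U) \<inter> (P1 \<inter> W')"
  have G: "\<exists>y. q = \<phi> y \<and> y \<in> U \<and> y \<in> V \<and> g q = \<psi> y" if q: "q \<in> ?G" for q
  proof -
    have "q \<in> \<phi> ` U" using q interior_subset[of "\<phi> ` U"] by auto
    then obtain y where y: "y \<in> U" "q = \<phi> y" by auto
    then show ?thesis using q P1(2)[OF y(1)] g(3)[of y] by auto
  qed
  have "continuous_on ?G g"
    using smooth_on_continuous[OF g(1)] by (rule continuous_on_subset) auto
  moreover have "inj_on g ?G"
  proof (rule inj_onI)
    fix q q' assume *: "q \<in> ?G" "q' \<in> ?G" "g q = g q'"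
    obtain y y' where "q = \<phi> y" "y \<in> V" "g q = \<psi> y" "q' = \<phi> y'" "y' \<in> V" "g q' = \<psi> y'"
      using G[OF *(1)] G[OF *(2)] by auto
    then show "q = q'" using inj_onD[OF coord_inj[OF d]] *(3) by auto
  qed
  moreover have "open ?G" using P1(1) smooth_on_open[OF g(1)] by (intro open_Int open_interior)
  ultimately have "open (g ` ?G)"
    using invariance_of_domain_gen[of ?G g] dim by simp
  moreover have "g ` ?G \<subseteq> \<psi> ` V" using G by auto
  moreover have "\<psi> x \<in> g ` ?G"
    using i P1(2)[OF U(2)] xS V(2) g(2,3) U(2) by (intro image_eqI[of _ _ "\<phi> x"]) auto
  ultimately show ?thesis by (meson interiorI)
qed

text \<open>Off the seam, interior points of the pieces are interior in \<open>M\<close>. At a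
  boundary point of \<open>M\<close> on the seam, the coordinate of \<open>M\<close> in direction
  \<open>e\<close> would increase into both pieces, whereas the defining function of
  \<open>SA\<close> has opposite signs on them; both behaviors are expressed by the conormals and
  clash at the vector \<open>e\<close>.\<close>

lemma gluing_boundaryless:
  fixes M :: "('a, real^'n) manifold"
  assumes M: "smooth_manifold M" and MA: "smooth_manifold (submanifold M SA :: ('a, real^'n) manifold)"
    and MB: "smooth_manifold (submanifold M SB :: ('a, 'd::euclidean_space) manifold)" and dim: "DIM('d) = CARD('n)"
    and cover: "SA \<union> SB = pts M"
    and NA: "SA \<inter> SB = boundary (submanifold M SA :: ('a, real^'n) manifold)"
    and NB: "SA \<inter> SB = boundary (submanifold M SB :: ('a, 'd) manifold)"
  shows "boundary M = {}"
proof (rule ccontr)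
  assume "boundary M \<noteq> {}"
  then obtain x V \<psi> where V: "(V, \<psi>) \<in> atlas M" "x \<in> V" "\<psi> x \<notin> interior (\<psi> ` V)"
    unfolding boundary_def by auto
  have xM: "x \<in> pts M" using coord_subset[OF charted_coord[OF smooth_manifold_charted[OF M] V(1)]] V(2) by auto
  have xA: "x \<in> SA \<inter> SB" if xS: "x \<in> SA"
  proof (rule ccontr)
    assume n: "x \<notin> SA \<inter> SB"
    obtain U and \<phi> :: "'a \<Rightarrow> real^'n" where U: "(U, \<phi>) \<in> atlas (submanifold M SA)" "x \<in> U"
      using charted_obtain[OF smooth_manifold_charted[OF MA], of x] xM xS by auto
    have "\<phi> x \<in> interior (\<phi> ` U)" using boundary_iff[OF MA U] n NA by auto
    then show False using interior_chart_transfer[OF M U V(1,2)] V(3) by simp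
  qed
  have xB: "x \<in> SA \<inter> SB" if xS: "x \<in> SB"
  proof (rule ccontr)
    assume n: "x \<notin> SA \<inter> SB"
    obtain U and \<phi> :: "'a \<Rightarrow> 'd" where U: "(U, \<phi>) \<in> atlas (submanifold M SB)" "x \<in> U"
      using charted_obtain[OF smooth_manifold_charted[OF MB], of x] xM xS by auto
    have "\<phi> x \<in> interior (\<phi> ` U)" using boundary_iff[OF MB U] n NB by auto
    then show False using interior_chart_transfer[OF M U V(1,2)] V(3) dim by simp
  qed
  have xN: "x \<in> SA" "x \<in> SB" "x \<in> boundary (submanifold M SA :: ('a, real^'n) manifold)"
    using xA xB cover xM NA by blast+
  have "\<not> open (\<psi> ` V)" using V(2,3) interior_open by blast
  moreover have "chart_image (\<psi> ` V)" using M V(1) unfolding smooth_manifold_def is_chart_def by fast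
  ultimately obtain e where e: "e \<in> Basis" "openin (top_of_set {p. 0 \<le> p \<bullet> e}) (\<psi> ` V)"
    unfolding chart_image_def by blast
  then obtain P0 where P0: "open P0" "\<psi> ` V = {p. 0 \<le> p \<bullet> e} \<inter> P0" by (auto simp: openin_open)
  have e0: "e \<noteq> 0" using e(1) nonzero_Basis by blast
  have "interior (\<psi> ` V) = {p. 0 < p \<bullet> e} \<inter> P0"
    using P0 interior_halfspace_ge[OF e0, of 0] by (simp add: interior_open inner_commute)
  moreover have "\<psi> x \<in> P0" "0 \<le> \<psi> x \<bullet> e" using P0(2) V(2) by auto
  ultimately have ex: "\<psi> x \<bullet> e = 0" using V(3) by auto
  obtain Q W and f :: "real^'n \<Rightarrow> real^'n" and b where Q: "openin (mtop M) Q" "x \<in> Q" "Q \<subseteq> V" and f: "smooth_on W f" "\<And>z. z \<in> Q \<Longrightarrow> \<psi> z \<in> W"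
    and QS: "\<And>z. z \<in> Q \<Longrightarrow> z \<in> SA \<longleftrightarrow> 0 \<le> f (\<psi> z) \<bullet> b"
    and Qb: "\<And>z. z \<in> Q \<Longrightarrow> z \<in> boundary (submanifold M SA :: ('a, real^'n) manifold) \<longleftrightarrow> f (\<psi> z) \<bullet> b = 0"
    and nz: "\<And>q. q \<in> W \<Longrightarrow> \<exists>w. frechet_derivative f (at q) w \<bullet> b \<noteq> 0"
    by (rule boundary_defining_function[OF M MA xN(3) V(1,2)]) (rule that; assumption)
  obtain \<tau>A where \<tau>A: "inward_conormal M SA x V \<psi> \<tau>A"
    using ex_inward_conormal[OF M smooth_manifold_charted[OF MA] refl xM xN(1) V(1,2)] by blast
  obtain \<tau>B where \<tau>B: "inward_conormal M SB x V \<psi> \<tau>B"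
    using ex_inward_conormal[OF M smooth_manifold_charted[OF MB] _ xM xN(2) V(1,2)] dim by auto
  let ?F = "frechet_derivative f (at (\<psi> x))"
  have F: "((\<lambda>q. f q \<bullet> b) has_derivative (\<lambda>v. ?F v \<bullet> b)) (at (\<psi> x))"
    by (rule has_derivative_inner_left[OF smooth_on_has_derivative[OF f(1) f(2)[OF Q(2)]]])
  have f0: "f (\<psi> x) \<bullet> b = 0" using Qb[OF Q(2)] xN(3) by simp
  obtain c where c: "0 \<le> c" "\<And>v. ?F v \<bullet> b = c * \<tau>A v"
    by (rule inward_conormalD[OF \<tau>A Q(1,2) F]) (use QS f0 in auto)
  have F': "((\<lambda>q. - (f q \<bullet> b)) has_derivative (\<lambda>v. - (?F v \<bullet> b))) (at (\<psi> x))"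
    using has_derivative_minus[OF F] .
  have neg: "- (f (\<psi> x) \<bullet> b) \<le> - (f (\<psi> z) \<bullet> b)" if z: "z \<in> Q \<inter> SB \<inter> V" for z
  proof (cases "z \<in> SA")
    case True
    then have "f (\<psi> z) \<bullet> b = 0" using Qb[of z] z NA by auto
    then show ?thesis using f0 by simp
  next
    case False
    then show ?thesis using QS[of z] z f0 by auto
  qed
  obtain c' where c': "0 \<le> c'" "\<And>v. - (?F v \<bullet> b) = c' * \<tau>B v"
    by (rule inward_conormalD[OF \<tau>B Q(1,2) F' neg]) auto
  have E: "((\<lambda>q. q \<bullet> e) has_derivative (\<lambda>v. v \<bullet> e)) (at (\<psi> x))"
    by (rule has_derivative_inner_left) simp
  have Ege: "\<psi> x \<bullet> e \<le> \<psi> z \<bullet> e" if "z \<in> V" for z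
  proof -
    have "\<psi> z \<in> \<psi> ` V" using that by blast
    then show ?thesis unfolding P0(2) ex by simp
  qed
  \<comment> \<open>The boundary coordinate of \<open>M\<close> is minimal at \<open>x\<close> on
    all of the chart domain, hence along both pieces, and so it is a nonnegative multiple of both
    conormals.\<close>
  obtain c1 where c1: "0 \<le> c1" "\<And>v. v \<bullet> e = c1 * \<tau>A v"
    by (rule inward_conormalD[OF \<tau>A openin_topspace xM E]) (use Ege in auto)
  obtain c2 where c2: "0 \<le> c2" "\<And>v. v \<bullet> e = c2 * \<tau>B v"
    by (rule inward_conormalD[OF \<tau>B openin_topspace xM E]) (use Ege in auto)
  obtain w where w: "?F w \<bullet> b \<noteq> 0" using nz[OF f(2)[OF Q(2)]] by blast
  have cpos: "0 < c" "0 < c'" using c c'(1) c'(2)[of w] c(2)[of w] w by (auto simp: less_le)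
  have ee: "0 < e \<bullet> e" using e0 by simp
  have 1: "0 < c1 * \<tau>A e" "0 < c2 * \<tau>B e" using ee c1(2)[of e] c2(2)[of e] by simp_all
  then have "0 < \<tau>A e" "0 < \<tau>B e" using c1(1) c2(1) by (auto simp: zero_less_mult_iff)
  then have "0 < ?F e \<bullet> b" "0 < - (?F e \<bullet> b)" using c(2)[of e] c'(2)[of e] cpos by simp_all
  then show False by simp
qed

lemma closed_chart_smooth:
  fixes M :: "('a, 'e::euclidean_space) manifold" and F :: "'a \<Rightarrow> 'c::euclidean_space"
  assumes M: "closed_manifold M" and F: "smooth_map_on M Q euclid F" and Q: "openin (mtop M) Q" and V: "(V, \<psi>) \<in> atlas M"
  shows "smooth_on (\<psi> ` (Q \<inter> V)) (\<lambda>p. F (inv_into V \<psi> p))"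
proof -
  have d: "coord (mtop M) V \<psi>" using charted_coord[OF closed_manifold_charted[OF M] V] .
  obtain W where W: "open W" "\<And>y. y \<in> V \<Longrightarrow> \<psi> y \<in> W \<longleftrightarrow> y \<in> Q" using coord_open[OF d Q] by blast
  have "\<psi> ` (Q \<inter> V) = \<psi> ` V \<inter> W" using W(2) by auto
  then have "open (\<psi> ` (Q \<inter> V))" using closed_manifold_chart_open[OF M V] W(1) by auto
  moreover have "smooth_on_set (\<psi> ` (Q \<inter> V)) (F \<circ> inv_into V \<psi>)"
    using F V smooth_map_on_euclid_iff[OF closed_manifold_charted[OF M]] by fast
  ultimately show ?thesis using smooth_on_set_imp_smooth_on by (simp add: o_def)
qed

lemma regular_chart_change:
  fixes M :: "('a, 'e::euclidean_space) manifold" and F :: "'a \<Rightarrow> 'c::euclidean_space"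
  assumes M: "closed_manifold M" and F: "smooth_map_on M Q euclid F" and Q: "openin (mtop M) Q" "x \<in> Q"
    and V: "(V, \<psi>) \<in> atlas M" "x \<in> V" and V': "(V', \<psi>') \<in> atlas M" "x \<in> V'"
    and nz: "frechet_derivative (\<lambda>p. F (inv_into V \<psi> p)) (at (\<psi> x)) w \<noteq> 0"
  shows "\<exists>w. frechet_derivative (\<lambda>p. F (inv_into V' \<psi>' p)) (at (\<psi>' x)) w \<noteq> 0"
proof -
  have d: "coord (mtop M) V \<psi>" and d': "coord (mtop M) V' \<psi>'"
    using charted_coord[OF closed_manifold_charted[OF M]] V V' by blast+
  have o: "openin (mtop M) (Q \<inter> V')" using Q(1) coord_openin[OF d'] by blast
  have 1: "smooth_on (\<psi> ` (Q \<inter> V' \<inter> V)) (\<lambda>p. \<psi>' (inv_into V \<psi> p))"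
    by (rule closed_chart_smooth[OF M smooth_map_on_subset[OF smooth_map_on_chart[OF closed_manifold_smooth[OF M] V'(1)]] o V(1)]) auto
  have 2: "smooth_on (\<psi>' ` (Q \<inter> V')) (\<lambda>p. F (inv_into V' \<psi>' p))"
    by (rule closed_chart_smooth[OF M F Q(1) V'(1)])
  have x: "\<psi> x \<in> \<psi> ` (Q \<inter> V' \<inter> V)" "\<psi>' (inv_into V \<psi> (\<psi> x)) = \<psi>' x"
    using Q V V' coord_inv[OF d] by auto
  have e1: "frechet_derivative (\<lambda>p. F (inv_into V \<psi> p)) (at (\<psi> x)) =
      frechet_derivative (\<lambda>p. F (inv_into V' \<psi>' (\<psi>' (inv_into V \<psi> p)))) (at (\<psi> x))"
    by (rule frechet_derivative_cong_open[OF smooth_on_open[OF 1] x(1)]) (use coord_inv[OF d] coord_inv[OF d'] in auto)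
  have e2: "frechet_derivative (\<lambda>p. F (inv_into V' \<psi>' (\<psi>' (inv_into V \<psi> p)))) (at (\<psi> x)) w = frechet_derivative (\<lambda>p. F (inv_into V' \<psi>' p)) (at (\<psi>' x)) (frechet_derivative (\<lambda>p. \<psi>' (inv_into V \<psi> p)) (at (\<psi> x)) w)"
    using frechet_derivative_compose[OF 2 1, of "\<psi> x"] x Q V' by simp
  show ?thesis using nz unfolding e1 e2 by blast
qed

lemma seam_defining_function:
  fixes M :: "('a, real^'n) manifold"
  assumes M: "closed_manifold M" and MA: "smooth_manifold (submanifold M SA :: ('a, real^'n) manifold)"
    and cover: "SA \<union> SB = pts M"
    and NA: "SA \<inter> SB = boundary (submanifold M SA :: ('a, real^'n) manifold)"
    and x: "x \<in> SA \<inter> SB"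
  obtains Q and \<sigma> :: "'a \<Rightarrow> real" where "openin (mtop M) Q" "x \<in> Q" "smooth_map_on M Q euclid \<sigma>"
    "\<And>z. z \<in> Q \<Longrightarrow> z \<in> SA \<longleftrightarrow> 0 \<le> \<sigma> z" "\<And>z. z \<in> Q \<Longrightarrow> z \<in> SB \<longleftrightarrow> \<sigma> z \<le> 0"
    "\<And>z V \<psi>. z \<in> Q \<Longrightarrow> (V, \<psi>) \<in> atlas M \<Longrightarrow> z \<in> V \<Longrightarrow> \<exists>w. frechet_derivative (\<lambda>p. \<sigma> (inv_into V \<psi> p)) (at (\<psi> z)) w \<noteq> 0"
proof -
  note MS = closed_manifold_smooth[OF M] and MC = closed_manifold_charted[OF M]
  have xM: "x \<in> pts M" using x cover by blast
  obtain V \<psi> where V: "(V, \<psi>) \<in> atlas M" "x \<in> V" using charted_obtain[OF MC xM] by blast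
  have d: "coord (mtop M) V \<psi>" using charted_coord[OF MC V(1)] .
  have xb: "x \<in> boundary (submanifold M SA :: ('a, real^'n) manifold)" using x NA by blast
  obtain Q W and f :: "real^'n \<Rightarrow> real^'n" and b where Q: "openin (mtop M) Q" "x \<in> Q" "Q \<subseteq> V" and f: "smooth_on W f" "\<And>z. z \<in> Q \<Longrightarrow> \<psi> z \<in> W"
    and QS: "\<And>z. z \<in> Q \<Longrightarrow> z \<in> SA \<longleftrightarrow> 0 \<le> f (\<psi> z) \<bullet> b"
    and Qb: "\<And>z. z \<in> Q \<Longrightarrow> z \<in> boundary (submanifold M SA :: ('a, real^'n) manifold) \<longleftrightarrow> f (\<psi> z) \<bullet> b = 0"
    and nz: "\<And>q. q \<in> W \<Longrightarrow> \<exists>w. frechet_derivative f (at q) w \<bullet> b \<noteq> 0"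
    by (rule boundary_defining_function[OF MS MA xb V]) (rule that; assumption)
  let ?\<sigma> = "\<lambda>z. f (\<psi> z) \<bullet> b"
  have sf: "smooth_on W (\<lambda>q. f q \<bullet> b)" by (rule smooth_on_linear[OF bounded_linear_inner_left f(1)])
  have s: "smooth_map_on M Q euclid ?\<sigma>"
    by (rule smooth_map_on_smooth_on[OF MC smooth_map_on_subset[OF smooth_map_on_chart[OF MS V(1)] Q(3)] sf]) (use f(2) in auto)
  show thesis
  proof (rule that[OF Q(1,2) s])
    show "z \<in> SA \<longleftrightarrow> 0 \<le> ?\<sigma> z" if "z \<in> Q" for z using QS[OF that] .
    show "z \<in> SB \<longleftrightarrow> ?\<sigma> z \<le> 0" if z: "z \<in> Q" for z
    proof -
      have "z \<in> pts M" using openin_subset[OF Q(1)] z by blast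
      then have "z \<in> SB \<longleftrightarrow> z \<notin> SA \<or> z \<in> boundary (submanifold M SA :: ('a, real^'n) manifold)"
        using cover NA by blast
      then show ?thesis using QS[OF z] Qb[OF z] by auto
    qed
    fix z V' \<psi>' assume z: "z \<in> Q" and V': "(V', \<psi>') \<in> atlas M" "z \<in> V'"
    have o: "open (\<psi> ` (Q \<inter> V))" using smooth_on_open[OF closed_chart_smooth[OF M s Q(1) V(1)]] .
    have zV: "z \<in> V" using z Q(3) by blast
    obtain w where w: "frechet_derivative f (at (\<psi> z)) w \<bullet> b \<noteq> 0" using nz f(2)[OF z] by blast
    have "((\<lambda>q. f q \<bullet> b) has_derivative (\<lambda>v. frechet_derivative f (at (\<psi> z)) v \<bullet> b)) (at (\<psi> z))"
      by (rule has_derivative_inner_left[OF smooth_on_has_derivative[OF f(1) f(2)[OF z]]])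
    then have "frechet_derivative (\<lambda>q. f q \<bullet> b) (at (\<psi> z)) = (\<lambda>v. frechet_derivative f (at (\<psi> z)) v \<bullet> b)"
      by (rule frechet_derivative_at[symmetric])
    moreover have "frechet_derivative (\<lambda>p. ?\<sigma> (inv_into V \<psi> p)) (at (\<psi> z)) = frechet_derivative (\<lambda>q. f q \<bullet> b) (at (\<psi> z))"
      by (rule frechet_derivative_cong_open[OF o]) (use z zV coord_inv[OF d] in auto)
    ultimately have "frechet_derivative (\<lambda>p. ?\<sigma> (inv_into V \<psi> p)) (at (\<psi> z)) w \<noteq> 0" using w by simp
    then show "\<exists>w. frechet_derivative (\<lambda>p. ?\<sigma> (inv_into V' \<psi>' p)) (at (\<psi>' z)) w \<noteq> 0"
      by (rule regular_chart_change[OF M s Q(1) z V(1) zV V'])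
  qed
qed

section \<open>A submersion to the circle on a glued manifold\<close>

text \<open>For a complex map \<open>u\<close> of modulus 1, a nonzero derivative is the same as
  being a submersion to the circle, whose tangent lines are one-dimensional.\<close>

definition regular_at :: "('a, 'e::euclidean_space) manifold \<Rightarrow> ('a \<Rightarrow> 'c::euclidean_space) \<Rightarrow> 'a \<Rightarrow> bool" where
  "regular_at M u x \<longleftrightarrow> (\<exists>(V, \<psi>)\<in>atlas M. x \<in> V \<and> (\<exists>w. frechet_derivative (\<lambda>p. u (inv_into V \<psi> p)) (at (\<psi> x)) w \<noteq> 0))"

text \<open>
  The curve is two-sided and stays in \<open>S\<close>, so at a boundary point of \<open>S\<close> it is tangent to the boundary;
  this survives interpolation across the boundary.
\<close>

definition turning_curve :: "('a, 'e::euclidean_space) manifold \<Rightarrow> 'a set \<Rightarrow> ('a \<Rightarrow> complex) \<Rightarrow> 'a \<Rightarrow> bool" where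
  "turning_curve M S u x \<longleftrightarrow> (\<exists>\<gamma> e k. 0 < e \<and> k \<noteq> 0 \<and> smooth_map_on euclid {-e<..<e::real} M \<gamma> \<and> \<gamma> 0 = x \<and>
     (\<forall>t\<in>{-e<..<e}. \<gamma> t \<in> S \<and> u (\<gamma> t) = u x * cis (k * t)))"

lemma curve_velocity:
  fixes M :: "('a, 'e::euclidean_space) manifold"
  assumes M: "charted M" and \<gamma>: "smooth_map_on euclid {-e<..<e::real} M \<gamma>" "0 < e" and V: "(V, \<psi>) \<in> atlas M" "\<gamma> 0 \<in> V"
    and Q: "openin (mtop M) Q" "\<gamma> 0 \<in> Q"
  obtains v e' where "0 < e'" "e' \<le> e" "\<And>t. \<bar>t\<bar> < e' \<Longrightarrow> \<gamma> t \<in> V \<inter> Q" "((\<lambda>t. \<psi> (\<gamma> t)) has_derivative (\<lambda>t. t *\<^sub>R v)) (at 0)"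
proof -
  have d: "coord (mtop M) V \<psi>" using charted_coord[OF M V(1)] .
  have o: "openin (mtop M) (V \<inter> Q)" using coord_openin[OF d] Q(1) by blast
  obtain I where I: "open I" "\<And>t. t \<in> {-e<..<e} \<Longrightarrow> \<gamma> t \<in> V \<inter> Q \<longleftrightarrow> t \<in> I"
    by (rule smooth_map_on_preimage[OF \<gamma>(1) o]) auto
  let ?J = "{-e<..<e} \<inter> I"
  have J: "open ?J" "0 \<in> ?J" using I(1) I(2)[of 0] V Q \<gamma>(2) by auto
  have "smooth_on_set ({-e<..<e} \<inter> \<gamma> -` V) (\<lambda>t. \<psi> (\<gamma> t))"
    using smooth_map_onD[OF \<gamma>(1) _ V(1), of UNIV "\<lambda>t. t"] by (simp add: o_def)
  then have "smooth_on_set ?J (\<lambda>t. \<psi> (\<gamma> t))"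
  proof (rule smooth_on_set_subset)
    show "?J \<subseteq> {-e<..<e} \<inter> \<gamma> -` V"
    proof
      fix t assume t: "t \<in> ?J"
      then show "t \<in> {-e<..<e} \<inter> \<gamma> -` V" using I(2)[of t] by blast
    qed
  qed
  then have "smooth_on ?J (\<lambda>t. \<psi> (\<gamma> t))" using smooth_on_set_imp_smooth_on J(1) by blast
  then have D: "((\<lambda>t. \<psi> (\<gamma> t)) has_derivative frechet_derivative (\<lambda>t. \<psi> (\<gamma> t)) (at 0)) (at 0)"
    using smooth_on_has_derivative J(2) by blast
  have lin: "frechet_derivative (\<lambda>t. \<psi> (\<gamma> t)) (at 0) = (\<lambda>t. t *\<^sub>R frechet_derivative (\<lambda>t. \<psi> (\<gamma> t)) (at 0) 1)"
  proof (rule ext)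
    fix t :: real
    show "frechet_derivative (\<lambda>t. \<psi> (\<gamma> t)) (at 0) t = t *\<^sub>R frechet_derivative (\<lambda>t. \<psi> (\<gamma> t)) (at 0) 1"
      using linear_scale[OF has_derivative_linear[OF D], of t 1] by simp
  qed
  have D': "((\<lambda>t. \<psi> (\<gamma> t)) has_derivative (\<lambda>t. t *\<^sub>R frechet_derivative (\<lambda>t. \<psi> (\<gamma> t)) (at 0) 1)) (at 0)"
    by (rule has_derivative_eq_rhs[OF D lin])
  obtain e' where e': "0 < e'" "ball 0 e' \<subseteq> ?J" using J open_contains_ball by blast
  show thesis
  proof (rule that[OF _ _ _ D', of "min e' e"])
    show "\<gamma> t \<in> V \<inter> Q" if "\<bar>t\<bar> < min e' e" for t
    proof -
      have "t \<in> ?J" using e'(2) that by (auto simp: subset_iff dist_norm)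
      then show ?thesis using I(2)[of t] by blast
    qed
  qed (use e' \<gamma> in auto)
qed

lemma derivative_along_curve:
  fixes F :: "'a \<Rightarrow> 'c::euclidean_space" and M :: "('a, 'e::euclidean_space) manifold"
  assumes M: "closed_manifold M" and F: "smooth_map_on M Q euclid F" "openin (mtop M) Q" and x: "\<gamma> 0 \<in> Q"
    and V: "(V, \<psi>) \<in> atlas M" and e: "0 < e" "\<And>t. \<bar>t\<bar> < e \<Longrightarrow> \<gamma> t \<in> V" and D: "((\<lambda>t. \<psi> (\<gamma> t)) has_derivative (\<lambda>t. t *\<^sub>R v)) (at (0::real))"
  shows "((\<lambda>t. F (\<gamma> t)) has_vector_derivative frechet_derivative (\<lambda>p. F (inv_into V \<psi> p)) (at (\<psi> (\<gamma> 0))) v) (at 0)"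
proof -
  have d: "coord (mtop M) V \<psi>" using charted_coord[OF closed_manifold_charted[OF M] V] .
  have s: "smooth_on (\<psi> ` (Q \<inter> V)) (\<lambda>p. F (inv_into V \<psi> p))" by (rule closed_chart_smooth[OF M F V])
  have 0: "\<gamma> 0 \<in> V" using e(2)[of 0] e(1) by simp
  have "((\<lambda>p. F (inv_into V \<psi> p)) has_derivative frechet_derivative (\<lambda>p. F (inv_into V \<psi> p)) (at (\<psi> (\<gamma> 0)))) (at (\<psi> (\<gamma> 0)))"
    by (rule smooth_on_has_derivative[OF s]) (use x 0 in blast)
  from diff_chain_at[OF D this]
  have "((\<lambda>t. F (inv_into V \<psi> (\<psi> (\<gamma> t)))) has_derivative (\<lambda>t. frechet_derivative (\<lambda>p. F (inv_into V \<psi> p)) (at (\<psi> (\<gamma> 0))) (t *\<^sub>R v))) (at 0)"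
    by (simp add: o_def)
  moreover have "frechet_derivative (\<lambda>p. F (inv_into V \<psi> p)) (at (\<psi> (\<gamma> 0))) (t *\<^sub>R v) = t *\<^sub>R frechet_derivative (\<lambda>p. F (inv_into V \<psi> p)) (at (\<psi> (\<gamma> 0))) v" for t
    using linear_scale[OF has_derivative_linear[OF smooth_on_has_derivative[OF s]]] x 0 by blast
  ultimately have "((\<lambda>t. F (inv_into V \<psi> (\<psi> (\<gamma> t)))) has_vector_derivative frechet_derivative (\<lambda>p. F (inv_into V \<psi> p)) (at (\<psi> (\<gamma> 0))) v) (at 0)"
    by (simp add: has_vector_derivative_def)
  then show ?thesis
    by (rule has_vector_derivative_transform_within_open[of _ _ _ "{-e<..<e}"]) (use e coord_inv[OF d] in auto)
qed

text \<open>Along the curve \<open>u\<close> is \<open>b * v x * cis (k * t)\<close>, whose velocity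
  at 0 is not zero. The factor \<open>b\<close> accommodates the rotation of \<open>uB\<close> by
  \<open>cis C\<close>.\<close>

lemma regular_at_turning_curve:
  fixes M :: "('a, 'e::euclidean_space) manifold"
  assumes M: "closed_manifold M" and u: "smooth_map_on M Q euclid u" "openin (mtop M) Q" "x \<in> Q" and c: "turning_curve M S v x"
    and eq: "\<And>y. y \<in> Q \<inter> S \<Longrightarrow> u y = b * v y" and b: "b * v x \<noteq> 0"
  shows "regular_at M u x"
proof -
  note MC = closed_manifold_charted[OF M]
  obtain \<gamma> e k where \<gamma>: "0 < e" "k \<noteq> 0" "smooth_map_on euclid {-e<..<e::real} M \<gamma>" "\<gamma> 0 = x"
    "\<And>t. t \<in> {-e<..<e} \<Longrightarrow> \<gamma> t \<in> S \<and> v (\<gamma> t) = v x * cis (k * t)"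
    using c unfolding turning_curve_def by metis
  have "x \<in> pts M" using u openin_subset by blast
  then obtain V \<psi> where V: "(V, \<psi>) \<in> atlas M" "x \<in> V" using charted_obtain[OF MC] by blast
  obtain w e' where e': "0 < e'" "e' \<le> e" "\<And>t. \<bar>t\<bar> < e' \<Longrightarrow> \<gamma> t \<in> V \<inter> Q" "((\<lambda>t. \<psi> (\<gamma> t)) has_derivative (\<lambda>t. t *\<^sub>R w)) (at 0)"
    by (rule curve_velocity[OF MC \<gamma>(3,1) V(1) _ u(2)]) (use V u \<gamma> in auto)
  have "((\<lambda>t. u (\<gamma> t)) has_vector_derivative frechet_derivative (\<lambda>p. u (inv_into V \<psi> p)) (at (\<psi> (\<gamma> 0))) w) (at 0)"
    by (rule derivative_along_curve[OF M u(1,2) _ V(1) e'(1) _ e'(4)]) (use u \<gamma> e' in auto)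
  then have 1: "((\<lambda>t. b * v x * cis (k * t)) has_vector_derivative frechet_derivative (\<lambda>p. u (inv_into V \<psi> p)) (at (\<psi> (\<gamma> 0))) w) (at 0)"
  proof (rule has_vector_derivative_transform_within_open[of _ _ _ "{-e'<..<e'}"])
    fix t assume "t \<in> {-e'<..<e'}"
    then have "t \<in> {-e<..<e}" "\<gamma> t \<in> Q" using e'(2) e'(3)[of t] by auto
    then show "u (\<gamma> t) = b * v x * cis (k * t)" using \<gamma>(5)[of t] eq[of "\<gamma> t"] by (simp add: mult.assoc)
  qed (use e' in auto)
  have "((\<lambda>t. b * v x * cis (k * t)) has_vector_derivative b * v x * (\<i> * of_real k)) (at 0)"
    by (auto intro!: derivative_eq_intros simp: has_vector_derivative_def scaleR_conv_of_real)
  then have "frechet_derivative (\<lambda>p. u (inv_into V \<psi> p)) (at (\<psi> (\<gamma> 0))) w = b * v x * (\<i> * of_real k)"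
    using vector_derivative_unique_at[OF 1] by simp
  then have "frechet_derivative (\<lambda>p. u (inv_into V \<psi> p)) (at (\<psi> x)) w \<noteq> 0"
    using b \<gamma>(2,4) by simp
  then show ?thesis unfolding regular_at_def using V by blast
qed

section \<open>Extension from closed sets and branches of the angle\<close>

text \<open>Local extensions exist by the very definition of smoothness on a set;
  \<open>glue_convex\<close> merges them under the constraint \<open>{f y}\<close> on
  \<open>S\<close>.\<close>

lemma smooth_extension:
  fixes M :: "('a, 'e::euclidean_space) manifold" and f :: "'a \<Rightarrow> 'd::euclidean_space"
  assumes M: "closed_manifold M" and S: "closedin (mtop M) S" and f: "smooth_map_on M S euclid f"
  obtains F where "smooth_map_on M (pts M) euclid F" "\<And>y. y \<in> S \<Longrightarrow> F y = f y"
proof -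
  note MC = closed_manifold_charted[OF M] and MS = closed_manifold_smooth[OF M]
  have "\<exists>C g. openin (mtop M) C \<and> x \<in> C \<and> smooth_map_on M C euclid g \<and> (\<forall>y\<in>C. g y \<in> (if y \<in> S then {f y} else UNIV))"
    if x: "x \<in> pts M" for x
  proof (cases "x \<in> S")
    case True
    obtain V \<psi> where V: "(V, \<psi>) \<in> atlas M" "x \<in> V" using charted_obtain[OF MC x] by blast
    have d: "coord (mtop M) V \<psi>" using charted_coord[OF MC V(1)] .
    have "smooth_on_set (\<psi> ` (S \<inter> V)) (f \<circ> inv_into V \<psi>)"
      using f V(1) unfolding smooth_map_on_euclid_iff[OF MC] by fast
    moreover have "\<psi> x \<in> \<psi> ` (S \<inter> V)" using True V by blast
    ultimately obtain W g where g: "smooth_on W g" "\<psi> x \<in> W" "\<And>q. q \<in> \<psi> ` (S \<inter> V) \<inter> W \<Longrightarrow> g q = (f \<circ> inv_into V \<psi>) q"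
      unfolding smooth_on_set_iff by meson
    have "smooth_map_on M (V \<inter> \<psi> -` W) euclid (\<lambda>z. g (\<psi> z))"
      by (rule smooth_map_on_smooth_on[OF MC smooth_map_on_subset[OF smooth_map_on_chart[OF MS V(1)]] g(1)]) auto
    moreover have "g (\<psi> y) = f y" if "y \<in> V \<inter> \<psi> -` W" "y \<in> S" for y
      using g(3)[of "\<psi> y"] that coord_inv[OF d, of y] by simp
    ultimately show ?thesis
      using coord_preimage[OF d smooth_on_open[OF g(1)]] V(2) g(2)
      by (intro exI[of _ "V \<inter> \<psi> -` W"] exI[of _ "\<lambda>z. g (\<psi> z)"]) auto
  next
    case False
    then show ?thesis using x S openin_diff[OF openin_topspace S]
      by (intro exI[of _ "pts M - S"] exI[of _ "\<lambda>z. 0"]) (auto simp: smooth_map_on_const[OF MC])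
  qed
  note loc = this
  have cv: "convex (if y \<in> S then {f y} else UNIV)" for y by simp
  obtain F where F: "smooth_map_on M (pts M) euclid F" "\<And>y. y \<in> pts M \<Longrightarrow> F y \<in> (if y \<in> S then {f y} else UNIV)"
    by (rule glue_convex[OF M cv loc, rotated]) (rule that; assumption)
  show thesis
  proof (rule that[OF F(1)])
    show "F y = f y" if "y \<in> S" for y
      using F(2)[of y] that closedin_subset[OF S] by auto
  qed
qed

lemma openin_smooth_preimage:
  assumes "smooth_map_on M (pts M) euclid f" "open W"
  shows "openin (mtop M) {x \<in> pts M. f x \<in> W}"
  using openin_continuous_map_preimage[OF smooth_map_on_continuous[OF assms(1)], of W] assms(2) by simp

lemma Ln_cis: "\<bar>t\<bar> < pi \<Longrightarrow> Im (Ln (cis t)) = t"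
  using Ln_exp[of "\<i> * of_real t"] by (simp add: cis_conv_exp)

lemma cis_notin_nonpos: "\<bar>t\<bar> < pi \<Longrightarrow> cis t \<notin> \<real>\<^sub>\<le>\<^sub>0"
proof
  assume t: "\<bar>t\<bar> < pi" "cis t \<in> \<real>\<^sub>\<le>\<^sub>0"
  then have "cis t = -1"
    using norm_cis[of t] by (auto simp: complex_nonpos_Reals_iff complex_eq_iff cmod_def)
  then have "cos t = cos pi" by (simp add: complex_eq_iff)
  then have "\<bar>t\<bar> = pi" using cos_inj_pi[of "\<bar>t\<bar>" pi] t by simp
  then show False using t by simp
qed

lemma cis_Im_Ln: "z \<noteq> 0 \<Longrightarrow> cis (Im (Ln z)) = z / of_real (cmod z)"
  using cis_Arg[of z] by (simp add: Arg_eq_Im_Ln sgn_eq)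

lemma smooth_on_normalize: "smooth_on (- {0}) (\<lambda>w::complex. w / of_real (cmod w))"
proof -
  have 1: "smooth_on (- {0}) (\<lambda>w::complex. w \<bullet> w)"
    by (rule smooth_on_subset[OF smooth_on_norm_sq]) auto
  have 2: "smooth_on (- {0}) (\<lambda>w::complex. sqrt (w \<bullet> w))"
    by (rule smooth_on_compose[OF smooth_on_sqrt 1]) auto
  have 3: "smooth_on (- {0}) (\<lambda>w::complex. inverse (sqrt (w \<bullet> w)))"
    by (rule smooth_on_inverse_fun[OF 2]) auto
  have "smooth_on (- {0}) (\<lambda>w::complex. inverse (sqrt (w \<bullet> w)) *\<^sub>R w)"
    by (rule smooth_on_scaleR[OF 3 smooth_on_id]) auto
  then show ?thesis
    by (rule smooth_on_cong) (simp add: norm_eq_sqrt_inner scaleR_conv_of_real divide_inverse of_real_inverse)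
qed

lemma smooth_on_Im_Ln: "smooth_on (- \<real>\<^sub>\<le>\<^sub>0) (\<lambda>z. Im (Ln z))"
  by (rule smooth_on_linear[OF bounded_linear_Im smooth_on_Ln])

lemma isCont_tendsto_nhds: "isCont f p \<Longrightarrow> (f \<longlongrightarrow> f p) (nhds p)"
  by (simp add: isCont_def tendsto_at_iff_tendsto_nhds)

section \<open>Perturbation of linear functionals\<close>

text \<open>The vector \<open>v - (s y v / s y w) w\<close> depends continuously on
  \<open>y\<close>, equals \<open>v\<close> at \<open>p\<close> and lies in the kernel of
  \<open>s y\<close>. On it the term with \<open>m\<close> vanishes whatever the size of
  \<open>m\<close>, and a small \<open>l\<close> cannot cancel the value of
  \<open>a\<close>.\<close>

lemma functional_combination_nonzero:
  fixes a b s :: "'e::euclidean_space \<Rightarrow> 'e \<Rightarrow> real"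
  assumes P: "open P" "p \<in> P"
    and lin: "\<And>y. y \<in> P \<Longrightarrow> linear (a y)" "\<And>y. y \<in> P \<Longrightarrow> linear (b y)" "\<And>y. y \<in> P \<Longrightarrow> linear (s y)"
    and cont: "\<And>v. continuous_on P (\<lambda>y. a y v)" "\<And>v. continuous_on P (\<lambda>y. b y v)" "\<And>v. continuous_on P (\<lambda>y. s y v)"
    and v: "a p v \<noteq> 0" "s p v = 0" and w: "s p w \<noteq> 0"
  obtains O' e where "open O'" "p \<in> O'" "O' \<subseteq> P" "(0::real) < e"
    "\<And>y l m. y \<in> O' \<Longrightarrow> \<bar>l\<bar> \<le> e \<Longrightarrow> \<exists>u. a y u + l * b y u + m * s y u \<noteq> 0"
proof -
  have at: "isCont (\<lambda>y. a y u) p" "isCont (\<lambda>y. b y u) p" "isCont (\<lambda>y. s y u) p" for u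
    using cont P continuous_on_eq_continuous_at by blast+
  define F where "F y = a y v - (s y v / s y w) * a y w" for y
  define G where "G y = b y v - (s y v / s y w) * b y w" for y
  have cF: "isCont F p" and cG: "isCont G p"
    unfolding F_def G_def using w by (auto intro!: continuous_intros at)
  have Fp: "F p \<noteq> 0" using v by (simp add: F_def)
  have "\<forall>\<^sub>F y in nhds p. y \<in> P \<and> \<bar>F p\<bar> / 2 < \<bar>F y\<bar> \<and> \<bar>G y\<bar> < \<bar>G p\<bar> + 1 \<and> s y w \<noteq> 0"
  proof (intro eventually_conj)
    show "\<forall>\<^sub>F y in nhds p. y \<in> P" using P eventually_nhds_in_open by blast
    have l: "((\<lambda>y. \<bar>F y\<bar>) \<longlongrightarrow> \<bar>F p\<bar>) (nhds p)" "((\<lambda>y. \<bar>G y\<bar>) \<longlongrightarrow> \<bar>G p\<bar>) (nhds p)" "((\<lambda>y. s y w) \<longlongrightarrow> s p w) (nhds p)"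
      by (rule tendsto_rabs[OF isCont_tendsto_nhds] isCont_tendsto_nhds cF cG at)+
    show "\<forall>\<^sub>F y in nhds p. \<bar>F p\<bar> / 2 < \<bar>F y\<bar>" using order_tendstoD(1)[OF l(1), of "\<bar>F p\<bar> / 2"] Fp by simp
    show "\<forall>\<^sub>F y in nhds p. \<bar>G y\<bar> < \<bar>G p\<bar> + 1" using order_tendstoD(2)[OF l(2), of "\<bar>G p\<bar> + 1"] by simp
    show "\<forall>\<^sub>F y in nhds p. s y w \<noteq> 0" using tendsto_imp_eventually_ne[OF l(3) w] .
  qed
  then obtain O' where O': "open O'" "p \<in> O'" "\<And>y. y \<in> O' \<Longrightarrow> y \<in> P \<and> \<bar>F p\<bar> / 2 < \<bar>F y\<bar> \<and> \<bar>G y\<bar> < \<bar>G p\<bar> + 1 \<and> s y w \<noteq> 0"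
    unfolding eventually_nhds by metis
  define g where "g = \<bar>G p\<bar> + 1"
  have g: "0 < g" unfolding g_def by linarith
  define e where "e = \<bar>F p\<bar> / 2 / g"
  have e: "0 < e" unfolding e_def using Fp g by (intro divide_pos_pos) auto
  show thesis
  proof (rule that[OF O'(1,2) _ e])
    show "O' \<subseteq> P" using O' by blast
    fix y l m assume y: "y \<in> O'" and l: "\<bar>l\<bar> \<le> e"
    let ?u = "v - (s y v / s y w) *\<^sub>R w"
    have yP: "y \<in> P" "s y w \<noteq> 0" using O'(3)[OF y] by auto
    have uu: "a y ?u = F y" "b y ?u = G y" "s y ?u = 0"
      using yP by (simp_all add: F_def G_def linear_diff[OF lin(1)[OF yP(1)]] linear_scale[OF lin(1)[OF yP(1)]]
        linear_diff[OF lin(2)[OF yP(1)]] linear_scale[OF lin(2)[OF yP(1)]]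
        linear_diff[OF lin(3)[OF yP(1)]] linear_scale[OF lin(3)[OF yP(1)]])
    have "\<bar>l * G y\<bar> \<le> e * (\<bar>G p\<bar> + 1)"
      unfolding abs_mult using l O'(3)[OF y] e by (intro mult_mono) auto
    moreover have "e * (\<bar>G p\<bar> + 1) = \<bar>F p\<bar> / 2" using g by (simp add: e_def g_def[symmetric])
    ultimately have "\<bar>l * G y\<bar> < \<bar>F y\<bar>" using O'(3)[OF y] by linarith
    then have "F y + l * G y \<noteq> 0" by auto
    then show "\<exists>u. a y u + l * b y u + m * s y u \<noteq> 0" using uu by (intro exI[of _ ?u]) simp
  qed
qed

text \<open>Everything is evaluated on the one vector \<open>w\<close> that \<open>s p\<close> does
  not kill. Near \<open>p\<close> the first two terms are bounded and \<open>s y w\<close> stays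
  away from 0, so a large \<open>m\<close> wins.\<close>

lemma functional_combination_dominated:
  fixes a b s :: "'e::euclidean_space \<Rightarrow> 'e \<Rightarrow> real"
  assumes P: "open P" "p \<in> P"
    and cont: "continuous_on P (\<lambda>y. a y w)" "continuous_on P (\<lambda>y. b y w)" "continuous_on P (\<lambda>y. s y w)" "continuous_on P h"
    and w: "s p w \<noteq> 0"
  obtains O' K where "open O'" "p \<in> O'" "O' \<subseteq> P" "(0::real) < K" "\<And>y. y \<in> O' \<Longrightarrow> \<bar>h y\<bar> \<le> K"
    "\<And>y l m. y \<in> O' \<Longrightarrow> 0 \<le> l \<Longrightarrow> l \<le> 1 \<Longrightarrow> K \<le> \<bar>m\<bar> \<Longrightarrow> a y w + l * b y w + m * s y w \<noteq> 0"
proof -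
  have at: "isCont (\<lambda>y. a y w) p" "isCont (\<lambda>y. b y w) p" "isCont (\<lambda>y. s y w) p" "isCont h p"
    using cont P continuous_on_eq_continuous_at by blast+
  have l: "((\<lambda>y. \<bar>a y w\<bar>) \<longlongrightarrow> \<bar>a p w\<bar>) (nhds p)" "((\<lambda>y. \<bar>b y w\<bar>) \<longlongrightarrow> \<bar>b p w\<bar>) (nhds p)"
    "((\<lambda>y. \<bar>s y w\<bar>) \<longlongrightarrow> \<bar>s p w\<bar>) (nhds p)" "((\<lambda>y. \<bar>h y\<bar>) \<longlongrightarrow> \<bar>h p\<bar>) (nhds p)"
    by (rule tendsto_rabs[OF isCont_tendsto_nhds] at)+
  have "\<forall>\<^sub>F y in nhds p. y \<in> P \<and> \<bar>a y w\<bar> < \<bar>a p w\<bar> + 1 \<and> \<bar>b y w\<bar> < \<bar>b p w\<bar> + 1 \<and> \<bar>s p w\<bar> / 2 < \<bar>s y w\<bar> \<and> \<bar>h y\<bar> < \<bar>h p\<bar> + 1"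
    using eventually_nhds_in_open[OF P] order_tendstoD(2)[OF l(1), of "\<bar>a p w\<bar> + 1"] order_tendstoD(2)[OF l(2), of "\<bar>b p w\<bar> + 1"]
      order_tendstoD(1)[OF l(3), of "\<bar>s p w\<bar> / 2"] order_tendstoD(2)[OF l(4), of "\<bar>h p\<bar> + 1"] w
    by (intro eventually_conj) auto
  then obtain O' where O': "open O'" "p \<in> O'" "\<And>y. y \<in> O' \<Longrightarrow> y \<in> P \<and> \<bar>a y w\<bar> < \<bar>a p w\<bar> + 1 \<and> \<bar>b y w\<bar> < \<bar>b p w\<bar> + 1 \<and> \<bar>s p w\<bar> / 2 < \<bar>s y w\<bar> \<and> \<bar>h y\<bar> < \<bar>h p\<bar> + 1"
    unfolding eventually_nhds by metis
  \<comment> \<open>The quotient is the size of \<open>m\<close> that is needed; the remaining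
    summands bound \<open>h\<close> on \<open>O'\<close>. One constant serves both purposes.\<close>
  define K where "K = (\<bar>a p w\<bar> + \<bar>b p w\<bar> + 2) / (\<bar>s p w\<bar> / 2) + \<bar>h p\<bar> + 1"
  have sw: "0 < \<bar>s p w\<bar> / 2" using w by simp
  have q: "0 < (\<bar>a p w\<bar> + \<bar>b p w\<bar> + 2) / (\<bar>s p w\<bar> / 2)" using sw by (intro divide_pos_pos) auto
  show thesis
  proof (rule that[OF O'(1,2), of K])
    show "O' \<subseteq> P" using O' by blast
    show K0: "0 < K" using q by (simp add: K_def)
    show "\<bar>h y\<bar> \<le> K" if "y \<in> O'" for y using O'(3)[OF that] q by (simp add: K_def)
    fix y and l m :: real assume y: "y \<in> O'" and l: "0 \<le> l" "l \<le> 1" and m: "K \<le> \<bar>m\<bar>"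
    note yb = O'(3)[OF y]
    have "(\<bar>a p w\<bar> + \<bar>b p w\<bar> + 2) / (\<bar>s p w\<bar> / 2) \<le> \<bar>m\<bar>" using m by (simp add: K_def)
    then have "\<bar>a p w\<bar> + \<bar>b p w\<bar> + 2 \<le> \<bar>m\<bar> * (\<bar>s p w\<bar> / 2)" using sw by (simp add: pos_divide_le_eq)
    also have "\<dots> \<le> \<bar>m\<bar> * \<bar>s y w\<bar>" using yb by (intro mult_left_mono) auto
    also have "\<dots> = \<bar>m * s y w\<bar>" by (simp add: abs_mult)
    finally have 1: "\<bar>a p w\<bar> + \<bar>b p w\<bar> + 2 \<le> \<bar>m * s y w\<bar>" .
    have "\<bar>l * b y w\<bar> \<le> 1 * \<bar>b y w\<bar>" unfolding abs_mult using l by (intro mult_right_mono) auto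
    then have "\<bar>a y w + l * b y w\<bar> < \<bar>a p w\<bar> + \<bar>b p w\<bar> + 2" using yb by linarith
    then show "a y w + l * b y w + m * s y w \<noteq> 0" using 1 by linarith
  qed
qed

lemma cis_derivative_unique:
  assumes s: "(s has_real_derivative s') (at 0)" and c: "c \<noteq> 0" and e: "0 < e"
    and eq: "\<And>t. \<bar>t\<bar> < e \<Longrightarrow> c * cis (s t) = c' * cis (k * t)"
  shows "s' = k"
proof -
  have "((\<lambda>t. c * cis (s t)) has_vector_derivative c * (of_real s' * (\<i> * cis (s 0)))) (at 0)"
    using s unfolding has_real_derivative_iff_has_vector_derivative has_vector_derivative_def
    by (auto intro!: derivative_eq_intros simp: scaleR_conv_of_real)
  then have 1: "((\<lambda>t. c' * cis (k * t)) has_vector_derivative c * (of_real s' * (\<i> * cis (s 0)))) (at 0)"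
    by (rule has_vector_derivative_transform_within_open[of _ _ _ "{-e<..<e}"]) (use e eq in auto)
  have "((\<lambda>t. c' * cis (k * t)) has_vector_derivative c' * (\<i> * of_real k)) (at 0)"
    by (auto intro!: derivative_eq_intros simp: has_vector_derivative_def scaleR_conv_of_real)
  then have "c * (of_real s' * (\<i> * cis (s 0))) = c' * (\<i> * of_real k)"
    using vector_derivative_unique_at[OF 1] by simp
  moreover have "c' = c * cis (s 0)" using eq[of 0] e by simp
  ultimately have "c * cis (s 0) * (\<i> * of_real s') = c * cis (s 0) * (\<i> * of_real k)" by (simp add: mult_ac)
  then show "s' = k" using c by simp
qed

lemma regular_at_all_charts:
  fixes M :: "('a, 'e::euclidean_space) manifold" and F :: "'a \<Rightarrow> 'c::euclidean_space"
  assumes M: "closed_manifold M" and F: "smooth_map_on M Q euclid F" "openin (mtop M) Q" "x \<in> Q" and r: "regular_at M F x"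
    and V: "(V, \<psi>) \<in> atlas M" "x \<in> V"
  obtains w where "frechet_derivative (\<lambda>p. F (inv_into V \<psi> p)) (at (\<psi> x)) w \<noteq> 0"
proof -
  obtain V' \<psi>' w where V': "(V', \<psi>') \<in> atlas M" "x \<in> V'" "frechet_derivative (\<lambda>p. F (inv_into V' \<psi>' p)) (at (\<psi>' x)) w \<noteq> 0"
    using r unfolding regular_at_def by blast
  show thesis using regular_chart_change[OF M F V'(1,2) V V'(3)] that by blast
qed

section \<open>Seam function, seam angle and interpolation\<close>

text \<open>Local defining functions have the correct signs, which survive averaging. Regularity
  could be lost by cancellation of differentials; it is not, since at a seam point each of them is a
  positive multiple of the same inward conormal of \<open>SA\<close>.\<close>

lemma seam_function:
  fixes M :: "('a, real^'n) manifold"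
  assumes M: "closed_manifold M" and MA: "smooth_manifold (submanifold M SA :: ('a, real^'n) manifold)"
    and cover: "SA \<union> SB = pts M" and cl: "closedin (mtop M) SA" "closedin (mtop M) SB"
    and NA: "SA \<inter> SB = boundary (submanifold M SA :: ('a, real^'n) manifold)"
  obtains \<sigma> :: "'a \<Rightarrow> real" where "smooth_map_on M (pts M) euclid \<sigma>"
    "\<And>z. z \<in> pts M \<Longrightarrow> z \<in> SA \<longleftrightarrow> 0 \<le> \<sigma> z" "\<And>z. z \<in> pts M \<Longrightarrow> z \<in> SB \<longleftrightarrow> \<sigma> z \<le> 0"
    "\<And>z. z \<in> SA \<inter> SB \<Longrightarrow> regular_at M \<sigma> z"
proof -
  note MC = closed_manifold_charted[OF M] and MS = closed_manifold_smooth[OF M]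
  have "\<exists>C (\<sigma> :: 'a \<Rightarrow> real). openin (mtop M) C \<and> x \<in> C \<and> smooth_map_on M C euclid \<sigma> \<and>
      (\<forall>z\<in>C. (z \<in> SA \<longleftrightarrow> 0 \<le> \<sigma> z) \<and> (z \<in> SB \<longleftrightarrow> \<sigma> z \<le> 0) \<and>
        (z \<in> SA \<inter> SB \<longrightarrow> (\<forall>V \<psi>. (V, \<psi>) \<in> atlas M \<and> z \<in> V \<longrightarrow> (\<exists>w. frechet_derivative (\<lambda>p. \<sigma> (inv_into V \<psi> p)) (at (\<psi> z)) w \<noteq> 0))))"
    if x: "x \<in> pts M" for x
  proof -
    consider "x \<in> SA \<inter> SB" | "x \<notin> SB" | "x \<notin> SA" by blast
    then show ?thesis
    proof cases
      case 1
      obtain Q and \<sigma> :: "'a \<Rightarrow> real" where Q: "openin (mtop M) Q" "x \<in> Q" "smooth_map_on M Q euclid \<sigma>"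
        "\<And>z. z \<in> Q \<Longrightarrow> z \<in> SA \<longleftrightarrow> 0 \<le> \<sigma> z" "\<And>z. z \<in> Q \<Longrightarrow> z \<in> SB \<longleftrightarrow> \<sigma> z \<le> 0"
        "\<And>z V \<psi>. z \<in> Q \<Longrightarrow> (V, \<psi>) \<in> atlas M \<Longrightarrow> z \<in> V \<Longrightarrow> \<exists>w. frechet_derivative (\<lambda>p. \<sigma> (inv_into V \<psi> p)) (at (\<psi> z)) w \<noteq> 0"
        by (rule seam_defining_function[OF M MA cover NA 1]) (rule that; assumption)
      show ?thesis by (rule exI[of _ Q], rule exI[of _ \<sigma>]) (use Q in simp)
    next
      \<comment> \<open>Off the seam a constant of the right sign is an admissible local choice, as
        nothing is asked of its derivative there.\<close>
      case 2
      have "pts M - SB \<subseteq> SA" using cover by blast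
      then show ?thesis using 2 x openin_diff[OF openin_topspace cl(2)]
        by (intro exI[of _ "pts M - SB"] exI[of _ "\<lambda>z. 1"]) (auto simp: smooth_map_on_const[OF MC])
    next
      case 3
      have "pts M - SA \<subseteq> SB" using cover by blast
      then show ?thesis using 3 x openin_diff[OF openin_topspace cl(1)]
        by (intro exI[of _ "pts M - SA"] exI[of _ "\<lambda>z. - 1"]) (auto simp: smooth_map_on_const[OF MC])
    qed
  qed
  then have "\<forall>x\<in>pts M. \<exists>C (\<sigma> :: 'a \<Rightarrow> real). openin (mtop M) C \<and> x \<in> C \<and> smooth_map_on M C euclid \<sigma> \<and>
      (\<forall>z\<in>C. (z \<in> SA \<longleftrightarrow> 0 \<le> \<sigma> z) \<and> (z \<in> SB \<longleftrightarrow> \<sigma> z \<le> 0) \<and>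
        (z \<in> SA \<inter> SB \<longrightarrow> (\<forall>V \<psi>. (V, \<psi>) \<in> atlas M \<and> z \<in> V \<longrightarrow> (\<exists>w. frechet_derivative (\<lambda>p. \<sigma> (inv_into V \<psi> p)) (at (\<psi> z)) w \<noteq> 0))))"
    by (rule ballI)
  from bchoice[OF this] obtain C where "\<forall>x\<in>pts M. \<exists>(\<sigma> :: 'a \<Rightarrow> real). openin (mtop M) (C x) \<and> x \<in> C x \<and> smooth_map_on M (C x) euclid \<sigma> \<and>
      (\<forall>z\<in>C x. (z \<in> SA \<longleftrightarrow> 0 \<le> \<sigma> z) \<and> (z \<in> SB \<longleftrightarrow> \<sigma> z \<le> 0) \<and>
        (z \<in> SA \<inter> SB \<longrightarrow> (\<forall>V \<psi>. (V, \<psi>) \<in> atlas M \<and> z \<in> V \<longrightarrow> (\<exists>w. frechet_derivative (\<lambda>p. \<sigma> (inv_into V \<psi> p)) (at (\<psi> z)) w \<noteq> 0))))" ..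
  from bchoice[OF this] obtain s :: "'a \<Rightarrow> 'a \<Rightarrow> real" where Cs: "\<forall>x\<in>pts M. openin (mtop M) (C x) \<and> x \<in> C x \<and> smooth_map_on M (C x) euclid (s x) \<and>
      (\<forall>z\<in>C x. (z \<in> SA \<longleftrightarrow> 0 \<le> s x z) \<and> (z \<in> SB \<longleftrightarrow> s x z \<le> 0) \<and>
        (z \<in> SA \<inter> SB \<longrightarrow> (\<forall>V \<psi>. (V, \<psi>) \<in> atlas M \<and> z \<in> V \<longrightarrow> (\<exists>w. frechet_derivative (\<lambda>p. s x (inv_into V \<psi> p)) (at (\<psi> z)) w \<noteq> 0))))" ..
  have C: "\<And>x. x \<in> pts M \<Longrightarrow> openin (mtop M) (C x) \<and> x \<in> C x" using Cs by simp
  have ss: "\<And>x. x \<in> pts M \<Longrightarrow> smooth_map_on M (C x) euclid (s x)"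
    and sA: "\<And>x z. x \<in> pts M \<Longrightarrow> z \<in> C x \<Longrightarrow> z \<in> SA \<longleftrightarrow> 0 \<le> s x z"
    and sB: "\<And>x z. x \<in> pts M \<Longrightarrow> z \<in> C x \<Longrightarrow> z \<in> SB \<longleftrightarrow> s x z \<le> 0"
    and sr: "\<And>x z V \<psi>. x \<in> pts M \<Longrightarrow> z \<in> C x \<Longrightarrow> z \<in> SA \<inter> SB \<Longrightarrow> (V, \<psi>) \<in> atlas M \<Longrightarrow> z \<in> V \<Longrightarrow> \<exists>w. frechet_derivative (\<lambda>p. s x (inv_into V \<psi> p)) (at (\<psi> z)) w \<noteq> 0"
    using Cs by simp_all
  obtain F and \<rho> :: "'a \<Rightarrow> 'a \<Rightarrow> real" and K where F: "finite F" "F \<subseteq> pts M"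
    and \<rho>: "\<And>i. i \<in> F \<Longrightarrow> smooth_map_on M (pts M) euclid (\<rho> i)" "\<And>i y. 0 \<le> \<rho> i y"
    "\<And>y. y \<in> pts M \<Longrightarrow> (\<Sum>i\<in>F. \<rho> i y) = 1"
    and K: "\<And>i. i \<in> F \<Longrightarrow> closedin (mtop M) (K i)" "\<And>i. i \<in> F \<Longrightarrow> K i \<subseteq> C i" "\<And>i y. i \<in> F \<Longrightarrow> y \<notin> K i \<Longrightarrow> \<rho> i y = 0"
    by (rule partition_of_unity[OF M C, rotated]) (rule that; assumption)
  define T where "T i y = (if y \<in> C i then \<rho> i y * s i y else 0)" for i y
  have T: "smooth_map_on M (pts M) euclid (T i)" if i: "i \<in> F" for i
  proof -
    have iM: "i \<in> pts M" using i F by blast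
    have t: "smooth_map_on M (C i) euclid (\<lambda>y. \<rho> i y * s i y)"
      using openin_subset[of "mtop M" "C i"] C[OF iM]
      by (intro smooth_map_on_mult[OF MC smooth_map_on_subset[OF \<rho>(1)[OF i]] ss[OF iM]]) simp
    show ?thesis unfolding T_def[abs_def]
      by (rule smooth_map_on_extend_zero[OF MC t conjunct1[OF C[OF iM]] K(1,2)[OF i]]) (simp add: K(3)[OF i])
  qed
  have ex: "\<exists>i\<in>F. 0 < \<rho> i y \<and> y \<in> C i" if y: "y \<in> pts M" for y
  proof (rule ccontr)
    assume n: "\<not> (\<exists>i\<in>F. 0 < \<rho> i y \<and> y \<in> C i)"
    have "\<rho> i y = 0" if i: "i \<in> F" for i
    proof (cases "y \<in> C i")
      case True then show ?thesis using n i \<rho>(2)[of i y] by (auto simp: less_le)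
    next
      case False then show ?thesis using K(2,3)[OF i] by blast
    qed
    then show False using \<rho>(3)[OF y] by simp
  qed
  define \<sigma> where "\<sigma> y = (\<Sum>i\<in>F. T i y)" for y
  have \<sigma>: "smooth_map_on M (pts M) euclid \<sigma>"
    unfolding \<sigma>_def[abs_def] by (rule smooth_map_on_sum[OF MC T])
  have pos: "0 < \<sigma> y" if y: "y \<in> pts M" "y \<notin> SB" for y
  proof -
    have ge: "0 \<le> T i y" if i: "i \<in> F" for i
    proof -
      have "\<not> s i y \<le> 0" if "y \<in> C i" using sB[of i y] i F(2) that y(2) by blast
      then show ?thesis using \<rho>(2)[of i y] by (auto simp: T_def)
    qed
    obtain i where i: "i \<in> F" "0 < \<rho> i y" "y \<in> C i" using ex[OF y(1)] by blast
    have "\<not> s i y \<le> 0" using sB[of i y] i F(2) y(2) by blast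
    then have "0 < T i y" using i by (simp add: T_def)
    then show ?thesis unfolding \<sigma>_def by (rule sum_pos2[OF F(1) i(1) _ ge])
  qed
  have neg: "\<sigma> y < 0" if y: "y \<in> pts M" "y \<notin> SA" for y
  proof -
    have ge: "0 \<le> - T i y" if i: "i \<in> F" for i
    proof -
      have "\<not> 0 \<le> s i y" if "y \<in> C i" using sA[of i y] i F(2) that y(2) by blast
      then show ?thesis using \<rho>(2)[of i y] by (auto simp: T_def mult_nonneg_nonpos)
    qed
    obtain i where i: "i \<in> F" "0 < \<rho> i y" "y \<in> C i" using ex[OF y(1)] by blast
    have "\<not> 0 \<le> s i y" using sA[of i y] i F(2) y(2) by blast
    then have "0 < - T i y" using i by (simp add: T_def mult_pos_neg)
    then have "0 < (\<Sum>i\<in>F. - T i y)" by (rule sum_pos2[OF F(1) i(1) _ ge])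
    then show ?thesis by (simp add: \<sigma>_def sum_negf)
  qed
  have zero: "\<sigma> y = 0" if y: "y \<in> SA" "y \<in> SB" for y
  proof -
    have "T i y = 0" if i: "i \<in> F" for i
      using sA[of i y] sB[of i y] i F(2) y by (auto simp: T_def)
    then show ?thesis by (simp add: \<sigma>_def)
  qed
  show thesis
  proof (rule that[OF \<sigma>])
    show "z \<in> SA \<longleftrightarrow> 0 \<le> \<sigma> z" if z: "z \<in> pts M" for z
      using neg[OF z] pos[OF z] zero[of z] by (cases "z \<in> SA"; cases "z \<in> SB") auto
    show "z \<in> SB \<longleftrightarrow> \<sigma> z \<le> 0" if z: "z \<in> pts M" for z
      using neg[OF z] pos[OF z] zero[of z] cover z by (cases "z \<in> SA"; cases "z \<in> SB") auto
    fix x assume x: "x \<in> SA \<inter> SB"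
    have xM: "x \<in> pts M" using x cover by blast
    obtain V \<psi> where V: "(V, \<psi>) \<in> atlas M" "x \<in> V" using charted_obtain[OF MC xM] by blast
    have d: "coord (mtop M) V \<psi>" using charted_coord[OF MC V(1)] .
    obtain \<tau> where \<tau>: "inward_conormal M SA x V \<psi> \<tau>"
      using ex_inward_conormal[OF MS smooth_manifold_charted[OF MA] refl xM _ V] x by blast
    then obtain w where w: "0 < \<tau> w" unfolding inward_conormal_def by blast
    have smT: "smooth_on (\<psi> ` (pts M \<inter> V)) (\<lambda>p. T i (inv_into V \<psi> p))" if "i \<in> F" for i
      by (rule closed_chart_smooth[OF M T[OF that] openin_topspace V(1)])
    have px: "\<psi> x \<in> \<psi> ` (pts M \<inter> V)" using xM V by blast
    define DT where "DT i = frechet_derivative (\<lambda>p. T i (inv_into V \<psi> p)) (at (\<psi> x))" for i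
    have DT: "((\<lambda>p. T i (inv_into V \<psi> p)) has_derivative DT i) (at (\<psi> x))" if "i \<in> F" for i
      unfolding DT_def using smooth_on_has_derivative[OF smT[OF that] px] .
    \<comment> \<open>Since \<open>s i\<close> vanishes at \<open>x\<close>, the derivative of the
      product is \<open>\<rho> i x\<close> times that of \<open>s i\<close>; the derivatives of the
      weights do not enter.\<close>
    have DTw: "0 \<le> DT i w \<and> (0 < \<rho> i x \<and> x \<in> C i \<longrightarrow> 0 < DT i w)" if i: "i \<in> F" for i
    proof (cases "x \<in> C i")
      case False
      have "openin (mtop M) (pts M - K i)" using K(1)[OF i] by blast
      then obtain W where W: "open W" "\<And>y. y \<in> V \<Longrightarrow> \<psi> y \<in> W \<longleftrightarrow> y \<in> pts M - K i" using coord_open[OF d] by blast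
      have o: "open (\<psi> ` (pts M \<inter> V) \<inter> W)" using smooth_on_open[OF smT[OF i]] W(1) by blast
      have xK: "x \<notin> K i" using False K(2)[OF i] by blast
      have "((\<lambda>p. 0) has_derivative (\<lambda>v. 0)) (at (\<psi> x))" by simp
      then have "((\<lambda>p. T i (inv_into V \<psi> p)) has_derivative (\<lambda>v. 0)) (at (\<psi> x))"
      proof (rule has_derivative_transform_within_open[OF _ o])
        show "\<psi> x \<in> \<psi> ` (pts M \<inter> V) \<inter> W" using px W(2)[OF V(2)] xM xK by blast
        fix p assume "p \<in> \<psi> ` (pts M \<inter> V) \<inter> W"
        then obtain y where y: "y \<in> V" "p = \<psi> y" "\<psi> y \<in> W" by blast
        then have "y \<notin> K i" using W(2) by blast
        then show "0 = T i (inv_into V \<psi> p)" using K(3)[OF i] y coord_inv[OF d] by (simp add: T_def)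
      qed
      then have "DT i w = 0" using has_derivative_unique[OF DT[OF i]] by metis
      then show ?thesis using False by simp
    next
      case True
      have iM: "i \<in> pts M" using i F by blast
      have Ci: "openin (mtop M) (C i)" using C[OF iM] by blast
      have pxC: "\<psi> x \<in> \<psi> ` (C i \<inter> V)" using True V by blast
      have smC: "smooth_on (\<psi> ` (C i \<inter> V)) (\<lambda>p. s i (inv_into V \<psi> p))"
        by (rule closed_chart_smooth[OF M ss[OF iM] Ci V(1)])
      have smR: "smooth_on (\<psi> ` (pts M \<inter> V)) (\<lambda>p. \<rho> i (inv_into V \<psi> p))"
        by (rule closed_chart_smooth[OF M \<rho>(1)[OF i] openin_topspace V(1)])
      let ?S = "frechet_derivative (\<lambda>p. s i (inv_into V \<psi> p)) (at (\<psi> x))"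
      let ?R = "frechet_derivative (\<lambda>p. \<rho> i (inv_into V \<psi> p)) (at (\<psi> x))"
      have DS: "((\<lambda>p. s i (inv_into V \<psi> p)) has_derivative ?S) (at (\<psi> x))"
        using smooth_on_has_derivative[OF smC pxC] .
      have DR: "((\<lambda>p. \<rho> i (inv_into V \<psi> p)) has_derivative ?R) (at (\<psi> x))"
        using smooth_on_has_derivative[OF smR px] .
      have ix: "inv_into V \<psi> (\<psi> x) = x" using coord_inv[OF d V(2)] .
      have s0: "s i x = 0" using sA[OF iM True] sB[OF iM True] x by auto
      obtain c where c: "0 \<le> c" "\<And>v. ?S v = c * \<tau> v"
      proof (rule inward_conormalD[OF \<tau> Ci True DS])
        fix z assume z: "z \<in> C i \<inter> SA \<inter> V"
        then have "inv_into V \<psi> (\<psi> z) = z" "0 \<le> s i z"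
          using sA[OF iM, of z] coord_inv[OF d, of z] by auto
        then show "s i (inv_into V \<psi> (\<psi> x)) \<le> s i (inv_into V \<psi> (\<psi> z))"
          unfolding ix s0 by simp
      qed (rule that; assumption)
      obtain w' where "?S w' \<noteq> 0" using sr[OF iM True x V] by blast
      then have cp: "0 < c" using c by (cases "c = 0") auto
      have "((\<lambda>p. \<rho> i (inv_into V \<psi> p) * s i (inv_into V \<psi> p)) has_derivative
          (\<lambda>v. \<rho> i (inv_into V \<psi> (\<psi> x)) * ?S v + ?R v * s i (inv_into V \<psi> (\<psi> x)))) (at (\<psi> x))"
        by (rule has_derivative_mult[OF DR DS])
      then have "((\<lambda>p. T i (inv_into V \<psi> p)) has_derivative (\<lambda>v. \<rho> i (inv_into V \<psi> (\<psi> x)) * ?S v + ?R v * s i (inv_into V \<psi> (\<psi> x)))) (at (\<psi> x))"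
        by (rule has_derivative_transform_within_open[OF _ smooth_on_open[OF smC] pxC]) (use coord_inv[OF d] in \<open>auto simp: T_def\<close>)
      then have "DT i w = \<rho> i x * (c * \<tau> w)"
        using has_derivative_unique[OF DT[OF i]] ix s0 c(2) by auto
      then show ?thesis using \<rho>(2)[of i x] cp w by simp
    qed
    have "((\<lambda>p. \<Sum>i\<in>F. T i (inv_into V \<psi> p)) has_derivative (\<lambda>v. \<Sum>i\<in>F. DT i v)) (at (\<psi> x))"
      by (rule has_derivative_sum[OF DT])
    then have "frechet_derivative (\<lambda>p. \<sigma> (inv_into V \<psi> p)) (at (\<psi> x)) = (\<lambda>v. \<Sum>i\<in>F. DT i v)"
      unfolding \<sigma>_def by (rule frechet_derivative_at[symmetric])
    moreover have "0 < (\<Sum>i\<in>F. DT i w)"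
    proof -
      obtain i where i: "i \<in> F" "0 < \<rho> i x" "x \<in> C i" using ex[OF xM] by blast
      then have "0 < DT i w" using DTw[OF i(1)] by blast
      then show ?thesis by (rule sum_pos2[OF F(1) i(1)]) (use DTw in simp)
    qed
    ultimately have "frechet_derivative (\<lambda>p. \<sigma> (inv_into V \<psi> p)) (at (\<psi> x)) w \<noteq> 0" by simp
    then show "regular_at M \<sigma> x" unfolding regular_at_def using V by blast
  qed
qed

lemma openin_smooth_map_on_preimage:
  assumes "smooth_map_on M Q euclid f" "openin (mtop M) Q" "open W"
  shows "openin (mtop M) {x \<in> Q. f x \<in> W}"
proof -
  obtain R where R: "openin (mtop M) R" "\<And>x. x \<in> Q \<Longrightarrow> x \<in> pts M \<Longrightarrow> f x \<in> W \<longleftrightarrow> x \<in> R"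
    by (rule smooth_map_on_preimage[OF assms(1), of W]) (use assms(3) in auto)
  have "{x \<in> Q. f x \<in> W} = Q \<inter> R" using R(2) openin_subset[OF assms(2)] by blast
  then show ?thesis using R(1) assms(2) by auto
qed

text \<open>The extensions of \<open>uA\<close> and \<open>uB\<close> off their pieces need not have
  modulus 1 and are normalized where they do not vanish. The angle \<open>h\<close> is only
  continuous on the seam, but there it agrees with smooth branches of the angle of the quotient
  \<open>R\<close>. Glued branches give a smooth \<open>H\<close> that is exact on the seam, and
  adding the small angle of \<open>R cis (- H)\<close> makes it exact nearby.\<close>

lemma seam_angle:
  fixes M :: "('a, 'e::euclidean_space) manifold" and uA uB :: "'a \<Rightarrow> complex"
  assumes M: "closed_manifold M" and cl: "closedin (mtop M) SA" "closedin (mtop M) SB"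
    and uA: "smooth_map_on M SA euclid uA" "\<And>x. x \<in> SA \<Longrightarrow> cmod (uA x) = 1"
    and uB: "smooth_map_on M SB euclid uB" "\<And>x. x \<in> SB \<Longrightarrow> cmod (uB x) = 1"
    and h: "continuous_map (subtopology (mtop M) (SA \<inter> SB)) euclideanreal h" "\<And>x. x \<in> SA \<inter> SB \<Longrightarrow> uB x = uA x * cis (h x)"
  obtains A B :: "'a \<Rightarrow> complex" and h' QA QB \<Omega> where
    "openin (mtop M) QA" "SA \<subseteq> QA" "smooth_map_on M QA euclid A" "\<And>x. x \<in> SA \<Longrightarrow> A x = uA x" "\<And>x. x \<in> QA \<Longrightarrow> cmod (A x) = 1"
    "openin (mtop M) QB" "SB \<subseteq> QB" "smooth_map_on M QB euclid B" "\<And>x. x \<in> SB \<Longrightarrow> B x = uB x" "\<And>x. x \<in> QB \<Longrightarrow> cmod (B x) = 1"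
    "openin (mtop M) \<Omega>" "SA \<inter> SB \<subseteq> \<Omega>" "\<Omega> \<subseteq> QA" "\<Omega> \<subseteq> QB" "smooth_map_on M \<Omega> euclid h'" "\<And>x. x \<in> \<Omega> \<Longrightarrow> B x = A x * cis (h' x)"
proof -
  note MC = closed_manifold_charted[OF M] and MS = closed_manifold_smooth[OF M]
  obtain UA where UA: "smooth_map_on M (pts M) euclid UA" "\<And>y. y \<in> SA \<Longrightarrow> UA y = uA y"
    by (rule smooth_extension[OF M cl(1) uA(1)]) (rule that; assumption)
  obtain UB where UB: "smooth_map_on M (pts M) euclid UB" "\<And>y. y \<in> SB \<Longrightarrow> UB y = uB y"
    by (rule smooth_extension[OF M cl(2) uB(1)]) (rule that; assumption)
  have SM: "SA \<subseteq> pts M" "SB \<subseteq> pts M" using cl closedin_subset by blast+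
  define QA where "QA = {x \<in> pts M. UA x \<in> - {0}}"
  define QB where "QB = {x \<in> pts M. UB x \<in> - {0}}"
  have QA: "openin (mtop M) QA" "SA \<subseteq> QA" "QA \<subseteq> pts M"
  proof -
    show "openin (mtop M) QA" unfolding QA_def by (rule openin_smooth_preimage[OF UA(1)]) auto
    show "QA \<subseteq> pts M" by (auto simp: QA_def)
    show "SA \<subseteq> QA"
    proof
      fix y assume y: "y \<in> SA"
      have "UA y \<noteq> 0" using UA(2)[OF y] uA(2)[OF y] by auto
      then show "y \<in> QA" using y SM by (auto simp: QA_def)
    qed
  qed
  have QB: "openin (mtop M) QB" "SB \<subseteq> QB" "QB \<subseteq> pts M"
  proof -
    show "openin (mtop M) QB" unfolding QB_def by (rule openin_smooth_preimage[OF UB(1)]) auto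
    show "QB \<subseteq> pts M" by (auto simp: QB_def)
    show "SB \<subseteq> QB"
    proof
      fix y assume y: "y \<in> SB"
      have "UB y \<noteq> 0" using UB(2)[OF y] uB(2)[OF y] by auto
      then show "y \<in> QB" using y SM by (auto simp: QB_def)
    qed
  qed
  define R where "R = (\<lambda>x. UB x * inverse (UA x))"
  have iA: "smooth_map_on M QA euclid (\<lambda>x. inverse (UA x))"
    by (rule smooth_map_on_smooth_on[OF MC smooth_map_on_subset[OF UA(1) QA(3)] smooth_on_inverse_complex]) (simp add: QA_def)
  have R: "smooth_map_on M QA euclid R" unfolding R_def
    by (rule smooth_map_on_mult[OF MC smooth_map_on_subset[OF UB(1) QA(3)] iA])
  have RN: "R x = cis (h x)" if "x \<in> SA \<inter> SB" for x
  proof -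
    have "uA x \<noteq> 0" using uA(2)[of x] that by auto
    then show ?thesis using that UA(2)[of x] UB(2)[of x] h(2)[of x] by (auto simp: R_def)
  qed
  define g where "g c = (\<lambda>x. R x * cis (- c x))" for c :: "'a \<Rightarrow> real"
  have g: "smooth_map_on M Q euclid (g c)" if "smooth_map_on M Q euclid c" "Q \<subseteq> QA" for c Q
  proof -
    have c: "smooth_map_on M Q euclid (\<lambda>x. cis (- c x))"
      by (rule smooth_map_on_smooth_on[OF MC that(1) smooth_on_cis_fun[OF smooth_on_minus[OF smooth_on_id[OF open_UNIV]]]]) simp
    show ?thesis unfolding g_def
      by (rule smooth_map_on_mult[OF MC smooth_map_on_subset[OF R that(2)] c])
  qed
  \<comment> \<open>The branch of the angle of \<open>R\<close> that lies closest to the prescribed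
    value \<open>c x\<close>.\<close>
  define L where "L c = (\<lambda>x. c x + Im (Ln (g c x)))" for c :: "'a \<Rightarrow> real"
  have L: "openin (mtop M) {x \<in> Q. g c x \<in> - \<real>\<^sub>\<le>\<^sub>0} \<and> smooth_map_on M {x \<in> Q. g c x \<in> - \<real>\<^sub>\<le>\<^sub>0} euclid (L c)"
    if c: "smooth_map_on M Q euclid c" "Q \<subseteq> QA" "openin (mtop M) Q" for c Q
  proof
    show o: "openin (mtop M) {x \<in> Q. g c x \<in> - \<real>\<^sub>\<le>\<^sub>0}"
      by (rule openin_smooth_map_on_preimage[OF g[OF c(1,2)] c(3)]) auto
    show "smooth_map_on M {x \<in> Q. g c x \<in> - \<real>\<^sub>\<le>\<^sub>0} euclid (L c)"
    proof -
      let ?X = "{x \<in> Q. g c x \<in> - \<real>\<^sub>\<le>\<^sub>0}"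
      have s: "?X \<subseteq> Q" by blast
      have l: "smooth_map_on M ?X euclid (\<lambda>x. Im (Ln (g c x)))"
        by (rule smooth_map_on_smooth_on[OF MC smooth_map_on_subset[OF g[OF c(1,2)] s] smooth_on_Im_Ln]) simp
      show ?thesis unfolding L_def
        by (rule smooth_map_on_add[OF MC smooth_map_on_subset[OF c(1) s] l])
    qed
  qed
  have cv: "convex (if y \<in> SA \<inter> SB then {h y} else UNIV)" for y by simp
  have loc: "\<exists>C f. openin (mtop M) C \<and> x \<in> C \<and> smooth_map_on M C euclid f \<and> (\<forall>y\<in>C. f y \<in> (if y \<in> SA \<inter> SB then {h y} else UNIV))"
    if x: "x \<in> pts M" for x
  proof (cases "x \<in> SA \<inter> SB")
    case False
    then show ?thesis using x openin_diff[OF openin_topspace closedin_Int[OF cl]]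
      by (intro exI[of _ "pts M - (SA \<inter> SB)"] exI[of _ "\<lambda>z. 0"]) (auto simp: smooth_map_on_const[OF MC])
  next
    case True
    have "openin (subtopology (mtop M) (SA \<inter> SB)) {y \<in> topspace (subtopology (mtop M) (SA \<inter> SB)). h y \<in> ball (h x) pi}"
      by (rule openin_continuous_map_preimage[OF h(1)]) simp
    then obtain C0 where C0: "openin (mtop M) C0" "{y \<in> topspace (subtopology (mtop M) (SA \<inter> SB)). h y \<in> ball (h x) pi} = C0 \<inter> (SA \<inter> SB)"
      by (auto simp: openin_subtopology)
    \<comment> \<open>Where \<open>h\<close> differs from \<open>h x\<close> by less than pi, the
      branch of the angle closest to the constant \<open>h x\<close> is \<open>h\<close>
      itself.\<close>
    have near: "\<bar>h y - h x\<bar> < pi \<longleftrightarrow> y \<in> C0" if "y \<in> SA \<inter> SB" for y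
      using C0(2) that SM by (auto simp: dist_real_def abs_minus_commute set_eq_iff)
    let ?Q = "QA \<inter> C0" and ?c = "\<lambda>_. h x"
    let ?C = "{y \<in> ?Q. g ?c y \<in> - \<real>\<^sub>\<le>\<^sub>0}"
    have oC: "openin (mtop M) ?Q" using QA C0 by blast
    have gy: "g ?c y = cis (h y - h x)" if "y \<in> SA \<inter> SB" for y
      using RN[OF that] by (simp add: g_def cis_mult)
    have "x \<in> ?C" using near[OF True] gy[OF True] True QA by auto
    moreover have "L ?c y = h y" if "y \<in> ?C" "y \<in> SA \<inter> SB" for y
      using near[OF that(2)] that(1) gy[OF that(2)] Ln_cis[of "h y - h x"] by (simp add: L_def)
    ultimately show ?thesis
      using L[OF smooth_map_on_const[OF MC] _ oC, of "h x"]
      by (intro exI[of _ ?C] exI[of _ "L ?c"]) auto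
  qed
  obtain H where H: "smooth_map_on M (pts M) euclid H" "\<And>y. y \<in> pts M \<Longrightarrow> H y \<in> (if y \<in> SA \<inter> SB then {h y} else UNIV)"
    by (rule glue_convex[OF M cv loc, rotated]) (rule that; assumption)
  have HN: "H y = h y" if "y \<in> SA \<inter> SB" for y using H(2)[of y] that SM by auto
  define Q where "Q = QA \<inter> QB"
  have Q: "openin (mtop M) Q" "Q \<subseteq> QA" "smooth_map_on M Q euclid H"
  proof -
    show "openin (mtop M) Q" "Q \<subseteq> QA" using QA QB by (auto simp: Q_def)
    show "smooth_map_on M Q euclid H"
      by (rule smooth_map_on_subset[OF H(1)]) (use QA(3) in \<open>auto simp: Q_def\<close>)
  qed
  define \<Omega> where "\<Omega> = {x \<in> Q. g H x \<in> - \<real>\<^sub>\<le>\<^sub>0}"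
  have \<Omega>: "openin (mtop M) \<Omega>" "smooth_map_on M \<Omega> euclid (L H)" using L[OF Q(3,2,1)] by (simp_all add: \<Omega>_def)
  define nm where "nm w = w / of_real (cmod w)" for w :: complex
  have nm1: "cmod (nm w) = 1" if "w \<noteq> 0" for w using that by (simp add: nm_def norm_divide)
  have nm: "smooth_on (- {0}) nm" using smooth_on_normalize by (simp add: nm_def[abs_def])
  show thesis
  proof (rule that[of QA "\<lambda>x. nm (UA x)" QB "\<lambda>x. nm (UB x)" \<Omega> "L H"])
    show "smooth_map_on M QA euclid (\<lambda>x. nm (UA x))"
      by (rule smooth_map_on_smooth_on[OF MC smooth_map_on_subset[OF UA(1) QA(3)] nm]) (simp add: QA_def)
    show "smooth_map_on M QB euclid (\<lambda>x. nm (UB x))"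
      by (rule smooth_map_on_smooth_on[OF MC smooth_map_on_subset[OF UB(1) QB(3)] nm]) (simp add: QB_def)
    show "nm (UA x) = uA x" if "x \<in> SA" for x using UA(2)[OF that] uA(2)[OF that] by (simp add: nm_def)
    show "nm (UB x) = uB x" if "x \<in> SB" for x using UB(2)[OF that] uB(2)[OF that] by (simp add: nm_def)
    show "cmod (nm (UA x)) = 1" if "x \<in> QA" for x using that nm1 by (simp add: QA_def)
    show "cmod (nm (UB x)) = 1" if "x \<in> QB" for x using that nm1 by (simp add: QB_def)
    show "SA \<inter> SB \<subseteq> \<Omega>"
    proof
      fix x assume x: "x \<in> SA \<inter> SB"
      have "g H x = 1" using RN[OF x] HN[OF x] by (simp add: g_def cis_mult)
      then show "x \<in> \<Omega>" using x QA QB by (auto simp: \<Omega>_def Q_def)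
    qed
    show "nm (UB x) = nm (UA x) * cis (L H x)" if x: "x \<in> \<Omega>" for x
    proof -
      have z: "UA x \<noteq> 0" "UB x \<noteq> 0" using x by (auto simp: \<Omega>_def Q_def QA_def QB_def)
      have gz: "g H x \<noteq> 0" using z by (simp add: g_def R_def)
      have "cis (L H x) = cis (H x) * (g H x / of_real (cmod (g H x)))"
        using cis_Im_Ln[OF gz] by (simp add: L_def cis_mult[symmetric])
      also have "\<dots> = (cis (H x) * cis (- H x)) * (R x / of_real (cmod (R x)))"
        by (simp add: g_def norm_mult)
      also have "cis (H x) * cis (- H x) = 1" by (simp add: cis_mult)
      finally have "cis (L H x) = nm (R x)" by (simp add: nm_def)
      moreover have "UB x = UA x * R x" using z by (simp add: R_def)
      ultimately show ?thesis by (simp add: nm_def norm_mult)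
    qed
  qed (use QA QB \<Omega> in \<open>auto simp: \<Omega>_def Q_def\<close>)
qed

text \<open>In a chart the angle of the interpolated map has the differential
  \<open>a + l b + m s\<close>, where \<open>a\<close>, \<open>b\<close>, \<open>s\<close> are the
  differentials of the angle of \<open>A\<close>, of \<open>h\<close> and of
  \<open>\<sigma>\<close>, and \<open>l = f (\<sigma> y)\<close>,
  \<open>m = f' (\<sigma> y) * (h y + C)\<close>. The set \<open>Q\<close> and the constants
  \<open>e\<close>, \<open>K\<close> are found before \<open>f\<close> and \<open>C\<close> are
  given, so that these can be adjusted to them afterwards.\<close>

lemma seam_regularity:
  fixes M :: "('a, 'e::euclidean_space) manifold" and A uA uB :: "'a \<Rightarrow> complex" and h \<sigma> :: "'a \<Rightarrow> real"
  assumes M: "closed_manifold M" and \<Omega>: "openin (mtop M) \<Omega>" "x \<in> \<Omega>"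
    and A: "smooth_map_on M \<Omega> euclid A" "\<And>y. y \<in> \<Omega> \<Longrightarrow> cmod (A y) = 1" "\<And>y. y \<in> \<Omega> \<inter> SA \<Longrightarrow> A y = uA y"
    and h: "smooth_map_on M \<Omega> euclid h" "\<And>y. y \<in> \<Omega> \<inter> SB \<Longrightarrow> A y * cis (h y) = uB y"
    and \<sigma>: "smooth_map_on M (pts M) euclid \<sigma>" "\<And>y. y \<in> SA \<Longrightarrow> 0 \<le> \<sigma> y" "\<And>y. y \<in> SB \<Longrightarrow> \<sigma> y \<le> 0" "\<sigma> x = 0" "regular_at M \<sigma> x"
    and x: "x \<in> SA" "x \<in> SB" and tc: "turning_curve M SA uA x" "turning_curve M SB uB x"
  obtains Q e K where "openin (mtop M) Q" "x \<in> Q" "Q \<subseteq> \<Omega>" "(0::real) < e" "0 < K" "\<And>y. y \<in> Q \<Longrightarrow> \<bar>h y\<bar> \<le> K"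
    "\<And>y f f' C. y \<in> Q \<Longrightarrow> \<forall>t. (f has_real_derivative f' t) (at t) \<Longrightarrow>
      0 \<le> f (\<sigma> y) \<Longrightarrow> f (\<sigma> y) \<le> 1 \<Longrightarrow> f (\<sigma> y) \<le> e \<or> 1 - e \<le> f (\<sigma> y) \<or> K \<le> \<bar>f' (\<sigma> y) * (h y + C)\<bar> \<Longrightarrow>
      regular_at M (\<lambda>z. A z * cis (f (\<sigma> z) * (h z + C))) y"
proof -
  note MC = closed_manifold_charted[OF M] and MS = closed_manifold_smooth[OF M]
  have xM: "x \<in> pts M" using \<Omega> openin_subset by blast
  obtain V \<psi> where V: "(V, \<psi>) \<in> atlas M" "x \<in> V" using charted_obtain[OF MC xM] by blast
  have d: "coord (mtop M) V \<psi>" using charted_coord[OF MC V(1)] .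
  define c0 where "c0 = A x"
  have c0: "cmod c0 = 1" "c0 \<noteq> 0" using A(2)[OF \<Omega>(2)] by (auto simp: c0_def)
  define r where "r = (\<lambda>y. A y * inverse c0)"
  have r: "smooth_map_on M \<Omega> euclid r" unfolding r_def
    by (rule smooth_map_on_mult[OF MC A(1) smooth_map_on_const[OF MC]])
  define Q where "Q = {y \<in> \<Omega>. r y \<in> - \<real>\<^sub>\<le>\<^sub>0} \<inter> V"
  have oR: "openin (mtop M) {y \<in> \<Omega>. r y \<in> - \<real>\<^sub>\<le>\<^sub>0}"
    by (rule openin_smooth_map_on_preimage[OF r \<Omega>(1)]) auto
  have Q: "openin (mtop M) Q" "Q \<subseteq> \<Omega>" "Q \<subseteq> V" "Q \<subseteq> pts M"
    unfolding Q_def using oR coord_openin[OF d] coord_subset[OF d] by auto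
  have xQ: "x \<in> Q" using \<Omega>(2) V(2) c0 by (simp add: Q_def r_def c0_def)
  define \<theta> where "\<theta> = (\<lambda>y. Im (Ln (r y)))"
  have \<theta>: "smooth_map_on M Q euclid \<theta>" unfolding \<theta>_def
    by (rule smooth_map_on_smooth_on[OF MC smooth_map_on_subset[OF r Q(2)] smooth_on_Im_Ln]) (simp add: Q_def)
  have A\<theta>: "A y = c0 * cis (\<theta> y)" if y: "y \<in> Q" for y
  proof -
    have "cmod (A y) = 1" using A(2) y Q(2) by blast
    then have "cmod (r y) = 1" using c0 by (simp add: r_def norm_mult norm_inverse)
    moreover from this have "r y \<noteq> 0" by auto
    ultimately have "cis (\<theta> y) = r y" using cis_Im_Ln[of "r y"] by (simp add: \<theta>_def)
    then show ?thesis using c0(2) by (simp add: r_def)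
  qed
  have hQ: "smooth_map_on M Q euclid h" and \<sigma>Q: "smooth_map_on M Q euclid \<sigma>"
    using smooth_map_on_subset[OF h(1) Q(2)] smooth_map_on_subset[OF \<sigma>(1) Q(4)] .
  let ?P = "\<psi> ` (Q \<inter> V)"
  define \<theta>' where "\<theta>' = (\<lambda>p. \<theta> (inv_into V \<psi> p))"
  define h' where "h' = (\<lambda>p. h (inv_into V \<psi> p))"
  define \<sigma>' where "\<sigma>' = (\<lambda>p. \<sigma> (inv_into V \<psi> p))"
  have s\<theta>: "smooth_on ?P \<theta>'" unfolding \<theta>'_def by (rule closed_chart_smooth[OF M \<theta> Q(1) V(1)])
  have sh: "smooth_on ?P h'" unfolding h'_def by (rule closed_chart_smooth[OF M hQ Q(1) V(1)])
  have s\<sigma>: "smooth_on ?P \<sigma>'" unfolding \<sigma>'_def by (rule closed_chart_smooth[OF M \<sigma>Q Q(1) V(1)])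
  have P: "open ?P" "\<psi> x \<in> ?P" using smooth_on_open[OF s\<theta>] xQ V(2) by auto
  define a where "a y = frechet_derivative \<theta>' (at y)" for y
  define b where "b y = frechet_derivative h' (at y)" for y
  define s where "s y = frechet_derivative \<sigma>' (at y)" for y
  have Da: "(\<theta>' has_derivative a y) (at y)" and Db: "(h' has_derivative b y) (at y)" and Ds: "(\<sigma>' has_derivative s y) (at y)"
    if "y \<in> ?P" for y
    unfolding a_def b_def s_def
    using smooth_on_has_derivative[OF s\<theta> that] smooth_on_has_derivative[OF sh that] smooth_on_has_derivative[OF s\<sigma> that] .
  have lin: "linear (a y)" "linear (b y)" "linear (s y)" if "y \<in> ?P" for y
    using Da[OF that] Db[OF that] Ds[OF that] has_derivative_linear by blast+
  have linab: "linear (\<lambda>v. a y v + b y v)" if "y \<in> ?P" for y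
    using linear_compose_add[OF lin(1,2)[OF that]] .
  have cont: "continuous_on ?P (\<lambda>y. a y v)" "continuous_on ?P (\<lambda>y. b y v)" "continuous_on ?P (\<lambda>y. s y v)" for v
    unfolding a_def b_def s_def
    using smooth_on_continuous[OF smooth_on_frechet[OF s\<theta>]] smooth_on_continuous[OF smooth_on_frechet[OF sh]]
      smooth_on_continuous[OF smooth_on_frechet[OF s\<sigma>]] .
  have contab: "continuous_on ?P (\<lambda>y. a y v + b y v)" for v
    by (rule continuous_on_add[OF cont(1,2)])
  obtain w where w: "s (\<psi> x) w \<noteq> 0"
    using regular_at_all_charts[OF M \<sigma>Q Q(1) xQ \<sigma>(5) V] unfolding s_def \<sigma>'_def by blast
  \<comment> \<open>Along a two-sided curve that stays on one side of the seam,
    \<open>\<sigma>\<close> has an extremum at the seam point, so the velocity lies in the kernel of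
    the differential of \<open>\<sigma>\<close>. The sign of \<open>k\<close> covers both
    sides.\<close>
  have curve: "\<exists>v. s (\<psi> x) v = 0 \<and> ((\<lambda>t. \<theta> (\<gamma> t)) has_real_derivative a (\<psi> x) v) (at 0) \<and>
      ((\<lambda>t. h (\<gamma> t)) has_real_derivative b (\<psi> x) v) (at 0) \<and> (\<exists>e'>0. e' \<le> e \<and> (\<forall>t. \<bar>t\<bar> < e' \<longrightarrow> \<gamma> t \<in> Q))"
    if \<gamma>: "0 < e" "smooth_map_on euclid {-e<..<e::real} M \<gamma>" "\<gamma> 0 = x" "\<And>t. t \<in> {-e<..<e} \<Longrightarrow> 0 \<le> k * \<sigma> (\<gamma> t)" and k: "k \<noteq> 0" for \<gamma> e k
  proof -
    obtain v e' where e': "0 < e'" "e' \<le> e" "\<And>t. \<bar>t\<bar> < e' \<Longrightarrow> \<gamma> t \<in> V \<inter> Q" "((\<lambda>t. \<psi> (\<gamma> t)) has_derivative (\<lambda>t. t *\<^sub>R v)) (at 0)"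
      by (rule curve_velocity[OF MC \<gamma>(2,1) V(1) _ Q(1)]) (use V xQ \<gamma>(3) in auto)
    have g0: "\<gamma> 0 \<in> Q" using xQ \<gamma>(3) by simp
    have inV: "\<gamma> t \<in> V" if "\<bar>t\<bar> < e'" for t using e'(3)[OF that] by blast
    note dac = derivative_along_curve[OF M _ Q(1) g0 V(1) e'(1) inV e'(4), unfolded \<gamma>(3)]
    have D\<sigma>: "((\<lambda>t. \<sigma> (\<gamma> t)) has_real_derivative s (\<psi> x) v) (at 0)"
      using dac[OF \<sigma>Q] unfolding s_def \<sigma>'_def has_real_derivative_iff_has_vector_derivative .
    have "((\<lambda>t. k * \<sigma> (\<gamma> t)) has_real_derivative k * s (\<psi> x) v) (at 0)"
      by (rule DERIV_cmult[OF D\<sigma>])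
    then have "k * s (\<psi> x) v = 0"
    proof (rule DERIV_local_min[OF _ \<gamma>(1)], intro allI impI)
      fix y :: real assume "\<bar>0 - y\<bar> < e"
      then have "y \<in> {-e<..<e}" by (auto simp: abs_less_iff)
      from \<gamma>(4)[OF this] show "k * \<sigma> (\<gamma> 0) \<le> k * \<sigma> (\<gamma> y)" using \<sigma>(4) unfolding \<gamma>(3) by simp
    qed
    then have "s (\<psi> x) v = 0" using k by simp
    moreover have "((\<lambda>t. \<theta> (\<gamma> t)) has_real_derivative a (\<psi> x) v) (at 0)"
      using dac[OF \<theta>] unfolding a_def \<theta>'_def has_real_derivative_iff_has_vector_derivative .
    moreover have "((\<lambda>t. h (\<gamma> t)) has_real_derivative b (\<psi> x) v) (at 0)"
      using dac[OF hQ] unfolding b_def h'_def has_real_derivative_iff_has_vector_derivative .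
    ultimately show ?thesis using e'(1-3) by blast
  qed
  obtain vA where vA: "a (\<psi> x) vA \<noteq> 0" "s (\<psi> x) vA = 0"
  proof -
    obtain \<gamma> e k where \<gamma>: "0 < e" "k \<noteq> 0" "smooth_map_on euclid {-e<..<e::real} M \<gamma>" "\<gamma> 0 = x"
      "\<And>t. t \<in> {-e<..<e} \<Longrightarrow> \<gamma> t \<in> SA \<and> uA (\<gamma> t) = uA x * cis (k * t)"
      using tc(1) unfolding turning_curve_def by metis
    have pos: "0 \<le> 1 * \<sigma> (\<gamma> t)" if "t \<in> {-e<..<e}" for t using \<gamma>(5)[OF that] \<sigma>(2) by simp
    obtain v e' where v: "s (\<psi> x) v = 0" "((\<lambda>t. \<theta> (\<gamma> t)) has_real_derivative a (\<psi> x) v) (at 0)"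
      "0 < e'" "e' \<le> e" "\<And>t. \<bar>t\<bar> < e' \<Longrightarrow> \<gamma> t \<in> Q"
      using curve[OF \<gamma>(1,3,4) pos] by auto
    have "a (\<psi> x) v = k"
    proof (rule cis_derivative_unique[OF v(2) c0(2) v(3)])
      fix t assume t: "\<bar>t\<bar> < e'"
      then have "\<gamma> t \<in> SA \<and> uA (\<gamma> t) = uA x * cis (k * t)"
        using v(4) by (intro \<gamma>(5)) (auto simp: abs_less_iff)
      then show "c0 * cis (\<theta> (\<gamma> t)) = uA x * cis (k * t)"
        using A\<theta>[OF v(5)[OF t]] A(3)[of "\<gamma> t"] v(5)[OF t] Q(2) by auto
    qed
    then show thesis using \<gamma>(2) by (intro that[of v] v(1)) simp
  qed
  \<comment> \<open>On \<open>SB\<close> the map \<open>uB\<close> is \<open>A cis h\<close>, whose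
    angle has differential \<open>a + b\<close>.\<close>
  obtain vB where vB: "a (\<psi> x) vB + b (\<psi> x) vB \<noteq> 0" "s (\<psi> x) vB = 0"
  proof -
    obtain \<gamma> e k where \<gamma>: "0 < e" "k \<noteq> 0" "smooth_map_on euclid {-e<..<e::real} M \<gamma>" "\<gamma> 0 = x"
      "\<And>t. t \<in> {-e<..<e} \<Longrightarrow> \<gamma> t \<in> SB \<and> uB (\<gamma> t) = uB x * cis (k * t)"
      using tc(2) unfolding turning_curve_def by metis
    have pos: "0 \<le> (- 1) * \<sigma> (\<gamma> t)" if "t \<in> {-e<..<e}" for t using \<gamma>(5)[OF that] \<sigma>(3) by simp
    obtain v e' where v: "s (\<psi> x) v = 0" "((\<lambda>t. \<theta> (\<gamma> t)) has_real_derivative a (\<psi> x) v) (at 0)"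
      "((\<lambda>t. h (\<gamma> t)) has_real_derivative b (\<psi> x) v) (at 0)"
      "0 < e'" "e' \<le> e" "\<And>t. \<bar>t\<bar> < e' \<Longrightarrow> \<gamma> t \<in> Q"
      using curve[OF \<gamma>(1,3,4) pos] by auto
    have "a (\<psi> x) v + b (\<psi> x) v = k"
    proof (rule cis_derivative_unique[OF DERIV_add[OF v(2,3)] c0(2) v(4)])
      fix t assume t: "\<bar>t\<bar> < e'"
      then have "\<gamma> t \<in> SB \<and> uB (\<gamma> t) = uB x * cis (k * t)"
        using v(5) by (intro \<gamma>(5)) (auto simp: abs_less_iff)
      then show "c0 * cis (\<theta> (\<gamma> t) + h (\<gamma> t)) = uB x * cis (k * t)"
        using A\<theta>[OF v(6)[OF t]] h(2)[of "\<gamma> t"] v(6)[OF t] Q(2) by (auto simp: cis_mult[symmetric] mult.assoc)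
    qed
    then show thesis using \<gamma>(2) by (intro that[of v] v(1)) simp
  qed
  obtain O1 e1 where O1: "open O1" "\<psi> x \<in> O1" "O1 \<subseteq> ?P" "(0::real) < e1"
    "\<And>y l m. y \<in> O1 \<Longrightarrow> \<bar>l\<bar> \<le> e1 \<Longrightarrow> \<exists>u. a y u + l * b y u + m * s y u \<noteq> 0"
    by (rule functional_combination_nonzero[where a = a and b = b and s = s and w = w and v = vA, OF P lin(1) lin(2) lin(3) cont(1) cont(2) cont(3) vA w, rotated 3]) (rule that; assumption)
  \<comment> \<open>This application is centered at \<open>l = 1\<close>, where the interpolated
    angle is that of \<open>uB\<close> up to a constant.\<close>
  obtain O2 e2 where O2: "open O2" "\<psi> x \<in> O2" "O2 \<subseteq> ?P" "(0::real) < e2"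
    "\<And>y l m. y \<in> O2 \<Longrightarrow> \<bar>l\<bar> \<le> e2 \<Longrightarrow> \<exists>u. (a y u + b y u) + l * b y u + m * s y u \<noteq> 0"
    by (rule functional_combination_nonzero[where a = "\<lambda>y v. a y v + b y v" and b = b and s = s and w = w and v = vB, OF P linab lin(2) lin(3) contab cont(2) cont(3) vB w, rotated 3]) (rule that; assumption)
  obtain O3 K where O3: "open O3" "\<psi> x \<in> O3" "O3 \<subseteq> ?P" "(0::real) < K" "\<And>y. y \<in> O3 \<Longrightarrow> \<bar>h' y\<bar> \<le> K"
    "\<And>y l m. y \<in> O3 \<Longrightarrow> 0 \<le> l \<Longrightarrow> l \<le> 1 \<Longrightarrow> K \<le> \<bar>m\<bar> \<Longrightarrow> a y w + l * b y w + m * s y w \<noteq> 0"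
    by (rule functional_combination_dominated[where a = a and b = b and s = s and w = w, OF P cont(1) cont(2) cont(3) smooth_on_continuous[OF sh] w]) (rule that; assumption)
  define R where "R = Q \<inter> (V \<inter> \<psi> -` (O1 \<inter> O2 \<inter> O3))"
  show thesis
  proof (rule that[of R "min e1 e2" K])
    show "openin (mtop M) R" unfolding R_def
      using Q(1) coord_preimage[OF d, of "O1 \<inter> O2 \<inter> O3"] O1(1) O2(1) O3(1) by blast
    show "x \<in> R" using xQ V(2) O1(2) O2(2) O3(2) by (simp add: R_def)
    show "R \<subseteq> \<Omega>" using Q(2) by (auto simp: R_def)
    show "0 < min e1 e2" "0 < K" using O1(4) O2(4) O3(4) by auto
    show "\<bar>h y\<bar> \<le> K" if "y \<in> R" for y
      using that O3(5)[of "\<psi> y"] coord_inv[OF d, of y] by (auto simp: R_def h'_def)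
    fix y and f f' :: "real \<Rightarrow> real" and C :: real
    assume y: "y \<in> R" and f: "\<forall>t. (f has_real_derivative f' t) (at t)" and f01: "0 \<le> f (\<sigma> y)" "f (\<sigma> y) \<le> 1"
      and alt: "f (\<sigma> y) \<le> min e1 e2 \<or> 1 - min e1 e2 \<le> f (\<sigma> y) \<or> K \<le> \<bar>f' (\<sigma> y) * (h y + C)\<bar>"
    let ?p = "\<psi> y" and ?l = "f (\<sigma> y)" and ?m = "f' (\<sigma> y) * (h y + C)"
    have yV: "y \<in> V" "y \<in> Q" and py: "?p \<in> O1" "?p \<in> O2" "?p \<in> O3" "?p \<in> ?P"
      using y Q(3) by (auto simp: R_def)
    have iy: "inv_into V \<psi> ?p = y" using coord_inv[OF d yV(1)] .
    have "\<exists>u. a ?p u + ?l * b ?p u + ?m * s ?p u \<noteq> 0"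
    proof -
      consider "?l \<le> e1" | "1 - e2 \<le> ?l" | "K \<le> \<bar>?m\<bar>" using alt by linarith
      then show ?thesis
      proof cases
        case 1 then show ?thesis using O1(5)[OF py(1), of ?l ?m] f01 by simp
      next
        case 2
        then have "\<bar>?l - 1\<bar> \<le> e2" using f01 by simp
        then obtain u where "(a ?p u + b ?p u) + (?l - 1) * b ?p u + ?m * s ?p u \<noteq> 0"
          using O2(5)[OF py(2), of "?l - 1" ?m] by blast
        then show ?thesis by (intro exI[of _ u]) (simp add: algebra_simps)
      next
        case 3 then show ?thesis using O3(6)[OF py(3) f01] by blast
      qed
    qed
    then obtain u where u: "a ?p u + ?l * b ?p u + ?m * s ?p u \<noteq> 0" by blast
    have l: "f (\<sigma>' ?p) = ?l" "f' (\<sigma>' ?p) * (h' ?p + C) = ?m" by (simp_all add: \<sigma>'_def h'_def iy)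
    have 1: "((\<lambda>p. f (\<sigma>' p)) has_derivative (\<lambda>v. f' (\<sigma>' ?p) * s ?p v)) (at ?p)"
      using diff_chain_at[OF Ds[OF py(4)], of f "(*) (f' (\<sigma>' ?p))"] f[rule_format, of "\<sigma>' ?p"]
      by (simp add: has_field_derivative_def o_def)
    have 2: "((\<lambda>p. h' p + C) has_derivative b ?p) (at ?p)"
      using has_derivative_add[OF Db[OF py(4)] has_derivative_const[of C]] by simp
    have 3: "((\<lambda>p. \<theta>' p + f (\<sigma>' p) * (h' p + C)) has_derivative
        (\<lambda>v. a ?p v + (f (\<sigma>' ?p) * b ?p v + f' (\<sigma>' ?p) * s ?p v * (h' ?p + C)))) (at ?p)"
      by (rule has_derivative_add[OF Da[OF py(4)] has_derivative_mult[OF 1 2]])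
    have 4: "((\<lambda>p. c0 * cis (\<theta>' p + f (\<sigma>' p) * (h' p + C))) has_derivative
        (\<lambda>v. c0 * ((a ?p v + (f (\<sigma>' ?p) * b ?p v + f' (\<sigma>' ?p) * s ?p v * (h' ?p + C))) *\<^sub>R (\<i> * cis (\<theta>' ?p + f (\<sigma>' ?p) * (h' ?p + C)))))) (at ?p)"
      by (rule has_derivative_mult_right[OF has_derivative_cis[OF 3]])
    have eq: "A (inv_into V \<psi> p) * cis (f (\<sigma> (inv_into V \<psi> p)) * (h (inv_into V \<psi> p) + C)) = c0 * cis (\<theta>' p + f (\<sigma>' p) * (h' p + C))"
      if p: "p \<in> ?P" for p
    proof -
      have "inv_into V \<psi> p \<in> Q" using p coord_inv[OF d] by auto
      then show ?thesis using A\<theta> by (simp add: \<theta>'_def h'_def \<sigma>'_def cis_mult[symmetric] mult.assoc)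
    qed
    have "frechet_derivative (\<lambda>p. A (inv_into V \<psi> p) * cis (f (\<sigma> (inv_into V \<psi> p)) * (h (inv_into V \<psi> p) + C))) (at ?p) =
        frechet_derivative (\<lambda>p. c0 * cis (\<theta>' p + f (\<sigma>' p) * (h' p + C))) (at ?p)"
      by (rule frechet_derivative_cong_open[OF P(1) py(4) eq])
    also have "\<dots> = (\<lambda>v. c0 * ((a ?p v + (f (\<sigma>' ?p) * b ?p v + f' (\<sigma>' ?p) * s ?p v * (h' ?p + C))) *\<^sub>R (\<i> * cis (\<theta>' ?p + f (\<sigma>' ?p) * (h' ?p + C)))))"
      by (rule frechet_derivative_at[OF 4, symmetric])
    finally have "frechet_derivative (\<lambda>p. A (inv_into V \<psi> p) * cis (f (\<sigma> (inv_into V \<psi> p)) * (h (inv_into V \<psi> p) + C))) (at ?p) u =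
       c0 * ((a ?p u + (f (\<sigma>' ?p) * b ?p u + f' (\<sigma>' ?p) * s ?p u * (h' ?p + C))) *\<^sub>R (\<i> * cis (\<theta>' ?p + f (\<sigma>' ?p) * (h' ?p + C))))"
      by simp
    moreover have "a ?p u + (f (\<sigma>' ?p) * b ?p u + f' (\<sigma>' ?p) * s ?p u * (h' ?p + C)) = a ?p u + ?l * b ?p u + ?m * s ?p u"
      unfolding l[symmetric] by (simp add: algebra_simps)
    ultimately have "frechet_derivative (\<lambda>p. A (inv_into V \<psi> p) * cis (f (\<sigma> (inv_into V \<psi> p)) * (h (inv_into V \<psi> p) + C))) (at ?p) u \<noteq> 0"
      using u c0(2) by simp
    then show "regular_at M (\<lambda>z. A z * cis (f (\<sigma> z) * (h z + C))) y"
      unfolding regular_at_def using V(1) yV(1) by blast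
  qed
qed

text \<open>The order of choices is what makes the estimate close: \<open>e\<close> and
  \<open>K\<close> come from a finite cover of the seam, \<open>r\<close> from the extent of that
  cover, \<open>\<delta>\<close> from \<open>e\<close>, and only then \<open>C\<close> from all of
  them.\<close>

theorem glued_submersion:
  fixes M :: "('a, real^'n) manifold" and uA uB :: "'a \<Rightarrow> complex"
  assumes M: "closed_manifold M" and MA: "smooth_manifold (submanifold M SA :: ('a, real^'n) manifold)"
    and cover: "SA \<union> SB = pts M" and cl: "closedin (mtop M) SA" "closedin (mtop M) SB"
    and NA: "SA \<inter> SB = boundary (submanifold M SA :: ('a, real^'n) manifold)"
    and uA: "smooth_map_on M SA euclid uA" "\<And>x. x \<in> SA \<Longrightarrow> cmod (uA x) = 1" "\<And>x. x \<in> SA \<Longrightarrow> turning_curve M SA uA x"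
    and uB: "smooth_map_on M SB euclid uB" "\<And>x. x \<in> SB \<Longrightarrow> cmod (uB x) = 1" "\<And>x. x \<in> SB \<Longrightarrow> turning_curve M SB uB x"
    and h: "continuous_map (subtopology (mtop M) (SA \<inter> SB)) euclideanreal h" "\<And>x. x \<in> SA \<inter> SB \<Longrightarrow> uB x = uA x * cis (h x)"
  obtains u :: "'a \<Rightarrow> complex" where "smooth_map_on M (pts M) euclid u" "\<And>x. x \<in> pts M \<Longrightarrow> cmod (u x) = 1"
    "\<And>x. x \<in> pts M \<Longrightarrow> regular_at M u x"
proof -
  note MC = closed_manifold_charted[OF M] and MS = closed_manifold_smooth[OF M]
  obtain \<sigma> :: "'a \<Rightarrow> real" where \<sigma>: "smooth_map_on M (pts M) euclid \<sigma>"
    "\<And>z. z \<in> pts M \<Longrightarrow> z \<in> SA \<longleftrightarrow> 0 \<le> \<sigma> z" "\<And>z. z \<in> pts M \<Longrightarrow> z \<in> SB \<longleftrightarrow> \<sigma> z \<le> 0"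
    "\<And>z. z \<in> SA \<inter> SB \<Longrightarrow> regular_at M \<sigma> z"
    by (rule seam_function[OF M MA cover cl NA]) (rule that; assumption)
  obtain A B :: "'a \<Rightarrow> complex" and k QA QB \<Omega> where
    A: "openin (mtop M) QA" "SA \<subseteq> QA" "smooth_map_on M QA euclid A" "\<And>x. x \<in> SA \<Longrightarrow> A x = uA x" "\<And>x. x \<in> QA \<Longrightarrow> cmod (A x) = 1"
    and B: "openin (mtop M) QB" "SB \<subseteq> QB" "smooth_map_on M QB euclid B" "\<And>x. x \<in> SB \<Longrightarrow> B x = uB x" "\<And>x. x \<in> QB \<Longrightarrow> cmod (B x) = 1"
    and \<Omega>: "openin (mtop M) \<Omega>" "SA \<inter> SB \<subseteq> \<Omega>" "\<Omega> \<subseteq> QA" "\<Omega> \<subseteq> QB" and k: "smooth_map_on M \<Omega> euclid k" "\<And>x. x \<in> \<Omega> \<Longrightarrow> B x = A x * cis (k x)"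
    by (rule seam_angle[OF M cl uA(1,2) uB(1,2) h, rotated 3]) (rule that; assumption)
  have SM: "SA \<subseteq> pts M" "SB \<subseteq> pts M" using cover by blast+
  \<comment> \<open>Finite unions preserve this property with the minimum of the \<open>e\<close>
    and the maximum of the \<open>K\<close>, so compactness of the seam yields uniform
    constants.\<close>
  define good where "good Q e K \<longleftrightarrow> openin (mtop M) Q \<and> Q \<subseteq> \<Omega> \<and> (0::real) < e \<and> 0 < K \<and> (\<forall>y\<in>Q. \<bar>k y\<bar> \<le> K) \<and>
    (\<forall>y f f' C. y \<in> Q \<longrightarrow> (\<forall>t. (f has_real_derivative f' t) (at t)) \<longrightarrow>
      0 \<le> f (\<sigma> y) \<longrightarrow> f (\<sigma> y) \<le> 1 \<longrightarrow> f (\<sigma> y) \<le> e \<or> 1 - e \<le> f (\<sigma> y) \<or> K \<le> \<bar>f' (\<sigma> y) * (k y + C)\<bar> \<longrightarrow>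
      regular_at M (\<lambda>z. A z * cis (f (\<sigma> z) * (k z + C))) y)" for Q e K
  have good_ex: "\<exists>Q. x \<in> Q \<and> (\<exists>e K. good Q e K)" if x: "x \<in> SA \<inter> SB" for x
  proof -
    have xs: "x \<in> SA" "x \<in> SB" "x \<in> \<Omega>" "x \<in> pts M" using x \<Omega>(2) SM by blast+
    have \<sigma>x: "\<sigma> x = 0" using \<sigma>(2,3)[OF xs(4)] xs by simp
    have A\<Omega>: "smooth_map_on M \<Omega> euclid A" by (rule smooth_map_on_subset[OF A(3) \<Omega>(3)])
    have a1: "cmod (A y) = 1" if "y \<in> \<Omega>" for y using A(5) \<Omega>(3) that by blast
    have a2: "A y = uA y" if "y \<in> \<Omega> \<inter> SA" for y using A(4) that by blast
    have a3: "A y * cis (k y) = uB y" if "y \<in> \<Omega> \<inter> SB" for y using k(2)[of y] B(4)[of y] that by simp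
    have s1: "0 \<le> \<sigma> y" if "y \<in> SA" for y using \<sigma>(2)[of y] that SM by blast
    have s2: "\<sigma> y \<le> 0" if "y \<in> SB" for y using \<sigma>(3)[of y] that SM by blast
    obtain Q e K where Q: "openin (mtop M) Q" "x \<in> Q" "Q \<subseteq> \<Omega>" "(0::real) < e" "0 < K" "\<And>y. y \<in> Q \<Longrightarrow> \<bar>k y\<bar> \<le> K"
      "\<And>y f f' C. y \<in> Q \<Longrightarrow> \<forall>t. (f has_real_derivative f' t) (at t) \<Longrightarrow>
      0 \<le> f (\<sigma> y) \<Longrightarrow> f (\<sigma> y) \<le> 1 \<Longrightarrow> f (\<sigma> y) \<le> e \<or> 1 - e \<le> f (\<sigma> y) \<or> K \<le> \<bar>f' (\<sigma> y) * (k y + C)\<bar> \<Longrightarrow>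
      regular_at M (\<lambda>z. A z * cis (f (\<sigma> z) * (k z + C))) y"
      by (rule seam_regularity[OF M \<Omega>(1) xs(3) A\<Omega> a1 a2 k(1) a3 \<sigma>(1) s1 s2 \<sigma>x \<sigma>(4)[OF x] xs(1,2) uA(3)[OF xs(1)] uB(3)[OF xs(2)], rotated 5]) (rule that; assumption)
    have "good Q e K" unfolding good_def
    proof (intro conjI ballI allI impI)
      fix y f f' C assume *: "y \<in> Q" "\<forall>t. (f has_real_derivative f' t) (at t)" "0 \<le> f (\<sigma> y)" "f (\<sigma> y) \<le> 1"
        "f (\<sigma> y) \<le> e \<or> 1 - e \<le> f (\<sigma> y) \<or> K \<le> \<bar>f' (\<sigma> y) * (k y + C)\<bar>"
      show "regular_at M (\<lambda>z. A z * cis (f (\<sigma> z) * (k z + C))) y"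
        by (rule Q(7)[OF *])
    qed (use Q in auto)
    then show ?thesis using Q(2) by blast
  qed
  have good_mono: "good Q e' K'" if "good Q e K" "0 < e'" "e' \<le> e" "K \<le> K'" for Q e K e' K'
  proof -
    note g = that(1)[unfolded good_def]
    show ?thesis unfolding good_def
    proof (intro conjI ballI allI impI)
      fix y f f' C assume *: "y \<in> Q" "\<forall>t. (f has_real_derivative f' t) (at t)" "0 \<le> f (\<sigma> y)" "f (\<sigma> y) \<le> 1"
        "f (\<sigma> y) \<le> e' \<or> 1 - e' \<le> f (\<sigma> y) \<or> K' \<le> \<bar>f' (\<sigma> y) * (k y + C)\<bar>"
      then have "f (\<sigma> y) \<le> e \<or> 1 - e \<le> f (\<sigma> y) \<or> K \<le> \<bar>f' (\<sigma> y) * (k y + C)\<bar>" using that by linarith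
      then show "regular_at M (\<lambda>z. A z * cis (f (\<sigma> z) * (k z + C))) y" using g * by blast
    qed (use g that in force)+
  qed
  have good_Union: "\<exists>e K. good (\<Union>\<Q>) e K" if "finite \<Q>" "\<forall>Q\<in>\<Q>. \<exists>e K. good Q e K" for \<Q>
    using that
  proof (induction \<Q> rule: finite_induct)
    case empty
    have "good {} 1 1" by (simp add: good_def)
    then show ?case by auto
  next
    case (insert Q \<Q>)
    obtain e1 K1 where 1: "good Q e1 K1" using insert by blast
    obtain e2 K2 where 2: "good (\<Union>\<Q>) e2 K2" using insert by blast
    have p: "0 < min e1 e2" using 1 2 by (simp add: good_def)
    have 1: "good Q (min e1 e2) (max K1 K2)" by (rule good_mono[OF 1 p]) auto
    have 2: "good (\<Union>\<Q>) (min e1 e2) (max K1 K2)" by (rule good_mono[OF 2 p]) auto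
    have "good (Q \<union> \<Union>\<Q>) (min e1 e2) (max K1 K2)"
      using 1 2 unfolding good_def by (simp only: ball_Un Un_iff Un_subset_iff openin_Un simp_thms) blast
    then show ?case by auto
  qed
  have cpt: "compact_space (mtop M)" using M by (simp add: closed_manifold_def)
  have "compactin (mtop M) (SA \<inter> SB)" using closedin_compact_space[OF cpt closedin_Int[OF cl]] .
  moreover have "SA \<inter> SB \<subseteq> \<Union>{Q. \<exists>e K. good Q e K}" using good_ex by blast
  moreover have "\<And>Q. Q \<in> {Q. \<exists>e K. good Q e K} \<Longrightarrow> openin (mtop M) Q" by (auto simp: good_def)
  ultimately obtain \<Q> where \<Q>: "finite \<Q>" "\<Q> \<subseteq> {Q. \<exists>e K. good Q e K}" "SA \<inter> SB \<subseteq> \<Union>\<Q>"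
    using compactinD[of "mtop M" "SA \<inter> SB" "{Q. \<exists>e K. good Q e K}"] by metis
  obtain e K where gO: "good (\<Union>\<Q>) e K" using good_Union[OF \<Q>(1)] \<Q>(2) by blast
  define Oq where "Oq = \<Union>\<Q>"
  have Oq: "openin (mtop M) Oq" "SA \<inter> SB \<subseteq> Oq" "Oq \<subseteq> \<Omega>" "0 < e" "0 < K" "\<And>y. y \<in> Oq \<Longrightarrow> \<bar>k y\<bar> \<le> K"
    using gO \<Q>(3) by (auto simp: good_def Oq_def)
  have reg: "regular_at M (\<lambda>z. A z * cis (f (\<sigma> z) * (k z + C))) y"
    if "y \<in> Oq" "\<And>t. (f has_real_derivative f' t) (at t)" "0 \<le> f (\<sigma> y)" "f (\<sigma> y) \<le> 1"
      "f (\<sigma> y) \<le> e \<or> 1 - e \<le> f (\<sigma> y) \<or> K \<le> \<bar>f' (\<sigma> y) * (k y + C)\<bar>" for y f f' C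
    using gO that unfolding good_def Oq_def by blast
  \<comment> \<open>The complement of \<open>Oq\<close> is compact and \<open>\<sigma>\<close> has
    no zero on it, so the absolute value of \<open>\<sigma>\<close> is bounded below there.\<close>
  obtain r where r: "0 < r" "\<And>y. y \<in> pts M \<Longrightarrow> \<bar>\<sigma> y\<bar> \<le> r \<Longrightarrow> y \<in> Oq"
  proof -
    have "compactin (mtop M) (pts M - Oq)"
      by (rule closedin_compact_space[OF cpt]) (use Oq(1) in blast)
    moreover have "continuous_map (mtop M) euclidean \<sigma>" using smooth_map_on_continuous[OF \<sigma>(1)] by simp
    ultimately have "compactin euclidean (\<sigma> ` (pts M - Oq))" by (rule image_compactin)
    then have "closed (\<sigma> ` (pts M - Oq))" by (simp add: compact_imp_closed)
    moreover have "0 \<notin> \<sigma> ` (pts M - Oq)"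
    proof
      assume "0 \<in> \<sigma> ` (pts M - Oq)"
      then obtain y where y: "y \<in> pts M" "y \<notin> Oq" "\<sigma> y = 0" by auto
      then have "y \<in> SA \<inter> SB" using \<sigma>(2,3)[OF y(1)] by simp
      then show False using y(2) Oq(2) by blast
    qed
    ultimately have "open (- \<sigma> ` (pts M - Oq))" "0 \<in> - \<sigma> ` (pts M - Oq)" by (auto simp: open_Compl)
    then obtain r where r: "0 < r" "ball 0 r \<subseteq> - \<sigma> ` (pts M - Oq)"
      using open_contains_ball by blast
    show thesis
    proof (rule that[of "r / 2"])
      fix y assume y: "y \<in> pts M" "\<bar>\<sigma> y\<bar> \<le> r / 2"
      then have "\<sigma> y \<in> ball 0 r" using r(1) by (simp add: dist_real_def)
      then show "y \<in> Oq" using r(2) y(1) by blast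
    qed (use r in simp)
  qed
  obtain d where d: "\<And>s. (smooth_step has_real_derivative d s) (at s)" "\<And>s. -1 < s \<Longrightarrow> s < 1 \<Longrightarrow> 0 < d s" "continuous_on UNIV d"
    using smooth_step_deriv by metis
  \<comment> \<open>On the compact set where the step is neither near 0 nor near 1 its derivative
    attains a positive minimum; the endpoints \<open>-1\<close> and \<open>1\<close> are excluded by
    their values 0 and 1.\<close>
  define T where "T = {t \<in> {-1..1}. e \<le> smooth_step t \<and> smooth_step t \<le> 1 - e}"
  have cs: "continuous_on UNIV smooth_step" by (rule smooth_on_continuous[OF smooth_on_smooth_step])
  have "T = {-1..1} \<inter> (smooth_step -` {e..1 - e})" by (auto simp: T_def)
  then have "compact T"
    using continuous_closed_vimage[of "{e..1 - e}" smooth_step] cs by (simp add: compact_Int_closed continuous_on_eq_continuous_at)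
  obtain \<delta> where \<delta>: "0 < \<delta>" "\<And>t. t \<in> T \<Longrightarrow> \<delta> \<le> d t"
  proof (cases "T = {}")
    case True
    then show thesis using that[of 1] by simp
  next
    case False
    obtain t0 where t0: "t0 \<in> T" "\<And>t. t \<in> T \<Longrightarrow> d t0 \<le> d t"
      using continuous_attains_inf[OF \<open>compact T\<close> False continuous_on_subset[OF d(3)]] by auto
    have "t0 \<noteq> -1" "t0 \<noteq> 1" using t0(1) smooth_step_eq_0[of "-1"] smooth_step_eq_1[of 1] Oq(4) by (auto simp: T_def)
    then have "0 < d t0" using t0(1) by (intro d(2)) (auto simp: T_def)
    then show thesis using that t0(2) by blast
  qed
  \<comment> \<open>Where \<open>f\<close> is close to 0 or 1 the turning curves of \<open>uA\<close> and \<open>uB\<close> give regularity; elsewhere \<open>f'\<close> is bounded away from 0 and a large \<open>C\<close> makes the derivative of \<open>\<sigma>\<close> dominate.\<close>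
  define C where "C = K * r / \<delta> + K"
  define f where "f t = smooth_step (- (t / r))" for t
  define f' where "f' t = - (d (- (t / r)) / r)" for t
  have f: "(f has_real_derivative f' t) (at t)" for t
  proof -
    have "((\<lambda>t. - (t / r)) has_real_derivative - (1 / r)) (at t)" using r(1) by (auto intro!: derivative_eq_intros)
    from DERIV_chain2[OF d(1) this] show ?thesis by (simp add: f_def[abs_def] f'_def)
  qed
  have fs: "smooth_on UNIV f"
  proof -
    have "smooth_on UNIV (\<lambda>t. - (t / r))"
      by (rule smooth_on_minus[OF smooth_on_linear[OF bounded_linear_divide smooth_on_id]]) simp
    then show ?thesis unfolding f_def[abs_def] by (rule smooth_on_compose[OF smooth_on_smooth_step]) simp
  qed
  have f01: "0 \<le> f t" "f t \<le> 1" for t using smooth_step_range by (auto simp: f_def)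
  have f0: "f t = 0" if "r \<le> t" for t proof -
    have "1 \<le> t / r" using that r(1) by (subst le_divide_eq_1_pos) auto
    then show ?thesis by (simp add: f_def smooth_step_eq_0)
  qed
  have f1: "f t = 1" if "t \<le> - r" for t
  proof -
    have "1 \<le> (- t) / r" using that r(1) by (subst le_divide_eq_1_pos) auto
    then have "1 \<le> - (t / r)" by simp
    then show ?thesis by (simp add: f_def smooth_step_eq_1)
  qed
  define w where "w = (\<lambda>z. A z * cis (f (\<sigma> z) * (k z + C)))"
  \<comment> \<open>Outside \<open>Oq\<close> the cutoff is constantly 0 or 1, and the interpolation
    would be \<open>A\<close> or \<open>A cis (k + C) = B cis C\<close>; these expressions continue
    over the rest of the respective piece.\<close>
  define u where "u z = (if z \<in> Oq then w z else if 0 < \<sigma> z then A z else B z * cis C)" for z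
  have OM: "Oq \<subseteq> pts M" using openin_subset[OF Oq(1)] .
  have w: "smooth_map_on M Oq euclid w"
  proof -
    have 1: "smooth_map_on M Oq euclid (\<lambda>z. f (\<sigma> z))"
      by (rule smooth_map_on_smooth_on[OF MC smooth_map_on_subset[OF \<sigma>(1) OM] fs]) simp
    have 2: "smooth_map_on M Oq euclid (\<lambda>z. k z + C)"
      by (rule smooth_map_on_add[OF MC smooth_map_on_subset[OF k(1) Oq(3)] smooth_map_on_const[OF MC]])
    have 3: "smooth_map_on M Oq euclid (\<lambda>z. cis (f (\<sigma> z) * (k z + C)))"
      by (rule smooth_map_on_smooth_on[OF MC smooth_map_on_mult[OF MC 1 2] smooth_on_cis]) simp
    have 4: "smooth_map_on M Oq euclid A" by (rule smooth_map_on_subset[OF A(3)]) (use Oq(3) \<Omega>(3) in blast)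
    show ?thesis unfolding w_def by (rule smooth_map_on_mult[OF MC 4 3])
  qed
  define P where "P = {z \<in> pts M. \<sigma> z \<in> {r<..}}"
  define N where "N = {z \<in> pts M. \<sigma> z \<in> {..<-r}}"
  have P: "openin (mtop M) P" "P \<subseteq> SA"
  proof -
    show "openin (mtop M) P" unfolding P_def by (rule openin_smooth_preimage[OF \<sigma>(1)]) auto
    show "P \<subseteq> SA"
    proof
      fix z assume "z \<in> P"
      then have "z \<in> pts M" "0 \<le> \<sigma> z" using r(1) by (auto simp: P_def)
      then show "z \<in> SA" using \<sigma>(2) by blast
    qed
  qed
  have N: "openin (mtop M) N" "N \<subseteq> SB"
  proof -
    show "openin (mtop M) N" unfolding N_def by (rule openin_smooth_preimage[OF \<sigma>(1)]) auto
    show "N \<subseteq> SB"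
    proof
      fix z assume "z \<in> N"
      then have "z \<in> pts M" "\<sigma> z \<le> 0" using r(1) by (auto simp: N_def)
      then show "z \<in> SB" using \<sigma>(3) by blast
    qed
  qed
  have cover3: "z \<in> Oq \<or> z \<in> P \<or> z \<in> N" if z: "z \<in> pts M" for z
  proof -
    consider "\<bar>\<sigma> z\<bar> \<le> r" | "r < \<sigma> z" | "\<sigma> z < - r" by linarith
    then show ?thesis
      by cases (use r(2)[OF z] z in \<open>auto simp: P_def N_def\<close>)
  qed
  have uP: "u z = A z" if "z \<in> P" for z using that f0[of "\<sigma> z"] r(1) by (auto simp: u_def w_def P_def)
  have uN: "u z = B z * cis C" if "z \<in> N" for z
    using that f1[of "\<sigma> z"] r(1) k(2)[of z] Oq(3) by (auto simp: u_def w_def N_def cis_mult[symmetric] mult.assoc)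
  have uO: "u z = w z" if "z \<in> Oq" for z using that by (simp add: u_def)
  have sP: "smooth_map_on M P euclid u"
    by (rule smooth_map_on_cong[OF MC smooth_map_on_subset[OF A(3)]]) (use P A(2) uP in auto)
  have sN: "smooth_map_on M N euclid u"
  proof -
    have "smooth_map_on M N euclid (\<lambda>z. B z * cis C)"
      by (rule smooth_map_on_mult[OF MC smooth_map_on_subset[OF B(3)] smooth_map_on_const[OF MC]]) (use N B(2) in auto)
    then show ?thesis by (rule smooth_map_on_cong[OF MC]) (use uN in auto)
  qed
  have sO: "smooth_map_on M Oq euclid u"
    by (rule smooth_map_on_cong[OF MC w]) (use uO in auto)
  show thesis
  proof (rule that[of u])
    show "smooth_map_on M (pts M) euclid u"
    proof (rule smooth_map_on_local[OF MC])
      fix x assume "x \<in> pts M"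
      have sub: "smooth_map_on M (pts M \<inter> Q) euclid u" if "smooth_map_on M Q euclid u" for Q
        by (rule smooth_map_on_subset[OF that]) simp
      from cover3[OF \<open>x \<in> pts M\<close>] show "\<exists>Q. openin (mtop M) Q \<and> x \<in> Q \<and> smooth_map_on M (pts M \<inter> Q) euclid u"
      proof (elim disjE)
        assume "x \<in> Oq" then show ?thesis using Oq(1) sub[OF sO] by (intro exI[of _ Oq]) simp
      next
        assume "x \<in> P" then show ?thesis using P(1) sub[OF sP] by (intro exI[of _ P]) simp
      next
        assume "x \<in> N" then show ?thesis using N(1) sub[OF sN] by (intro exI[of _ N]) simp
      qed
    qed
    fix x assume x: "x \<in> pts M"
    show "cmod (u x) = 1" using cover3[OF x]
    proof (elim disjE)
      assume "x \<in> Oq" then show ?thesis using uO A(5)[of x] Oq(3) \<Omega>(3) by (auto simp: w_def norm_mult)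
    next
      assume "x \<in> P" then show ?thesis using uP A(5)[of x] P(2) A(2) by auto
    next
      assume "x \<in> N" then show ?thesis using uN B(5)[of x] N(2) B(2) by (auto simp: norm_mult)
    qed
    show "regular_at M u x" using cover3[OF x]
    proof (elim disjE)
      assume xO: "x \<in> Oq"
      have "regular_at M w x" unfolding w_def
      proof (rule reg[OF xO f f01])
        show "f (\<sigma> x) \<le> e \<or> 1 - e \<le> f (\<sigma> x) \<or> K \<le> \<bar>f' (\<sigma> x) * (k x + C)\<bar>"
        proof (rule ccontr)
          assume n: "\<not> (f (\<sigma> x) \<le> e \<or> 1 - e \<le> f (\<sigma> x) \<or> K \<le> \<bar>f' (\<sigma> x) * (k x + C)\<bar>)"
          let ?t = "- (\<sigma> x / r)"
          have st: "e < smooth_step ?t" "smooth_step ?t < 1 - e" using n by (auto simp: f_def)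
          have "-1 < ?t" using smooth_step_eq_0[of ?t] st(1) Oq(4) by linarith
          moreover have "?t < 1" using smooth_step_eq_1[of ?t] st(2) Oq(4) by linarith
          ultimately have "?t \<in> T" using st by (auto simp: T_def)
          then have dt: "\<delta> \<le> d ?t" by (rule \<delta>(2))
          \<comment> \<open>The summand \<open>K\<close> of \<open>C\<close> absorbs the bound on
            \<open>k\<close>; the other summand is calibrated against the lower bound
            \<open>\<delta> / r\<close> for the absolute value of \<open>f'\<close>.\<close>
          have kc: "K * r / \<delta> \<le> k x + C" using Oq(6)[OF xO] by (simp add: C_def abs_le_iff)
          have pos: "0 \<le> K * r / \<delta>" using Oq(5) r(1) \<delta>(1) by simp
          have "K = (\<delta> / r) * (K * r / \<delta>)" using r(1) \<delta>(1) by simp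
          also have "\<dots> \<le> (d ?t / r) * (k x + C)"
            using dt kc pos r(1) \<delta>(1) by (intro mult_mono divide_right_mono) auto
          also have "\<dots> = - (f' (\<sigma> x) * (k x + C))" by (simp add: f'_def)
          also have "\<dots> \<le> \<bar>f' (\<sigma> x) * (k x + C)\<bar>" by linarith
          finally show False using n by simp
        qed
      qed
      then obtain V \<psi> v where V: "(V, \<psi>) \<in> atlas M" "x \<in> V" "frechet_derivative (\<lambda>p. w (inv_into V \<psi> p)) (at (\<psi> x)) v \<noteq> 0"
        unfolding regular_at_def by blast
      have "frechet_derivative (\<lambda>p. u (inv_into V \<psi> p)) (at (\<psi> x)) = frechet_derivative (\<lambda>p. w (inv_into V \<psi> p)) (at (\<psi> x))"
        by (rule frechet_derivative_cong_open[OF smooth_on_open[OF closed_chart_smooth[OF M w Oq(1) V(1)]]])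
          (use xO V(2) uO coord_inv[OF charted_coord[OF MC V(1)]] in auto)
      then have "frechet_derivative (\<lambda>p. u (inv_into V \<psi> p)) (at (\<psi> x)) v \<noteq> 0" using V(3) by simp
      then show ?thesis using V(1,2) unfolding regular_at_def by blast
    next
      assume xP: "x \<in> P"
      have xA: "x \<in> SA" using xP P(2) by blast
      have "uA x \<noteq> 0" using uA(2)[OF xA] by auto
      then show ?thesis
        using regular_at_turning_curve[OF M sP P(1) xP uA(3)[OF xA], of 1] uP A(4) by simp
    next
      assume xN: "x \<in> N"
      have xB: "x \<in> SB" using xN N(2) by blast
      have "uB x \<noteq> 0" using uB(2)[OF xB] by auto
      then show ?thesis
        using regular_at_turning_curve[OF M sN N(1) xN uB(3)[OF xB], of "cis C"] uN B(4) by (simp add: mult.commute)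
    qed
  qed
qed

section \<open>Submersions to the circle are fiber bundles\<close>

text \<open>A chart \<open>G\<close> onto a ball, with inverse \<open>R\<close>, in which the
  coordinate \<open>i\<close> is the angle of \<open>u\<close> relative to \<open>b\<close>. Since
  \<open>q\<close> has coordinate 0 and \<open>r \<le> 1\<close>, the angle stays between
  \<open>-1\<close> and \<open>1\<close>, where \<open>cis\<close> is injective.\<close>

definition adapted_chart ::
  "('a, real^'n) manifold \<Rightarrow> ('a \<Rightarrow> complex) \<Rightarrow> complex \<Rightarrow> 'n \<Rightarrow> 'a set \<Rightarrow> ('a \<Rightarrow> real^'n) \<Rightarrow> (real^'n \<Rightarrow> 'a) \<Rightarrow> real^'n \<Rightarrow> real \<Rightarrow> bool" where
  "adapted_chart M u b i W G R q r \<longleftrightarrow> openin (mtop M) W \<and> smooth_map_on M W euclid G \<and> smooth_map_on euclid (ball q r) M R \<and>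
     G ` W = ball q r \<and> (\<forall>z\<in>W. R (G z) = z) \<and> 0 < r \<and> r \<le> 1 \<and> q $ i = 0 \<and> (\<forall>z\<in>W. u z = b * cis (G z $ i))"

lemma local_angle:
  fixes M :: "('a, 'e::euclidean_space) manifold" and u :: "'a \<Rightarrow> complex"
  assumes M: "closed_manifold M" and u: "smooth_map_on M (pts M) euclid u" "\<And>x. x \<in> pts M \<Longrightarrow> cmod (u x) = 1" and x: "x \<in> pts M"
  obtains Q \<theta> where "openin (mtop M) Q" "x \<in> Q" "smooth_map_on M Q euclid \<theta>" "\<And>y. y \<in> Q \<Longrightarrow> u y = u x * cis (\<theta> y)" "\<theta> x = 0"
proof -
  note MC = closed_manifold_charted[OF M]
  have c0: "u x \<noteq> 0" using u(2)[OF x] by auto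
  define r where "r = (\<lambda>y. u y * inverse (u x))"
  have r: "smooth_map_on M (pts M) euclid r" unfolding r_def
    by (rule smooth_map_on_mult[OF MC u(1) smooth_map_on_const[OF MC]])
  define Q where "Q = {y \<in> pts M. r y \<in> - \<real>\<^sub>\<le>\<^sub>0}"
  show thesis
  proof (rule that[of Q "\<lambda>y. Im (Ln (r y))"])
    show "openin (mtop M) Q" unfolding Q_def by (rule openin_smooth_preimage[OF r]) auto
    show "x \<in> Q" using x c0 by (simp add: Q_def r_def)
    show "Im (Ln (r x)) = 0" using c0 by (simp add: r_def)
    have sub: "Q \<subseteq> pts M" by (auto simp: Q_def)
    show "smooth_map_on M Q euclid (\<lambda>y. Im (Ln (r y)))"
      by (rule smooth_map_on_smooth_on[OF MC smooth_map_on_subset[OF r sub] smooth_on_Im_Ln]) (simp add: Q_def)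
    fix y assume "y \<in> Q"
    then have "cmod (u y) = 1" using u(2) sub by blast
    then have "cmod (r y) = 1" using u(2)[OF x] by (simp add: r_def norm_mult norm_inverse)
    moreover from this have "r y \<noteq> 0" by auto
    ultimately have "cis (Im (Ln (r y))) = r y" using cis_Im_Ln[of "r y"] by simp
    then show "u y = u x * cis (Im (Ln (r y)))" using c0 by (simp add: r_def)
  qed
qed

text \<open>The submersion theorem in coordinates: one coordinate \<open>i\<close>, in whose
  direction the angle has nonzero derivative, is replaced by the angle, and the inverse function
  theorem applies to this change of coordinates.\<close>

lemma ex_adapted_chart:
  fixes M :: "('a, real^'n) manifold" and u :: "'a \<Rightarrow> complex"
  assumes M: "closed_manifold M" and u: "smooth_map_on M (pts M) euclid u" "\<And>x. x \<in> pts M \<Longrightarrow> cmod (u x) = 1"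
    and reg: "\<And>x. x \<in> pts M \<Longrightarrow> regular_at M u x" and x: "x \<in> pts M"
  shows "\<exists>i W G R q r. adapted_chart M u (u x) i W G R q r \<and> x \<in> W \<and> G x = q"
proof -
  note MC = closed_manifold_charted[OF M] and MS = closed_manifold_smooth[OF M]
  obtain Q \<theta> where Q: "openin (mtop M) Q" "x \<in> Q" and \<theta>: "smooth_map_on M Q euclid \<theta>" "\<And>y. y \<in> Q \<Longrightarrow> u y = u x * cis (\<theta> y)" "\<theta> x = 0"
    by (rule local_angle[OF M u x, rotated]) (rule that; assumption)
  obtain V \<psi> where V: "(V, \<psi>) \<in> atlas M" "x \<in> V" using charted_obtain[OF MC x] by blast
  have d: "coord (mtop M) V \<psi>" using charted_coord[OF MC V(1)] .
  have QM: "Q \<subseteq> pts M" using openin_subset[OF Q(1)] .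
  let ?P = "\<psi> ` (Q \<inter> V)"
  define t where "t = (\<lambda>p. \<theta> (inv_into V \<psi> p))"
  have t: "smooth_on ?P t" unfolding t_def by (rule closed_chart_smooth[OF M \<theta>(1) Q(1) V(1)])
  have px: "\<psi> x \<in> ?P" using Q V by blast
  let ?D = "frechet_derivative t (at (\<psi> x))"
  have D: "(t has_derivative ?D) (at (\<psi> x))" using smooth_on_has_derivative[OF t px] .
  have linD: "linear ?D" using has_derivative_linear[OF D] .
  obtain w where w: "?D w \<noteq> 0"
  proof -
    obtain w where w: "frechet_derivative (\<lambda>p. u (inv_into V \<psi> p)) (at (\<psi> x)) w \<noteq> 0"
      by (rule regular_at_all_charts[OF M smooth_map_on_subset[OF u(1) QM] Q reg[OF x] V])
    have "((\<lambda>p. u x * cis (t p)) has_derivative (\<lambda>v. u x * (?D v *\<^sub>R (\<i> * cis (t (\<psi> x)))))) (at (\<psi> x))"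
      by (rule has_derivative_mult_right[OF has_derivative_cis[OF D]])
    then have "frechet_derivative (\<lambda>p. u x * cis (t p)) (at (\<psi> x)) = (\<lambda>v. u x * (?D v *\<^sub>R (\<i> * cis (t (\<psi> x)))))"
      by (rule frechet_derivative_at[symmetric])
    moreover have "frechet_derivative (\<lambda>p. u (inv_into V \<psi> p)) (at (\<psi> x)) = frechet_derivative (\<lambda>p. u x * cis (t p)) (at (\<psi> x))"
      by (rule frechet_derivative_cong_open[OF smooth_on_open[OF t] px]) (use \<theta>(2) coord_inv[OF d] in \<open>auto simp: t_def\<close>)
    ultimately have "?D w \<noteq> 0" using w by auto
    then show thesis using that by blast
  qed
  have "\<exists>i. ?D (axis i 1) \<noteq> 0"
  proof (rule ccontr)
    assume n: "\<not> ?thesis"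
    have "?D w = ?D (\<Sum>i\<in>UNIV. w $ i *\<^sub>R (axis i 1 :: real^'n))"
      using basis_expansion[of w] by (simp add: scalar_mult_eq_scaleR)
    also have "\<dots> = (\<Sum>i\<in>UNIV. w $ i *\<^sub>R ?D (axis i 1))"
      by (simp add: linear_sum[OF linD] linear_scale[OF linD])
    finally show False using n w by simp
  qed
  then obtain i where i: "?D (axis i 1) \<noteq> 0" by blast
  define g where "g = (\<lambda>p. p + (t p - p $ i) *\<^sub>R (axis i 1 :: real^'n))"
  have pid: "smooth_on ?P (\<lambda>p. p)" by (rule smooth_on_id[OF smooth_on_open[OF t]])
  have g: "smooth_on ?P g" unfolding g_def
    by (rule smooth_on_add[OF pid smooth_on_scaleR[OF smooth_on_diff[OF t smooth_on_linear[OF bounded_linear_vec_nth pid]] smooth_on_const[OF smooth_on_open[OF t]]]])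
  have gi: "g p $ i = t p" for p by (simp add: g_def)
  have gj: "g p $ j = p $ j" if "j \<noteq> i" for p j using that by (simp add: g_def axis_def)
  have Dg: "(g has_derivative (\<lambda>v. v + (?D v - v $ i) *\<^sub>R axis i 1)) (at (\<psi> x))"
  proof -
    have "((\<lambda>p. p $ i) has_derivative (\<lambda>v. v $ i)) (at (\<psi> x))"
      by (rule bounded_linear.has_derivative[OF bounded_linear_vec_nth]) simp
    from has_derivative_add[OF has_derivative_ident has_derivative_scaleR_left[OF has_derivative_diff[OF D this], of "axis i 1"]]
    show ?thesis unfolding g_def by simp
  qed
  have inj: "v = 0" if v: "frechet_derivative g (at (\<psi> x)) v = 0" for v
  proof -
    have e: "v + (?D v - v $ i) *\<^sub>R axis i 1 = 0" using v fun_cong[OF frechet_derivative_at[OF Dg], of v] by simp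
    have vj: "v $ j = 0" if "j \<noteq> i" for j
      using arg_cong[OF e, of "\<lambda>z. z $ j"] that by (simp add: axis_def)
    have "?D v = 0" using arg_cong[OF e, of "\<lambda>z. z $ i"] by simp
    moreover have "v = v $ i *\<^sub>R axis i 1" using vj by (simp add: vec_eq_iff axis_def)
    then have "?D v = v $ i *\<^sub>R ?D (axis i 1)" using linear_scale[OF linD] by metis
    ultimately have "v $ i = 0" using i by simp
    then show "v = 0" using vj by (metis vec_eq_iff zero_index)
  qed
  obtain U k where U: "open U" "\<psi> x \<in> U" "U \<subseteq> ?P" "smooth_on (g ` U) k" "\<And>p. p \<in> U \<Longrightarrow> k (g p) = p"
    by (rule smooth_inverse_function[OF g px inj]) auto
  define q where "q = g (\<psi> x)"
  have "q \<in> g ` U" using U(2) by (simp add: q_def)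
  then obtain r0 where r0: "0 < r0" "ball q r0 \<subseteq> g ` U"
    using smooth_on_open[OF U(4)] open_contains_ball by blast
  define r where "r = min r0 1"
  have r: "0 < r" "r \<le> 1" "ball q r \<subseteq> g ` U" using r0 by (auto simp: r_def)
  have qi: "q $ i = 0" using \<theta>(3) coord_inv[OF d V(2)] by (simp add: q_def gi t_def)
  have oB: "open (U \<inter> g -` ball q r)"
    by (rule smooth_on_preimage[OF smooth_on_subset[OF g U(1,3)]]) simp
  define W where "W = Q \<inter> (V \<inter> \<psi> -` (U \<inter> g -` ball q r))"
  define G where "G = (\<lambda>z. g (\<psi> z))"
  define R where "R = (\<lambda>p. inv_into V \<psi> (k p))"
  have Bz: "\<exists>z. z \<in> W \<and> G z = p \<and> R p = z" if p: "p \<in> ball q r" for p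
  proof -
    obtain y where y: "y \<in> U" "p = g y" using p r(3) by blast
    obtain z where z: "z \<in> Q" "z \<in> V" "y = \<psi> z" using y(1) U(3) by blast
    have "R p = z" using U(5)[OF y(1)] y(2) z coord_inv[OF d z(2)] by (simp add: R_def)
    then show ?thesis using p y z by (intro exI[of _ z]) (simp add: W_def G_def)
  qed
  have "adapted_chart M u (u x) i W G R q r"
    unfolding adapted_chart_def
  proof (intro conjI ballI)
    show "openin (mtop M) W" unfolding W_def using Q(1) coord_preimage[OF d oB] by blast
    have WV: "W \<subseteq> V" by (auto simp: W_def)
    show "smooth_map_on M W euclid G" unfolding G_def
      by (rule smooth_map_on_smooth_on[OF MC smooth_map_on_subset[OF smooth_map_on_chart[OF MS V(1)] WV] smooth_on_subset[OF g U(1,3)]])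
        (simp add: W_def)
    have k1: "smooth_map_on euclid (ball q r) euclid k"
      unfolding smooth_map_on_euclid_euclid by (rule smooth_on_set_subset[OF smooth_on_imp_smooth_on_set[OF U(4)] r(3)])
    show "smooth_map_on euclid (ball q r) M R" unfolding R_def
    proof (rule smooth_map_on_compose[OF charted_euclid charted_euclid k1 smooth_map_on_chart_inv[OF MS V(1)]])
      fix p assume "p \<in> ball q r"
      then obtain y where y: "y \<in> U" "p = g y" using r(3) by blast
      then show "k p \<in> \<psi> ` V" using U(3,5) by auto
    qed
    show "G ` W = ball q r"
    proof
      show "G ` W \<subseteq> ball q r" by (auto simp: G_def W_def)
      show "ball q r \<subseteq> G ` W" using Bz by blast
    qed
    show "R (G z) = z" if "z \<in> W" for z using that U(5)[of "\<psi> z"] coord_inv[OF d, of z] by (simp add: W_def G_def R_def)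
    show "u z = u x * cis (G z $ i)" if "z \<in> W" for z
      using that \<theta>(2)[of z] coord_inv[OF d, of z] by (simp add: W_def G_def gi t_def)
  qed (use r qi in auto)
  moreover have "x \<in> W" using Q(2) V(2) U(2) r(1) by (simp add: W_def q_def)
  ultimately show ?thesis unfolding q_def G_def by blast
qed

lemma adapted_chartD:
  assumes "adapted_chart M u b i W G R q r"
  shows "openin (mtop M) W" "smooth_map_on M W euclid G" "smooth_map_on euclid (ball q r) M R"
    "\<And>z. z \<in> W \<Longrightarrow> G z \<in> ball q r" "\<And>z. z \<in> W \<Longrightarrow> R (G z) = z" "0 < r" "r \<le> 1" "q $ i = 0" "\<And>z. z \<in> W \<Longrightarrow> u z = b * cis (G z $ i)"
    "\<And>p. p \<in> ball q r \<Longrightarrow> R p \<in> W" "\<And>p. p \<in> ball q r \<Longrightarrow> G (R p) = p" "\<And>z. z \<in> W \<Longrightarrow> \<bar>G z $ i\<bar> < 1" "W \<subseteq> pts M"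
proof -
  note a = assms[unfolded adapted_chart_def]
  have *: "\<exists>z. z \<in> W \<and> p = G z" if "p \<in> ball q r" for p using a that by blast
  show "R p \<in> W" "G (R p) = p" if "p \<in> ball q r" for p using *[OF that] a by auto
  show "\<bar>G z $ i\<bar> < 1" if "z \<in> W" for z
  proof -
    have "G z \<in> ball q r" using a that by blast
    then have "norm (G z - q) < 1" using a by (auto simp: dist_norm norm_minus_commute)
    then show ?thesis using component_le_norm_cart[of "G z - q" i] a by simp
  qed
  show "W \<subseteq> pts M" using a openin_subset by blast
qed (use assms[unfolded adapted_chart_def] in auto)

lemma cis_inj_small:
  assumes "cis s = cis t" "\<bar>s\<bar> < 1" "\<bar>t\<bar> < 1"
  shows "s = t"
proof -
  have "\<bar>s\<bar> < pi" "\<bar>t\<bar> < pi" using assms pi_gt3 by linarith+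
  have "s = Im (Ln (cis s))" using Ln_cis[OF \<open>\<bar>s\<bar> < pi\<close>] by (rule sym)
  also have "\<dots> = t" unfolding assms(1) by (rule Ln_cis[OF \<open>\<bar>t\<bar> < pi\<close>])
  finally show ?thesis .
qed

lemma adapted_chart_fiber:
  assumes "adapted_chart M u b i W G R q r" "z \<in> W" "b \<noteq> 0"
  shows "u z = b \<longleftrightarrow> G z $ i = 0"
proof
  note uz = adapted_chartD(9)[OF assms(1,2)]
  show "G z $ i = 0 \<Longrightarrow> u z = b" by (simp add: uz)
  assume "u z = b"
  then have "cis (G z $ i) = 1" using uz assms(3) by simp
  then show "G z $ i = 0" using cis_inj_small[of "G z $ i" 0] adapted_chartD(12)[OF assms(1,2)] by simp
qed

lemma ex_hyperplane_iso:
  fixes i :: "'n::finite"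
  assumes "CARD('n) = DIM('d::euclidean_space) + 1"
  obtains L :: "real^'n \<Rightarrow> 'd::euclidean_space" and J :: "'d::euclidean_space \<Rightarrow> real^'n" where "linear L" "linear J" "\<And>y. L (J y) = y" "\<And>y. J y $ i = 0" "\<And>p. p $ i = 0 \<Longrightarrow> J (L p) = p"
proof -
  let ?H = "{p :: real^'n. axis i 1 \<bullet> p = 0}"
  have H: "p \<in> ?H \<longleftrightarrow> p $ i = 0" for p by (simp add: inner_axis' )
  have dimH: "dim ?H = dim (UNIV :: 'd set)"
    using dim_hyperplane[of "axis i 1 :: real^'n"] assms by (simp add: axis_eq_0_iff)
  have sH: "subspace ?H" by (rule subspace_hyperplane)
  obtain f g where fg: "linear f" "linear g" "f ` ?H = (UNIV :: 'd set)" "g ` (UNIV :: 'd set) = ?H"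
    "\<And>x. x \<in> ?H \<Longrightarrow> g (f x) = x" "\<And>x. x \<in> (UNIV :: 'd set) \<Longrightarrow> f (g x) = x"
    by (rule isometries_subspaces[OF sH subspace_UNIV dimH]) blast
  show thesis
  proof (rule that[OF fg(1,2)])
    show "g y $ i = 0" for y using fg(4) H by blast
  qed (use fg H in auto)
qed

text \<open>In an adapted chart the fiber is the hyperplane where the coordinate \<open>i\<close>
  vanishes; the linear maps \<open>L\<close> and \<open>J\<close> identify this hyperplane with the
  model space of the fiber.\<close>

lemma smooth_manifold_fiber:
  fixes M :: "('a, real^'n) manifold" and u :: "'a \<Rightarrow> complex"
  assumes M: "closed_manifold M" and u: "smooth_map_on M (pts M) euclid u" "\<And>x. x \<in> pts M \<Longrightarrow> cmod (u x) = 1"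
    and reg: "\<And>x. x \<in> pts M \<Longrightarrow> regular_at M u x" and dim: "CARD('n) = DIM('d::euclidean_space) + 1"
  shows "smooth_manifold (submanifold M {z \<in> pts M. u z = b} :: ('a, 'd::euclidean_space) manifold)"
proof -
  note MC = closed_manifold_charted[OF M] and MS = closed_manifold_smooth[OF M]
  let ?F = "{z \<in> pts M. u z = b}"
  have "charted (submanifold M ?F :: ('a, 'd) manifold)"
  proof (rule charted_submanifoldI)
    fix x assume x: "x \<in> ?F" "x \<in> pts M"
    obtain i W G R q r where a: "adapted_chart M u (u x) i W G R q r" and xW: "x \<in> W"
      using ex_adapted_chart[OF M u reg x(2)] by blast
    have b: "u x = b" "b \<noteq> 0" using x u(2)[of x] by auto
    note aD = adapted_chartD[OF a]
    have fib: "u z = b \<longleftrightarrow> G z $ i = 0" if "z \<in> W" for z using adapted_chart_fiber[OF a that] b by simp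
    obtain L :: "real^'n \<Rightarrow> 'd" and J where LJ: "linear L" "linear J" "\<And>y. L (J y) = y" "\<And>y. J y $ i = 0" "\<And>p. p $ i = 0 \<Longrightarrow> J (L p) = p"
      using ex_hyperplane_iso[OF dim, of i] by metis
    define U where "U = ?F \<inter> W"
    define \<phi> where "\<phi> z = L (G z)" for z
    have im: "\<phi> ` U = J -` ball q r"
    proof
      show "\<phi> ` U \<subseteq> J -` ball q r"
      proof
        fix y assume "y \<in> \<phi> ` U"
        then obtain z where z: "y = \<phi> z" "z \<in> W" "u z = b" by (auto simp: U_def)
        have "J y = G z" using LJ(5) fib[OF z(2)] z(1,3) by (simp add: \<phi>_def)
        then show "y \<in> J -` ball q r" using aD(4)[OF z(2)] by simp
      qed
      show "J -` ball q r \<subseteq> \<phi> ` U"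
      proof
        fix y assume "y \<in> J -` ball q r"
        then have y: "J y \<in> ball q r" by simp
        have "R (J y) \<in> W" "G (R (J y)) = J y" using aD(10,11)[OF y] by auto
        moreover from this have "u (R (J y)) = b" using fib LJ(4) by simp
        ultimately have "R (J y) \<in> U" "\<phi> (R (J y)) = y" using aD(13) LJ(3) by (auto simp: U_def \<phi>_def)
        then show "y \<in> \<phi> ` U" by force
      qed
    qed
    have sJ: "smooth_on UNIV J" and sL: "smooth_on UNIV L"
      using smooth_on_linear[OF linear_conv_bounded_linear[THEN iffD1, OF LJ(2)] smooth_on_id[OF open_UNIV]]
        smooth_on_linear[OF linear_conv_bounded_linear[THEN iffD1, OF LJ(1)] smooth_on_id[OF open_UNIV]] by auto
    have oim: "open (\<phi> ` U)" unfolding im using smooth_on_preimage[OF sJ, of "ball q r"] by simp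
    have UW: "U \<subseteq> W" "U \<subseteq> ?F" by (auto simp: U_def)
    have s\<phi>: "smooth_map_on M U euclid \<phi>" unfolding \<phi>_def
      by (rule smooth_map_on_smooth_on[OF MC smooth_map_on_subset[OF aD(2) UW(1)] sL]) simp
    have RJ: "smooth_map_on euclid (\<phi> ` U) M (\<lambda>y. R (J y))"
    proof (rule smooth_map_on_compose[OF charted_euclid charted_euclid _ aD(3)])
      show "smooth_map_on euclid (\<phi> ` U) euclid J"
        unfolding smooth_map_on_euclid_euclid by (rule smooth_on_set_subset[OF smooth_on_imp_smooth_on_set[OF sJ]]) simp
    qed (use im in auto)
    have RJ\<phi>: "R (J (\<phi> z)) = z" if "z \<in> U" for z
      using that fib[of z] LJ(5)[of "G z"] aD(5)[of z] by (simp add: U_def \<phi>_def)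
    have RJim: "R (J y) \<in> U" if "y \<in> \<phi> ` U" for y using that RJ\<phi> by auto
    have c: "coord (subtopology (mtop M) ?F) U \<phi>"
    proof (rule coordI[where g = "\<lambda>y. R (J y)"])
      show "openin (subtopology (mtop M) ?F) U" unfolding U_def by (rule openin_subtopology_Int2[OF aD(1)])
      show "continuous_map (subtopology (subtopology (mtop M) ?F) U) euclidean \<phi>"
        using smooth_map_on_continuous[OF s\<phi>] UW by (simp add: subtopology_subtopology Int_absorb1)
      show "continuous_map (top_of_set (\<phi> ` U)) (subtopology (mtop M) ?F) (\<lambda>y. R (J y))"
        using smooth_map_on_continuous[OF RJ] RJim UW(2) by (auto simp: continuous_map_in_subtopology)
    qed (rule RJ\<phi>)
    have "smooth_map_on euclid (\<phi> ` U) M (inv_into U \<phi>)"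
      by (rule smooth_map_on_cong[OF charted_euclid RJ]) (use RJ\<phi> coord_inv[OF c] in auto)
    then have "(U, \<phi>) \<in> atlas (submanifold M ?F)"
      using c s\<phi> oim by (simp add: submanifold_atlas_iff is_chart_coord chart_image_def)
    then show "\<exists>U \<phi>. x \<in> U \<and> (U, \<phi>) \<in> atlas (submanifold M ?F :: ('a, 'd) manifold)"
      using x xW by (intro exI[of _ U] exI[of _ \<phi>]) (simp add: U_def)
  qed
  then show ?thesis by (rule smooth_manifold_submanifold[OF MS])
qed

section \<open>Retraction onto a fiber\<close>

text \<open>In an adapted chart the angle is multiplied by \<open>1 - \<beta>\<close>. This does
  nothing where the bump function vanishes or the angle is already 0, and it lands in the fiber
  where the bump function is 1. The ball is preserved because its center has angle 0.\<close>

lemma ex_fiber_push: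
  fixes M :: "('a, real^'n) manifold" and u :: "'a \<Rightarrow> complex"
  assumes M: "closed_manifold M" and u: "smooth_map_on M (pts M) euclid u" "\<And>x. x \<in> pts M \<Longrightarrow> cmod (u x) = 1"
    and reg: "\<And>x. x \<in> pts M \<Longrightarrow> regular_at M u x" and x: "x \<in> pts M" "u x = b"
  obtains f Q where "smooth_map_on M (pts M) M f" "\<And>z. z \<in> pts M \<Longrightarrow> u z = b \<Longrightarrow> f z = z"
    "openin (mtop M) Q" "x \<in> Q" "\<And>z. z \<in> Q \<Longrightarrow> u (f z) = b"
proof -
  note MC = closed_manifold_charted[OF M] and MS = closed_manifold_smooth[OF M]
  obtain i W G R q r where a: "adapted_chart M u (u x) i W G R q r" and xW: "x \<in> W"
    using ex_adapted_chart[OF M u reg x(1)] by blast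
  have b: "b \<noteq> 0" using x u(2)[of x] by auto
  note a = a[unfolded x(2)] note aD = adapted_chartD[OF a]
  obtain \<beta> :: "'a \<Rightarrow> real" and K Q where \<beta>: "smooth_map_on M (pts M) euclid \<beta>" "\<And>y. 0 \<le> \<beta> y" "\<And>y. \<beta> y \<le> 1"
    "closedin (mtop M) K" "K \<subseteq> W" "\<And>y. y \<notin> K \<Longrightarrow> \<beta> y = 0" "openin (mtop M) Q" "x \<in> Q" "Q \<subseteq> K" "\<And>y. y \<in> Q \<Longrightarrow> \<beta> y = 1"
    by (rule ex_bump[OF M aD(1) xW]) (rule that; assumption)
  define p where "p z = G z + (- (\<beta> z * G z $ i)) *\<^sub>R (axis i 1 :: real^'n)" for z
  have pi: "p z $ i = (1 - \<beta> z) * G z $ i" for z by (simp add: p_def algebra_simps)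
  have pj: "p z $ j = G z $ j" if "j \<noteq> i" for z j using that by (simp add: p_def axis_def)
  have pb: "p z \<in> ball q r" if z: "z \<in> W" for z
  proof -
    have "norm (p z - q) \<le> norm (G z - q)"
    proof (rule norm_le_componentwise_cart)
      fix j
      show "norm ((p z - q) $ j) \<le> norm ((G z - q) $ j)"
      proof (cases "j = i")
        case True
        have "\<bar>(1 - \<beta> z) * G z $ i\<bar> \<le> 1 * \<bar>G z $ i\<bar>"
          unfolding abs_mult using \<beta>(2,3)[of z] by (intro mult_right_mono) auto
        then show ?thesis using True aD(8) by (simp add: pi)
      qed (simp add: pj)
    qed
    then show ?thesis using aD(4)[OF z] by (simp add: dist_norm norm_minus_commute)
  qed
  define f where "f z = (if z \<in> W then R (p z) else z)" for z
  have fid: "f z = z" if "z \<notin> K" for z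
    using that \<beta>(6)[OF that] aD(5)[of z] by (simp add: f_def p_def)
  have sp: "smooth_map_on M W euclid p"
  proof -
    have "smooth_map_on M W euclid (\<lambda>z. G z $ i)"
      by (rule smooth_map_on_smooth_on[OF MC aD(2) smooth_on_linear[OF bounded_linear_vec_nth smooth_on_id[OF open_UNIV]]]) simp
    then have "smooth_map_on M W euclid (\<lambda>z. \<beta> z * G z $ i)"
      by (rule smooth_map_on_mult[OF MC smooth_map_on_subset[OF \<beta>(1) aD(13)]])
    then have "smooth_map_on M W euclid (\<lambda>z. - (\<beta> z * G z $ i))"
      by (rule smooth_map_on_smooth_on[OF MC _ smooth_on_minus[OF smooth_on_id[OF open_UNIV]]]) simp
    then show ?thesis unfolding p_def
      by (intro smooth_map_on_add[OF MC aD(2)] smooth_map_on_scaleR[OF MC _ smooth_map_on_const[OF MC]])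
  qed
  have sW: "smooth_map_on M W M f"
  proof -
    have "smooth_map_on M W M (\<lambda>z. R (p z))"
      by (rule smooth_map_on_compose[OF MC charted_euclid sp aD(3)]) (rule pb)
    then show ?thesis by (rule smooth_map_on_cong[OF MC]) (simp add: f_def)
  qed
  have sK: "smooth_map_on M (pts M - K) M f"
  proof -
    have "smooth_map_on (submanifold M (pts M) :: ('a, real^'n) manifold) (pts M - K) M (\<lambda>z. z)" by (rule smooth_map_on_incl)
    then have "smooth_map_on M (pts M - K) M (\<lambda>z. z)"
      by (rule smooth_map_on_from_sub[OF charted_open_submanifold[OF MS openin_topspace] MC, rotated]) auto
    then show ?thesis by (rule smooth_map_on_cong[OF MC]) (use fid in auto)
  qed
  show thesis
  proof (rule that[of f Q])
    show "smooth_map_on M (pts M) M f"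
    proof (rule smooth_map_on_local[OF MC])
      fix z assume z: "z \<in> pts M"
      show "\<exists>Q. openin (mtop M) Q \<and> z \<in> Q \<and> smooth_map_on M (pts M \<inter> Q) M f"
      proof (cases "z \<in> W")
        case True
        then show ?thesis using aD(1) smooth_map_on_subset[OF sW, of "pts M \<inter> W"] by blast
      next
        case False
        then show ?thesis using z \<beta>(4,5) smooth_map_on_subset[OF sK, of "pts M \<inter> (pts M - K)"] openin_diff[OF openin_topspace \<beta>(4)]
          by (intro exI[of _ "pts M - K"]) auto
      qed
    qed
    show "f z = z" if "z \<in> pts M" "u z = b" for z
    proof (cases "z \<in> W")
      case True
      then have "G z $ i = 0" using adapted_chart_fiber[OF a True b] that by simp
      then show ?thesis using True aD(5) by (simp add: f_def p_def)
    qed (simp add: f_def)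
    show "u (f z) = b" if z: "z \<in> Q" for z
    proof -
      have zW: "z \<in> W" using z \<beta>(5,9) by blast
      have "p z $ i = 0" using \<beta>(10)[OF z] by (simp add: pi)
      then have "G (R (p z)) $ i = 0" using aD(11)[OF pb[OF zW]] by simp
      then show ?thesis using adapted_chart_fiber[OF a aD(10)[OF pb[OF zW]] b] zW by (simp add: f_def)
    qed
  qed (use \<beta> in auto)
qed

lemma smooth_map_on_ident: "smooth_manifold M \<Longrightarrow> smooth_map_on M S M (\<lambda>z. z)"
proof -
  assume M: "smooth_manifold M"
  note MC = smooth_manifold_charted[OF M]
  have "smooth_map_on M (pts M) M (\<lambda>z. z)"
    by (rule smooth_map_on_from_sub[OF charted_open_submanifold[OF M openin_topspace] MC subset_refl smooth_map_on_incl])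
  then have "smooth_map_on M (S \<inter> pts M) M (\<lambda>z. z)" by (rule smooth_map_on_subset) simp
  then show ?thesis
    by (intro smooth_map_on_local[OF MC] exI[of _ "pts M"]) simp
qed

text \<open>
  A composition of finitely many pushes towards the fiber in charts. Together with \<open>u\<close> it trivializes the bundle
  locally, which replaces the integration of vector fields in Ehresmann's theorem.
\<close>

lemma fiber_retraction:
  fixes M :: "('a, real^'n) manifold" and u :: "'a \<Rightarrow> complex"
  assumes M: "closed_manifold M" and u: "smooth_map_on M (pts M) euclid u" "\<And>x. x \<in> pts M \<Longrightarrow> cmod (u x) = 1"
    and reg: "\<And>x. x \<in> pts M \<Longrightarrow> regular_at M u x"
  obtains Q \<pi> where "openin (mtop M) Q" "{z \<in> pts M. u z = b} \<subseteq> Q" "smooth_map_on M (pts M) M \<pi>"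
    "\<And>z. z \<in> pts M \<Longrightarrow> u z = b \<Longrightarrow> \<pi> z = z" "\<And>z. z \<in> Q \<Longrightarrow> u (\<pi> z) = b"
proof -
  note MC = closed_manifold_charted[OF M] and MS = closed_manifold_smooth[OF M]
  let ?F = "{z \<in> pts M. u z = b}"
  define good where "good Q \<longleftrightarrow> openin (mtop M) Q \<and> (\<exists>f. smooth_map_on M (pts M) M f \<and> (\<forall>z\<in>?F. f z = z) \<and> (\<forall>z\<in>Q. u (f z) = b))" for Q
  have ex: "\<exists>Q. good Q \<and> x \<in> Q" if x: "x \<in> ?F" for x
  proof -
    have xs: "x \<in> pts M" "u x = b" using x by auto
    obtain f Q where "smooth_map_on M (pts M) M f" "\<And>z. z \<in> pts M \<Longrightarrow> u z = b \<Longrightarrow> f z = z"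
    "openin (mtop M) Q" "x \<in> Q" "\<And>z. z \<in> Q \<Longrightarrow> u (f z) = b"
      by (rule ex_fiber_push[OF M u reg xs, rotated 2]) (rule that; assumption)
    then show ?thesis unfolding good_def by (intro exI[of _ Q] conjI exI[of _ f]) auto
  qed
  have good_Union: "\<exists>Q. ?F \<inter> \<Union>\<Q> \<subseteq> Q \<and> good Q" if "finite \<Q>" "\<forall>Q\<in>\<Q>. good Q" for \<Q>
    using that
  proof (induction \<Q> rule: finite_induct)
    case empty
    have "good {}" unfolding good_def
      by (intro conjI exI[of _ "\<lambda>z. z"] smooth_map_on_ident[OF MS]) auto
    then show ?case by (intro exI[of _ "{}"]) simp
  next
    case (insert P \<Q>)
    obtain Q where Q: "?F \<inter> \<Union>\<Q> \<subseteq> Q" "good Q" using insert.IH insert.prems by auto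
    obtain f where f: "smooth_map_on M (pts M) M f" "\<And>z. z \<in> ?F \<Longrightarrow> f z = z" "\<And>z. z \<in> Q \<Longrightarrow> u (f z) = b" "openin (mtop M) Q"
      using Q(2) unfolding good_def by auto
    obtain g where g: "smooth_map_on M (pts M) M g" "\<And>z. z \<in> ?F \<Longrightarrow> g z = z" "\<And>z. z \<in> P \<Longrightarrow> u (g z) = b" "openin (mtop M) P"
      using insert.prems[rule_format, of P] unfolding good_def by auto
    obtain P' where P': "openin (mtop M) P'" "\<And>z. z \<in> pts M \<Longrightarrow> z \<in> pts M \<Longrightarrow> f z \<in> P \<longleftrightarrow> z \<in> P'"
      by (rule smooth_map_on_preimage[OF f(1) g(4)]) blast
    have fM: "f z \<in> pts M" if "z \<in> pts M" for z using smooth_map_on_into[OF f(1) that that] .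
    \<comment> \<open>The push \<open>f\<close> of the earlier sets is applied first: on
      \<open>Q\<close> it lands in the fiber, which \<open>g\<close> fixes, and on \<open>P'\<close>
      it lands in \<open>P\<close>, where \<open>g\<close> pushes into the fiber. As
      \<open>f\<close> fixes the fiber, \<open>P'\<close> still contains the fiber points of
      \<open>P\<close>.\<close>
    have "good (Q \<union> P')" unfolding good_def
    proof (intro conjI exI[of _ "\<lambda>z. g (f z)"] ballI)
      show "openin (mtop M) (Q \<union> P')" using f(4) P'(1) by blast
      show "smooth_map_on M (pts M) M (\<lambda>z. g (f z))"
        by (rule smooth_map_on_compose[OF MC MC f(1) g(1)]) (rule fM)
      show "g (f z) = z" if "z \<in> ?F" for z using f(2)[OF that] g(2)[OF that] by simp
      fix z assume "z \<in> Q \<union> P'"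
      then show "u (g (f z)) = b"
      proof
        assume z: "z \<in> Q"
        then have "z \<in> pts M" using openin_subset[OF f(4)] by blast
        then have "f z \<in> ?F" using f(3)[OF z] fM by simp
        then show ?thesis using g(2) f(3)[OF z] by simp
      next
        assume z: "z \<in> P'"
        then have "z \<in> pts M" using openin_subset[OF P'(1)] by blast
        then show ?thesis using P'(2) z g(3) by blast
      qed
    qed
    moreover have "?F \<inter> \<Union>(insert P \<Q>) \<subseteq> Q \<union> P'"
    proof
      fix z assume z: "z \<in> ?F \<inter> \<Union>(insert P \<Q>)"
      show "z \<in> Q \<union> P'"
      proof (cases "z \<in> P")
        case True
        have "f z = z" using f(2) z by blast
        then have "f z \<in> P" using True by simp
        then show ?thesis using P'(2)[of z] z by blast
      qed (use z Q(1) in blast)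
    qed
    ultimately show ?case by blast
  qed
  have cpt: "compact_space (mtop M)" using M by (simp add: closed_manifold_def)
  have cu: "continuous_map (mtop M) euclidean u" using smooth_map_on_continuous[OF u(1)] by simp
  have "closedin (mtop M) {x \<in> topspace (mtop M). u x \<in> {b}}"
    by (rule closedin_continuous_map_preimage[OF cu]) simp
  then have "compactin (mtop M) ?F" using closedin_compact_space[OF cpt] by simp
  moreover have "?F \<subseteq> \<Union>{Q. good Q}" using ex by blast
  moreover have "\<And>Q. Q \<in> {Q. good Q} \<Longrightarrow> openin (mtop M) Q" by (simp add: good_def)
  ultimately have "\<exists>\<Q>. finite \<Q> \<and> \<Q> \<subseteq> {Q. good Q} \<and> ?F \<subseteq> \<Union>\<Q>"
    by (intro compactinD[of "mtop M" ?F "{Q. good Q}"]) auto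
  then obtain \<Q> where \<Q>: "finite \<Q>" "\<Q> \<subseteq> {Q. good Q}" "?F \<subseteq> \<Union>\<Q>" by blast
  have "\<forall>Q\<in>\<Q>. good Q" using \<Q>(2) by auto
  from good_Union[OF \<Q>(1) this] obtain Q where Q: "?F \<inter> \<Union>\<Q> \<subseteq> Q" "good Q" by (elim exE conjE) (rule that)
  obtain f where f: "smooth_map_on M (pts M) M f" "\<And>z. z \<in> ?F \<Longrightarrow> f z = z" "\<And>z. z \<in> Q \<Longrightarrow> u (f z) = b" "openin (mtop M) Q"
    using Q(2) unfolding good_def by auto
  have FQ: "?F \<subseteq> Q" using Q(1) \<Q>(3) by auto
  show thesis
    by (rule that[OF f(4) FQ f(1)]) (use f(2,3) in simp_all)
qed

section \<open>Local trivializations over arcs\<close>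

definition arc_around :: "complex \<Rightarrow> real \<Rightarrow> complex set" where
  "arc_around b s = (\<lambda>t. b * cis t) ` {-s<..<s}"

lemma smooth_map_on_circle_euclid:
  assumes "charted P" "charted circle" "smooth_map_on P S circle f"
  shows "smooth_map_on P S euclid f"
  using assms smooth_map_on_out_sub[of P euclid "sphere 0 1" S f] unfolding circle_def by blast

lemma smooth_map_on_euclid_circle:
  assumes "charted P" "smooth_map_on P S euclid f" "\<And>x. x \<in> S \<Longrightarrow> x \<in> pts P \<Longrightarrow> cmod (f x) = 1"
  shows "smooth_map_on P S circle f"
  unfolding circle_def by (rule smooth_map_on_to_sub[OF assms(1) charted_euclid assms(2)]) (use assms(3) in simp)

lemma pts_circle [simp]: "pts circle = sphere 0 1" and mtop_circle: "mtop circle = top_of_set (sphere 0 1)"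
  by (simp_all add: circle_def)

lemma angle_on_arc:
  assumes "b \<noteq> 0" "\<bar>t\<bar> < 1"
  shows "Im (Ln (b * cis t * inverse b)) = t" "b * cis t * inverse b \<notin> \<real>\<^sub>\<le>\<^sub>0"
proof -
  have e: "b * cis t * inverse b = cis t" using assms(1) by (simp add: field_simps)
  have "\<bar>t\<bar> < pi" using assms(2) pi_gt3 by linarith
  then show "Im (Ln (b * cis t * inverse b)) = t" "b * cis t * inverse b \<notin> \<real>\<^sub>\<le>\<^sub>0"
    unfolding e by (rule Ln_cis, rule cis_notin_nonpos)
qed

lemma openin_arc_around:
  assumes b: "cmod b = 1" and s: "0 < s" "s \<le> 1"
  shows "openin (mtop circle) (arc_around b s)"
proof -
  have b0: "b \<noteq> 0" using b by auto
  define T where "T = {c. c * inverse b \<in> - \<real>\<^sub>\<le>\<^sub>0}"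
  have lin: "smooth_on UNIV (\<lambda>c. c * inverse b)"
    by (rule smooth_on_linear[OF bounded_linear_mult_left smooth_on_id[OF open_UNIV]])
  have "T = UNIV \<inter> (\<lambda>c. c * inverse b) -` (- \<real>\<^sub>\<le>\<^sub>0)" by (auto simp: T_def)
  then have oT: "open T" using smooth_on_preimage[OF lin, of "- \<real>\<^sub>\<le>\<^sub>0"] by (simp add: open_Compl)
  have tau: "smooth_on T (\<lambda>c. Im (Ln (c * inverse b)))"
    by (rule smooth_on_compose[OF smooth_on_Im_Ln smooth_on_subset[OF lin oT]]) (auto simp: T_def)
  have "arc_around b s = sphere 0 1 \<inter> (T \<inter> (\<lambda>c. Im (Ln (c * inverse b))) -` {-s<..<s})"
  proof
    show "arc_around b s \<subseteq> sphere 0 1 \<inter> (T \<inter> (\<lambda>c. Im (Ln (c * inverse b))) -` {-s<..<s})"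
    proof
      fix c assume "c \<in> arc_around b s"
      then obtain t where t: "c = b * cis t" "-s < t" "t < s"
        unfolding arc_around_def by (elim imageE) (rule that, auto)
      then have "\<bar>t\<bar> < 1" using s by linarith
      from angle_on_arc[OF b0 this] show "c \<in> sphere 0 1 \<inter> (T \<inter> (\<lambda>c. Im (Ln (c * inverse b))) -` {-s<..<s})"
        using t b by (simp add: T_def norm_mult)
    qed
    show "sphere 0 1 \<inter> (T \<inter> (\<lambda>c. Im (Ln (c * inverse b))) -` {-s<..<s}) \<subseteq> arc_around b s"
    proof
      fix c assume c: "c \<in> sphere 0 1 \<inter> (T \<inter> (\<lambda>c. Im (Ln (c * inverse b))) -` {-s<..<s})"
      then have n: "cmod (c * inverse b) = 1" using b by (simp add: norm_mult norm_inverse)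
      then have "c * inverse b \<noteq> 0" by auto
      from cis_Im_Ln[OF this] have "cis (Im (Ln (c * inverse b))) = c * inverse b" using n by simp
      then have "c = b * cis (Im (Ln (c * inverse b)))" using b0 by simp
      then show "c \<in> arc_around b s" unfolding arc_around_def using c by blast
    qed
  qed
  moreover have "open (T \<inter> (\<lambda>c. Im (Ln (c * inverse b))) -` {-s<..<s})"
    by (rule smooth_on_preimage[OF tau]) simp
  ultimately show ?thesis unfolding mtop_circle by (metis openin_open_Int)
qed

text \<open>Provides a local section of the pair \<open>(u, \<pi>)\<close> over an arc together with
  local injectivity of that pair. In adapted coordinates the pair becomes \<open>H\<close>, which
  keeps the angle and takes the other coordinates from \<open>G (\<pi> (R p))\<close>; both
  conclusions come from inverting \<open>H\<close>.\<close>

lemma local_section: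
  fixes M :: "('a, real^'n) manifold" and u :: "'a \<Rightarrow> complex"
  assumes M: "closed_manifold M" and circ: "smooth_manifold circle" and u: "smooth_map_on M (pts M) euclid u" "\<And>x. x \<in> pts M \<Longrightarrow> cmod (u x) = 1"
    and reg: "\<And>x. x \<in> pts M \<Longrightarrow> regular_at M u x" and x: "x \<in> pts M" "u x = b"
    and Q: "openin (mtop M) Q" "{z \<in> pts M. u z = b} \<subseteq> Q" and \<pi>: "smooth_map_on M (pts M) M \<pi>"
    "\<And>z. z \<in> pts M \<Longrightarrow> u z = b \<Longrightarrow> \<pi> z = z" "\<And>z. z \<in> Q \<Longrightarrow> u (\<pi> z) = b"
  obtains A s S N where "openin (mtop M) A" "x \<in> A" "0 < s" "s \<le> (1::real)"
    "smooth_map_on (prod_manifold circle M) (arc_around b s \<times> A) M S"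
    "\<And>c y. c \<in> arc_around b s \<Longrightarrow> y \<in> A \<Longrightarrow> u y = b \<Longrightarrow> S (c, y) \<in> Q \<and> u (S (c, y)) = c \<and> \<pi> (S (c, y)) = y"
    "openin (mtop M) N" "x \<in> N" "\<And>z z'. z \<in> N \<Longrightarrow> z' \<in> N \<Longrightarrow> u z = u z' \<Longrightarrow> \<pi> z = \<pi> z' \<Longrightarrow> z = z'"
proof -
  note MC = closed_manifold_charted[OF M] and MS = closed_manifold_smooth[OF M]
  have b: "b \<noteq> 0" using x u(2)[of x] by auto
  obtain i W G R q r where a: "adapted_chart M u b i W G R q r" and xW: "x \<in> W" and Gx: "G x = q"
    using ex_adapted_chart[OF M u reg x(1)] x(2) by blast
  note aD = adapted_chartD[OF a]
  have fib: "u z = b \<longleftrightarrow> G z $ i = 0" if "z \<in> W" for z using adapted_chart_fiber[OF a that b] .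
  have \<pi>M: "\<pi> z \<in> pts M" if "z \<in> pts M" for z using smooth_map_on_into[OF \<pi>(1) that that] .
  obtain W' where W': "openin (mtop M) W'" "\<And>z. z \<in> pts M \<Longrightarrow> z \<in> pts M \<Longrightarrow> \<pi> z \<in> W \<longleftrightarrow> z \<in> W'"
    by (rule smooth_map_on_preimage[OF \<pi>(1) aD(1)]) auto
  obtain P0 where P0: "openin (mtop euclid) P0" "\<And>p. p \<in> ball q r \<Longrightarrow> p \<in> pts euclid \<Longrightarrow> R p \<in> Q \<inter> W' \<longleftrightarrow> p \<in> P0"
    by (rule smooth_map_on_preimage[OF aD(3) openin_Int[OF Q(1) W'(1)]]) auto
  define P where "P = ball q r \<inter> P0"
  have oP: "open P" using P0(1) by (auto simp: P_def)
  have PB: "P \<subseteq> ball q r" by (auto simp: P_def)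
  have PR: "R p \<in> W" "R p \<in> Q" "\<pi> (R p) \<in> W" "R p \<in> pts M" "G (R p) = p" if p: "p \<in> P" for p
  proof -
    have pb: "p \<in> ball q r" using p PB by blast
    show "R p \<in> W" "G (R p) = p" using aD(10,11)[OF pb] .
    then show m: "R p \<in> pts M" using aD(13) by blast
    have "R p \<in> Q \<inter> W'" using P0(2)[OF pb] p by (simp add: P_def)
    then show "R p \<in> Q" "\<pi> (R p) \<in> W" using W'(2)[OF m m] by auto
  qed
  have fixF: "G (\<pi> (R p)) = p" if p: "p \<in> P" "p $ i = 0" for p
  proof -
    have "u (R p) = b" using fib[OF PR(1)[OF p(1)]] PR(5)[OF p(1)] p(2) by simp
    then have "\<pi> (R p) = R p" using \<pi>(2) PR(4)[OF p(1)] by blast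
    then show ?thesis using PR(5)[OF p(1)] by simp
  qed
  have Rq: "R q = x" using aD(5)[OF xW] Gx by simp
  have qB: "q \<in> ball q r" using aD(6) by simp
  have qP: "q \<in> P"
  proof -
    have "x \<in> Q" using Q(2) x by blast
    moreover have "x \<in> W'" using W'(2)[OF x(1) x(1)] \<pi>(2)[OF x] xW by simp
    ultimately show ?thesis using P0(2)[OF qB] qB Rq by (simp add: P_def)
  qed
  define g where "g p = G (\<pi> (R p))" for p
  define H where "H p = g p + (p $ i - g p $ i) *\<^sub>R (axis i 1 :: real^'n)" for p
  have sg: "smooth_on P g"
  proof -
    have 1: "smooth_map_on euclid P M (\<lambda>p. \<pi> (R p))"
      by (rule smooth_map_on_compose[OF charted_euclid MC smooth_map_on_subset[OF aD(3) PB] \<pi>(1)]) (use PR(4) in auto)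
    have "smooth_map_on euclid P euclid g" unfolding g_def
      by (rule smooth_map_on_compose[OF charted_euclid MC 1 aD(2)]) (use PR(3) in auto)
    then show ?thesis using smooth_on_set_imp_smooth_on[OF _ oP] by (simp add: smooth_map_on_euclid_euclid)
  qed
  have pid: "smooth_on P (\<lambda>p. p)" by (rule smooth_on_id[OF oP])
  have sH: "smooth_on P H" unfolding H_def
    by (rule smooth_on_add[OF sg smooth_on_scaleR[OF smooth_on_diff[OF smooth_on_linear[OF bounded_linear_vec_nth pid] smooth_on_linear[OF bounded_linear_vec_nth sg]] smooth_on_const[OF oP]]])
  have Hi: "H p $ i = p $ i" for p by (simp add: H_def)
  have Hq: "H p = p" if "p \<in> P" "p $ i = 0" for p using fixF[OF that] that(2) by (simp add: H_def g_def)
  have DH: "(H has_derivative frechet_derivative H (at q)) (at q)" using smooth_on_has_derivative[OF sH qP] .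
  \<comment> \<open>\<open>H\<close> preserves the coordinate \<open>i\<close>, so a kernel vector
    is tangent to the hyperplane where this coordinate vanishes; on that hyperplane \<open>H\<close>
    is the identity.\<close>
  have inj: "v = 0" if v: "frechet_derivative H (at q) v = 0" for v
  proof -
    have "((\<lambda>p. H p $ i) has_derivative (\<lambda>v. frechet_derivative H (at q) v $ i)) (at q)"
      by (rule bounded_linear.has_derivative[OF bounded_linear_vec_nth DH])
    then have 1: "((\<lambda>p. p $ i) has_derivative (\<lambda>v. frechet_derivative H (at q) v $ i)) (at q)" by (simp add: Hi)
    have "((\<lambda>p::real^'n. p $ i) has_derivative (\<lambda>v. v $ i)) (at q)"
      by (rule bounded_linear.has_derivative[OF bounded_linear_vec_nth]) simp
    from has_derivative_unique[OF 1 this] have "frechet_derivative H (at q) v $ i = v $ i" by (rule fun_cong)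
    then have vi: "v $ i = 0" using v by simp
    have c: "((\<lambda>t. q + t *\<^sub>R v) has_derivative (\<lambda>t. t *\<^sub>R v)) (at (0::real))"
      by (auto intro!: derivative_eq_intros)
    have DH0: "(H has_derivative frechet_derivative H (at q)) (at (q + 0 *\<^sub>R v))" using DH by simp
    have 2: "((\<lambda>t. H (q + t *\<^sub>R v)) has_derivative (\<lambda>t. frechet_derivative H (at q) (t *\<^sub>R v))) (at (0::real))"
      using diff_chain_at[OF c DH0] by (simp add: o_def)
    have oc: "open ((\<lambda>t. q + t *\<^sub>R v) -` P)"
      by (rule open_vimage[OF oP]) (auto intro!: continuous_intros)
    have "((\<lambda>t. q + t *\<^sub>R v) has_derivative (\<lambda>t. frechet_derivative H (at q) (t *\<^sub>R v))) (at (0::real))"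
      by (rule has_derivative_transform_within_open[OF 2 oc]) (use qP Hq aD(8) vi in auto)
    from has_derivative_unique[OF this c] have "frechet_derivative H (at q) (1 *\<^sub>R v) = 1 *\<^sub>R v" by (rule fun_cong)
    then show "v = 0" using v by simp
  qed
  obtain U k where U: "open U" "q \<in> U" "U \<subseteq> P" "smooth_on (H ` U) k" "\<And>p. p \<in> U \<Longrightarrow> k (H p) = p"
    by (rule smooth_inverse_function[OF sH qP inj]) auto
  have "q \<in> H ` U" using U(2) Hq[OF qP aD(8)] by (metis imageI)
  then obtain \<rho> where \<rho>: "0 < \<rho>" "ball q \<rho> \<subseteq> H ` U" using smooth_on_open[OF U(4)] open_contains_ball by blast
  define s where "s = min (\<rho> / 2) 1"
  have s: "0 < s" "s \<le> 1" "s \<le> \<rho> / 2" using \<rho> by (auto simp: s_def)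
  define A where "A = {y \<in> W. G y \<in> ball q (\<rho> / 2)}"
  define \<tau> where "\<tau> c = Im (Ln (c * inverse b))" for c
  \<comment> \<open>For \<open>y\<close> in the fiber these are the values that \<open>H\<close>
    must take at the point sought over \<open>(c, y)\<close>: the coordinates of \<open>y\<close>,
    moved by the angle of \<open>c\<close> in direction \<open>i\<close>.\<close>
  define e where "e z = G (snd z) + \<tau> (fst z) *\<^sub>R (axis i 1 :: real^'n)" for z
  define S where "S z = R (k (e z))" for z
  have \<tau>: "\<tau> c = t \<and> \<bar>t\<bar> < s" if "c = b * cis t" "-s < t" "t < s" for c t
  proof -
    have "\<bar>t\<bar> < 1" "\<bar>t\<bar> < s" using that s by linarith+
    then show ?thesis using angle_on_arc(1)[OF b] that(1) by (simp add: \<tau>_def)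
  qed
  have arc: "\<exists>t. c = b * cis t \<and> \<tau> c = t \<and> \<bar>t\<bar> < s" if "c \<in> arc_around b s" for c
    using that \<tau> by (auto simp: arc_around_def)
  have eH: "e (c, y) \<in> H ` U" if "c \<in> arc_around b s" "y \<in> A" for c y
  proof -
    have t: "\<tau> c = \<tau> c" "\<bar>\<tau> c\<bar> < s" using arc[OF that(1)] by auto
    define t where "t = \<tau> c"
    note t = t[folded t_def]
    have "norm (e (c, y) - q) \<le> norm (G y - q) + norm (t *\<^sub>R (axis i 1 :: real^'n))"
      unfolding e_def using norm_triangle_ineq[of "G y - q" "t *\<^sub>R axis i 1"] by (simp add: algebra_simps t_def)
    also have "\<dots> < \<rho> / 2 + \<rho> / 2"
      using that(2) t(2) s(3) unfolding t_def by (intro add_strict_mono) (auto simp: A_def dist_norm norm_minus_commute)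
    finally have "e (c, y) \<in> ball q \<rho>" by (simp add: dist_norm norm_minus_commute)
    then show ?thesis using \<rho>(2) by blast
  qed
  show thesis
  proof (rule that[of A s S "{z \<in> W. G z \<in> U}"])
    show "openin (mtop M) A" unfolding A_def by (rule openin_smooth_map_on_preimage[OF aD(2,1)]) simp
    show "x \<in> A" using xW Gx \<rho> by (simp add: A_def)
    show "0 < s" "s \<le> 1" using s by auto
    show "openin (mtop M) {z \<in> W. G z \<in> U}" by (rule openin_smooth_map_on_preimage[OF aD(2,1) U(1)])
    show "x \<in> {z \<in> W. G z \<in> U}" using xW Gx U(2) by simp
    show "z = z'" if z: "z \<in> {z \<in> W. G z \<in> U}" "z' \<in> {z \<in> W. G z \<in> U}" "u z = u z'" "\<pi> z = \<pi> z'" for z z'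
    proof -
      have zW: "z \<in> W" "z' \<in> W" "G z \<in> U" "G z' \<in> U" using z by auto
      have "cis (G z $ i) = cis (G z' $ i)" using aD(9)[OF zW(1)] aD(9)[OF zW(2)] z(3) b by simp
      then have "G z $ i = G z' $ i" by (rule cis_inj_small[OF _ aD(12)[OF zW(1)] aD(12)[OF zW(2)]])
      moreover have "g (G z) = g (G z')" using z(4) aD(5)[OF zW(1)] aD(5)[OF zW(2)] by (simp add: g_def)
      ultimately have "H (G z) = H (G z')" by (simp add: H_def)
      then have "G z = G z'" using U(5)[OF zW(3)] U(5)[OF zW(4)] by metis
      then show "z = z'" using aD(5)[OF zW(1)] aD(5)[OF zW(2)] by metis
    qed
    show "S (c, y) \<in> Q \<and> u (S (c, y)) = c \<and> \<pi> (S (c, y)) = y" if c: "c \<in> arc_around b s" and y: "y \<in> A" "u y = b" for c y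
    proof -
      obtain t where t: "c = b * cis t" "\<tau> c = t" using arc[OF c] by blast
      have yW: "y \<in> W" using y by (simp add: A_def)
      have Gy: "G y $ i = 0" using fib[OF yW] y(2) by simp
      obtain p where p: "p \<in> U" "e (c, y) = H p" using eH[OF c y(1)] by blast
      have pP: "p \<in> P" using p(1) U(3) by blast
      have S: "S (c, y) = R p" using U(5)[OF p(1)] p(2) by (simp add: S_def)
      have pi: "p $ i = t" using arg_cong[OF p(2), of "\<lambda>v. v $ i"] Hi[of p] Gy t(2) by (simp add: e_def)
      have "u (R p) = c" using aD(9)[OF PR(1)[OF pP]] PR(5)[OF pP] pi t(1) by simp
      moreover have "\<pi> (R p) = y"
      proof -
        have "u (\<pi> (R p)) = b" using \<pi>(3)[OF PR(2)[OF pP]] .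
        then have gi: "g p $ i = 0" using fib[OF PR(3)[OF pP]] by (simp add: g_def)
        have "g p + p $ i *\<^sub>R axis i 1 = G y + t *\<^sub>R axis i 1" using p(2) t(2) gi by (simp add: e_def H_def)
        then have "G (\<pi> (R p)) = G y" using pi by (simp add: g_def)
        then show ?thesis using aD(5)[OF PR(3)[OF pP]] aD(5)[OF yW] by metis
      qed
      ultimately show ?thesis using S PR(2)[OF pP] by simp
    qed
    let ?P = "prod_manifold circle M" and ?X = "arc_around b s \<times> A"
    have PC: "charted ?P" by (rule charted_prod[OF smooth_manifold_charted[OF circ] MC])
    have f: "smooth_map_on ?P ?X euclid fst"
      by (rule smooth_map_on_circle_euclid[OF PC smooth_manifold_charted[OF circ] smooth_map_on_prod_fst[OF circ MC]])
    have lin: "smooth_on UNIV (\<lambda>c. c * inverse b)"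
      by (rule smooth_on_linear[OF bounded_linear_mult_left smooth_on_id[OF open_UNIV]])
    have f2: "smooth_map_on ?P ?X euclid (\<lambda>z. fst z * inverse b)" by (rule smooth_map_on_smooth_on[OF PC f lin]) simp
    have ft: "smooth_map_on ?P ?X euclid (\<lambda>z. \<tau> (fst z))" unfolding \<tau>_def
    proof (rule smooth_map_on_smooth_on[OF PC f2 smooth_on_Im_Ln])
      fix z assume "z \<in> ?X"
      then obtain t where t: "fst z = b * cis t" "\<bar>t\<bar> < s" using arc[of "fst z"] by auto
      then show "fst z * inverse b \<in> - \<real>\<^sub>\<le>\<^sub>0" using angle_on_arc(2)[OF b, of t] s by simp
    qed
    have fG: "smooth_map_on ?P ?X euclid (\<lambda>z. G (snd z))"
      by (rule smooth_map_on_compose[OF PC MC smooth_map_on_prod_snd[OF smooth_manifold_charted[OF circ] MS] aD(2)]) (auto simp: A_def)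
    have fe: "smooth_map_on ?P ?X euclid e" unfolding e_def
      by (rule smooth_map_on_add[OF PC fG smooth_map_on_scaleR[OF PC ft smooth_map_on_const[OF PC]]])
    have fk: "smooth_map_on ?P ?X euclid (\<lambda>z. k (e z))"
      by (rule smooth_map_on_smooth_on[OF PC fe U(4)]) (use eH in auto)
    show "smooth_map_on ?P ?X M S" unfolding S_def
    proof (rule smooth_map_on_compose[OF PC charted_euclid fk aD(3)])
      fix z assume "z \<in> ?X"
      then obtain p where "p \<in> U" "e z = H p" using eH[of "fst z" "snd z"] by auto
      then show "k (e z) \<in> ball q r" using U(3,5) PB by auto
    qed
  qed
qed

text \<open>The trivialization is the pair \<open>(u, \<pi>)\<close>. Compactness of the fiber turns
  local sections and local injectivity into statements over one short arc; the inverse is smooth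
  because it agrees locally with the sections.\<close>

lemma local_trivialization:
  fixes M :: "('a, real^'n) manifold" and u :: "'a \<Rightarrow> complex"
  assumes M: "closed_manifold M" and circ: "smooth_manifold circle" and u: "smooth_map_on M (pts M) euclid u" "\<And>x. x \<in> pts M \<Longrightarrow> cmod (u x) = 1"
    and reg: "\<And>x. x \<in> pts M \<Longrightarrow> regular_at M u x" and b: "cmod b = 1" and dim: "CARD('n) = DIM('d::euclidean_space) + 1"
  obtains V \<Phi> where "openin (mtop circle) V" "b \<in> V"
    "diffeomorphism (submanifold M (pts M \<inter> u -` V) :: ('a, real^'n) manifold)
      (prod_manifold (submanifold circle V :: (complex, real) manifold) (submanifold M {z \<in> pts M. u z = b} :: ('a, 'd::euclidean_space) manifold)) \<Phi>"
    "\<And>z. z \<in> pts M \<Longrightarrow> u z \<in> V \<Longrightarrow> fst (\<Phi> z) = u z"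
proof -
  note MC = closed_manifold_charted[OF M] and MS = closed_manifold_smooth[OF M] and CC = smooth_manifold_charted[OF circ]
  let ?F = "{z \<in> pts M. u z = b}"
  let ?FM = "submanifold M ?F :: ('a, 'd) manifold"
  have FS: "smooth_manifold ?FM" by (rule smooth_manifold_fiber[OF M u reg dim])
  note FC = smooth_manifold_charted[OF FS]
  obtain Q \<pi> where Q: "openin (mtop M) Q" "?F \<subseteq> Q" and \<pi>: "smooth_map_on M (pts M) M \<pi>"
    "\<And>z. z \<in> pts M \<Longrightarrow> u z = b \<Longrightarrow> \<pi> z = z" "\<And>z. z \<in> Q \<Longrightarrow> u (\<pi> z) = b"
    by (rule fiber_retraction[OF M u reg, rotated 2]) (rule that; assumption)
  have QM: "Q \<subseteq> pts M" using openin_subset[OF Q(1)] .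
  have \<pi>M: "\<pi> z \<in> pts M" if "z \<in> pts M" for z using smooth_map_on_into[OF \<pi>(1) that that] .
  have cpt: "compact_space (mtop M)" and Haus: "Hausdorff_space (mtop M)" using M by (simp_all add: closed_manifold_def smooth_manifold_def)
  have cu: "continuous_map (mtop M) euclidean u" using smooth_map_on_continuous[OF u(1)] by simp
  have "closedin (mtop M) {x \<in> topspace (mtop M). u x \<in> {b}}"
    by (rule closedin_continuous_map_preimage[OF cu]) simp
  then have cF: "compactin (mtop M) ?F" using closedin_compact_space[OF cpt] by simp
  define good where "good A s \<longleftrightarrow> openin (mtop M) A \<and> 0 < s \<and> s \<le> (1::real) \<and>
    (\<exists>S. smooth_map_on (prod_manifold circle M) (arc_around b s \<times> A) M S \<and>
      (\<forall>c\<in>arc_around b s. \<forall>y\<in>A. u y = b \<longrightarrow> S (c, y) \<in> Q \<and> u (S (c, y)) = c \<and> \<pi> (S (c, y)) = y))" for A s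
  define injective where "injective N \<longleftrightarrow> openin (mtop M) N \<and> (\<forall>z\<in>N. \<forall>z'\<in>N. u z = u z' \<longrightarrow> \<pi> z = \<pi> z' \<longrightarrow> z = z')" for N
  have ex: "(\<exists>A s. good A s \<and> x \<in> A) \<and> (\<exists>N. injective N \<and> x \<in> N)" if x: "x \<in> ?F" for x
  proof -
    have xs: "x \<in> pts M" "u x = b" using x by auto
    obtain A s S N where "openin (mtop M) A" "x \<in> A" "0 < s" "s \<le> (1::real)"
    "smooth_map_on (prod_manifold circle M) (arc_around b s \<times> A) M S"
    "\<And>c y. c \<in> arc_around b s \<Longrightarrow> y \<in> A \<Longrightarrow> u y = b \<Longrightarrow> S (c, y) \<in> Q \<and> u (S (c, y)) = c \<and> \<pi> (S (c, y)) = y"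
    "openin (mtop M) N" "x \<in> N" "\<And>z z'. z \<in> N \<Longrightarrow> z' \<in> N \<Longrightarrow> u z = u z' \<Longrightarrow> \<pi> z = \<pi> z' \<Longrightarrow> z = z'"
      by (rule local_section[OF M circ u reg xs Q \<pi>, rotated 5]) (rule that; assumption)
    note l = this
    have "good A s" unfolding good_def using l(1,3-6) by (intro conjI exI[of _ S]) auto
    moreover have "injective N" unfolding injective_def using l(7,9) by (intro conjI) auto
    ultimately show ?thesis using l(2,8) by (intro conjI exI[of _ A] exI[of _ s] exI[of _ N])
  qed
  have arc_mono: "arc_around b s' \<subseteq> arc_around b s" if "s' \<le> s" for s s'
    unfolding arc_around_def by (rule image_mono) (use that in auto)
  have good_mono: "good A s'" if g: "good A s" "0 < s'" "s' \<le> s" for A s s'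
  proof -
    obtain S where S: "smooth_map_on (prod_manifold circle M) (arc_around b s \<times> A) M S"
      "\<forall>c\<in>arc_around b s. \<forall>y\<in>A. u y = b \<longrightarrow> S (c, y) \<in> Q \<and> u (S (c, y)) = c \<and> \<pi> (S (c, y)) = y"
      using g(1) unfolding good_def by (elim conjE exE) (rule that)
    have "smooth_map_on (prod_manifold circle M) (arc_around b s' \<times> A) M S"
      by (rule smooth_map_on_subset[OF S(1)]) (use arc_mono[OF g(3)] in auto)
    moreover have "\<forall>c\<in>arc_around b s'. \<forall>y\<in>A. u y = b \<longrightarrow> S (c, y) \<in> Q \<and> u (S (c, y)) = c \<and> \<pi> (S (c, y)) = y"
      using S(2) arc_mono[OF g(3)] by (meson subsetD)
    moreover have "openin (mtop M) A" "s' \<le> 1" using g unfolding good_def by simp_all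
    ultimately show ?thesis unfolding good_def using g(2) by (intro conjI exI[of _ S])
  qed
  have "\<exists>\<A>. finite \<A> \<and> \<A> \<subseteq> {A. \<exists>s. good A s} \<and> ?F \<subseteq> \<Union>\<A>"
  proof (rule compactinD[OF cF])
    show "openin (mtop M) A" if "A \<in> {A. \<exists>s. good A s}" for A using that by (auto simp: good_def)
    show "?F \<subseteq> \<Union>{A. \<exists>s. good A s}" using ex by blast
  qed
  then obtain \<A> where \<A>: "finite \<A>" "\<A> \<subseteq> {A. \<exists>s. good A s}" "?F \<subseteq> \<Union>\<A>" by (elim exE conjE) (rule that)
  have "\<exists>s>0. s \<le> 1 \<and> (\<forall>A\<in>\<A>. good A s)"
    using \<A>(1,2)
  proof (induction \<A> rule: finite_induct)
    case empty
    then show ?case by (intro exI[of _ 1]) simp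
  next
    case (insert A \<A>)
    obtain s where s: "0 < s" "s \<le> 1" "\<forall>A\<in>\<A>. good A s" using insert.IH insert.prems by auto
    obtain s' where s': "good A s'" using insert.prems by auto
    then have "0 < s'" by (simp add: good_def)
    then show ?case using s good_mono[OF s', of "min s s'"] good_mono[of _ s "min s s'"]
      by (intro exI[of _ "min s s'"]) auto
  qed
  then obtain s where s: "0 < s" "s \<le> 1" "\<And>A. A \<in> \<A> \<Longrightarrow> good A s" by auto
  \<comment> \<open>Injectivity near single points does not exclude that distant points share an
    image. \<open>Z\<close> collects products of open sets on which this is excluded for pairs, both
    on and off the diagonal.\<close>
  define Z where "Z = \<Union>{A \<times> B |A B. openin (mtop M) A \<and> openin (mtop M) B \<and> (\<forall>z\<in>A. \<forall>z'\<in>B. u z = u z' \<longrightarrow> \<pi> z = \<pi> z' \<longrightarrow> z = z')}"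
  have oZ: "openin (prod_topology (mtop M) (mtop M)) Z"
    unfolding Z_def by (rule openin_Union) (auto simp: openin_prod_Times_iff)
  have FZ: "?F \<times> ?F \<subseteq> Z"
  proof
    fix w assume "w \<in> ?F \<times> ?F"
    then obtain z z' where w: "w = (z, z')" "z \<in> ?F" "z' \<in> ?F" by auto
    show "w \<in> Z"
    proof (cases "z = z'")
      case True
      obtain N where N: "injective N" "z \<in> N" using ex[OF w(2)] by auto
      have "N \<times> N \<in> {A \<times> B |A B. openin (mtop M) A \<and> openin (mtop M) B \<and> (\<forall>z\<in>A. \<forall>z'\<in>B. u z = u z' \<longrightarrow> \<pi> z = \<pi> z' \<longrightarrow> z = z')}"
        using N(1) unfolding injective_def by auto
      then show ?thesis unfolding Z_def using N(2) w(1) True by blast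
    next
      \<comment> \<open>\<open>\<pi>\<close> fixes \<open>z\<close> and \<open>z'\<close>, so
        disjoint neighborhoods of them pull back along \<open>\<pi>\<close> to neighborhoods on
        which \<open>\<pi>\<close> takes distinct values.\<close>
      case False
      have zM: "z \<in> pts M" "z' \<in> pts M" using w by auto
      obtain A B where AB: "openin (mtop M) A" "openin (mtop M) B" "z \<in> A" "z' \<in> B" "disjnt A B"
        using Haus zM False unfolding Hausdorff_space_def by blast
      obtain A' where A': "openin (mtop M) A'" "\<And>y. y \<in> pts M \<Longrightarrow> y \<in> pts M \<Longrightarrow> \<pi> y \<in> A \<longleftrightarrow> y \<in> A'"
        by (rule smooth_map_on_preimage[OF \<pi>(1) AB(1)]) auto
      obtain B' where B': "openin (mtop M) B'" "\<And>y. y \<in> pts M \<Longrightarrow> y \<in> pts M \<Longrightarrow> \<pi> y \<in> B \<longleftrightarrow> y \<in> B'"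
        by (rule smooth_map_on_preimage[OF \<pi>(1) AB(2)]) auto
      have ne: "\<pi> y \<noteq> \<pi> y'" if "y \<in> A'" "y' \<in> B'" for y y'
      proof -
        have "y \<in> pts M" "y' \<in> pts M" using that openin_subset[OF A'(1)] openin_subset[OF B'(1)] by auto
        then have "\<pi> y \<in> A" "\<pi> y' \<in> B" using A'(2) B'(2) that by auto
        then show ?thesis using AB(5) by (auto simp: disjnt_def)
      qed
      have "A' \<times> B' \<in> {A \<times> B |A B. openin (mtop M) A \<and> openin (mtop M) B \<and> (\<forall>z\<in>A. \<forall>z'\<in>B. u z = u z' \<longrightarrow> \<pi> z = \<pi> z' \<longrightarrow> z = z')}"
        using A'(1) B'(1) ne by blast
      moreover have "z \<in> A'" "z' \<in> B'" using A'(2)[OF zM(1) zM(1)] B'(2)[OF zM(2) zM(2)] AB(3,4) \<pi>(2) w by auto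
      ultimately show ?thesis unfolding Z_def w(1) by blast
    qed
  qed
  \<comment> \<open>The tube lemma for compact factors replaces the open set of pairs by a product
    of neighborhoods of the fiber.\<close>
  obtain N1 N2 where N12: "openin (mtop M) N1" "openin (mtop M) N2" "?F \<subseteq> N1" "?F \<subseteq> N2" "N1 \<times> N2 \<subseteq> Z"
    by (rule Wallace_theorem_prod_topology[OF cF cF oZ FZ])
  define N where "N = N1 \<inter> N2 \<inter> Q"
  have N: "openin (mtop M) N" "?F \<subseteq> N" "N \<subseteq> Q" using N12 Q by (auto simp: N_def)
  have Ninj: "z = z'" if "z \<in> N" "z' \<in> N" "u z = u z'" "\<pi> z = \<pi> z'" for z z'
  proof -
    have "(z, z') \<in> Z" using that(1,2) N12(5) by (auto simp: N_def)
    then show ?thesis using that(3,4) unfolding Z_def by auto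
  qed
  \<comment> \<open>The complement of \<open>N\<close> is compact and \<open>u\<close> avoids
    \<open>b\<close> on it, so all points over a short arc around \<open>b\<close> lie in
    \<open>N\<close>.\<close>
  obtain \<epsilon> where \<epsilon>: "0 < \<epsilon>" "\<And>z. z \<in> pts M \<Longrightarrow> u z \<in> arc_around b \<epsilon> \<Longrightarrow> z \<in> N"
  proof -
    have "compactin (mtop M) (pts M - N)"
      by (rule closedin_compact_space[OF cpt]) (use N(1) in blast)
    then have "compactin euclidean (u ` (pts M - N))" by (rule image_compactin[OF _ cu])
    then have "open (- u ` (pts M - N))" by (simp add: compact_imp_closed open_Compl)
    moreover have "b * cis 0 \<in> - u ` (pts M - N)" using N(2) by auto
    moreover have "continuous_on UNIV (\<lambda>t. b * cis t)" by (intro continuous_intros)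
    ultimately have "open ((\<lambda>t. b * cis t) -` (- u ` (pts M - N)))" "0 \<in> (\<lambda>t. b * cis t) -` (- u ` (pts M - N))"
      by (auto simp: continuous_on_open_vimage)
    then obtain e where e: "0 < e" "ball 0 e \<subseteq> (\<lambda>t. b * cis t) -` (- u ` (pts M - N))"
      using open_contains_ball by blast
    show thesis
    proof (rule that[OF e(1)])
      fix z assume z: "z \<in> pts M" "u z \<in> arc_around b e"
      then obtain t where t: "u z = b * cis t" "t \<in> {-e<..<e}" unfolding arc_around_def by (elim imageE) (rule that)
      have "t \<in> ball 0 e" using t(2) by (auto simp: dist_real_def)
      then have "u z \<notin> u ` (pts M - N)" using e(2) t(1) by auto
      then show "z \<in> N" using z(1) by blast
    qed
  qed
  define s0 where "s0 = min s \<epsilon>"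
  define V where "V = arc_around b s0"
  have s0: "0 < s0" "s0 \<le> 1" "s0 \<le> s" "s0 \<le> \<epsilon>" using s \<epsilon> by (auto simp: s0_def)
  have oV: "openin (mtop circle) V" unfolding V_def by (rule openin_arc_around[OF b s0(1,2)])
  have bV: "b \<in> V" unfolding V_def arc_around_def using s0 by (intro image_eqI[of _ _ 0]) auto
  have VN: "z \<in> N" if "z \<in> pts M" "u z \<in> V" for z
    using \<epsilon>(2)[OF that(1)] that(2) arc_mono[OF s0(4)] unfolding V_def by blast
  have good0: "good A s0" if "A \<in> \<A>" for A by (rule good_mono[OF s(3)[OF that] s0(1,3)])
  have exz: "\<exists>z. z \<in> N \<and> u z = c \<and> \<pi> z = y" if c: "c \<in> V" and y: "y \<in> ?F" for c y
  proof -
    obtain A where A: "A \<in> \<A>" "y \<in> A" using \<A>(3) y by blast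
    obtain S where S: "\<forall>c\<in>arc_around b s0. \<forall>y\<in>A. u y = b \<longrightarrow> S (c, y) \<in> Q \<and> u (S (c, y)) = c \<and> \<pi> (S (c, y)) = y"
      using good0[OF A(1)] unfolding good_def by (elim conjE exE) (rule that)
    have z: "S (c, y) \<in> Q" "u (S (c, y)) = c" "\<pi> (S (c, y)) = y" using S c y A(2) by (auto simp: V_def)
    have "S (c, y) \<in> N" by (rule VN) (use z QM c in auto)
    then show ?thesis using z by blast
  qed
  \<comment> \<open>The choice is pointwise; injectivity on \<open>N\<close> forces it to coincide
    with every local section, and smoothness follows.\<close>
  define \<Psi> where "\<Psi> w = (SOME z. z \<in> N \<and> u z = fst w \<and> \<pi> z = snd w)" for w
  have \<Psi>: "\<Psi> w \<in> N \<and> u (\<Psi> w) = fst w \<and> \<pi> (\<Psi> w) = snd w" if "fst w \<in> V" "snd w \<in> ?F" for w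
    unfolding \<Psi>_def by (rule someI_ex) (rule exz[OF that])
  let ?E = "pts M \<inter> u -` V"
  have oE: "openin (mtop M) ?E"
  proof -
    obtain W where W: "open W" "V = sphere 0 1 \<inter> W" using oV by (auto simp: mtop_circle openin_open)
    have "?E = {z \<in> pts M. u z \<in> W}" using u(2) W(2) by auto
    then show ?thesis using openin_smooth_preimage[OF u(1) W(1)] by simp
  qed
  let ?EM = "submanifold M ?E :: ('a, real^'n) manifold"
  let ?VM = "submanifold circle V :: (complex, real) manifold"
  have EC: "charted ?EM" by (rule charted_open_submanifold[OF MS oE])
  have VC: "charted ?VM" by (rule charted_open_submanifold[OF circ oV])
  have VS: "smooth_manifold ?VM" by (rule smooth_manifold_submanifold[OF circ VC])
  let ?P = "prod_manifold ?VM ?FM"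
  have PC: "charted ?P" by (rule charted_prod[OF VC FC])
  have VsubC: "V \<subseteq> sphere 0 1" using openin_subset[OF oV] by simp
  have ptsE: "pts ?EM = ?E" by auto
  have ptsP: "pts ?P = V \<times> ?F" using VsubC by auto
  have sPhi: "smooth_map_on ?EM (pts ?EM) ?P (\<lambda>z. (u z, \<pi> z))"
  proof (rule smooth_map_on_prod_Pair[OF EC])
    have "smooth_map_on M ?E circle u"
      by (rule smooth_map_on_euclid_circle[OF MC smooth_map_on_subset[OF u(1)]]) (use u(2) in auto)
    then have "smooth_map_on M ?E ?VM u" by (rule smooth_map_on_to_sub[OF MC CC]) auto
    then show "smooth_map_on ?EM (pts ?EM) ?VM u" unfolding ptsE by (rule smooth_map_on_restrict_sub[OF EC MC])
    have "smooth_map_on M ?E M \<pi>" by (rule smooth_map_on_subset[OF \<pi>(1)]) auto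
    then have "smooth_map_on M ?E ?FM \<pi>"
    proof (rule smooth_map_on_to_sub[OF MC MC])
      fix z assume "z \<in> ?E" "z \<in> pts M"
      then have "z \<in> N" "z \<in> pts M" using VN by auto
      then show "\<pi> z \<in> ?F" using \<pi>M \<pi>(3) N(3) by auto
    qed
    then show "smooth_map_on ?EM (pts ?EM) ?FM \<pi>" unfolding ptsE by (rule smooth_map_on_restrict_sub[OF EC MC])
  qed
  have sPsi: "smooth_map_on ?P (pts ?P) ?EM \<Psi>"
  proof (rule smooth_map_on_to_sub[OF PC MC])
    show "\<Psi> w \<in> ?E" if "w \<in> pts ?P" for w
      using \<Psi>[of w] that N(3) QM unfolding ptsP by auto
    show "smooth_map_on ?P (pts ?P) M \<Psi>"
    proof (rule smooth_map_on_local[OF PC])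
      fix w assume "w \<in> pts ?P"
      then have w: "fst w \<in> V" "snd w \<in> ?F" unfolding ptsP by auto
      obtain A where A: "A \<in> \<A>" "snd w \<in> A" using \<A>(3) w(2) by blast
      obtain S where S: "smooth_map_on (prod_manifold circle M) (arc_around b s0 \<times> A) M S"
        "\<forall>c\<in>arc_around b s0. \<forall>y\<in>A. u y = b \<longrightarrow> S (c, y) \<in> Q \<and> u (S (c, y)) = c \<and> \<pi> (S (c, y)) = y"
        using good0[OF A(1)] unfolding good_def by (elim conjE exE) (rule that)
      have oA: "openin (mtop M) A" using good0[OF A(1)] by (simp add: good_def)
      let ?Q = "V \<times> (?F \<inter> A)"
      have oQ: "openin (mtop ?P) ?Q"
        using oV openin_subtopology_Int2[OF oA, of ?F] by (auto simp: openin_prod_Times_iff openin_subtopology_self openin_open_subtopology)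
      have f1: "smooth_map_on ?P ?Q circle fst"
        by (rule smooth_map_on_out_sub[OF PC VC smooth_map_on_prod_fst[OF VS FC]])
      have f2: "smooth_map_on ?P ?Q M snd"
        by (rule smooth_map_on_out_sub[OF PC FC smooth_map_on_prod_snd[OF VC FS]])
      have f: "smooth_map_on ?P ?Q (prod_manifold circle M) (\<lambda>w. (fst w, snd w))"
        by (rule smooth_map_on_prod_Pair[OF PC f1 f2])
      have "smooth_map_on ?P ?Q M (\<lambda>w. S (fst w, snd w))"
        by (rule smooth_map_on_compose[OF PC charted_prod[OF CC MC] f S(1)]) (auto simp: V_def)
      then have "smooth_map_on ?P ?Q M \<Psi>"
      proof (rule smooth_map_on_cong[OF PC])
        fix w assume "w \<in> ?Q"
        then have w: "fst w \<in> V" "snd w \<in> ?F" "snd w \<in> A" by auto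
        then have z: "S (fst w, snd w) \<in> Q" "u (S (fst w, snd w)) = fst w" "\<pi> (S (fst w, snd w)) = snd w"
          using S(2)[rule_format, of "fst w" "snd w"] by (auto simp: V_def)
        have "S (fst w, snd w) \<in> N" by (rule VN) (use z QM w in auto)
        then show "S (fst w, snd w) = \<Psi> w" using Ninj[of "S (fst w, snd w)" "\<Psi> w"] \<Psi>[OF w(1,2)] z by simp
      qed
      then have "smooth_map_on ?P (pts ?P \<inter> ?Q) M \<Psi>" by (rule smooth_map_on_subset) simp
      moreover have "w \<in> ?Q" using w A(2) by (simp add: mem_Times_iff)
      ultimately show "\<exists>Q. openin (mtop ?P) Q \<and> w \<in> Q \<and> smooth_map_on ?P (pts ?P \<inter> Q) M \<Psi>"
        using oQ by (intro exI[of _ ?Q] conjI)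
    qed
  qed
  have "diffeomorphism ?EM ?P (\<lambda>z. (u z, \<pi> z))"
  proof (rule diffeomorphismI[OF EC PC sPhi sPsi])
    fix z assume "z \<in> pts ?EM"
    then have z: "z \<in> pts M" "u z \<in> V" unfolding ptsE by auto
    have zN: "z \<in> N" by (rule VN[OF z])
    have "\<pi> z \<in> ?F" using \<pi>M[OF z(1)] \<pi>(3) zN N(3) by auto
    then have "\<Psi> (u z, \<pi> z) \<in> N \<and> u (\<Psi> (u z, \<pi> z)) = u z \<and> \<pi> (\<Psi> (u z, \<pi> z)) = \<pi> z"
      using \<Psi>[of "(u z, \<pi> z)"] z(2) by simp
    then show "\<Psi> (u z, \<pi> z) = z" using Ninj zN by blast
  next
    fix w assume "w \<in> pts ?P"
    then show "(u (\<Psi> w), \<pi> (\<Psi> w)) = w" using \<Psi>[of w] unfolding ptsP by auto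
  qed
  then show thesis by (rule that[OF oV bV]) simp
qed

text \<open>Restricting a trivialization to the base point \<open>c\<close> identifies the fiber
  over \<open>c\<close>, with its own submanifold structure, with the model fiber. This allows the
  fibers over different points to be compared.\<close>

lemma fiber_slice:
  fixes M :: "('a, real^'n) manifold" and u :: "'a \<Rightarrow> complex"
  assumes M: "closed_manifold M" and circ: "smooth_manifold circle" and V: "openin (mtop circle) V" and c: "c \<in> V"
    and FM: "smooth_manifold FM" and Fc: "smooth_manifold (submanifold M {z \<in> pts M. u z = c} :: ('a, 'd::euclidean_space) manifold)"
    and oE: "openin (mtop M) (pts M \<inter> u -` V)"
    and \<Phi>: "diffeomorphism (submanifold M (pts M \<inter> u -` V) :: ('a, real^'n) manifold) (prod_manifold (submanifold circle V :: (complex, real) manifold) FM) \<Phi>"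
    and f: "\<And>z. z \<in> pts M \<Longrightarrow> u z \<in> V \<Longrightarrow> fst (\<Phi> z) = u z"
  shows "diffeomorphism (submanifold M {z \<in> pts M. u z = c} :: ('a, 'd) manifold) FM (\<lambda>z. snd (\<Phi> z))"
proof -
  note MC = closed_manifold_charted[OF M] and MS = closed_manifold_smooth[OF M]
  let ?E = "pts M \<inter> u -` V"
  let ?EM = "submanifold M ?E :: ('a, real^'n) manifold"
  let ?VM = "submanifold circle V :: (complex, real) manifold"
  let ?Fc = "submanifold M {z \<in> pts M. u z = c} :: ('a, 'd) manifold"
  note FC = smooth_manifold_charted[OF FM] and FcC = smooth_manifold_charted[OF Fc]
  have EC: "charted ?EM" by (rule charted_open_submanifold[OF MS oE])
  have VC: "charted ?VM" by (rule charted_open_submanifold[OF circ V])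
  have VS: "smooth_manifold ?VM" by (rule smooth_manifold_submanifold[OF circ VC])
  let ?P = "prod_manifold ?VM FM"
  have PC: "charted ?P" by (rule charted_prod[OF VC FC])
  have VsubC: "V \<subseteq> sphere 0 1" using openin_subset[OF V] by simp
  have ptsE: "pts ?EM = ?E" by auto
  have ptsP: "pts ?P = V \<times> pts FM" using VsubC by auto
  have ptsFc: "pts ?Fc = {z \<in> pts M. u z = c}" by auto
  obtain \<Psi> where \<Psi>: "smooth_map_on ?EM (pts ?EM) ?P \<Phi>" "smooth_map_on ?P (pts ?P) ?EM \<Psi>"
    "\<And>z. z \<in> pts ?EM \<Longrightarrow> \<Psi> (\<Phi> z) = z" "\<And>w. w \<in> pts ?P \<Longrightarrow> \<Phi> (\<Psi> w) = w"
    using diffeomorphismE[OF \<Phi>] by metis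
  have FcE: "{z \<in> pts M. u z = c} \<subseteq> ?E" using c by auto
  have s1: "smooth_map_on ?Fc (pts ?Fc) FM (\<lambda>z. snd (\<Phi> z))"
  proof -
    have "smooth_map_on M ?E ?P \<Phi>"
      by (rule smooth_map_on_from_sub[OF EC MC subset_refl]) (use \<Psi>(1) in \<open>simp only: ptsE\<close>)
    then have "smooth_map_on M (pts ?Fc) ?P \<Phi>" by (rule smooth_map_on_subset) (use FcE in auto)
    then have "smooth_map_on ?Fc (pts ?Fc) ?P \<Phi>" by (rule smooth_map_on_restrict_sub[OF FcC MC])
    from smooth_map_on_compose[OF FcC PC this smooth_map_on_prod_snd[OF VC FM, of UNIV]] show ?thesis by simp
  qed
  have cc: "smooth_map_on FM (pts FM) ?VM (\<lambda>y. c)"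
  proof (rule smooth_map_on_to_sub[OF FC smooth_manifold_charted[OF circ]])
    show "smooth_map_on FM (pts FM) circle (\<lambda>y. c)"
      by (rule smooth_map_on_euclid_circle[OF FC smooth_map_on_const[OF FC]]) (use VsubC c in auto)
  qed (rule c)
  have s2: "smooth_map_on FM (pts FM) ?Fc (\<lambda>y. \<Psi> (c, y))"
  proof (rule smooth_map_on_to_sub[OF FC MC])
    have p: "smooth_map_on FM (pts FM) ?P (\<lambda>y. (c, y))"
      by (rule smooth_map_on_prod_Pair[OF FC cc smooth_map_on_ident[OF FM]])
    have "smooth_map_on FM (pts FM) ?EM (\<lambda>y. \<Psi> (c, y))"
      by (rule smooth_map_on_compose[OF FC PC p \<Psi>(2)]) (use c ptsP in auto)
    then show "smooth_map_on FM (pts FM) M (\<lambda>y. \<Psi> (c, y))" by (rule smooth_map_on_out_sub[OF FC EC])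
    fix y assume "y \<in> pts FM"
    then have w: "(c, y) \<in> pts ?P" using c ptsP by auto
    then have z: "\<Psi> (c, y) \<in> ?E" using smooth_map_on_into[OF \<Psi>(2) w w] ptsE by simp
    then have "u (\<Psi> (c, y)) = c" using f[of "\<Psi> (c, y)"] \<Psi>(4)[OF w] by simp
    then show "\<Psi> (c, y) \<in> {z \<in> pts M. u z = c}" using z by simp
  qed
  show ?thesis
  proof (rule diffeomorphismI[OF FcC FC s1 s2])
    fix z assume "z \<in> pts ?Fc"
    then have z: "z \<in> pts M" "u z = c" by auto
    then have "fst (\<Phi> z) = c" using f c by simp
    then have "(c, snd (\<Phi> z)) = \<Phi> z" by (metis prod.collapse)
    then show "\<Psi> (c, snd (\<Phi> z)) = z" using \<Psi>(3)[of z] z c by simp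
  next
    fix y assume "y \<in> pts FM"
    then have w: "(c, y) \<in> pts ?P" using c ptsP by auto
    show "snd (\<Phi> (\<Psi> (c, y))) = y" using \<Psi>(4)[OF w] by simp
  qed
qed

text \<open>Each local trivialization comes with its own fiber as model. Being diffeomorphic is
  locally constant in the base point and the circle is connected, so every model can be replaced by
  the fiber over 1.\<close>

theorem circle_submersion_bundle:
  fixes M :: "('a, real^'n) manifold" and u :: "'a \<Rightarrow> complex"
  assumes M: "closed_manifold M" and circ: "smooth_manifold circle" and u: "smooth_map_on M (pts M) euclid u" "\<And>x. x \<in> pts M \<Longrightarrow> cmod (u x) = 1"
    and reg: "\<And>x. x \<in> pts M \<Longrightarrow> regular_at M u x" and dim: "CARD('n) = DIM('d::euclidean_space) + 1"
  shows "\<exists>F :: ('a, 'd::euclidean_space) manifold. smooth_fiber_bundle M circle F (diffeos F) u"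
proof -
  note MC = closed_manifold_charted[OF M] and MS = closed_manifold_smooth[OF M] and CC = smooth_manifold_charted[OF circ]
  define F where "F b = (submanifold M {z \<in> pts M. u z = b} :: ('a, 'd) manifold)" for b
  have FS: "smooth_manifold (F b)" for b unfolding F_def by (rule smooth_manifold_fiber[OF M u reg dim])
  note FC = smooth_manifold_charted[OF FS]
  have ptsF: "pts (F b) = {z \<in> pts M. u z = b}" for b by (auto simp: F_def)
  have "\<forall>b\<in>sphere 0 1. \<exists>V \<Phi>. openin (mtop circle) V \<and> b \<in> V \<and>
    diffeomorphism (submanifold M (pts M \<inter> u -` V) :: ('a, real^'n) manifold) (prod_manifold (submanifold circle V :: (complex, real) manifold) (F b)) \<Phi> \<and>
    (\<forall>z\<in>pts M \<inter> u -` V. fst (\<Phi> z) = u z)"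
  proof
    fix b :: complex assume "b \<in> sphere 0 1"
    then have b: "cmod b = 1" by simp
    obtain V \<Phi> where "openin (mtop circle) V" "b \<in> V"
    "diffeomorphism (submanifold M (pts M \<inter> u -` V) :: ('a, real^'n) manifold)
      (prod_manifold (submanifold circle V :: (complex, real) manifold) (submanifold M {z \<in> pts M. u z = b} :: ('a, 'd) manifold)) \<Phi>"
    "\<And>z. z \<in> pts M \<Longrightarrow> u z \<in> V \<Longrightarrow> fst (\<Phi> z) = u z"
      by (rule local_trivialization[OF M circ u reg b dim, rotated 2]) (rule that; assumption)
    then show "\<exists>V \<Phi>. openin (mtop circle) V \<and> b \<in> V \<and>
    diffeomorphism (submanifold M (pts M \<inter> u -` V) :: ('a, real^'n) manifold) (prod_manifold (submanifold circle V :: (complex, real) manifold) (F b)) \<Phi> \<and>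
    (\<forall>z\<in>pts M \<inter> u -` V. fst (\<Phi> z) = u z)"
      unfolding F_def by (intro exI[of _ V] exI[of _ \<Phi>]) simp
  qed
  from bchoice[OF this] obtain V where "\<forall>b\<in>sphere 0 1. \<exists>\<Phi>. openin (mtop circle) (V b) \<and> b \<in> V b \<and>
    diffeomorphism (submanifold M (pts M \<inter> u -` V b) :: ('a, real^'n) manifold) (prod_manifold (submanifold circle (V b) :: (complex, real) manifold) (F b)) \<Phi> \<and>
    (\<forall>z\<in>pts M \<inter> u -` V b. fst (\<Phi> z) = u z)" ..
  from bchoice[OF this] obtain \<Phi> where V\<Phi>: "\<forall>b\<in>sphere 0 1. openin (mtop circle) (V b) \<and> b \<in> V b \<and>
    diffeomorphism (submanifold M (pts M \<inter> u -` V b) :: ('a, real^'n) manifold) (prod_manifold (submanifold circle (V b) :: (complex, real) manifold) (F b)) (\<Phi> b) \<and>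
    (\<forall>z\<in>pts M \<inter> u -` V b. fst (\<Phi> b z) = u z)" ..
  have V: "openin (mtop circle) (V b)" "b \<in> V b" and \<Phi>: "diffeomorphism (submanifold M (pts M \<inter> u -` V b) :: ('a, real^'n) manifold) (prod_manifold (submanifold circle (V b) :: (complex, real) manifold) (F b)) (\<Phi> b)"
    and fst\<Phi>: "\<And>z. z \<in> pts M \<Longrightarrow> u z \<in> V b \<Longrightarrow> fst (\<Phi> b z) = u z" if "b \<in> sphere 0 1" for b
    using V\<Phi> that by auto
  have VC: "V b \<subseteq> sphere 0 1" if "b \<in> sphere 0 1" for b using openin_subset[OF V(1)[OF that]] by simp
  have oE: "openin (mtop M) (pts M \<inter> u -` V b)" if b: "b \<in> sphere 0 1" for b
  proof -
    obtain W where W: "open W" "V b = sphere 0 1 \<inter> W" using V(1)[OF b] by (auto simp: mtop_circle openin_open)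
    have "pts M \<inter> u -` V b = {z \<in> pts M. u z \<in> W}" using u(2) W(2) by auto
    then show ?thesis using openin_smooth_preimage[OF u(1) W(1)] by simp
  qed
  have slice: "diffeomorphism (F c) (F b) (\<lambda>z. snd (\<Phi> b z))" if b: "b \<in> sphere 0 1" and c: "c \<in> V b" for b c
    unfolding F_def[of c]
    by (rule fiber_slice[OF M circ V(1)[OF b] c FS FS[of c, unfolded F_def] oE[OF b] \<Phi>[OF b] fst\<Phi>[OF b]])
  define D where "D b c \<longleftrightarrow> (\<exists>f. diffeomorphism (F b) (F c) f)" for b c
  have D: "D b c" if b: "b \<in> sphere 0 1" and c: "c \<in> sphere 0 1" for b c
  proof (rule connected_equivalence_relation[of "sphere 0 1 :: complex set", OF _ b c])
    show "connected (sphere 0 1 :: complex set)" by (rule connected_sphere) simp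
    show "D y x" if "D x y" for x y using that diffeomorphism_inv[OF FC FC] unfolding D_def by blast
    show "D x z" if "D x y" "D y z" for x y z using that diffeomorphism_compose[OF FC FC FC] unfolding D_def by blast
    fix a :: complex assume a: "a \<in> sphere 0 1"
    show "\<exists>T. openin (top_of_set (sphere 0 1)) T \<and> a \<in> T \<and> (\<forall>x\<in>T. D a x)"
    proof (intro exI[of _ "V a"] conjI ballI)
      show "openin (top_of_set (sphere 0 1)) (V a)" "a \<in> V a" using V[OF a] by (simp_all add: mtop_circle)
      show "D a x" if "x \<in> V a" for x
        using diffeomorphism_inv[OF FC FC slice[OF a that]] unfolding D_def by blast
    qed
  qed
  have 1: "(1::complex) \<in> sphere 0 1" by simp
  have "\<forall>b\<in>sphere 0 1. \<exists>f. diffeomorphism (F b) (F 1) f" using D[OF _ 1] unfolding D_def by blast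
  from bchoice[OF this] obtain \<delta> where \<delta>': "\<forall>b\<in>sphere 0 1. diffeomorphism (F b) (F 1) (\<delta> b)" ..
  have \<delta>: "diffeomorphism (F b) (F 1) (\<delta> b)" if "b \<in> sphere 0 1" for b using \<delta>' that by auto
  define \<Phi>' where "\<Phi>' b z = (fst (\<Phi> b z), \<delta> b (snd (\<Phi> b z)))" for b z
  have \<Phi>': "diffeomorphism (submanifold M (pts M \<inter> u -` V b) :: ('a, real^'n) manifold) (prod_manifold (submanifold circle (V b) :: (complex, real) manifold) (F 1)) (\<Phi>' b)"
    if b: "b \<in> sphere 0 1" for b
  proof -
    let ?VM = "submanifold circle (V b) :: (complex, real) manifold"
    have EC: "charted (submanifold M (pts M \<inter> u -` V b) :: ('a, real^'n) manifold)" by (rule charted_open_submanifold[OF MS oE[OF b]])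
    have VMC: "charted ?VM" by (rule charted_open_submanifold[OF circ V(1)[OF b]])
    have VS: "smooth_manifold ?VM" by (rule smooth_manifold_submanifold[OF circ VMC])
    obtain e where e: "smooth_map_on (F b) (pts (F b)) (F 1) (\<delta> b)" "smooth_map_on (F 1) (pts (F 1)) (F b) e"
      "\<And>x. x \<in> pts (F b) \<Longrightarrow> e (\<delta> b x) = x" "\<And>y. y \<in> pts (F 1) \<Longrightarrow> \<delta> b (e y) = y"
      using diffeomorphismE[OF \<delta>[OF b]] by metis
    have C1: "charted (prod_manifold ?VM (F b))" and C2: "charted (prod_manifold ?VM (F 1))" by (rule charted_prod[OF VMC FC])+
    have g: "diffeomorphism (prod_manifold ?VM (F b)) (prod_manifold ?VM (F 1)) (\<lambda>w. (fst w, \<delta> b (snd w)))"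
    proof (rule diffeomorphismI[OF C1 C2, where g = "\<lambda>w. (fst w, e (snd w))"])
      show "smooth_map_on (prod_manifold ?VM (F b)) (pts (prod_manifold ?VM (F b))) (prod_manifold ?VM (F 1)) (\<lambda>w. (fst w, \<delta> b (snd w)))"
        by (rule smooth_map_on_prod_Pair[OF C1 smooth_map_on_prod_fst[OF VS FC] smooth_map_on_compose[OF C1 FC smooth_map_on_prod_snd[OF VMC FS] e(1)]]) auto
      show "smooth_map_on (prod_manifold ?VM (F 1)) (pts (prod_manifold ?VM (F 1))) (prod_manifold ?VM (F b)) (\<lambda>w. (fst w, e (snd w)))"
        by (rule smooth_map_on_prod_Pair[OF C2 smooth_map_on_prod_fst[OF VS FC] smooth_map_on_compose[OF C2 FC smooth_map_on_prod_snd[OF VMC FS] e(2)]]) auto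
    qed (use e(3,4) in auto)
    show ?thesis using diffeomorphism_compose[OF EC C1 C2 \<Phi>[OF b] g] unfolding \<Phi>'_def .
  qed
  define h where "h b z = \<delta> b (snd (\<Phi> b z))" for b z
  have h: "diffeomorphism (F c) (F 1) (h b)" if "b \<in> sphere 0 1" "c \<in> V b" for b c
    unfolding h_def by (rule diffeomorphism_compose[OF FC FC FC slice[OF that] \<delta>[OF that(1)]])
  have \<Phi>'h: "\<Phi>' b z = (u z, h b z)" if "b \<in> sphere 0 1" "z \<in> pts M" "u z \<in> V b" for b z
    using fst\<Phi>[OF that] by (simp add: \<Phi>'_def h_def)
  \<comment> \<open>Over \<open>c\<close> both trivializations restrict to diffeomorphisms from the
    fiber over \<open>c\<close> to \<open>F 1\<close>; the transition is one of them after the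
    inverse of the other.\<close>
  have trans: "\<exists>g\<in>diffeos (F 1). \<forall>y\<in>pts (F 1). \<Phi>' b' (inv_into (pts M \<inter> u -` V b) (\<Phi>' b) (c, y)) = (c, g y)"
    if b: "b \<in> sphere 0 1" and b': "b' \<in> sphere 0 1" and c: "c \<in> V b" "c \<in> V b'" for b b' c
  proof (intro bexI ballI)
    let ?g = "\<lambda>y. h b' (inv_into (pts (F c)) (h b) y)"
    show "?g \<in> diffeos (F 1)" unfolding diffeos_def
      using diffeomorphism_compose[OF FC FC FC diffeomorphism_inv[OF FC FC h[OF b c(1)]] h[OF b' c(2)]] by simp
    fix y assume y: "y \<in> pts (F 1)"
    let ?z = "inv_into (pts M \<inter> u -` V b) (\<Phi>' b) (c, y)"
    have pE: "pts (submanifold M (pts M \<inter> u -` V b) :: ('a, real^'n) manifold) = pts M \<inter> u -` V b" by auto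
    have w: "(c, y) \<in> pts (prod_manifold (submanifold circle (V b) :: (complex, real) manifold) (F 1))"
      using c(1) y VC[OF b] by auto
    have "\<Phi>' b ?z = (c, y)" using inv_into_diffeo(2)[OF \<Phi>'[OF b] w] unfolding pE .
    moreover have "?z \<in> pts M \<inter> u -` V b"
    proof -
      have "bij_betw (\<Phi>' b) (pts M \<inter> u -` V b) (pts (prod_manifold (submanifold circle (V b) :: (complex, real) manifold) (F 1)))"
        using \<Phi>'[OF b] pE unfolding diffeomorphism_def by metis
      then show ?thesis using w inv_into_into[of "(c, y)" "\<Phi>' b" "pts M \<inter> u -` V b"] unfolding bij_betw_def by metis
    qed
    ultimately have z: "?z \<in> pts M" "u ?z = c" "h b ?z = y" using \<Phi>'h[OF b, of ?z] by auto
    have "inv_into (pts (F c)) (h b) y = ?z"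
      using inv_into_diffeo(1)[OF h[OF b c(1)], of ?z] z ptsF by simp
    moreover have "\<Phi>' b' ?z = (u ?z, h b' ?z)" using \<Phi>'h[OF b' z(1)] z(2) c(2) by simp
    ultimately show "\<Phi>' b' ?z = (c, ?g y)" using z(2) by simp
  qed
  have "smooth_map M circle u" unfolding smooth_map_def
    by (rule smooth_map_on_euclid_circle[OF MC u(1)]) (use u(2) in auto)
  then have "smooth_fiber_bundle M circle (F 1) (diffeos (F 1)) u"
    unfolding smooth_fiber_bundle_def
  proof (intro conjI MS circ FS exI[of _ "(\<lambda>b. (V b, \<Phi>' b)) ` sphere 0 1"])
    show "\<Union>(fst ` (\<lambda>b. (V b, \<Phi>' b)) ` sphere 0 1) = pts circle" using V(2) VC by force
    show "\<forall>(Va, \<Phi>)\<in>(\<lambda>b. (V b, \<Phi>' b)) ` sphere 0 1. openin (mtop circle) Va \<and>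
       diffeomorphism (submanifold M (pts M \<inter> u -` Va) :: ('a, real^'n) manifold) (prod_manifold (submanifold circle Va :: (complex, real) manifold) (F 1)) \<Phi> \<and>
       (\<forall>x\<in>pts M \<inter> u -` Va. fst (\<Phi> x) = u x)"
      using V(1) \<Phi>' \<Phi>'h by auto
    show "\<forall>(Va, \<Phi>)\<in>(\<lambda>b. (V b, \<Phi>' b)) ` sphere 0 1. \<forall>(V', \<Phi>')\<in>(\<lambda>b. (V b, \<Phi>' b)) ` sphere 0 1. \<forall>b\<in>Va \<inter> V'.
       \<exists>g\<in>diffeos (F 1). \<forall>y\<in>pts (F 1). \<Phi>' (inv_into (pts M \<inter> u -` Va) \<Phi> (b, y)) = (b, g y)"
    proof (intro ballI, clarify)
      fix b b' c assume "b \<in> sphere (0::complex) 1" "b' \<in> sphere (0::complex) 1" "c \<in> V b" "c \<in> V b'"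
      then show "\<exists>g\<in>diffeos (F 1). \<forall>y\<in>pts (F 1). \<Phi>' b' (inv_into (pts M \<inter> u -` V b) (\<Phi>' b) (c, y)) = (c, g y)"
        by (rule trans)
    qed
  qed
  then show ?thesis by blast
qed

section \<open>Circle-valued maps on the 3-torus\<close>

text \<open>Fraction-free Gaussian elimination: a row \<open>p\<close> with nonzero entry in column
  \<open>i0\<close> clears that column from the other rows, and a relation between the reduced rows
  translates back.\<close>

lemma integer_dependence:
  fixes N :: "'j \<Rightarrow> 'i \<Rightarrow> int"
  assumes "finite I" "finite J" "card I < card J"
  shows "\<exists>m. (\<exists>j\<in>J. m j \<noteq> 0) \<and> (\<forall>i\<in>I. (\<Sum>j\<in>J. m j * N j i) = 0)"
  using assms
proof (induction I arbitrary: J N rule: finite_induct)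
  case empty
  then obtain j where "j \<in> J" by (metis card_gt_0_iff card.empty ex_in_conv)
  then show ?case by (intro exI[of _ "\<lambda>_. 1"]) auto
next
  case (insert i0 I)
  show ?case
  proof (cases "\<forall>j\<in>J. N j i0 = 0")
    case True
    have "card I < card J" using insert by simp
    then obtain m where "\<exists>j\<in>J. m j \<noteq> 0" "\<forall>i\<in>I. (\<Sum>j\<in>J. m j * N j i) = 0"
      using insert.IH[OF insert.prems(1), of N] by blast
    then show ?thesis using True by (intro exI[of _ m]) auto
  next
    case False
    then obtain p where p: "p \<in> J" "N p i0 \<noteq> 0" by blast
    have "card I < card (J - {p})" using insert p by simp
    then obtain m where m: "\<exists>j\<in>J - {p}. m j \<noteq> 0"
      "\<forall>i\<in>I. (\<Sum>j\<in>J - {p}. m j * (N p i0 * N j i - N j i0 * N p i)) = 0"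
      using insert.IH[of "J - {p}" "\<lambda>j i. N p i0 * N j i - N j i0 * N p i"] insert.prems(1) by auto
    \<comment> \<open>Scaling by the pivot avoids division; the coefficient at \<open>p\<close>
      collects the multiples of row \<open>p\<close> that the elimination subtracted.\<close>
    define m' where "m' j = (if j = p then - (\<Sum>j\<in>J - {p}. m j * N j i0) else N p i0 * m j)" for j
    have sum: "(\<Sum>j\<in>J. m' j * N j i) = (\<Sum>j\<in>J - {p}. m j * (N p i0 * N j i - N j i0 * N p i))" for i
    proof -
      have "(\<Sum>j\<in>J. m' j * N j i) = m' p * N p i + (\<Sum>j\<in>J - {p}. m' j * N j i)"
        by (rule sum.remove[OF insert.prems(1) p(1)])
      also have "(\<Sum>j\<in>J - {p}. m' j * N j i) = (\<Sum>j\<in>J - {p}. N p i0 * m j * N j i)"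
        by (rule sum.cong) (auto simp: m'_def)
      also have "m' p * N p i = (\<Sum>j\<in>J - {p}. - (m j * N j i0) * N p i)"
        by (simp add: m'_def sum_distrib_right sum_negf)
      finally show ?thesis by (simp add: sum.distrib[symmetric] algebra_simps)
    qed
    have "\<exists>j\<in>J. m' j \<noteq> 0" using m(1) p(2) by (auto simp: m'_def)
    moreover have "\<forall>i\<in>insert i0 I. (\<Sum>j\<in>J. m' j * N j i) = 0"
      using m(2) unfolding sum by (auto simp: mult.commute)
    ultimately show ?thesis by blast
  qed
qed

section \<open>Lifting to and descending from the universal cover of the torus\<close>

lemma exp_ii_lift:
  fixes g :: "'a::euclidean_space \<Rightarrow> complex"
  assumes g: "continuous_on UNIV g" "\<And>t. cmod (g t) = 1"
  obtains \<theta> where "continuous_on UNIV \<theta>" "\<And>t. g t = cis (\<theta> t)"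
proof -
  have "g z \<noteq> 0" for z using g(2)[of z] by auto
  then obtain G where G: "continuous_on UNIV G" "\<And>x. g x = exp (G x)"
    using continuous_logarithm_on_contractible[OF g(1) convex_imp_contractible[OF convex_UNIV]] by (metis UNIV_I)
  have "Re (G x) = 0" for x using g(2)[of x] unfolding G(2) by simp
  then have "g x = cis (Im (G x))" for x unfolding G(2) by (simp add: exp_eq_polar)
  then show thesis using that[of "\<lambda>x. Im (G x)"] G(1) by (simp add: continuous_on_Im)
qed

text \<open>The universal covering of the 3-torus, with pairs nested as in the parametrization of a
  tube around a torus.\<close>

definition torus_exp :: "(real \<times> real) \<times> real \<Rightarrow> (complex \<times> complex) \<times> complex" where
  "torus_exp t = ((cis (fst (fst t)), cis (snd (fst t))), cis (snd t))"

lemma cis_eq_iff: "cis x = cis y \<longleftrightarrow> (\<exists>n::int. x = y + 2 * pi * n)"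
  using sin_cos_eq_iff[of x y] by (auto simp: complex_eq_iff)

lemma cis_add_multiple_2pi: "cis (x + 2 * pi * of_int n) = cis x"
  unfolding cis_eq_iff by blast

lemma continuous_on_torus_exp: "continuous_on S torus_exp"
  unfolding torus_exp_def by (intro continuous_intros)

lemma torus_exp_image: "torus_exp ` (cbox ((-pi, -pi), -pi) ((pi, pi), pi)) = (sphere 0 1 \<times> sphere 0 1) \<times> sphere 0 1"
proof -
  have *: "\<exists>t. -pi \<le> t \<and> t \<le> pi \<and> z = cis t" if "cmod z = 1" for z
    using that cis_Arg[of z] Arg_bounded[of z] by (intro exI[of _ "Arg z"]) (cases "z = 0"; simp add: sgn_div_norm)
  show ?thesis
  proof (intro equalityI subsetI)
    fix w :: "(complex \<times> complex) \<times> complex" assume "w \<in> (sphere 0 1 \<times> sphere 0 1) \<times> sphere 0 1"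
    then have "cmod (fst (fst w)) = 1" "cmod (snd (fst w)) = 1" "cmod (snd w) = 1" by auto
    then obtain r s t where "-pi \<le> r" "r \<le> pi" "fst (fst w) = cis r" "-pi \<le> s" "s \<le> pi" "snd (fst w) = cis s"
      "-pi \<le> t" "t \<le> pi" "snd w = cis t" using * by metis
    then show "w \<in> torus_exp ` (cbox ((-pi, -pi), -pi) ((pi, pi), pi))"
      by (intro image_eqI[of _ _ "((r, s), t)"]) (auto simp: torus_exp_def prod_eq_iff cbox_Pair_eq)
  qed (auto simp: torus_exp_def)
qed

lemma Basis_real_triple: "(Basis :: ((real \<times> real) \<times> real) set) = {((1, 0), 0), ((0, 1), 0), ((0, 0), 1)}"
  by (auto simp: Basis_prod_def zero_prod_def)

lemma periodic_int:
  fixes \<Theta> :: "'a::real_vector \<Rightarrow> real" and n :: int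
  assumes "\<And>t. \<Theta> (t + b) = \<Theta> t"
  shows "\<Theta> (t + of_int n *\<^sub>R b) = \<Theta> t"
proof -
  have nat: "\<Theta> (t + of_nat k *\<^sub>R b) = \<Theta> t" for t k
  proof (induction k)
    case (Suc k)
    have "\<Theta> (t + of_nat (Suc k) *\<^sub>R b) = \<Theta> ((t + of_nat k *\<^sub>R b) + b)" by (simp add: algebra_simps)
    then show ?case unfolding assms Suc .
  qed simp
  show ?thesis
  proof (cases "0 \<le> n")
    case True then show ?thesis using nat[of t "nat n"] by simp
  next
    case False then show ?thesis using nat[of "t + of_int n *\<^sub>R b" "nat (-n)"] by (simp add: algebra_simps)
  qed
qed

text \<open>On a cube of side 2 pi \<open>torus_exp\<close> is a continuous surjection from a
  compact space to a Hausdorff space, hence a quotient map; this makes the induced function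
  continuous.\<close>

lemma torus_exp_descends:
  fixes \<Theta> :: "(real \<times> real) \<times> real \<Rightarrow> real"
  assumes cont: "continuous_on UNIV \<Theta>" and per: "\<And>t b. b \<in> Basis \<Longrightarrow> \<Theta> (t + (2 * pi) *\<^sub>R b) = \<Theta> t"
  shows "\<exists>h. continuous_on ((sphere 0 1 \<times> sphere 0 1) \<times> sphere 0 1) h \<and> (\<forall>t. h (torus_exp t) = \<Theta> t)"
proof -
  have per': "\<Theta> (t + of_int n *\<^sub>R (2 * pi) *\<^sub>R b) = \<Theta> t" if "b \<in> Basis" for t b n
    using per[OF that] by (rule periodic_int)
  have inv: "\<Theta> s = \<Theta> t" if e: "torus_exp s = torus_exp t" for s t
  proof -
    obtain k l n :: int where "fst (fst s) = fst (fst t) + 2 * pi * k" "snd (fst s) = snd (fst t) + 2 * pi * l" "snd s = snd t + 2 * pi * n"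
      using e unfolding torus_exp_def by (auto simp: cis_eq_iff)
    then have s: "s = ((t + of_int k *\<^sub>R (2 * pi) *\<^sub>R ((1, 0), 0)) + of_int l *\<^sub>R (2 * pi) *\<^sub>R ((0, 1), 0)) + of_int n *\<^sub>R (2 * pi) *\<^sub>R ((0, 0), 1)"
      by (auto simp: prod_eq_iff)
    have "\<Theta> s = \<Theta> ((t + of_int k *\<^sub>R (2 * pi) *\<^sub>R ((1, 0), 0)) + of_int l *\<^sub>R (2 * pi) *\<^sub>R ((0, 1), 0))"
      unfolding s by (rule per') (simp add: Basis_real_triple)
    also have "\<dots> = \<Theta> (t + of_int k *\<^sub>R (2 * pi) *\<^sub>R ((1, 0), 0))" by (rule per') (simp add: Basis_real_triple)
    also have "\<dots> = \<Theta> t" by (rule per') (simp add: Basis_real_triple)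
    finally show ?thesis .
  qed
  define h where "h x = \<Theta> (inv_into UNIV torus_exp x)" for x
  have h: "h (torus_exp t) = \<Theta> t" for t unfolding h_def by (rule inv) (rule f_inv_into_f, simp)
  let ?K = "cbox ((-pi, -pi), -pi) ((pi, pi), pi) :: ((real \<times> real) \<times> real) set"
  let ?T = "(sphere 0 1 \<times> sphere 0 1) \<times> sphere 0 1 :: ((complex \<times> complex) \<times> complex) set"
  have "quotient_map (top_of_set ?K) (top_of_set ?T) torus_exp"
  proof (rule T1_Spaces.continuous_imp_quotient_map)
    show "continuous_map (top_of_set ?K) (top_of_set ?T) torus_exp"
      using continuous_on_torus_exp torus_exp_image by (metis continuous_map_subtopology_eu image_subset_iff_funcset order_refl)
    show "compact_space (top_of_set ?K)" by (metis compact_cbox compact_space_subtopology compactin_euclidean_iff)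
    show "Hausdorff_space (top_of_set ?T)" by (simp add: Hausdorff_space_subtopology)
    show "torus_exp ` topspace (top_of_set ?K) = topspace (top_of_set ?T)" using torus_exp_image by simp
  qed
  moreover have "continuous_map (top_of_set ?K) euclidean (h \<circ> torus_exp)"
    using continuous_on_subset[OF cont, of ?K] by (simp add: h o_def)
  ultimately have "continuous_map (top_of_set ?T) euclidean h" by (rule continuous_compose_quotient_map)
  then show ?thesis using h by (intro exI[of _ h]) simp
qed

text \<open>Homotopy classes of maps from the 3-torus to the circle form a group of rank 3, so any four of them are dependent.\<close>

lemma torus_unit_maps_dependent:
  fixes g :: "'j \<Rightarrow> (complex \<times> complex) \<times> complex \<Rightarrow> complex"
  assumes J: "finite J" "3 < card J"
    and g: "\<And>j. j \<in> J \<Longrightarrow> continuous_on ((sphere 0 1 \<times> sphere 0 1) \<times> sphere 0 1) (g j)"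
      "\<And>j x. j \<in> J \<Longrightarrow> x \<in> (sphere 0 1 \<times> sphere 0 1) \<times> sphere 0 1 \<Longrightarrow> cmod (g j x) = 1"
  obtains m :: "'j \<Rightarrow> int" and h where "\<exists>j\<in>J. m j \<noteq> 0" "continuous_on ((sphere 0 1 \<times> sphere 0 1) \<times> sphere 0 1) h"
    "\<And>x. x \<in> (sphere 0 1 \<times> sphere 0 1) \<times> sphere 0 1 \<Longrightarrow> (\<Prod>j\<in>J. g j x powi m j) = cis (h x)"
proof -
  let ?T = "(sphere 0 1 \<times> sphere 0 1) \<times> sphere 0 1 :: ((complex \<times> complex) \<times> complex) set"
  have eT: "torus_exp t \<in> ?T" for t by (simp add: torus_exp_def)
  have "\<forall>j\<in>J. \<exists>\<theta>. continuous_on UNIV \<theta> \<and> (\<forall>t. g j (torus_exp t) = cis (\<theta> t))"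
  proof
    fix j assume j: "j \<in> J"
    have c: "continuous_on UNIV (\<lambda>t. g j (torus_exp t))"
      by (rule continuous_on_compose2[OF g(1)[OF j] continuous_on_torus_exp]) (use eT in blast)
    obtain \<theta> where "continuous_on UNIV \<theta>" "\<And>t. g j (torus_exp t) = cis (\<theta> t)"
      by (rule exp_ii_lift[OF c g(2)[OF j eT]]) (rule that; assumption)
    then show "\<exists>\<theta>. continuous_on UNIV \<theta> \<and> (\<forall>t. g j (torus_exp t) = cis (\<theta> t))" by blast
  qed
  from bchoice[OF this] obtain \<theta> where \<theta>: "\<And>j. j \<in> J \<Longrightarrow> continuous_on UNIV (\<theta> j)" "\<And>j t. j \<in> J \<Longrightarrow> g j (torus_exp t) = cis (\<theta> j t)"
    by blast
  \<comment> \<open>The integer is the winding number of \<open>g j\<close> along the circle of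
    direction \<open>b\<close>: the change of the lift over a period is continuous with values in
    the multiples of 2 pi, hence constant.\<close>
  have "\<exists>n::int. \<forall>t. \<theta> j (t + (2 * pi) *\<^sub>R b) - \<theta> j t = 2 * pi * n" if j: "j \<in> J" and b: "b \<in> Basis" for j b
  proof -
    let ?d = "\<lambda>t. \<theta> j (t + (2 * pi) *\<^sub>R b) - \<theta> j t"
    have per: "torus_exp (t + (2 * pi) *\<^sub>R b) = torus_exp t" for t
      using b cis_add_multiple_2pi[of _ 1] unfolding Basis_real_triple by (auto simp: torus_exp_def)
    have int: "\<exists>n::int. ?d t = 2 * pi * n" for t
    proof -
      have "cis (\<theta> j (t + (2 * pi) *\<^sub>R b)) = cis (\<theta> j t)"
        using \<theta>(2)[OF j, of "t + (2 * pi) *\<^sub>R b"] \<theta>(2)[OF j, of t] unfolding per by simp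
      then show ?thesis unfolding cis_eq_iff by (metis add_diff_cancel_left')
    qed
    have "?d constant_on UNIV"
    proof (rule continuous_discrete_range_constant)
      show "continuous_on UNIV ?d"
        by (intro continuous_intros continuous_on_compose2[OF \<theta>(1)[OF j]]) auto
      fix x
      obtain n :: int where n: "?d x = 2 * pi * n" using int by blast
      have "2 * pi \<le> norm (?d y - ?d x)" if "?d y \<noteq> ?d x" for y
      proof -
        obtain k :: int where k: "?d y = 2 * pi * k" using int by blast
        have "?d y - ?d x = 2 * pi * (of_int (k - n))" unfolding n k by (simp add: algebra_simps)
        then have "norm (?d y - ?d x) = 2 * pi * \<bar>of_int (k - n)\<bar>" by (simp add: abs_mult)
        moreover have "k \<noteq> n" using that n k by auto
        then have "(1::real) \<le> \<bar>of_int (k - n)\<bar>" by linarith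
        ultimately show ?thesis using pi_gt_zero by simp
      qed
      then show "\<exists>e>0. \<forall>y. y \<in> UNIV \<and> ?d y \<noteq> ?d x \<longrightarrow> e \<le> norm (?d y - ?d x)"
        by (intro exI[of _ "2 * pi"]) auto
    qed (rule convex_connected[OF convex_UNIV])
    then obtain c where c: "\<And>t. ?d t = c" unfolding constant_on_def by auto
    obtain n :: int where "?d 0 = 2 * pi * n" using int by blast
    then show ?thesis using c by (intro exI[of _ n]) metis
  qed
  then have "\<forall>j. \<forall>b. \<exists>n::int. j \<in> J \<longrightarrow> b \<in> Basis \<longrightarrow> (\<forall>t. \<theta> j (t + (2 * pi) *\<^sub>R b) - \<theta> j t = 2 * pi * of_int n)"
    by blast
  then obtain n where n: "\<And>j b t. j \<in> J \<Longrightarrow> b \<in> Basis \<Longrightarrow> \<theta> j (t + (2 * pi) *\<^sub>R b) - \<theta> j t = 2 * pi * of_int (n j b)"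
    unfolding choice_iff by blast
  have "card (Basis :: ((real \<times> real) \<times> real) set) < card J" using J by simp
  then obtain m where m: "\<exists>j\<in>J. m j \<noteq> 0" "\<forall>b\<in>Basis. (\<Sum>j\<in>J. m j * n j b) = 0"
    using integer_dependence[OF finite_Basis J(1)] by blast
  \<comment> \<open>The relation between the winding numbers makes this combination of lifts
    periodic, so it descends to the torus as an angle of the product.\<close>
  let ?\<Theta> = "\<lambda>t. \<Sum>j\<in>J. of_int (m j) * \<theta> j t"
  have c\<Theta>: "continuous_on UNIV ?\<Theta>" by (intro continuous_intros \<theta>(1))
  have per\<Theta>: "?\<Theta> (t + (2 * pi) *\<^sub>R b) = ?\<Theta> t" if b: "b \<in> Basis" for t b
  proof -
    have "?\<Theta> (t + (2 * pi) *\<^sub>R b) - ?\<Theta> t = (\<Sum>j\<in>J. of_int (m j) * (\<theta> j (t + (2 * pi) *\<^sub>R b) - \<theta> j t))"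
      by (simp add: sum_subtractf algebra_simps)
    also have "\<dots> = (\<Sum>j\<in>J. of_int (m j) * (2 * pi * of_int (n j b)))" using n[OF _ b] by simp
    also have "\<dots> = 2 * pi * of_int (\<Sum>j\<in>J. m j * n j b)" by (simp add: sum_distrib_left algebra_simps)
    also have "\<dots> = 0" using m(2) b by simp
    finally show ?thesis by simp
  qed
  have "\<exists>h. continuous_on ?T h \<and> (\<forall>t. h (torus_exp t) = ?\<Theta> t)"
  proof (rule torus_exp_descends[OF c\<Theta>])
    fix t b :: "(real \<times> real) \<times> real" assume "b \<in> Basis"
    then show "?\<Theta> (t + (2 * pi) *\<^sub>R b) = ?\<Theta> t" by (rule per\<Theta>)
  qed
  then obtain h where h': "continuous_on ?T h \<and> (\<forall>t. h (torus_exp t) = ?\<Theta> t)" by (rule exE)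
  note h = conjunct1[OF h'] conjunct2[OF h', rule_format]
  have "(\<Prod>j\<in>J. g j x powi m j) = cis (h x)" if "x \<in> ?T" for x
  proof -
    have "x \<in> torus_exp ` cbox ((-pi, -pi), -pi) ((pi, pi), pi)" unfolding torus_exp_image by (rule that)
    then obtain t where t: "x = torus_exp t" by (rule imageE)
    have "(\<Prod>j\<in>J. g j x powi m j) = (\<Prod>j\<in>J. cis (of_int (m j) * \<theta> j t))"
      by (rule prod.cong) (simp_all add: t \<theta>(2) cis_power_int)
    also have "\<dots> = cis (?\<Theta> t)" using J(1) by (induction J rule: finite_induct) (simp_all add: cis_mult)
    finally show ?thesis using h(2) t by simp
  qed
  then show thesis by (rule that[OF m(1) h(1)])
qed

section \<open>Boundaries and curves in bundles\<close>

lemma boundaryI: "(U, \<phi>) \<in> atlas M \<Longrightarrow> x \<in> U \<Longrightarrow> \<phi> x \<notin> interior (\<phi> ` U) \<Longrightarrow> x \<in> boundary M"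
  unfolding boundary_def by blast

lemma boundaryE:
  assumes "x \<in> boundary M"
  obtains U \<phi> where "(U, \<phi>) \<in> atlas M" "x \<in> U" "\<phi> x \<notin> interior (\<phi> ` U)"
  using assms unfolding boundary_def by blast

text \<open>Invariance of domain in charts, for maps that are merely continuous and injective and
  between manifolds with different model spaces. The statements on boundary points below derive from
  it.\<close>

lemma image_neighbourhood:
  fixes M :: "('a, 'e::euclidean_space) manifold" and N :: "('b, 'd::euclidean_space) manifold"
  assumes M: "charted M" and N: "charted N" and Q: "openin (mtop M) Q"
    and f: "continuous_map (subtopology (mtop M) Q) (mtop N) f" and inj: "inj_on f Q"
    and x: "x \<in> Q" "x \<notin> boundary M" and dim: "DIM('d::euclidean_space) \<le> DIM('e::euclidean_space)"
    and V: "(V, \<psi>) \<in> atlas N" "f x \<in> V"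
  shows "\<exists>G. open G \<and> \<psi> (f x) \<in> G \<and> G \<subseteq> \<psi> ` (V \<inter> f ` Q)"
proof -
  have xM: "x \<in> pts M" using x(1) openin_subset[OF Q] by auto
  obtain U \<phi> where U: "(U, \<phi>) \<in> atlas M" "x \<in> U" using charted_obtain[OF M xM] .
  have c: "coord (mtop M) U \<phi>" and d: "coord (mtop N) V \<psi>" using charted_coord[OF M U(1)] charted_coord[OF N V(1)] .
  have xi: "\<phi> x \<in> interior (\<phi> ` U)" using boundaryI[OF U] x(2) by blast
  let ?R = "{y \<in> Q. f y \<in> V}"
  have "openin (subtopology (mtop M) Q) {y \<in> topspace (subtopology (mtop M) Q). f y \<in> V}"
    by (rule openin_continuous_map_preimage[OF f coord_openin[OF d]])
  moreover have "{y \<in> topspace (subtopology (mtop M) Q). f y \<in> V} = ?R" using openin_subset[OF Q] by auto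
  ultimately have R: "openin (mtop M) ?R" using openin_open_subtopology[OF Q] by auto
  obtain P where P: "open P" "\<And>y. y \<in> U \<Longrightarrow> \<phi> y \<in> P \<longleftrightarrow> y \<in> ?R" by (rule coord_open[OF c R]) (rule that; assumption)
  define G where "G = interior (\<phi> ` U) \<inter> P"
  let ?j = "inv_into U \<phi>" let ?g = "\<lambda>q. \<psi> (f (?j q))"
  have G: "?j q \<in> ?R" "?j q \<in> U" "\<phi> (?j q) = q" if "q \<in> G" for q
  proof -
    have q: "q \<in> \<phi> ` U" "q \<in> P" using that interior_subset[of "\<phi> ` U"] unfolding G_def by auto
    show U: "?j q \<in> U" and e: "\<phi> (?j q) = q" using q(1) by (rule inv_into_into, rule f_inv_into_f)
    show "?j q \<in> ?R" using P(2)[OF U] q(2) unfolding e by blast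
  qed
  have "continuous_map (top_of_set G) (mtop M) ?j"
    by (rule continuous_map_from_subtopology_mono[OF coord_inv_continuous[OF c]])
      (use interior_subset[of "\<phi> ` U"] in \<open>auto simp: G_def\<close>)
  then have "continuous_map (top_of_set G) (subtopology (mtop M) Q) ?j"
    by (rule continuous_map_into_subtopology) (use G(1) in auto)
  from continuous_map_compose[OF this f] have "continuous_map (top_of_set G) (subtopology (mtop N) V) (f \<circ> ?j)"
    by (rule continuous_map_into_subtopology) (use G(1) in auto)
  from continuous_map_compose[OF this coord_continuous[OF d]] have gc: "continuous_on G ?g"
    by (simp add: o_def)
  have gi: "inj_on ?g G"
  proof (rule inj_onI)
    fix q q' assume q: "q \<in> G" "q' \<in> G" and e: "?g q = ?g q'"
    have "f (?j q) = f (?j q')" using inj_onD[OF coord_inj[OF d] e] G(1)[OF q(1)] G(1)[OF q(2)] by blast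
    then have "?j q = ?j q'" using inj_onD[OF inj] G(1)[OF q(1)] G(1)[OF q(2)] by blast
    then show "q = q'" using G(3)[OF q(1)] G(3)[OF q(2)] by metis
  qed
  have "open G" unfolding G_def using P(1) by (intro open_Int open_interior)
  then have o: "open (?g ` G)" using invariance_of_domain_gen[OF _ gc gi dim] by blast
  have xj: "?j (\<phi> x) = x" using coord_inv[OF c U(2)] .
  have "\<phi> x \<in> P" using P(2)[OF U(2)] x(1) V(2) by blast
  then have "\<phi> x \<in> G" using xi unfolding G_def by blast
  then have "\<psi> (f x) \<in> ?g ` G" using xj by (intro image_eqI[of _ _ "\<phi> x"]) simp_all
  moreover have "?g ` G \<subseteq> \<psi> ` (V \<inter> f ` Q)" using G(1) by blast
  ultimately show ?thesis using o by blast
qed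

lemma boundary_subset_pts: "charted M \<Longrightarrow> boundary M \<subseteq> pts M"
  using coord_subset[OF charted_coord] unfolding boundary_def by fastforce

lemma image_not_boundary:
  fixes M :: "('a, 'e::euclidean_space) manifold" and N :: "('b, 'd::euclidean_space) manifold"
  assumes M: "charted M" and N: "charted N" and Q: "openin (mtop M) Q"
    and f: "continuous_map (subtopology (mtop M) Q) (mtop N) f" and inj: "inj_on f Q"
    and x: "x \<in> Q" "x \<notin> boundary M" and dim: "DIM('d::euclidean_space) \<le> DIM('e::euclidean_space)"
  shows "f x \<notin> boundary N"
proof
  assume "f x \<in> boundary N"
  then obtain V \<psi> where V: "(V, \<psi>) \<in> atlas N" "f x \<in> V" "\<psi> (f x) \<notin> interior (\<psi> ` V)" by (rule boundaryE)
  obtain G where G: "open G" "\<psi> (f x) \<in> G" "G \<subseteq> \<psi> ` (V \<inter> f ` Q)"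
    using image_neighbourhood[OF M N Q f inj x dim V(1,2)] by blast
  then have "G \<subseteq> \<psi> ` V" by blast
  then show False using V(3) G(1,2) by (meson interiorI)
qed

lemma image_contains_open:
  fixes M :: "('a, 'e::euclidean_space) manifold" and N :: "('b, 'd::euclidean_space) manifold"
  assumes M: "charted M" and N: "charted N" and Q: "openin (mtop M) Q"
    and f: "continuous_map (subtopology (mtop M) Q) (mtop N) f" and inj: "inj_on f Q"
    and x: "x \<in> Q" "x \<notin> boundary M" and dim: "DIM('d::euclidean_space) \<le> DIM('e::euclidean_space)"
  shows "\<exists>P. openin (mtop N) P \<and> f x \<in> P \<and> P \<subseteq> f ` Q"
proof -
  have "x \<in> topspace (subtopology (mtop M) Q)" using x(1) openin_subset[OF Q] by auto
  then have "f x \<in> pts N" using f unfolding continuous_map_def by blast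
  then obtain V \<psi> where V: "(V, \<psi>) \<in> atlas N" "f x \<in> V" using charted_obtain[OF N] by blast
  have d: "coord (mtop N) V \<psi>" using charted_coord[OF N V(1)] .
  obtain G where G: "open G" "\<psi> (f x) \<in> G" "G \<subseteq> \<psi> ` (V \<inter> f ` Q)"
    using image_neighbourhood[OF M N Q f inj x dim V] by blast
  have "V \<inter> \<psi> -` G \<subseteq> f ` Q" using G(3) inj_onD[OF coord_inj[OF d]] by blast
  moreover have "f x \<in> V \<inter> \<psi> -` G" using V(2) G(2) by simp
  ultimately show ?thesis using coord_preimage[OF d G(1)] by (intro exI[of _ "V \<inter> \<psi> -` G"] conjI)
qed

lemma boundary_diffeomorphism:
  fixes M :: "('a, 'e::euclidean_space) manifold" and N :: "('b, 'd::euclidean_space) manifold"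
  assumes M: "charted M" and N: "charted N" and f: "diffeomorphism M N f" and dim: "DIM('d::euclidean_space) = DIM('e::euclidean_space)"
    and z: "z \<in> pts M"
  shows "f z \<in> boundary N \<longleftrightarrow> z \<in> boundary M"
proof -
  have b: "bij_betw f (pts M) (pts N)" and s: "smooth_map_on M (pts M) N f" "smooth_map_on N (pts N) M (inv_into (pts M) f)"
    using f unfolding diffeomorphism_def smooth_map_def by auto
  have fz: "f z \<in> pts N" using b z by (auto simp: bij_betw_def)
  have "f z \<notin> boundary N" if "z \<notin> boundary M"
    by (rule image_not_boundary[OF M N openin_topspace smooth_map_on_continuous[OF s(1)] _ z that]) (use b dim in \<open>auto simp: bij_betw_def\<close>)
  moreover have "inv_into (pts M) f (f z) \<notin> boundary M" if "f z \<notin> boundary N"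
    by (rule image_not_boundary[OF N M openin_topspace smooth_map_on_continuous[OF s(2)] _ fz that])
      (use bij_betw_inv_into[OF b] dim in \<open>auto simp: bij_betw_def\<close>)
  ultimately show ?thesis unfolding inv_into_diffeo(1)[OF f z] by blast
qed

lemma boundary_open_submanifold:
  fixes M :: "('a, 'e::euclidean_space) manifold"
  assumes M: "smooth_manifold M" and Q: "openin (mtop M) Q" and z: "z \<in> Q"
  shows "z \<in> boundary (submanifold M Q :: ('a, 'e::euclidean_space) manifold) \<longleftrightarrow> z \<in> boundary M"
proof -
  let ?Q = "submanifold M Q :: ('a, 'e::euclidean_space) manifold"
  have MC: "charted M" and QC: "charted ?Q" using smooth_manifold_charted[OF M] charted_open_submanifold[OF M Q] .
  have "z \<notin> boundary ?Q" if "z \<notin> boundary M"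
    using image_not_boundary[OF MC QC Q _ inj_on_id2 z that] by (simp add: continuous_map_id[unfolded id_def])
  moreover have "openin (mtop ?Q) Q" using openin_subset[OF Q] by (simp add: openin_subtopology_self openin_open_subtopology[OF Q] Q)
  then have "z \<notin> boundary M" if "z \<notin> boundary ?Q"
    using image_not_boundary[OF QC MC _ _ inj_on_id2 z that] 
    by (simp add: subtopology_subtopology continuous_map_from_subtopology continuous_map_id[unfolded id_def])
  ultimately show ?thesis by blast
qed

text \<open>The image of a product chart is a product, and its interior is the product of the
  interiors; charts of the first factor contribute interior points only.\<close>

lemma boundary_prod:
  assumes M: "charted M" "boundary M = {}" and x: "x \<in> pts M"
  shows "(x, y) \<in> boundary (prod_manifold M N) \<longleftrightarrow> y \<in> boundary N"
proof -
  have img: "interior (map_prod \<phi> \<psi> ` (U \<times> V)) = interior (\<phi> ` U) \<times> interior (\<psi> ` V)" for \<phi> U \<psi> V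
    by (simp add: map_prod_surj_on[OF refl refl] interior_Times)
  have i: "\<phi> x \<in> interior (\<phi> ` U)" if "(U, \<phi>) \<in> atlas M" "x \<in> U" for U \<phi>
    using boundaryI[OF that] M(2) by blast
  obtain U0 \<phi>0 where U0: "(U0, \<phi>0) \<in> atlas M" "x \<in> U0" using charted_obtain[OF M(1) x] .
  show ?thesis
  proof
    assume "(x, y) \<in> boundary (prod_manifold M N)"
    then obtain W \<chi>' where W: "(W, \<chi>') \<in> atlas (prod_manifold M N)" "(x, y) \<in> W" "\<chi>' (x, y) \<notin> interior (\<chi>' ` W)"
      by (rule boundaryE)
    have "\<exists>U \<phi> V \<psi>. (W, \<chi>') = (U \<times> V, map_prod \<phi> \<psi>) \<and> (U, \<phi>) \<in> atlas M \<and> (V, \<psi>) \<in> atlas N"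
      using W(1) unfolding prod_manifold_atlas .
    then obtain U \<phi> V \<psi> where e: "W = U \<times> V" "\<chi>' = map_prod \<phi> \<psi>" "(U, \<phi>) \<in> atlas M" "(V, \<psi>) \<in> atlas N"
      by (elim exE conjE) simp
    have xy: "x \<in> U" "y \<in> V" using W(2) unfolding e(1) by auto
    have "\<psi> y \<notin> interior (\<psi> ` V)" using W(3) i[OF e(3) xy(1)] unfolding e(1,2) img by simp
    then show "y \<in> boundary N" by (rule boundaryI[OF e(4) xy(2)])
  next
    assume "y \<in> boundary N"
    then obtain V \<psi> where V: "(V, \<psi>) \<in> atlas N" "y \<in> V" "\<psi> y \<notin> interior (\<psi> ` V)" by (rule boundaryE)
    have "(U0 \<times> V, map_prod \<phi>0 \<psi>) \<in> atlas (prod_manifold M N)" using U0 V unfolding prod_manifold_atlas by blast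
    moreover have "map_prod \<phi>0 \<psi> (x, y) \<notin> interior (map_prod \<phi>0 \<psi> ` (U0 \<times> V))" unfolding img using V(3) by simp
    moreover have "(x, y) \<in> U0 \<times> V" using U0(2) V(2) by simp
    ultimately show "(x, y) \<in> boundary (prod_manifold M N)" using boundaryI by metis
  qed
qed

lemma boundary_euclid: "boundary euclid = {}"
  by (simp add: boundary_def euclid_def)

text \<open>The charts of \<open>circle\<close> are not explicit. The arc
  \<open>t \<mapsto> z cis t\<close> is a continuous injection of an open interval through
  \<open>z\<close>, and \<open>image_not_boundary\<close> applies to it.\<close>

lemma boundary_circle:
  assumes circ: "smooth_manifold circle"
  shows "boundary circle = {}"
proof -
  have CC: "charted circle" using smooth_manifold_charted[OF circ] .
  have "z \<notin> boundary circle" if z: "z \<in> pts circle" for z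
  proof -
    have n: "cmod z = 1" "z \<noteq> 0" using z unfolding pts_circle by auto
    let ?f = "\<lambda>t. z * cis t" let ?Q = "{-1<..<1::real}"
    have "continuous_map (top_of_set ?Q) (top_of_set (sphere 0 1)) ?f"
      by (auto simp: continuous_map_in_subtopology norm_mult n intro!: continuous_intros)
    then have c: "continuous_map (subtopology (mtop (euclid :: (real, real) manifold)) ?Q) (mtop circle) ?f"
      by (simp add: circle_def euclid_def)
    have "inj_on ?f ?Q"
    proof (rule inj_onI)
      fix s t assume st: "s \<in> ?Q" "t \<in> ?Q" "z * cis s = z * cis t"
      have e: "cis s = cis t" using n(2) st(3) by (rule mult_left_cancel[THEN iffD1])
      have "\<bar>s\<bar> < pi" "\<bar>t\<bar> < pi" using st(1,2) pi_gt3 unfolding greaterThanLessThan_iff by linarith+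
      from this[THEN Ln_cis] show "s = t" unfolding e by simp
    qed
    moreover have "openin (mtop euclid) ?Q" by (simp add: euclid_def)
    ultimately have "?f 0 \<notin> boundary circle"
      using image_not_boundary[OF charted_euclid CC _ c, of 0] by (simp add: boundary_euclid)
    then show ?thesis by simp
  qed
  then show ?thesis using boundary_subset_pts[OF CC] by blast
qed

lemma boundary_torus:
  assumes circ: "smooth_manifold circle"
  shows "boundary torus = {}"
proof -
  have CC: "charted circle" using smooth_manifold_charted[OF circ] .
  have "w \<notin> boundary torus" if "w \<in> pts torus" for w
    using that boundary_prod[OF CC boundary_circle[OF circ], of "fst w" "snd w" circle] boundary_circle[OF circ]
    by (auto simp: torus_def)
  then show ?thesis using boundary_subset_pts[OF charted_prod[OF CC CC]] unfolding torus_def by blast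
qed

lemma smooth_map_on_const_point:
  assumes "charted P" "charted N" "y \<in> pts N"
  shows "smooth_map_on P S N (\<lambda>x. y)"
  unfolding smooth_map_on_def
proof (intro conjI ballI, safe)
  show "continuous_map (subtopology (mtop P) S) (mtop N) (\<lambda>x. y)" using assms(3) by simp
  fix U \<phi> V \<psi>
  show "smooth_on_set (\<phi> ` (S \<inter> U \<inter> (\<lambda>x. y) -` V)) (\<psi> \<circ> (\<lambda>x. y) \<circ> inv_into U \<phi>)"
    by (simp add: o_def smooth_on_set_subset[OF smooth_on_imp_smooth_on_set[OF smooth_on_const[of UNIV]]])
qed

text \<open>In a local trivialization the lift moves the base point along \<open>c\<close> and keeps
  the fiber coordinate fixed. As the base has no boundary, being a boundary point depends on the
  fiber coordinate alone, so a lift that starts in the boundary stays there.\<close>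

lemma bundle_curve_lift:
  fixes A :: "('a, 'e::euclidean_space) manifold" and B :: "('b, 'd::euclidean_space) manifold" and F :: "('f, 'c::euclidean_space) manifold"
  assumes bun: "smooth_fiber_bundle A B F G p" and bB: "boundary B = {}" and dim: "DIM('e::euclidean_space) = DIM('d::euclidean_space) + DIM('c::euclidean_space)"
    and x: "x \<in> pts A" and c: "smooth_map_on euclid {-e<..<e::real} B c" "0 < e" "c 0 = p x"
  shows "\<exists>\<gamma> d. 0 < d \<and> d \<le> e \<and> smooth_map_on euclid {-d<..<d} A \<gamma> \<and> \<gamma> 0 = x \<and>
    (\<forall>t\<in>{-d<..<d}. \<gamma> t \<in> pts A \<and> p (\<gamma> t) = c t \<and> (x \<in> boundary A \<longrightarrow> \<gamma> t \<in> boundary A))"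
proof -
  have AS: "smooth_manifold A" and BS: "smooth_manifold B" and FS: "smooth_manifold F" and p: "smooth_map_on A (pts A) B p"
    using bun unfolding smooth_fiber_bundle_def smooth_map_def by blast+
  note AC = smooth_manifold_charted[OF AS] and BC = smooth_manifold_charted[OF BS] and FC = smooth_manifold_charted[OF FS]
  have px: "p x \<in> pts B" using smooth_map_on_into[OF p x x] .
  obtain \<T> where \<T>: "\<Union>(fst ` \<T>) = pts B" "\<forall>(V, \<Phi>)\<in>\<T>. openin (mtop B) V \<and>
           diffeomorphism (submanifold A (pts A \<inter> p -` V) :: ('a, 'e) manifold)
             (prod_manifold (submanifold B V :: ('b, 'd) manifold) F) \<Phi> \<and>
           (\<forall>x\<in>pts A \<inter> p -` V. fst (\<Phi> x) = p x)"
    using bun unfolding smooth_fiber_bundle_def by (elim conjE exE) (rule that)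
  have "p x \<in> \<Union>(fst ` \<T>)" unfolding \<T>(1) by (rule px)
  then obtain V \<Phi> where V: "(V, \<Phi>) \<in> \<T>" "p x \<in> V" by auto
  let ?VB = "submanifold B V :: ('b, 'd) manifold" and ?E = "submanifold A (pts A \<inter> p -` V) :: ('a, 'e) manifold"
  have oV: "openin (mtop B) V" and \<Phi>: "diffeomorphism ?E (prod_manifold ?VB F) \<Phi>" and fst\<Phi>: "\<And>z. z \<in> pts A \<Longrightarrow> p z \<in> V \<Longrightarrow> fst (\<Phi> z) = p z"
    using bspec[OF \<T>(2) V(1)] by auto
  obtain Q where Q: "openin (mtop A) Q" "\<And>z. z \<in> pts A \<Longrightarrow> z \<in> pts A \<Longrightarrow> p z \<in> V \<longleftrightarrow> z \<in> Q"
    by (rule smooth_map_on_preimage[OF p oV]) (rule that; assumption)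
  have "pts A \<inter> p -` V = Q" using Q(2) openin_subset[OF Q(1)] by auto
  then have oE: "openin (mtop A) (pts A \<inter> p -` V)" using Q(1) by simp
  have VC: "charted ?VB" and EC: "charted ?E" using charted_open_submanifold[OF BS oV] charted_open_submanifold[OF AS oE] .
  have PC: "charted (prod_manifold ?VB F)" by (rule charted_prod[OF VC FC])
  obtain \<Psi> where \<Psi>: "smooth_map_on ?E (pts ?E) (prod_manifold ?VB F) \<Phi>" "smooth_map_on (prod_manifold ?VB F) (pts (prod_manifold ?VB F)) ?E \<Psi>"
    "\<And>z. z \<in> pts ?E \<Longrightarrow> \<Psi> (\<Phi> z) = z" "\<And>w. w \<in> pts (prod_manifold ?VB F) \<Longrightarrow> \<Phi> (\<Psi> w) = w"
    by (rule diffeomorphismE[OF \<Phi>]) (rule that; assumption)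
  have bVB: "boundary ?VB = {}"
  proof -
    have "z \<notin> boundary ?VB" if "z \<in> pts ?VB" for z
      using boundary_open_submanifold[OF BS oV, of z] that bB by auto
    then show ?thesis using boundary_subset_pts[OF VC] by blast
  qed
  have xE: "x \<in> pts ?E" using x V(2) by simp
  define y where "y = snd (\<Phi> x)"
  have \<Phi>x: "\<Phi> x = (p x, y)" using fst\<Phi>[OF x V(2)] by (simp add: y_def prod_eq_iff)
  have y: "y \<in> pts F" using smooth_map_on_into[OF \<Psi>(1) xE xE] unfolding \<Phi>x by simp
  obtain I where I: "openin (mtop euclid) I" "\<And>t. t \<in> {-e<..<e} \<Longrightarrow> t \<in> pts euclid \<Longrightarrow> c t \<in> V \<longleftrightarrow> t \<in> I"
    by (rule smooth_map_on_preimage[OF c(1) oV]) (rule that; assumption)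
  have "open I" "0 \<in> I" using I(1) I(2)[of 0] c(2,3) V(2) by (simp_all add: euclid_def)
  then obtain r where r: "0 < r" "ball 0 r \<subseteq> I" by (meson openE)
  define d where "d = min r e"
  have d: "0 < d" "d \<le> e" using r(1) c(2) by (auto simp: d_def)
  have tV: "c t \<in> V" "c t \<in> pts B" if "t \<in> {-d<..<d}" for t
  proof -
    have te: "t \<in> {-e<..<e}" and "t \<in> ball 0 r" using that by (auto simp: d_def)
    then show "c t \<in> V" using r(2) I(2)[OF te] by (auto simp: euclid_def)
    show "c t \<in> pts B" using smooth_map_on_into[OF c(1) te] by (simp add: euclid_def)
  qed
  have w: "(c t, y) \<in> pts (prod_manifold ?VB F)" if "t \<in> {-d<..<d}" for t using tV[OF that] y by simp
  let ?\<gamma> = "\<lambda>t. \<Psi> (c t, y)"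
  have cd: "smooth_map_on euclid {-d<..<d} B c" by (rule smooth_map_on_subset[OF c(1)]) (use d(2) in auto)
  have "smooth_map_on euclid {-d<..<d} ?VB c" by (rule smooth_map_on_to_sub[OF charted_euclid BC cd tV(1)])
  then have "smooth_map_on euclid {-d<..<d} (prod_manifold ?VB F) (\<lambda>t. (c t, y))"
    by (rule smooth_map_on_prod_Pair[OF charted_euclid _ smooth_map_on_const_point[OF charted_euclid FC y]])
  then have \<gamma>E: "smooth_map_on euclid {-d<..<d} ?E ?\<gamma>"
    by (rule smooth_map_on_compose[OF charted_euclid PC _ \<Psi>(2)]) (rule w)
  then have \<gamma>: "smooth_map_on euclid {-d<..<d} A ?\<gamma>"
    by (rule smooth_map_on_out_sub[OF charted_euclid EC])
  have \<gamma>t: "?\<gamma> t \<in> pts A \<and> p (?\<gamma> t) = c t \<and> (x \<in> boundary A \<longrightarrow> ?\<gamma> t \<in> boundary A)" if t: "t \<in> {-d<..<d}" for t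
  proof -
    have z: "?\<gamma> t \<in> pts ?E" using smooth_map_on_into[OF \<gamma>E t] by (simp add: euclid_def)
    then have zA: "?\<gamma> t \<in> pts A" "p (?\<gamma> t) \<in> V" by auto
    have \<Phi>z: "\<Phi> (?\<gamma> t) = (c t, y)" by (rule \<Psi>(4)[OF w[OF t]])
    then have "p (?\<gamma> t) = c t" using fst\<Phi>[OF zA] by simp
    moreover have "?\<gamma> t \<in> boundary A" if xb: "x \<in> boundary A"
    proof -
      have D: "DIM('d \<times> 'c) = DIM('e)" using dim by simp
      have "x \<in> boundary ?E" using boundary_open_submanifold[OF AS oE, of x] xE xb by simp
      then have "(p x, y) \<in> boundary (prod_manifold ?VB F)" using boundary_diffeomorphism[OF EC PC \<Phi> D xE] unfolding \<Phi>x by blast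
      then have "y \<in> boundary F" using boundary_prod[OF VC bVB, of "p x" y F] px V(2) by simp
      then have "(c t, y) \<in> boundary (prod_manifold ?VB F)" using boundary_prod[OF VC bVB, of "c t" y F] tV[OF t] by simp
      then have "?\<gamma> t \<in> boundary ?E" using boundary_diffeomorphism[OF EC PC \<Phi> D z] unfolding \<Phi>z by blast
      then show ?thesis using boundary_open_submanifold[OF AS oE, of "?\<gamma> t"] z by simp
    qed
    ultimately show ?thesis using zA by blast
  qed
  have "?\<gamma> 0 = x" unfolding c(3) using \<Psi>(3)[OF xE] unfolding \<Phi>x .
  then show ?thesis using d \<gamma> \<gamma>t by (intro exI[of _ ?\<gamma>] exI[of _ d] conjI ballI) auto
qed

section \<open>Tube exteriors and the surgered manifold\<close>

lemma pts_disk: "pts disk = cball 0 1" and mtop_disk: "mtop disk = top_of_set (cball 0 1)"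
  by (simp_all add: disk_def euclid_def)

lemma mtop_torus: "mtop torus = top_of_set (sphere 0 1 \<times> sphere 0 1)"
  by (simp add: torus_def circle_def euclid_def)

lemma smooth_embeddingD:
  fixes A :: "('a, 'e::euclidean_space) manifold" and M :: "('b, 'd::euclidean_space) manifold"
  assumes "smooth_embedding A M a"
  shows "a ` pts A \<subseteq> pts M" "inj_on a (pts A)" "continuous_map (mtop A) (mtop M) a"
    "smooth_manifold (submanifold M (a ` pts A) :: ('b, 'e::euclidean_space) manifold)"
    "diffeomorphism A (submanifold M (a ` pts A) :: ('b, 'e::euclidean_space) manifold) a"
proof -
  show "a ` pts A \<subseteq> pts M" using assms unfolding smooth_embedding_def by blast
  show "smooth_manifold (submanifold M (a ` pts A) :: ('b, 'e) manifold)" using assms unfolding smooth_embedding_def by blast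
  show d: "diffeomorphism A (submanifold M (a ` pts A) :: ('b, 'e) manifold) a" using assms unfolding smooth_embedding_def by blast
  show "inj_on a (pts A)" using d unfolding diffeomorphism_def bij_betw_def by blast
  have "smooth_map_on A (pts A) (submanifold M (a ` pts A) :: ('b, 'e) manifold) a"
    using d unfolding diffeomorphism_def smooth_map_def by blast
  from smooth_map_on_continuous[OF this] show "continuous_map (mtop A) (mtop M) a"
    by (simp add: continuous_map_in_subtopology)
qed

lemma tube_continuous:
  fixes S :: "('s, 'd::euclidean_space) manifold" and X :: "('a, 'e::euclidean_space) manifold"
  assumes emb: "smooth_embedding (prod_manifold S disk) X \<nu>" and C: "C \<subseteq> cball 0 1"
  shows "continuous_map (prod_topology (mtop S) (top_of_set C)) (mtop X) \<nu>"
proof -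
  have "continuous_map (prod_topology (mtop S) (top_of_set (cball 0 1))) (mtop X) \<nu>"
    using smooth_embeddingD(3)[OF emb] by (simp add: mtop_disk)
  then show ?thesis unfolding prod_topology_subtopology
    by (rule continuous_map_from_subtopology_mono) (use C in auto)
qed

text \<open>The open tube is open in \<open>X\<close> by invariance of domain, so the exterior is
  closed and compact. Off the closed tube its points are interior because \<open>X\<close> has no
  boundary. If a point on the surface of the tube were interior, the exterior would contain a
  neighborhood of it in \<open>X\<close>, which meets the open tube.\<close>

lemma tube_exterior:
  fixes S :: "('s, 'd::euclidean_space) manifold" and X :: "('a, 'e::euclidean_space) manifold"
  assumes X: "closed_manifold X" and S: "charted S" "boundary S = {}" "compact_space (mtop S)"
    and emb: "smooth_embedding (prod_manifold S disk) X \<nu>" and E: "charted (exterior S X \<nu>)"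
    and dim: "DIM('e::euclidean_space) = DIM('d::euclidean_space) + 2"
  shows "compact_space (mtop (exterior S X \<nu>))" "boundary (exterior S X \<nu>) = \<nu> ` (pts S \<times> sphere 0 1)"
proof -
  note XC = closed_manifold_charted[OF X]
  have Xb: "boundary X = {}" and Xc: "compact_space (mtop X)" and XH: "Hausdorff_space (mtop X)"
    using X unfolding closed_manifold_def smooth_manifold_def by auto
  let ?D = "pts S \<times> cball (0::complex) 1" and ?B = "pts S \<times> ball (0::complex) 1"
  have sub: "\<nu> ` ?D \<subseteq> pts X" and inj: "inj_on \<nu> ?D" using smooth_embeddingD(1,2)[OF emb] by (simp_all add: pts_disk)
  have ptsE: "pts (exterior S X \<nu>) = pts X - \<nu> ` ?B" by (auto simp: exterior_def)
  have oB: "openin (mtop X) (\<nu> ` ?B)"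
  proof (subst openin_subopen, intro ballI)
    fix x assume "x \<in> \<nu> ` ?B"
    then obtain w where w: "w \<in> ?B" "x = \<nu> w" by blast
    let ?P = "prod_manifold S (euclid :: (complex, complex) manifold)"
    have "boundary ?P = {}"
      using boundary_subset_pts[OF charted_prod[OF S(1) charted_euclid]] boundary_prod[OF S(1,2)] boundary_euclid by fastforce
    moreover have "openin (mtop ?P) ?B" by (simp add: openin_prod_Times_iff euclid_def)
    moreover have "continuous_map (subtopology (mtop ?P) ?B) (mtop X) \<nu>"
      using tube_continuous[OF emb ball_subset_cball] unfolding prod_topology_subtopology by (simp add: euclid_def)
    moreover have "inj_on \<nu> ?B" by (rule inj_on_subset[OF inj]) auto
    ultimately show "\<exists>P. openin (mtop X) P \<and> x \<in> P \<and> P \<subseteq> \<nu> ` ?B"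
      unfolding w(2) using image_contains_open[OF charted_prod[OF S(1) charted_euclid] XC _ _ _ w(1)] dim by simp
  qed
  then have cl: "closedin (mtop X) (pts X - \<nu> ` ?B)" by (simp add: closedin_diff)
  then show "compact_space (mtop (exterior S X \<nu>))"
    using closedin_compact_space[OF Xc cl] unfolding exterior_def submanifold_simps compactin_subspace by blast
  have "compactin (prod_topology (mtop S) (top_of_set (cball (0::complex) 1))) ?D"
    unfolding compactin_Times using S(3) by (simp add: compact_space_def compactin_subtopology)
  then have "compactin (mtop X) (\<nu> ` ?D)" by (rule image_compactin) (rule tube_continuous[OF emb subset_refl])
  then have clD: "closedin (mtop X) (\<nu> ` ?D)" by (rule compactin_imp_closedin[OF XH])
  show "boundary (exterior S X \<nu>) = \<nu> ` (pts S \<times> sphere 0 1)"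
  proof (intro equalityI subsetI)
    fix x assume x: "x \<in> boundary (exterior S X \<nu>)"
    then have xE: "x \<in> pts X - \<nu> ` ?B" using boundary_subset_pts[OF E] ptsE by blast
    have "x \<in> \<nu> ` ?D"
    proof (rule ccontr)
      assume n: "x \<notin> \<nu> ` ?D"
      let ?Q = "pts X - \<nu> ` ?D"
      have "openin (mtop X) ?Q" using clD by (simp add: openin_diff)
      moreover have "continuous_map (subtopology (mtop X) ?Q) (mtop (exterior S X \<nu>)) (\<lambda>x. x)"
        unfolding exterior_def submanifold_simps
        by (rule continuous_map_into_subtopology) (auto simp: continuous_map_from_subtopology continuous_map_id[unfolded id_def])
      ultimately have "x \<notin> boundary (exterior S X \<nu>)"
        using image_not_boundary[OF XC E _ _ inj_on_id2, of ?Q x] xE n Xb by simp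
      then show False using x by blast
    qed
    then obtain p c where pc: "x = \<nu> (p, c)" "p \<in> pts S" "cmod c \<le> 1" by auto
    moreover have "\<not> cmod c < 1" using xE pc by auto
    ultimately show "x \<in> \<nu> ` (pts S \<times> sphere 0 1)" by (intro image_eqI[of _ _ "(p, c)"]) auto
  next
    fix x assume "x \<in> \<nu> ` (pts S \<times> sphere 0 1)"
    then obtain p c where pc: "x = \<nu> (p, c)" "p \<in> pts S" "cmod c = 1" by auto
    have xE: "x \<in> pts (exterior S X \<nu>)"
    proof -
      have "x \<notin> \<nu> ` ?B"
      proof
        assume "x \<in> \<nu> ` ?B"
        then obtain w where w: "w \<in> ?B" "\<nu> (p, c) = \<nu> w" unfolding pc(1) by blast
        have "(p, c) = w" by (rule inj_onD[OF inj w(2)]) (use pc w(1) in auto)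
        then show False using w(1) pc(3) by auto
      qed
      moreover have "x \<in> pts X" using sub pc by auto
      ultimately show ?thesis unfolding ptsE by blast
    qed
    show "x \<in> boundary (exterior S X \<nu>)"
    proof (rule ccontr)
      assume n: "x \<notin> boundary (exterior S X \<nu>)"
      have "continuous_map (subtopology (mtop (exterior S X \<nu>)) (pts (exterior S X \<nu>))) (mtop X) (\<lambda>x. x)"
        by (simp add: exterior_def continuous_map_from_subtopology continuous_map_id[unfolded id_def])
      from image_contains_open[OF E XC openin_topspace this inj_on_id2 xE n]
      obtain P where P: "openin (mtop X) P" "x \<in> P" "P \<subseteq> pts X - \<nu> ` ?B" unfolding ptsE by auto
      \<comment> \<open>A radius of the normal disk approaches the point from inside the open
        tube.\<close>
      let ?\<gamma> = "\<lambda>r::real. \<nu> (p, of_real r * c)"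
      have "continuous_map (top_of_set {0..1}) (prod_topology (mtop S) (top_of_set (cball 0 1))) (\<lambda>r. (p, of_real r * c))"
        using pc(2,3) by (auto simp: continuous_map_pairwise o_def continuous_map_in_subtopology norm_mult intro!: continuous_intros)
      from continuous_map_compose[OF this tube_continuous[OF emb subset_refl]]
      have g: "continuous_map (top_of_set {0..1}) (mtop X) ?\<gamma>" by (simp add: o_def)
      have "openin (top_of_set {0..1}) {r \<in> topspace (top_of_set {0..1}). ?\<gamma> r \<in> P}"
        by (rule openin_continuous_map_preimage[OF g P(1)])
      moreover have "1 \<in> {r \<in> topspace (top_of_set {0..1}). ?\<gamma> r \<in> P}" using P(2) pc(1) by simp
      ultimately obtain e where e: "0 < e" "\<forall>r\<in>{0..1}. dist r 1 < e \<longrightarrow> r \<in> {r \<in> topspace (top_of_set {0..1}). ?\<gamma> r \<in> P}"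
        unfolding openin_euclidean_subtopology_iff by blast
      define r where "r = max 0 (1 - e / 2)"
      have r: "0 \<le> r" "r < 1" "dist r 1 < e" using e(1) by (auto simp: r_def dist_real_def)
      then have "?\<gamma> r \<in> P" using e(2) by auto
      moreover have "?\<gamma> r \<in> \<nu> ` ?B" using r(1,2) pc(2,3) by (intro imageI) (simp add: norm_mult)
      ultimately show False using P(3) by blast
    qed
  qed
qed

section \<open>Angles on the seam\<close>

text \<open>Along the turning curve through a maximum point, \<open>h\<close> changes by
  \<open>k t\<close> up to a multiple of 2 pi, and continuity excludes the multiple for small
  \<open>t\<close>. For \<open>t\<close> of the sign of \<open>k\<close> the maximum is then
  exceeded.\<close>

lemma no_global_angle:
  fixes M :: "('a, 'e::euclidean_space) manifold"
  assumes N: "compactin (mtop M) N" "N \<noteq> {}" and h: "continuous_map (subtopology (mtop M) N) euclideanreal h"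
    and v: "\<And>x. x \<in> N \<Longrightarrow> v x = cis (h x)" and tc: "\<And>x. x \<in> N \<Longrightarrow> turning_curve M N v x"
  shows False
proof -
  have "compactin (subtopology (mtop M) N) N" using N(1) by (simp add: compactin_subtopology)
  then have "compact (h ` N)" using image_compactin[OF _ h] by simp
  then obtain x where x: "x \<in> N" "\<And>y. y \<in> N \<Longrightarrow> h y \<le> h x"
    using compact_attains_sup[of "h ` N"] N(2) by blast
  obtain \<gamma> e k where g: "0 < e" "k \<noteq> 0" "smooth_map_on euclid {-e<..<e::real} M \<gamma>" "\<gamma> 0 = x"
     "\<forall>t\<in>{-e<..<e}. \<gamma> t \<in> N \<and> v (\<gamma> t) = v x * cis (k * t)"
    using tc[OF x(1)] unfolding turning_curve_def by (elim exE conjE) (rule that)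
  let ?I = "{-e<..<e}"
  define \<delta> where "\<delta> t = h (\<gamma> t) - h x - k * t" for t
  have "continuous_map (top_of_set ?I) (mtop M) \<gamma>" using smooth_map_on_continuous[OF g(3)] by (simp add: euclid_def)
  then have "continuous_map (top_of_set ?I) (subtopology (mtop M) N) \<gamma>"
    by (rule continuous_map_into_subtopology) (use g(5) in auto)
  from continuous_map_compose[OF this h] have "continuous_on ?I (\<lambda>t. h (\<gamma> t))" by (simp add: o_def)
  then have "continuous_on ?I \<delta>" unfolding \<delta>_def by (intro continuous_intros)
  then have "isCont \<delta> 0" using g(1) by (simp add: continuous_on_eq_continuous_at)
  moreover have \<delta>0: "\<delta> 0 = 0" by (simp add: \<delta>_def g(4))
  ultimately obtain d where d: "0 < d" "\<And>t. dist t 0 < d \<Longrightarrow> dist (\<delta> t) 0 < 2 * pi"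
    using continuous_at_eps_delta[of 0 \<delta>] by (metis pi_gt_zero zero_less_mult_iff zero_less_numeral)
  \<comment> \<open>The sign makes \<open>k * t\<close> positive; the absolute value stays below
    both \<open>d\<close> and \<open>e\<close>.\<close>
  define t where "t = sgn k * (min d e / 2)"
  have kt: "k * t = \<bar>k\<bar> * (min d e / 2)" by (simp add: t_def abs_sgn)
  have "0 < k * t" unfolding kt using g(1,2) d(1) by (intro mult_pos_pos) simp_all
  moreover have "\<bar>t\<bar> = min d e / 2" using g(1,2) d(1) by (simp add: t_def abs_mult sgn_if)
  ultimately have t: "\<bar>t\<bar> < d" "\<bar>t\<bar> < e" "0 < k * t" using g(1) d(1) by simp_all
  have tI: "t \<in> ?I" using t(2) by (simp add: abs_less_iff)
  have yN: "\<gamma> t \<in> N" using g(5) tI by blast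
  have "cis (h (\<gamma> t)) = cis (h x) * cis (k * t)" using bspec[OF g(5) tI] v[OF x(1)] v[OF yN] by simp
  then have "cis (h (\<gamma> t)) = cis (h x + k * t)" by (simp add: cis_mult)
  then obtain n :: int where n: "h (\<gamma> t) = h x + k * t + 2 * pi * n" unfolding cis_eq_iff by blast
  then have "\<delta> t = 2 * pi * n" by (simp add: \<delta>_def)
  moreover have "\<bar>\<delta> t\<bar> < 2 * pi" using d(2)[of t] t(1) by simp
  ultimately have "\<bar>real_of_int n\<bar> < 1" by (simp add: abs_mult)
  then have "n = 0" by linarith
  then show False using n t(3) x(2)[OF yN] by simp
qed

text \<open>As a continuous injection from a compact to a Hausdorff space, \<open>\<theta>\<close>
  identifies the standard torus with \<open>N\<close> topologically and carries the relation
  over.\<close>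

lemma torus_seam_relation:
  fixes T :: "'a topology" and H :: "nat \<Rightarrow> 'a \<Rightarrow> complex" and \<theta> :: "(complex \<times> complex) \<times> complex \<Rightarrow> 'a"
  defines "T3 \<equiv> (sphere 0 1 \<times> sphere 0 1) \<times> sphere 0 1"
  assumes Hd: "Hausdorff_space T" and \<theta>: "continuous_map (top_of_set T3) T \<theta>" "inj_on \<theta> T3" "\<theta> ` T3 = N"
    and H: "\<And>j. j < 4 \<Longrightarrow> continuous_map (subtopology T N) euclidean (H j)" "\<And>j x. j < 4 \<Longrightarrow> x \<in> N \<Longrightarrow> cmod (H j x) = 1"
  shows "\<exists>m h. (\<exists>j<4. m j \<noteq> (0::int)) \<and> continuous_map (subtopology T N) euclideanreal h \<and>
    (\<forall>x\<in>N. (\<Prod>j<4. H j x powi m j) = cis (h x))"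
proof -
  have N: "N \<subseteq> topspace T" using \<theta>(1,3) by (auto simp: continuous_map_def)
  have \<theta>N: "continuous_map (top_of_set T3) (subtopology T N) \<theta>"
    by (rule continuous_map_into_subtopology[OF \<theta>(1)]) (use \<theta>(3) in auto)
  have \<theta>T: "\<theta> w \<in> N" if "w \<in> T3" for w using that \<theta>(3) by blast
  have c: "continuous_on T3 (\<lambda>w. H j (\<theta> w))" if "j < 4" for j
    using continuous_map_compose[OF \<theta>N H(1)[OF that]] by (simp add: o_def)
  have "\<exists>m h. (\<exists>j<4. m j \<noteq> (0::int)) \<and> continuous_on T3 h \<and> (\<forall>w\<in>T3. (\<Prod>j<4. H j (\<theta> w) powi m j) = cis (h w))"
  proof (rule torus_unit_maps_dependent[of "{..<4::nat}" "\<lambda>j w. H j (\<theta> w)"])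
    show "continuous_on ((sphere 0 1 \<times> sphere 0 1) \<times> sphere 0 1) (\<lambda>w. H j (\<theta> w))" if "j \<in> {..<4}" for j
      using c that unfolding T3_def by simp
    show "cmod (H j (\<theta> x)) = 1" if "j \<in> {..<4}" "x \<in> (sphere 0 1 \<times> sphere 0 1) \<times> sphere 0 1" for j x
      using H(2) \<theta>T that unfolding T3_def by simp
    fix m :: "nat \<Rightarrow> int" and h
    assume "\<exists>j\<in>{..<4}. m j \<noteq> 0" "continuous_on ((sphere 0 1 \<times> sphere 0 1) \<times> sphere 0 1) h"
      "\<And>x. x \<in> (sphere 0 1 \<times> sphere 0 1) \<times> sphere 0 1 \<Longrightarrow> (\<Prod>j<4. H j (\<theta> x) powi m j) = cis (h x)"
    then show ?thesis unfolding T3_def by (intro exI[of _ m] exI[of _ h]) auto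
  qed simp_all
  then obtain m where "\<exists>h. (\<exists>j<4. m j \<noteq> (0::int)) \<and> continuous_on T3 h \<and> (\<forall>w\<in>T3. (\<Prod>j<4. H j (\<theta> w) powi m j) = cis (h w))"
    by (rule exE)
  then obtain h where mh: "(\<exists>j<4. m j \<noteq> (0::int)) \<and> continuous_on T3 h \<and> (\<forall>w\<in>T3. (\<Prod>j<4. H j (\<theta> w) powi m j) = cis (h w))"
    by (rule exE)
  note m = mh[THEN conjunct1] and h = mh[THEN conjunct2, THEN conjunct1] mh[THEN conjunct2, THEN conjunct2]
  define h' where "h' x = h (inv_into T3 \<theta> x)" for x
  have h'\<theta>: "h' (\<theta> w) = h w" if "w \<in> T3" for w using that \<theta>(2) by (simp add: h'_def)
  have "quotient_map (top_of_set T3) (subtopology T N) \<theta>"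
  proof (rule T1_Spaces.continuous_imp_quotient_map[OF \<theta>N])
    show "compact_space (top_of_set T3)" unfolding T3_def by (simp add: compact_space_subtopology compact_Times)
    show "Hausdorff_space (subtopology T N)" using Hd by (rule Hausdorff_space_subtopology)
    show "\<theta> ` topspace (top_of_set T3) = topspace (subtopology T N)" using \<theta>(3) N by auto
  qed
  moreover have "continuous_map (top_of_set T3) euclideanreal (h' \<circ> \<theta>)"
    using h(1) h'\<theta> by (simp cong: continuous_on_cong)
  ultimately have "continuous_map (subtopology T N) euclideanreal h'" by (rule continuous_compose_quotient_map)
  moreover have "\<forall>x\<in>N. (\<Prod>j<4. H j x powi m j) = cis (h' x)"
  proof
    fix x assume "x \<in> N"
    then obtain w where w: "w \<in> T3" "x = \<theta> w" using \<theta>(3) by blast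
    show "(\<Prod>j<4. H j x powi m j) = cis (h' x)" unfolding w(2) h'\<theta>[OF w(1)] using h(2) w(1) by blast
  qed
  ultimately show ?thesis using m by (intro exI[of _ m] exI[of _ h'] conjI)
qed

section \<open>Transport along embeddings and turning curves in the two pieces\<close>

lemma embedding_transport_map:
  fixes A :: "('a, 'e::euclidean_space) manifold" and M :: "('b, 'd::euclidean_space) manifold"
  assumes A: "charted A" and M: "charted M" and a: "smooth_embedding A M a" and u: "smooth_map_on A (pts A) P u"
  shows "smooth_map_on M (a ` pts A) P (\<lambda>x. u (inv_into (pts A) a x))"
proof -
  let ?N = "submanifold M (a ` pts A) :: ('b, 'e) manifold"
  note D = smooth_embeddingD[OF a]
  have NC: "charted ?N" using D(4) smooth_manifold_charted by blast
  have pN: "pts ?N = a ` pts A" using D(1) by auto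
  have i: "smooth_map_on ?N (pts ?N) A (inv_into (pts A) a)"
    using D(5) unfolding diffeomorphism_def smooth_map_def by blast
  have "smooth_map_on ?N (a ` pts A) P (\<lambda>x. u (inv_into (pts A) a x))"
    by (rule smooth_map_on_compose[OF NC A i[unfolded pN] u]) (simp add: inv_into_into)
  then show ?thesis by (rule smooth_map_on_from_sub[OF NC M subset_refl])
qed

lemma embedding_turning_curve:
  fixes A :: "('a, 'e::euclidean_space) manifold" and M :: "('b, 'd::euclidean_space) manifold"
  assumes A: "charted A" and a: "smooth_embedding A M a" and S: "S \<subseteq> pts A" and x: "x \<in> S" and tc: "turning_curve A S u x"
  shows "turning_curve M (a ` S) (\<lambda>x. u (inv_into (pts A) a x)) (a x)"
proof -
  let ?N = "submanifold M (a ` pts A) :: ('b, 'e) manifold"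
  note D = smooth_embeddingD[OF a]
  have NC: "charted ?N" using D(4) smooth_manifold_charted by blast
  obtain \<gamma> e k where g: "0 < e" "k \<noteq> 0" "smooth_map_on euclid {-e<..<e::real} A \<gamma>" "\<gamma> 0 = x"
     "\<forall>t\<in>{-e<..<e}. \<gamma> t \<in> S \<and> u (\<gamma> t) = u x * cis (k * t)"
    using tc unfolding turning_curve_def by (elim exE conjE) (rule that)
  have "smooth_map_on A (pts A) ?N a" using D(5) unfolding diffeomorphism_def smooth_map_def by blast
  then have "smooth_map_on euclid {-e<..<e} ?N (\<lambda>t. a (\<gamma> t))"
    by (rule smooth_map_on_compose[OF charted_euclid A g(3)]) (use g(5) S in blast)
  then have "smooth_map_on euclid {-e<..<e} M (\<lambda>t. a (\<gamma> t))" by (rule smooth_map_on_out_sub[OF charted_euclid NC])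
  moreover have "\<forall>t\<in>{-e<..<e}. a (\<gamma> t) \<in> a ` S \<and> u (inv_into (pts A) a (a (\<gamma> t))) = u (inv_into (pts A) a (a x)) * cis (k * t)"
  proof
    fix t assume "t \<in> {-e<..<e}"
    then have t: "\<gamma> t \<in> S" "u (\<gamma> t) = u x * cis (k * t)" using g(5) by blast+
    have "inv_into (pts A) a (a y) = y" if "y \<in> S" for y using that S by (intro inv_into_f_f[OF D(2)]) blast
    then show "a (\<gamma> t) \<in> a ` S \<and> u (inv_into (pts A) a (a (\<gamma> t))) = u (inv_into (pts A) a (a x)) * cis (k * t)"
      using t x by simp
  qed
  ultimately show ?thesis unfolding turning_curve_def using g(1,2,4) by (intro exI[of _ "\<lambda>t. a (\<gamma> t)"] exI[of _ e] exI[of _ k] conjI) simp_all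
qed

lemma smooth_map_on_powi:
  assumes M: "charted M" and u: "smooth_map_on M S euclid u" "\<And>x. x \<in> S \<Longrightarrow> x \<in> pts M \<Longrightarrow> cmod (u x) = 1"
  shows "smooth_map_on M S euclid (\<lambda>x. u x powi m)"
proof -
  have pow: "smooth_map_on M S euclid (\<lambda>x. v x ^ n)" if "smooth_map_on M S euclid v" for v :: "_ \<Rightarrow> complex" and n
  proof (induction n)
    case (Suc n)
    then show ?case using smooth_map_on_mult[OF M that Suc] by simp
  qed (simp add: smooth_map_on_const[OF M])
  show ?thesis
  proof (cases "0 \<le> m")
    case True
    then show ?thesis using pow[OF u(1)] by (simp add: power_int_def)
  next
    case False
    \<comment> \<open>On the unit circle the inverse is the conjugate, which is real linear and
      defined everywhere.\<close>
    have "smooth_map_on M S euclid (\<lambda>x. cnj (u x))"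
      by (rule smooth_map_on_apply[OF M u(1) smooth_on_imp_smooth_on_set[OF smooth_on_linear[OF bounded_linear_cnj smooth_on_id[OF open_UNIV]]]]) simp
    then have "smooth_map_on M S euclid (\<lambda>x. cnj (u x) ^ nat (- m))" by (rule pow)
    then show ?thesis
    proof (rule smooth_map_on_cong[OF M])
      fix x assume x: "x \<in> S" "x \<in> pts M"
      have "u x * cnj (u x) = 1" using u(2)[OF x] by (simp add: complex_norm_square[symmetric])
      then have "inverse (u x) = cnj (u x)" by (rule inverse_unique)
      then show "cnj (u x) ^ nat (- m) = u x powi m" using False by (simp add: power_int_def)
    qed
  qed
qed

lemma circle_bundle_angle:
  assumes circ: "smooth_manifold circle" and A: "charted A" and p: "smooth_map_on A S circle p"
  shows "smooth_map_on A S euclid (\<lambda>x. p x powi m)" "\<And>x. x \<in> S \<Longrightarrow> x \<in> pts A \<Longrightarrow> cmod (p x) = 1"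
proof -
  show n: "cmod (p x) = 1" if "x \<in> S" "x \<in> pts A" for x
    using smooth_map_on_into[OF p that] by (simp add: pts_circle)
  have "smooth_map_on A S euclid p"
    using smooth_map_on_out_sub[OF A smooth_manifold_charted[OF circ, unfolded circle_def] p[unfolded circle_def]] .
  then show "smooth_map_on A S euclid (\<lambda>x. p x powi m)" by (rule smooth_map_on_powi[OF A _ n])
qed

lemma smooth_circle_curve: "cmod z = 1 \<Longrightarrow> smooth_map_on euclid S circle (\<lambda>t. z * cis (k * t))"
proof (rule smooth_map_on_euclid_circle[OF charted_euclid])
  have "smooth_on UNIV (\<lambda>t. z * cis (k * t))"
    by (rule smooth_on_bilinear[OF bounded_bilinear_mult smooth_on_const[OF open_UNIV]
          smooth_on_cis_fun[OF smooth_on_bilinear[OF bounded_bilinear_mult smooth_on_const[OF open_UNIV] smooth_on_id[OF open_UNIV]]]])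
  then show "smooth_map_on euclid S euclid (\<lambda>t. z * cis (k * t))"
    unfolding smooth_map_on_euclid_euclid
    by (rule smooth_on_set_subset[OF smooth_on_imp_smooth_on_set]) simp
qed (simp add: norm_mult)

text \<open>If \<open>z\<close> turns with speed \<open>m\<close> and \<open>w\<close> with speed
  \<open>n\<close>, the monomial turns with speed \<open>m * m + n * n\<close>, which is nonzero
  unless both exponents vanish. This dictates the direction of the curves below.\<close>

lemma cis_powi_product:
  assumes "z' = z * cis (of_int m * t)" "w' = w * cis (of_int n * t)"
  shows "z' powi m * w' powi n = (z powi m * w powi n) * cis (of_int (m * m + n * n) * t)"
  unfolding assms by (simp add: power_int_mult_distrib cis_power_int cis_mult[symmetric] algebra_simps)

text \<open>The line of direction \<open>(m, n)\<close> in the base torus is lifted to the bundle; a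
  lift that starts in the boundary stays in it, which gives the second statement.\<close>

lemma torus_bundle_turning_curve:
  fixes A :: "('a, 'e::euclidean_space) manifold" and F :: "('f, 'c::euclidean_space) manifold"
  assumes circ: "smooth_manifold circle" and bun: "smooth_fiber_bundle A torus F G p" and dim: "DIM('e::euclidean_space) = DIM('c::euclidean_space) + 2"
    and mn: "(m, n) \<noteq> (0, 0)" and x: "x \<in> pts A"
  shows "turning_curve A (pts A) (\<lambda>x. fst (p x) powi m * snd (p x) powi n) x"
    "x \<in> boundary A \<Longrightarrow> turning_curve A (boundary A) (\<lambda>x. fst (p x) powi m * snd (p x) powi n) x"
proof -
  have AS: "smooth_manifold A" and p: "smooth_map_on A (pts A) torus p"
    using bun unfolding smooth_fiber_bundle_def smooth_map_def by blast+
  have "p x \<in> pts torus" using smooth_map_on_into[OF p x x] .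
  then have z: "cmod (fst (p x)) = 1" "cmod (snd (p x)) = 1" by (auto simp: mtop_torus)
  let ?c = "\<lambda>t. (fst (p x) * cis (of_int m * t), snd (p x) * cis (of_int n * t))"
  have c: "smooth_map_on euclid {-1<..<1} torus ?c" unfolding torus_def
    by (rule smooth_map_on_prod_Pair[OF charted_euclid smooth_circle_curve[OF z(1)] smooth_circle_curve[OF z(2)]])
  have "DIM('e) = DIM(real \<times> real) + DIM('c)" using dim by simp
  from bundle_curve_lift[OF bun boundary_torus[OF circ] this x c]
  obtain \<gamma> d where g: "0 < d" "smooth_map_on euclid {-d<..<d} A \<gamma>" "\<gamma> 0 = x"
    "\<forall>t\<in>{-d<..<d}. \<gamma> t \<in> pts A \<and> p (\<gamma> t) = ?c t \<and> (x \<in> boundary A \<longrightarrow> \<gamma> t \<in> boundary A)"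
    by auto
  have k: "real_of_int (m * m + n * n) \<noteq> 0" using mn by (simp add: sum_squares_eq_zero_iff del: of_int_add of_int_mult)
  have u: "fst (p (\<gamma> t)) powi m * snd (p (\<gamma> t)) powi n = (fst (p x) powi m * snd (p x) powi n) * cis (of_int (m * m + n * n) * t)"
    if "t \<in> {-d<..<d}" for t
    by (rule cis_powi_product) (use bspec[OF g(4) that] in simp_all)
  have S: "\<gamma> t \<in> pts A" "x \<in> boundary A \<Longrightarrow> \<gamma> t \<in> boundary A" if "t \<in> {-d<..<d}" for t
    using bspec[OF g(4) that] by blast+
  show "turning_curve A (pts A) (\<lambda>x. fst (p x) powi m * snd (p x) powi n) x"
    unfolding turning_curve_def
    by (intro exI[of _ \<gamma>] exI[of _ d] exI[of _ "real_of_int (m * m + n * n)"] conjI ballI; rule g(1-3) k u S; assumption?)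
  show "turning_curve A (boundary A) (\<lambda>x. fst (p x) powi m * snd (p x) powi n) x" if "x \<in> boundary A"
    unfolding turning_curve_def
    by (intro exI[of _ \<gamma>] exI[of _ d] exI[of _ "real_of_int (m * m + n * n)"] conjI ballI; rule g(1-3) k u S(2)[OF _ that]; assumption?)
qed

text \<open>The first coordinate is moved explicitly with speed \<open>m\<close>, and a curve of
  speed \<open>n\<close> in the base circle is lifted to \<open>E\<close>. The boundary of the
  product is governed by the second coordinate.\<close>

lemma circle_product_turning_curve:
  fixes E :: "('a, 'e::euclidean_space) manifold" and F :: "('f, 'c::euclidean_space) manifold"
  assumes circ: "smooth_manifold circle" and bun: "smooth_fiber_bundle E circle F G q" and dim: "DIM('e::euclidean_space) = DIM('c::euclidean_space) + 1"
    and mn: "(m, n) \<noteq> (0, 0)" and x: "x \<in> pts (prod_manifold circle E)"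
  defines "B \<equiv> prod_manifold circle E"
  shows "turning_curve B (pts B) (\<lambda>x. fst x powi m * q (snd x) powi n) x"
    "x \<in> boundary B \<Longrightarrow> turning_curve B (boundary B) (\<lambda>x. fst x powi m * q (snd x) powi n) x"
proof -
  have CC: "charted circle" using smooth_manifold_charted[OF circ] .
  have ES: "smooth_manifold E" and q: "smooth_map_on E (pts E) circle q"
    using bun unfolding smooth_fiber_bundle_def smooth_map_def by blast+
  have y: "fst x \<in> pts circle" "snd x \<in> pts E" using x by auto
  have z: "cmod (fst x) = 1" "cmod (q (snd x)) = 1"
    using smooth_map_on_into[OF q y(2) y(2)] y(1) by (simp_all add: pts_circle)
  have "DIM('e) = DIM(real) + DIM('c)" using dim by simp
  from bundle_curve_lift[OF bun boundary_circle[OF circ] this y(2) smooth_circle_curve[OF z(2), of "{-1<..<1}" "of_int n"]]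
  obtain \<gamma> d where g: "0 < d" "smooth_map_on euclid {-d<..<d} E \<gamma>" "\<gamma> 0 = snd x"
    "\<forall>t\<in>{-d<..<d}. \<gamma> t \<in> pts E \<and> q (\<gamma> t) = q (snd x) * cis (of_int n * t) \<and> (snd x \<in> boundary E \<longrightarrow> \<gamma> t \<in> boundary E)"
    by auto
  let ?\<beta> = "\<lambda>t. (fst x * cis (of_int m * t), \<gamma> t)"
  have \<beta>: "smooth_map_on euclid {-d<..<d} B ?\<beta>" unfolding B_def
    by (rule smooth_map_on_prod_Pair[OF charted_euclid smooth_circle_curve[OF z(1)] g(2)])
  have \<beta>0: "?\<beta> 0 = x" using g(3) by simp
  have k: "real_of_int (m * m + n * n) \<noteq> 0" using mn by (simp add: sum_squares_eq_zero_iff del: of_int_add of_int_mult)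
  have u: "fst (?\<beta> t) powi m * q (snd (?\<beta> t)) powi n = (fst x powi m * q (snd x) powi n) * cis (of_int (m * m + n * n) * t)"
    if "t \<in> {-d<..<d}" for t
    by (rule cis_powi_product) (use bspec[OF g(4) that] in simp_all)
  have S: "?\<beta> t \<in> pts B" "x \<in> boundary B \<Longrightarrow> ?\<beta> t \<in> boundary B" if t: "t \<in> {-d<..<d}" for t
  proof -
    have c: "fst x * cis (of_int m * t) \<in> pts circle" using z(1) by (simp add: pts_circle norm_mult)
    show "?\<beta> t \<in> pts B" unfolding B_def using c bspec[OF g(4) t] by simp
    assume "x \<in> boundary B"
    then have "snd x \<in> boundary E"
      using boundary_prod[OF CC boundary_circle[OF circ] y(1), of "snd x" E] unfolding B_def by simp
    then show "?\<beta> t \<in> boundary B"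
      using boundary_prod[OF CC boundary_circle[OF circ] c, of "\<gamma> t" E] bspec[OF g(4) t] unfolding B_def by simp
  qed
  show "turning_curve B (pts B) (\<lambda>x. fst x powi m * q (snd x) powi n) x"
    unfolding turning_curve_def
    by (intro exI[of _ ?\<beta>] exI[of _ d] exI[of _ "real_of_int (m * m + n * n)"] conjI ballI; rule g(1) k \<beta> \<beta>0 u S; assumption?)
  show "turning_curve B (boundary B) (\<lambda>x. fst x powi m * q (snd x) powi n) x" if "x \<in> boundary B"
    unfolding turning_curve_def
    by (intro exI[of _ ?\<beta>] exI[of _ d] exI[of _ "real_of_int (m * m + n * n)"] conjI ballI; rule g(1) k \<beta> \<beta>0 u S(2)[OF _ that]; assumption?)
qed

lemma boundary_embedding:
  fixes A :: "('a, 'e::euclidean_space) manifold" and M :: "('b, 'd::euclidean_space) manifold"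
  assumes A: "charted A" and a: "smooth_embedding A M a"
  shows "boundary (submanifold M (a ` pts A) :: ('b, 'e::euclidean_space) manifold) = a ` boundary A"
proof -
  let ?N = "submanifold M (a ` pts A) :: ('b, 'e) manifold"
  note D = smooth_embeddingD[OF a]
  have NC: "charted ?N" using D(4) smooth_manifold_charted by blast
  have iff: "a z \<in> boundary ?N \<longleftrightarrow> z \<in> boundary A" if "z \<in> pts A" for z
    by (rule boundary_diffeomorphism[OF A NC D(5) refl that])
  show ?thesis
  proof (intro equalityI subsetI)
    fix x assume x: "x \<in> boundary ?N"
    then obtain z where z: "z \<in> pts A" "x = a z" using boundary_subset_pts[OF NC] by auto
    then show "x \<in> a ` boundary A" using iff[OF z(1)] x by blast
  next
    fix x assume "x \<in> a ` boundary A"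
    then obtain z where z: "z \<in> boundary A" "x = a z" by blast
    then show "x \<in> boundary ?N" using iff[of z] boundary_subset_pts[OF A] by blast
  qed
qed

section \<open>The surgered manifold\<close>

theorem corollary4p5:
  fixes X :: "('a, real ^ 4) manifold" and \<O>X :: "('a set \<times> ('a \<Rightarrow> real ^ 4)) set"
    and Y :: "('b, real ^ 3) manifold" and \<O>Y :: "('b set \<times> ('b \<Rightarrow> real ^ 3)) set"
    and M :: "('m, real ^ 4) manifold"
    and T :: "'a set" and \<nu>T :: "(complex \<times> complex) \<times> complex \<Rightarrow> 'a"
    and K L :: "'b set" and \<nu>K :: "complex \<times> complex \<Rightarrow> 'b"
    and f :: "complex \<times> 'b \<Rightarrow> 'a"
    and s :: complex and t :: "complex \<times> complex"
  assumes X: "closed_manifold X" "connected_space (mtop X)" "orientation X \<O>X"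
    and T: "torus_fibered_knot X \<O>X T \<nu>T"
    and Y: "closed_manifold Y" "connected_space (mtop Y)" "orientation Y \<O>Y"
    and K: "fibered_knot Y K \<nu>K"
    and L: "longitude Y \<nu>K L"
    and f: "diffeomorphism (boundary_3manifold (circle_times_exterior Y \<nu>K))
              (boundary_3manifold (exterior torus X \<nu>T)) f"
    and st: "s \<in> pts circle" "t \<in> pts torus"
    and f_L: "f ` ({s} \<times> L) = \<nu>T ` ({t} \<times> sphere 0 1)"
    and M: "knot_surgery X \<nu>T Y \<nu>K f M"
  shows "fibers_over_circle M"
proof -
  let ?A = "exterior torus X \<nu>T" and ?E = "exterior circle Y \<nu>K"
  let ?B = "prod_manifold circle ?E"
  obtain F :: "('a, real^2) manifold" and p where embT: "smooth_embedding (prod_manifold torus disk) X \<nu>T"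
    and bunA: "smooth_fiber_bundle ?A torus F (diffeos_rel_boundary F) p"
    using T unfolding torus_fibered_knot_def tubular_neighborhood_def by (elim conjE exE) (rule that)
  obtain F' :: "('b, real^2) manifold" and q where embK: "smooth_embedding (prod_manifold circle disk) Y \<nu>K"
    and bunE: "smooth_fiber_bundle ?E circle F' (diffeos F') q"
    using K unfolding fibered_knot_def tubular_neighborhood_def Let_def by (elim conjE exE) (rule that)
  obtain a b where MS: "smooth_manifold M" and a: "smooth_embedding ?A M a" and b: "smooth_embedding ?B M b"
    and cover: "a ` pts ?A \<union> b ` pts ?B = pts M"
    and seamA: "a ` pts ?A \<inter> b ` pts ?B = a ` boundary ?A" and seamB: "a ` pts ?A \<inter> b ` pts ?B = b ` boundary ?B"
    using M unfolding knot_surgery_def is_gluing_def by (elim conjE exE) (rule that)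
  have AS: "smooth_manifold ?A" and p: "smooth_map_on ?A (pts ?A) torus p"
    using bunA unfolding smooth_fiber_bundle_def smooth_map_def by blast+
  have ES: "smooth_manifold ?E" and circ: "smooth_manifold circle" and q: "smooth_map_on ?E (pts ?E) circle q"
    using bunE unfolding smooth_fiber_bundle_def smooth_map_def by blast+
  note AC = smooth_manifold_charted[OF AS] and EC = smooth_manifold_charted[OF ES]
    and CC = smooth_manifold_charted[OF circ] and MC = smooth_manifold_charted[OF MS]
  have TC: "charted torus" unfolding torus_def by (rule charted_prod[OF CC CC])
  have BC: "charted ?B" by (rule charted_prod[OF CC EC])
  have Cc: "compact_space (mtop circle)" by (simp add: circle_def euclid_def compact_space_subtopology)
  have Tc: "compact_space (mtop torus)" by (simp add: mtop_torus compact_space_subtopology compact_Times)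
  have Ac: "compact_space (mtop ?A)" and bA: "boundary ?A = \<nu>T ` (pts torus \<times> sphere 0 1)"
    by (rule tube_exterior[OF X(1) TC boundary_torus[OF circ] Tc embT AC], simp)+
  have "compact_space (mtop ?E)"
    by (rule tube_exterior(1)[OF Y(1) CC boundary_circle[OF circ] Cc embK EC]) simp
  then have Bc: "compact_space (mtop ?B)" using Cc by (simp add: compact_space_prod_topology)
  define SA where "SA = a ` pts ?A"
  define SB where "SB = b ` pts ?B"
  define N where "N = SA \<inter> SB"
  note Da = smooth_embeddingD[OF a, folded SA_def] and Db = smooth_embeddingD[OF b, folded SB_def]
  have NA: "N = a ` boundary ?A" and NB: "N = b ` boundary ?B"
    using seamA seamB unfolding N_def SA_def SB_def by simp_all
  have MH: "Hausdorff_space (mtop M)" using MS unfolding smooth_manifold_def by blast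
  have cSA: "compactin (mtop M) SA" unfolding SA_def
    by (rule image_compactin[OF _ Da(3)]) (use Ac in \<open>simp add: compact_space_def\<close>)
  have cSB: "compactin (mtop M) SB" unfolding SB_def
    by (rule image_compactin[OF _ Db(3)]) (use Bc in \<open>simp only: compact_space_def\<close>)
  have cl: "closedin (mtop M) SA" "closedin (mtop M) SB"
    by (rule compactin_imp_closedin[OF MH cSA], rule compactin_imp_closedin[OF MH cSB])
  have coverS: "SA \<union> SB = pts M" using cover unfolding SA_def SB_def .
  have Mc: "compact_space (mtop M)" using compactin_Un[OF cSA cSB] unfolding coverS compact_space_def .
  have bMA: "SA \<inter> SB = boundary (submanifold M SA :: ('m, real^4) manifold)"
    using boundary_embedding[OF AC a] NA unfolding N_def SA_def by simp
  \<comment> \<open>The second piece carries the product model space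
    \<open>real \<times> (real^3)\<close>, of the same dimension as the model space of
    \<open>M\<close> but of another type.\<close>
  have bMB: "SA \<inter> SB = boundary (submanifold M SB :: ('m, real \<times> (real^3)) manifold)"
    using boundary_embedding[OF BC b] NB unfolding N_def SB_def by simp
  \<comment> \<open>A gluing is only asked to be a smooth manifold. That it is closed follows
    because it is covered by two compact pieces which meet in the full boundary of each.\<close>
  have "boundary M = {}"
    by (rule gluing_boundaryless[OF MS Da(4) Db(4) _ coverS bMA bMB]) simp
  then have Mcl: "closed_manifold M" using MS Mc unfolding closed_manifold_def by blast
  define a' where "a' = inv_into (pts ?A) a"
  define b' where "b' = inv_into (pts ?B) b"
  define P1 P2 S1 Q1 where P1: "P1 = (\<lambda>x. fst (p (a' x)))" and P2: "P2 = (\<lambda>x. snd (p (a' x)))"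
    and S1: "S1 = (\<lambda>x. fst (b' x))" and Q1: "Q1 = (\<lambda>x. q (snd (b' x)))"
  have p1: "smooth_map_on ?A (pts ?A) circle (\<lambda>x. fst (p x))"
    by (rule smooth_map_on_compose[OF AC TC p, of UNIV]) (simp_all add: torus_def smooth_map_on_prod_fst[OF circ CC])
  have p2: "smooth_map_on ?A (pts ?A) circle (\<lambda>x. snd (p x))"
    by (rule smooth_map_on_compose[OF AC TC p, of UNIV]) (simp_all add: torus_def smooth_map_on_prod_snd[OF CC circ])
  have q1: "smooth_map_on ?B (pts ?B) circle fst" by (rule smooth_map_on_prod_fst[OF circ EC])
  have q2: "smooth_map_on ?B (pts ?B) circle (\<lambda>x. q (snd x))"
    by (rule smooth_map_on_compose[OF BC EC smooth_map_on_prod_snd[OF CC ES] q]) auto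
  have sP1: "smooth_map_on M SA circle P1" and sP2: "smooth_map_on M SA circle P2"
    unfolding P1 P2 SA_def a'_def by (rule embedding_transport_map[OF AC MC a p1], rule embedding_transport_map[OF AC MC a p2])
  have sS1: "smooth_map_on M SB circle S1" and sQ1: "smooth_map_on M SB circle Q1"
    unfolding S1 Q1 SB_def b'_def by (rule embedding_transport_map[OF BC MC b q1], rule embedding_transport_map[OF BC MC b q2])
  note aP1 = circle_bundle_angle[OF circ MC sP1] and aP2 = circle_bundle_angle[OF circ MC sP2]
    and aS1 = circle_bundle_angle[OF circ MC sS1] and aQ1 = circle_bundle_angle[OF circ MC sQ1]
  have SM: "SA \<subseteq> pts M" "SB \<subseteq> pts M" using coverS by blast+
  have n1: "cmod (P1 x) = 1" "cmod (P2 x) = 1" if "x \<in> SA" for x using aP1(2)[OF that] aP2(2)[OF that] SM that by blast+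
  have n2: "cmod (S1 x) = 1" "cmod (Q1 x) = 1" if "x \<in> SB" for x using aS1(2)[OF that] aQ1(2)[OF that] SM that by blast+
  let ?T3 = "(sphere 0 1 \<times> sphere 0 1) \<times> sphere 0 1 :: ((complex \<times> complex) \<times> complex) set"
  have bAT: "boundary ?A = \<nu>T ` ?T3" using bA by (simp add: mtop_torus)
  \<comment> \<open>The seam is parametrized from the side of the torus: the boundary of its
    exterior is the surface of the tube, a standard 3-torus.\<close>
  define \<theta> where "\<theta> w = a (\<nu>T w)" for w
  have \<theta>N: "\<theta> ` ?T3 = N" unfolding NA bAT \<theta>_def by (simp add: image_image)
  have \<nu>A: "\<nu>T w \<in> pts ?A" if "w \<in> ?T3" for w using boundary_subset_pts[OF AC] bAT that by blast
  have \<theta>i: "inj_on \<theta> ?T3"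
  proof (rule inj_onI)
    fix v w assume vw: "v \<in> ?T3" "w \<in> ?T3" and e: "\<theta> v = \<theta> w"
    have "\<nu>T v = \<nu>T w" using inj_onD[OF Da(2)] e \<nu>A vw unfolding \<theta>_def by blast
    then show "v = w" by (rule inj_onD[OF smooth_embeddingD(2)[OF embT]]) (use vw in \<open>auto simp: mtop_torus pts_disk\<close>)
  qed
  have "continuous_map (top_of_set ?T3) (mtop X) \<nu>T"
    using tube_continuous[OF embT sphere_cball] by (simp add: mtop_torus)
  then have "continuous_map (top_of_set ?T3) (mtop ?A) \<nu>T" unfolding exterior_def submanifold_simps
    by (rule continuous_map_into_subtopology) (use \<nu>A in \<open>auto simp: exterior_def\<close>)
  from continuous_map_compose[OF this Da(3)] have \<theta>c: "continuous_map (top_of_set ?T3) (mtop M) \<theta>"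
    unfolding o_def \<theta>_def[abs_def] .
  \<comment> \<open>Four circle-valued maps on the 3-torus: the two base coordinates from the first
    piece, and the circle factor and the fibration of the knot exterior from the second.\<close>
  define H where "H j = (if j = 0 then P1 else if j = 1 then P2 else if j = 2 then S1 else Q1)" for j :: nat
  \<comment> \<open>The smoothness facts at hand speak of integer powers; the exponent 1 recovers
    the map itself.\<close>
  have cont: "continuous_map (subtopology (mtop M) N) euclidean g"
    if "smooth_map_on M S euclid (\<lambda>x. g x powi 1)" "N \<subseteq> S" for g :: "'m \<Rightarrow> complex" and S
    using continuous_map_from_subtopology_mono[OF smooth_map_on_continuous[OF that(1)] that(2)] by (simp add: euclid_def)
  have Hc: "continuous_map (subtopology (mtop M) N) euclidean (H j)" for j
    unfolding H_def using cont[OF aP1(1)] cont[OF aP2(1)] cont[OF aS1(1)] cont[OF aQ1(1)] by (simp add: N_def)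
  have Hn: "cmod (H j x) = 1" if "x \<in> N" for j x using that n1[of x] n2[of x] unfolding H_def N_def by simp
  have "\<exists>m h. (\<exists>j<4. m j \<noteq> (0::int)) \<and> continuous_map (subtopology (mtop M) N) euclideanreal h \<and>
      (\<forall>x\<in>N. (\<Prod>j<4. H j x powi m j) = cis (h x))"
    by (rule torus_seam_relation[OF MH \<theta>c \<theta>i \<theta>N Hc]) (rule Hn)
  then obtain m h j where "j < 4" "m j \<noteq> (0::int)" and h: "continuous_map (subtopology (mtop M) N) euclideanreal h"
    and prod: "\<forall>x\<in>N. (\<Prod>j<4. H j x powi m j) = cis (h x)"
    by (elim exE conjE) (rule that)
  moreover from this(1) have "j = 0 \<or> j = 1 \<or> j = 2 \<or> j = 3" by linarith
  ultimately have mnz: "m 0 \<noteq> 0 \<or> m 1 \<noteq> 0 \<or> m 2 \<noteq> 0 \<or> m 3 \<noteq> 0" by auto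
  \<comment> \<open>The relation is solved for the factors on the side of \<open>SB\<close>, hence
    the negative exponents.\<close>
  define uA where "uA x = P1 x powi (- m 0) * P2 x powi (- m 1)" for x
  define uB where "uB x = S1 x powi m 2 * Q1 x powi m 3" for x
  have rel: "uB x = uA x * cis (h x)" if x: "x \<in> N" for x
  proof -
    have "P1 x \<noteq> 0" "P2 x \<noteq> 0" using x n1[of x] unfolding N_def by auto
    moreover have "P1 x powi m 0 * P2 x powi m 1 * uB x = cis (h x)"
      using prod x by (simp add: H_def uB_def eval_nat_numeral algebra_simps)
    ultimately show ?thesis by (simp add: uA_def power_int_minus field_simps)
  qed
  have uA: "smooth_map_on M SA euclid uA" "\<And>x. x \<in> SA \<Longrightarrow> cmod (uA x) = 1"
    unfolding uA_def using smooth_map_on_mult[OF MC aP1(1) aP2(1)] n1 by (simp_all add: norm_mult norm_power_int)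
  have uB: "smooth_map_on M SB euclid uB" "\<And>x. x \<in> SB \<Longrightarrow> cmod (uB x) = 1"
    unfolding uB_def using smooth_map_on_mult[OF MC aS1(1) aQ1(1)] n2 by (simp_all add: norm_mult norm_power_int)
  have tA: "turning_curve M SA uA x" if x: "x \<in> SA" and nz: "(- m 0, - m 1) \<noteq> (0, 0)" for x
  proof -
    obtain z where z: "z \<in> pts ?A" "x = a z" using x unfolding SA_def by blast
    show ?thesis unfolding z(2) uA_def P1 P2 a'_def SA_def
      by (rule embedding_turning_curve[OF AC a subset_refl z(1) torus_bundle_turning_curve(1)[OF circ bunA _ nz z(1)]]) simp
  qed
  have tAN: "turning_curve M N uA x" if x: "x \<in> N" and nz: "(- m 0, - m 1) \<noteq> (0, 0)" for x
  proof -
    obtain z where z: "z \<in> boundary ?A" "x = a z" using x unfolding NA by blast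
    have zA: "z \<in> pts ?A" using z(1) boundary_subset_pts[OF AC] by blast
    show ?thesis unfolding z(2) uA_def P1 P2 a'_def NA
      by (rule embedding_turning_curve[OF AC a boundary_subset_pts[OF AC] z(1) torus_bundle_turning_curve(2)[OF circ bunA _ nz zA z(1)]]) simp
  qed
  have tB: "turning_curve M SB uB x" if x: "x \<in> SB" and nz: "(m 2, m 3) \<noteq> (0, 0)" for x
  proof -
    obtain z where z: "z \<in> pts ?B" "x = b z" using x unfolding SB_def by blast
    show ?thesis unfolding z(2) uB_def S1 Q1 b'_def SB_def
      by (rule embedding_turning_curve[OF BC b subset_refl z(1) circle_product_turning_curve(1)[OF circ bunE _ nz z(1)]]) simp
  qed
  have tBN: "turning_curve M N uB x" if x: "x \<in> N" and nz: "(m 2, m 3) \<noteq> (0, 0)" for x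
  proof -
    obtain z where z: "z \<in> boundary ?B" "x = b z" using x unfolding NB by blast
    have zB: "z \<in> pts ?B" using z(1) boundary_subset_pts[OF BC] by blast
    show ?thesis unfolding z(2) uB_def S1 Q1 b'_def NB
      by (rule embedding_turning_curve[OF BC b boundary_subset_pts[OF BC] z(1) circle_product_turning_curve(2)[OF circ bunE _ nz zB z(1)]]) simp
  qed
  have cN: "compactin (mtop M) N" unfolding N_def using closedin_compact_space[OF Mc] cl by blast
  have N0: "N \<noteq> {}" unfolding \<theta>N[symmetric] by (auto intro!: exI[of _ 1])
  \<comment> \<open>Otherwise \<open>uB\<close> would have the global angle \<open>h\<close> on the
    seam while turning along curves inside the seam.\<close>
  have nzA: "(- m 0, - m 1) \<noteq> (0, 0)"
  proof
    assume z: "(- m 0, - m 1) = (0, 0)"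
    then have nz: "(m 2, m 3) \<noteq> (0, 0)" using mnz by auto
    have "uB x = cis (h x)" if "x \<in> N" for x using rel[OF that] z by (simp add: uA_def)
    then show False by (rule no_global_angle[OF cN N0 h _ tBN[OF _ nz]])
  qed
  have nzB: "(m 2, m 3) \<noteq> (0, 0)"
  proof
    assume z: "(m 2, m 3) = (0, 0)"
    have h': "continuous_map (subtopology (mtop M) N) euclideanreal (\<lambda>x. - h x)"
      using h by (rule continuous_map_minus)
    have "uA x = cis (- h x)" if "x \<in> N" for x
    proof -
      have "uA x * cis (h x) = 1" using rel[OF that] z by (simp add: uB_def)
      then have "uA x * cis (h x) * cis (- h x) = cis (- h x)" by simp
      then show ?thesis by (simp add: mult.assoc cis_mult)
    qed
    then show False by (rule no_global_angle[OF cN N0 h' _ tAN[OF _ nzA]])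
  qed
  obtain u where u: "smooth_map_on M (pts M) euclid u" "\<And>x. x \<in> pts M \<Longrightarrow> cmod (u x) = 1" "\<And>x. x \<in> pts M \<Longrightarrow> regular_at M u x"
    by (rule glued_submersion[OF Mcl Da(4) coverS cl bMA uA tA[OF _ nzA] uB tB[OF _ nzB] h[unfolded N_def] rel[unfolded N_def]])
      (assumption | rule that)+
  have "CARD(4) = DIM(real^3) + 1" by simp
  from circle_submersion_bundle[OF Mcl circ u this] show ?thesis unfolding fibers_over_circle_def by blast
qed

end
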